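(* Let $p$ be a prime, $n,r,d$ integers with $p>d\ge1$, let $U\subseteq\mathbb{F}_p^n$ be nonempty and closed under shifts to zero, and let $X\subseteq\mathbb{A}^n$ be an absolutely irreducible $\mathbb{F}_p$-variety of dimension $r$ and degree $d$ which is not $(U-U)$-shift-free. Put $$\alpha=d^2+\big(5d^{13/3}+d^2\,\#(U-U)\big)p^{-1/2}$$ and assume $p\ge4\alpha^2$. Then $\Delta\ge p^r/2$.
   Context: $\overline{\mathbb{F}_p}$ is an algebraic closure of $\mathbb{F}_p$ and $\mathbb{A}^n=\overline{\mathbb{F}_p}^{\,n}$. An $\mathbb{F}_p$-variety is the common zero set in $\mathbb{A}^n$ of polynomials in $\mathbb{F}_p[x_1,\dots,x_n]$; $X(\mathbb{F}_p)=X\cap\mathbb{F}_p^n$. The degree of an absolutely irreducible variety $X$ is the maximum number of points in $X\cap L$ over affine linear subspaces $L$ of codimension $\dim X$ with $X\cap L$ finite. For $u\in\mathbb{A}^n$, $X^{(u)}=\{a+u:a\in X\}$. For absolutely irreducible $X$ and $V\subseteq\mathbb{F}_p^n$, $X$ is $V$-shift-free if $X\neq X^{(u)}$ for every nonzero $u\in V$. $U$ is closed under shifts to zero if for every $u\in U$ and every coordinate index $i$, the vector obtained from $u$ by replacing its $i$-th coordinate with $0$ lies in $U$. $U-U=\{v-w:v,w\in U\}$, $X(\mathbb{F}_p)+U=\{a+u:a\in X(\mathbb{F}_p),u\in U\}$, and $\Delta=\#X(\mathbb{F}_p)\cdot\#U-\#(X(\mathbb{F}_p)+U)$. *)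

theory Defs
  imports Complex_Main "HOL-Library.Poly_Mapping" "HOL-Computational_Algebra.Polynomial"
begin

text \<open>Multivariate polynomials in variables x_0, x_1, ... are finitely supported maps
from monomials (exponent vectors nat =>0 nat) to coefficients (the Poly_Mapping
representation). Points of affine n-space over the field 'k are functions
nat => 'k vanishing at indices >= n.\<close>

type_synonym 'a mpoly_rep = "(nat \<Rightarrow>\<^sub>0 nat) \<Rightarrow>\<^sub>0 'a"

definition mpeval :: "'a::comm_ring_1 mpoly_rep \<Rightarrow> (nat \<Rightarrow> 'a) \<Rightarrow> 'a" where
  "mpeval f x = (\<Sum>m\<in>Poly_Mapping.keys f. Poly_Mapping.lookup f m * (\<Prod>i\<in>Poly_Mapping.keys m. x i ^ Poly_Mapping.lookup m i))"

definition affine_space :: "nat \<Rightarrow> (nat \<Rightarrow> 'k::field) set" where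
  "affine_space n = {x. \<forall>i\<ge>n. x i = 0}"

definition prime_subfield :: "'k::field set" where
  "prime_subfield = range of_nat"

definition Fp_points :: "nat \<Rightarrow> (nat \<Rightarrow> 'k::field) set" where
  "Fp_points n = {x \<in> affine_space n. \<forall>i<n. x i \<in> prime_subfield}"

definition zero_set :: "nat \<Rightarrow> 'k::field mpoly_rep set \<Rightarrow> (nat \<Rightarrow> 'k) set" where
  "zero_set n S = {x \<in> affine_space n. \<forall>f\<in>S. mpeval f x = 0}"

definition Fp_variety :: "nat \<Rightarrow> (nat \<Rightarrow> 'k::field) set \<Rightarrow> bool" where
  "Fp_variety n X \<longleftrightarrow> (\<exists>S. (\<forall>f\<in>S. \<forall>m. Poly_Mapping.lookup f m \<in> prime_subfield) \<and> X = zero_set n S)"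

definition zariski_closed :: "nat \<Rightarrow> (nat \<Rightarrow> 'k::field) set \<Rightarrow> bool" where
  "zariski_closed n Z \<longleftrightarrow> (\<exists>S. Z = zero_set n S)"

text \<open>Irreducible (over the algebraically closed field, i.e. absolutely irreducible).\<close>
definition irreducible_closed :: "nat \<Rightarrow> (nat \<Rightarrow> 'k::field) set \<Rightarrow> bool" where
  "irreducible_closed n Z \<longleftrightarrow> zariski_closed n Z \<and> Z \<noteq> {} \<and>
     (\<forall>Z1 Z2. zariski_closed n Z1 \<and> zariski_closed n Z2 \<and> Z = Z1 \<union> Z2 \<longrightarrow> Z = Z1 \<or> Z = Z2)"

definition irr_chain :: "nat \<Rightarrow> (nat \<Rightarrow> (nat \<Rightarrow> 'k::field) set) \<Rightarrow> nat \<Rightarrow> (nat \<Rightarrow> 'k) set \<Rightarrow> bool" where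
  "irr_chain n C m X \<longleftrightarrow> (\<forall>j\<le>m. irreducible_closed n (C j)) \<and> (\<forall>j<m. C j \<subset> C (Suc j)) \<and> C m = X"

definition has_dim :: "nat \<Rightarrow> (nat \<Rightarrow> 'k::field) set \<Rightarrow> nat \<Rightarrow> bool" where
  "has_dim n X r \<longleftrightarrow> (\<exists>C. irr_chain n C r X) \<and> (\<forall>m C. irr_chain n C m X \<longrightarrow> m \<le> r)"

definition affine_subspace_codim :: "nat \<Rightarrow> nat \<Rightarrow> (nat \<Rightarrow> 'k::field) set \<Rightarrow> bool" where
  "affine_subspace_codim n c L \<longleftrightarrow> (\<exists>(a::nat \<Rightarrow> nat \<Rightarrow> 'k) (b::nat \<Rightarrow> 'k).
     (\<forall>lam::nat \<Rightarrow> 'k. (\<forall>i<n. (\<Sum>j<c. lam j * a j i) = 0) \<longrightarrow> (\<forall>j<c. lam j = 0)) \<and>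
     L = {x \<in> affine_space n. \<forall>j<c. (\<Sum>i<n. a j i * x i) = b j})"

definition has_degree :: "nat \<Rightarrow> (nat \<Rightarrow> 'k::field) set \<Rightarrow> nat \<Rightarrow> nat \<Rightarrow> bool" where
  "has_degree n X r d \<longleftrightarrow>
     (\<exists>L. affine_subspace_codim n r L \<and> finite (X \<inter> L) \<and> card (X \<inter> L) = d) \<and>
     (\<forall>L. affine_subspace_codim n r L \<and> finite (X \<inter> L) \<longrightarrow> card (X \<inter> L) \<le> d)"

definition vadd :: "(nat \<Rightarrow> 'k::field) \<Rightarrow> (nat \<Rightarrow> 'k) \<Rightarrow> (nat \<Rightarrow> 'k)" where
  "vadd a u = (\<lambda>i. a i + u i)"

definition vshift :: "(nat \<Rightarrow> 'k::field) set \<Rightarrow> (nat \<Rightarrow> 'k) \<Rightarrow> (nat \<Rightarrow> 'k) set" where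
  "vshift X u = (\<lambda>a. vadd a u) ` X"

definition shift_free :: "(nat \<Rightarrow> 'k::field) set \<Rightarrow> (nat \<Rightarrow> 'k) set \<Rightarrow> bool" where
  "shift_free X V \<longleftrightarrow> (\<forall>u\<in>V. u \<noteq> (\<lambda>_. 0) \<longrightarrow> X \<noteq> vshift X u)"

definition closed_under_shifts_to_zero :: "nat \<Rightarrow> (nat \<Rightarrow> 'k::field) set \<Rightarrow> bool" where
  "closed_under_shifts_to_zero n U \<longleftrightarrow> (\<forall>u\<in>U. \<forall>i<n. u(i := 0) \<in> U)"

definition setdiff_vec :: "(nat \<Rightarrow> 'k::field) set \<Rightarrow> (nat \<Rightarrow> 'k) set \<Rightarrow> (nat \<Rightarrow> 'k) set" where
  "setdiff_vec V W = {(\<lambda>i. v i - w i) | v w. v \<in> V \<and> w \<in> W}"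

definition setsum_vec :: "(nat \<Rightarrow> 'k::field) set \<Rightarrow> (nat \<Rightarrow> 'k) set \<Rightarrow> (nat \<Rightarrow> 'k) set" where
  "setsum_vec V W = {vadd v w | v w. v \<in> V \<and> w \<in> W}"

definition is_alg_closure_Fp :: "nat \<Rightarrow> 'k::field itself \<Rightarrow> bool" where
  "is_alg_closure_Fp p _ \<longleftrightarrow> prime p \<and> of_nat p = (0::'k) \<and>
     (\<forall>q::'k poly. degree q \<ge> 1 \<longrightarrow> (\<exists>x. poly q x = 0)) \<and>
     (\<forall>x::'k. \<exists>q::'k poly. q \<noteq> 0 \<and> (\<forall>i. coeff q i \<in> prime_subfield) \<and> poly q x = 0)"

end

theory Submission
  imports Defs "HOL-Computational_Algebra.Formal_Power_Series" "Jordan_Normal_Form.Char_Poly"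
begin

text \<open>Two elements of \<open>U\<close> translate \<open>X(\<F>\<^sub>p)\<close> to the same set, so \<open>\<Delta>\<close> is at least the number of points of
  \<open>X(\<F>\<^sub>p)\<close>, and this number has to be bounded below by \<open>p\<^sup>r / 2\<close>. A rational linear Noether normalisation
  \<open>x\<close> and a rational linear form \<open>y\<close> map \<open>X\<close> to a hypersurface \<open>f(x, y) = 0\<close>, where \<open>f\<close> is monic in \<open>y\<close> of degree
  \<open>D \<le> d\<close>, such that a point with nonzero discriminant has a unique preimage; hence rational points with
  nonzero discriminant lift to rational points. On most lines through a fixed rational point \<open>f\<close> stays
  irreducible: the exceptional directions are zeros of a polynomial of degree at most \<open>D\<^sup>4 / 2\<close>. On the other
  lines Stepanov's method gives more than \<open>p / 2\<close> points, and summation over the lines gives the bound.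
  A polynomial in several variables is represented by the function that it defines.\<close>

text \<open>The hypothesis on \<open>p\<close> enters only as \<open>21 * d ^ 4 \<le> p\<close> when
  \<open>d \<ge> 2\<close>. Both losses are measured against it: the exceptional directions make up
  at most \<open>1 / 42\<close> of all directions, every other line carries at least
  \<open>0.526 * p\<close> points, and \<open>41 / 42 * 0.526 > 1 / 2\<close>.

  Two demands pull against each other. The degree \<open>d\<close> is known only through finite
  linear sections, so \<open>D \<le> d\<close> must come from counting one fibre with
  \<open>D\<close> distinct points; this asks for a separable equation and hence for a generic
  coordinate change over the big field. A normalisation over the prime field asks for a rational
  point outside the leading form of a relation, so a relation of degree at most \<open>d\<close>
  must be known before anything is rational. Therefore normalisation, minimal equations and the
  bound \<open>D \<le> d\<close> are first proved over the closure and then fed back.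

  Throughout, the coefficient of \<open>y ^ j\<close> in an equation of degree \<open>D\<close> has
  degree at most \<open>D - j\<close>. This weighting is what bounds norms, discriminants and minors
  in terms of \<open>D\<close> alone.\<close>

hide_const (open) Module.smult

subsection \<open>Polynomial functions with a degree bound\<close>

text \<open>The degree bound is an integer, so that weighted bounds such as \<open>D - i\<close> need no truncation;
  for a negative bound only the zero function remains.\<close>

inductive pf :: "nat \<Rightarrow> int \<Rightarrow> ((nat \<Rightarrow> 'k::field) \<Rightarrow> 'k) \<Rightarrow> bool" for n where
  pf_zero: "pf n D (\<lambda>_. 0)"
| pf_const: "0 \<le> D \<Longrightarrow> pf n D (\<lambda>_. c)"
| pf_var: "i < n \<Longrightarrow> 1 \<le> D \<Longrightarrow> pf n D (\<lambda>z. z i)"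
| pf_add: "pf n D F \<Longrightarrow> pf n D G \<Longrightarrow> pf n D (\<lambda>z. F z + G z)"
| pf_mult: "pf n D F \<Longrightarrow> pf n E G \<Longrightarrow> pf n (D + E) (\<lambda>z. F z * G z)"

lemma pf_mono: "pf n D F \<Longrightarrow> D \<le> E \<Longrightarrow> pf n E F"
proof (induction arbitrary: E rule: pf.induct)
  case (pf_mult D F E G E')
  have "pf n (E' - E) F" using pf_mult by auto
  from pf.pf_mult[OF this pf_mult.hyps(2)] show ?case by simp
qed (auto intro: pf.intros)

lemma pf_neg: "pf n D F \<Longrightarrow> D < 0 \<Longrightarrow> F = (\<lambda>_. 0)"
proof (induction rule: pf.induct)
  case (pf_mult D F E G)
  then show ?case by (cases "D < 0") auto
qed auto

lemma pf_nonpos_const: "pf n D F \<Longrightarrow> D \<le> 0 \<Longrightarrow> \<exists>c. F = (\<lambda>_. c)"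
proof (induction rule: pf.induct)
  case (pf_mult D F E G)
  show ?case
  proof (cases "D \<le> 0 \<and> E \<le> 0")
    case True
    then show ?thesis using pf_mult by fastforce
  next
    case False
    then have "D < 0 \<or> E < 0" using pf_mult.prems by auto
    then have "F = (\<lambda>_. 0) \<or> G = (\<lambda>_. 0)" using pf_neg pf_mult.hyps by blast
    then show ?thesis by auto
  qed
qed auto

lemma pf_cong: "pf n D F \<Longrightarrow> (\<And>i. i < n \<Longrightarrow> z i = z' i) \<Longrightarrow> F z = F z'"
  by (induction rule: pf.induct) auto

lemma pf_cmult: "pf n D F \<Longrightarrow> pf n D (\<lambda>z. c * F z)"
  using pf_mult[OF pf_const[of 0 n c], of D F] by simp

lemma pf_uminus: "pf n D F \<Longrightarrow> pf n D (\<lambda>z. - F z)"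
  using pf_cmult[of n D F "-1"] by simp

lemma pf_diff: "pf n D F \<Longrightarrow> pf n D G \<Longrightarrow> pf n D (\<lambda>z. F z - G z)"
  using pf_add[of n D F "\<lambda>z. - G z"] pf_uminus[of n D G] by simp

lemma pf_sum: "(\<And>i. i \<in> A \<Longrightarrow> pf n D (F i)) \<Longrightarrow> pf n D (\<lambda>z. \<Sum>i\<in>A. F i z)"
  by (induction A rule: infinite_finite_induct) (auto intro: pf.intros)

lemma pf_prod: "finite A \<Longrightarrow> (\<And>i. i \<in> A \<Longrightarrow> pf n (e i) (F i)) \<Longrightarrow> pf n (\<Sum>i\<in>A. e i) (\<lambda>z. \<Prod>i\<in>A. F i z)"
  by (induction A rule: finite_induct) (auto intro!: pf_mult pf_const)

lemma pf_power: "pf n D F \<Longrightarrow> pf n (int k * D) (\<lambda>z. F z ^ k)"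
proof (induction k)
  case (Suc k)
  from pf_mult[OF Suc.prems Suc.IH[OF Suc.prems]] show ?case by (simp add: algebra_simps)
qed (simp add: pf_const)

lemma pf_comp:
  assumes "pf m D F" "\<And>j. j < m \<Longrightarrow> pf n 1 (\<lambda>z. \<phi> z j)"
  shows "pf n D (\<lambda>z. F (\<phi> z))"
  using assms(1)
proof (induction rule: pf.induct)
  case (pf_var i D)
  then show ?case using assms(2) pf_mono by blast
qed (auto intro: pf.intros)

lemma pf_extend: "pf m D F \<Longrightarrow> m \<le> n \<Longrightarrow> pf n D F"
  by (rule pf_comp[where \<phi> = "\<lambda>z. z"]) (auto intro: pf_var)

lemma pf_affine:
  assumes "pf n D F" "D \<le> 1"
  shows "\<exists>c0 c. \<forall>z. F z = c0 + (\<Sum>i<n. c i * z i)"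
  using assms
proof (induction rule: pf.induct)
  case (pf_zero D)
  show ?case by (rule exI[of _ 0], rule exI[of _ "\<lambda>_. 0"]) simp
next
  case (pf_const D c)
  show ?case by (rule exI[of _ c], rule exI[of _ "\<lambda>_. 0"]) simp
next
  case (pf_var i D)
  show ?case by (rule exI[of _ 0], rule exI[of _ "\<lambda>j. if j = i then 1 else 0"])
      (use pf_var in \<open>simp add: if_distrib[of "\<lambda>x. x * _"] cong: if_cong\<close>)
next
  case (pf_add D F G)
  then obtain a0 a b0 b where "\<forall>z. F z = a0 + (\<Sum>i<n. a i * z i)" "\<forall>z. G z = b0 + (\<Sum>i<n. b i * z i)"
    by auto
  then show ?case
    by (intro exI[of _ "a0 + b0"] exI[of _ "\<lambda>i. a i + b i"]) (simp add: algebra_simps sum.distrib)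
next
  case (pf_mult D F E G)
  have scale: "\<exists>c0 c'. \<forall>z. c * H z = c0 + (\<Sum>i<n. c' i * z i)"
    if "\<exists>c0 c. \<forall>z. H z = c0 + (\<Sum>i<n. c i * z i)" for c and H :: "(nat \<Rightarrow> 'a) \<Rightarrow> 'a"
  proof -
    from that obtain c0 c' where "\<forall>z. H z = c0 + (\<Sum>i<n. c' i * z i)" by blast
    then show ?thesis
      by (intro exI[of _ "c * c0"] exI[of _ "\<lambda>i. c * c' i"]) (simp add: algebra_simps sum_distrib_left)
  qed
  consider "D \<le> 0" "E \<le> 1" | "E \<le> 0" "D \<le> 1" | "D < 0" | "E < 0" using pf_mult.prems by linarith
  then show ?case
  proof cases
    case 1
    then obtain c where "F = (\<lambda>_. c)" using pf_nonpos_const pf_mult.hyps by blast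
    then show ?thesis using scale[OF pf_mult.IH(2)[OF 1(2)], of c] by simp
  next
    case 2
    then obtain c where "G = (\<lambda>_. c)" using pf_nonpos_const pf_mult.hyps by blast
    then show ?thesis using scale[OF pf_mult.IH(1)[OF 2(2)], of c] by (simp add: mult.commute)
  next
    case 3
    then have "F = (\<lambda>_. 0)" using pf_neg pf_mult.hyps by blast
    then show ?thesis by (intro exI[of _ 0] exI[of _ "\<lambda>_. 0"]) simp
  next
    case 4
    then have "G = (\<lambda>_. 0)" using pf_neg pf_mult.hyps by blast
    then show ?thesis by (intro exI[of _ 0] exI[of _ "\<lambda>_. 0"]) simp
  qed
qed

lemma pf_linear: "pf n 1 (\<lambda>z. \<Sum>i<n. c i * z i)"
  by (intro pf_sum pf_cmult pf_var) auto

section \<open>Polynomial functions of unspecified degree\<close>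

definition PF :: "nat \<Rightarrow> ((nat \<Rightarrow> 'k::field) \<Rightarrow> 'k) \<Rightarrow> bool" where
  "PF n F \<longleftrightarrow> (\<exists>D. pf n D F)"

lemma PF_I: "pf n D F \<Longrightarrow> PF n F" by (auto simp: PF_def)

lemma PF_pfE:
  assumes "PF n F" obtains D where "pf n (int D) F"
proof -
  obtain D where "pf n D F" using assms by (auto simp: PF_def)
  then have "pf n (int (nat D)) F" by (rule pf_mono) auto
  then show thesis by (rule that)
qed

lemma PF_const [simp, intro]: "PF n (\<lambda>_. c)" by (rule PF_I[OF pf_const[of 0]]) simp
lemma PF_var: "i < n \<Longrightarrow> PF n (\<lambda>z. z i)" by (rule PF_I[OF pf_var[of _ _ 1]]) auto

lemma PF_add: assumes "PF n F" "PF n G" shows "PF n (\<lambda>z. F z + G z)"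
proof -
  obtain D E where "pf n D F" "pf n E G" using assms by (auto simp: PF_def)
  then have "pf n (max D E) F" "pf n (max D E) G" by (auto elim: pf_mono)
  then show ?thesis by (auto intro: PF_I pf_add)
qed

lemma PF_mult: "PF n F \<Longrightarrow> PF n G \<Longrightarrow> PF n (\<lambda>z. F z * G z)"
  unfolding PF_def by (elim exE) (rule exI, erule (1) pf_mult)
lemma PF_cmult: "PF n F \<Longrightarrow> PF n (\<lambda>z. c * F z)"
  unfolding PF_def by (elim exE) (rule exI, erule pf_cmult)
lemma PF_uminus: "PF n F \<Longrightarrow> PF n (\<lambda>z. - F z)"
  unfolding PF_def by (elim exE) (rule exI, erule pf_uminus)
lemma PF_diff: "PF n F \<Longrightarrow> PF n G \<Longrightarrow> PF n (\<lambda>z. F z - G z)"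
  using PF_add[OF _ PF_uminus] by fastforce
lemma PF_sum: "(\<And>i. i \<in> A \<Longrightarrow> PF n (F i)) \<Longrightarrow> PF n (\<lambda>z. \<Sum>i\<in>A. F i z)"
  by (induction A rule: infinite_finite_induct) (auto intro: PF_add)
lemma PF_prod: "(\<And>i. i \<in> A \<Longrightarrow> PF n (F i)) \<Longrightarrow> PF n (\<lambda>z. \<Prod>i\<in>A. F i z)"
  by (induction A rule: infinite_finite_induct) (auto intro: PF_mult)
lemma PF_power: "PF n F \<Longrightarrow> PF n (\<lambda>z. F z ^ k)"
  unfolding PF_def by (elim exE) (rule exI, erule pf_power)
lemma PF_comp: "PF m F \<Longrightarrow> (\<And>j. j < m \<Longrightarrow> pf n 1 (\<lambda>z. \<phi> z j)) \<Longrightarrow> PF n (\<lambda>z. F (\<phi> z))"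
  unfolding PF_def by (elim exE) (rule exI, erule pf_comp)
lemma PF_cong: "PF n F \<Longrightarrow> (\<And>i. i < n \<Longrightarrow> z i = z' i) \<Longrightarrow> F z = F z'"
  by (auto simp: PF_def dest: pf_cong)
lemma PF_extend: "PF m F \<Longrightarrow> m \<le> n \<Longrightarrow> PF n F"
  by (auto simp: PF_def dest: pf_extend)

lemmas PF_intros = PF_var PF_add PF_mult PF_cmult PF_uminus PF_diff PF_sum PF_prod PF_power

text \<open>Row weights \<open>\<alpha>\<close> and column weights \<open>\<beta>\<close> give every
  permutation product the same bound, since a permutation only reorders the
  \<open>\<beta> j\<close>. The degree bounds for characteristic polynomials, norms, discriminants
  and minors below are instances with suitably chosen weights.\<close>

lemma pf_det:
  assumes "\<And>i j. i < N \<Longrightarrow> j < N \<Longrightarrow> pf n (\<alpha> i + \<beta> j) (m i j)"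
  shows "pf n ((\<Sum>i<N. \<alpha> i) + (\<Sum>j<N. \<beta> j)) (\<lambda>z. det (mat N N (\<lambda>(i,j). m i j z)))"
proof -
  have eq: "det (mat N N (\<lambda>(i,j). m i j z)) =
      (\<Sum>q\<in>{q. q permutes {0..<N}}. signof q * (\<Prod>i\<in>{0..<N}. m i (q i) z))" for z
  proof -
    have "(\<Prod>i\<in>{0..<N}. mat N N (\<lambda>(i,j). m i j z) $$ (i, q i)) = (\<Prod>i\<in>{0..<N}. m i (q i) z)"
      if "q permutes {0..<N}" for q
      by (rule prod.cong) (use permutes_in_image[OF that] in auto)
    then show ?thesis unfolding det_def by (auto intro!: sum.cong)
  qed
  have "pf n ((\<Sum>i<N. \<alpha> i) + (\<Sum>j<N. \<beta> j)) (\<lambda>z. signof q * (\<Prod>i\<in>{0..<N}. m i (q i) z))"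
    if q: "q permutes {0..<N}" for q
  proof -
    have "pf n (\<Sum>i\<in>{0..<N}. \<alpha> i + \<beta> (q i)) (\<lambda>z. \<Prod>i\<in>{0..<N}. m i (q i) z)"
      by (rule pf_prod) (use assms permutes_in_image[OF q] in auto)
    moreover have "(\<Sum>i\<in>{0..<N}. \<beta> (q i)) = (\<Sum>i\<in>{0..<N}. \<beta> i)"
      using sum.permute[OF q, of \<beta>] by (simp add: o_def)
    ultimately show ?thesis by (intro pf_cmult) (simp add: sum.distrib lessThan_atLeast0)
  qed
  then show ?thesis unfolding eq by (intro pf_sum) auto
qed

lemma PF_det:
  assumes "\<And>i j. i < N \<Longrightarrow> j < N \<Longrightarrow> PF n (m i j)"
  shows "PF n (\<lambda>z. det (mat N N (\<lambda>(i,j). m i j z)))"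
proof -
  have "\<forall>i j. \<exists>D. i < N \<longrightarrow> j < N \<longrightarrow> pf n (int D) (m i j)" using assms PF_pfE by metis
  then obtain D where D: "\<And>i j. i < N \<Longrightarrow> j < N \<Longrightarrow> pf n (int (D i j)) (m i j)" by metis
  have "pf n (int (\<Sum>j<N. D i j) + (0::int)) (m i j)" if "i < N" "j < N" for i j
    by (rule pf_mono[OF D[OF that]]) (use that in \<open>auto intro: member_le_sum\<close>)
  from pf_det[OF this] show ?thesis by (rule PF_I)
qed

subsection \<open>Restriction to lines and to the last variable\<close>

text \<open>A function carries no coefficients, so these are recovered by following its inductive
  construction while a polynomial \<open>P i z\<close> in \<open>t\<close> is substituted for the
  variable \<open>z i\<close>. The predicate \<open>R\<close> stands for whichever degree invariant
  is wanted; it has to survive the five formation rules.\<close>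

lemma pf_lift:
  fixes P :: "nat \<Rightarrow> 'a \<Rightarrow> 'k::field poly"
  assumes "pf n D F"
    and "\<And>D. R D (\<lambda>_. 0)" "\<And>D c. 0 \<le> D \<Longrightarrow> R D (\<lambda>_. [:c:])"
    and "\<And>D i. i < n \<Longrightarrow> 1 \<le> D \<Longrightarrow> R D (P i)"
    and "\<And>D A B. R D A \<Longrightarrow> R D B \<Longrightarrow> R D (\<lambda>z. A z + B z)"
    and "\<And>D E A B. R D A \<Longrightarrow> R E B \<Longrightarrow> R (D + E) (\<lambda>z. A z * B z)"
  shows "\<exists>A. R D A \<and> (\<forall>z t. poly (A z) t = F (\<lambda>i. poly (P i z) t))"
  using assms(1)
proof (induction rule: pf.induct)
  case (pf_zero D) then show ?case using assms(2) by (intro exI[of _ "\<lambda>_. 0"]) auto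
next
  case (pf_const D c) then show ?case using assms(3) by (intro exI[of _ "\<lambda>_. [:c:]"]) auto
next
  case (pf_var i D) then show ?case using assms(4) by (intro exI[of _ "P i"]) auto
next
  case (pf_add D F G)
  then obtain A B where "R D A \<and> (\<forall>z t. poly (A z) t = F (\<lambda>i. poly (P i z) t))"
    "R D B \<and> (\<forall>z t. poly (B z) t = G (\<lambda>i. poly (P i z) t))" by blast
  then show ?case by (intro exI[of _ "\<lambda>z. A z + B z"]) (auto intro: assms(5))
next
  case (pf_mult D F E G)
  then obtain A B where "R D A \<and> (\<forall>z t. poly (A z) t = F (\<lambda>i. poly (P i z) t))"
    "R E B \<and> (\<forall>z t. poly (B z) t = G (\<lambda>i. poly (P i z) t))" by blast
  then show ?case by (intro exI[of _ "\<lambda>z. A z * B z"]) (auto intro: assms(6))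
qed

text \<open>As for \<open>pf\<close>, the bound is an integer, and a negative one leaves only the
  zero polynomial; the natural number \<open>degree\<close> cannot express this.\<close>

definition dle :: "int \<Rightarrow> 'a::zero poly \<Rightarrow> bool" where
  "dle D q \<longleftrightarrow> (\<forall>i. D < int i \<longrightarrow> coeff q i = 0)"

lemma dle_0 [simp]: "dle D 0" by (simp add: dle_def)
lemma dle_const: "0 \<le> D \<Longrightarrow> dle D [:c:]" by (auto simp: dle_def coeff_pCons split: nat.splits)
lemma dle_1: "0 \<le> D \<Longrightarrow> dle D 1" by (auto simp: dle_def)
lemma dle_add: "dle D p \<Longrightarrow> dle D q \<Longrightarrow> dle D (p + q)" by (auto simp: dle_def)
lemma dle_diff: "dle D p \<Longrightarrow> dle D q \<Longrightarrow> dle D (p - q)" by (auto simp: dle_def)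
lemma dle_sum: "(\<And>i. i \<in> A \<Longrightarrow> dle D (f i)) \<Longrightarrow> dle D (\<Sum>i\<in>A. f i)"
  by (auto simp: dle_def coeff_sum)
lemma dle_mono: "dle D p \<Longrightarrow> D \<le> E \<Longrightarrow> dle E p" by (auto simp: dle_def)
lemma dle_mult: "dle D p \<Longrightarrow> dle E q \<Longrightarrow> dle (D + E) (p * q)" for p q :: "'a::comm_semiring_0 poly"
  unfolding dle_def coeff_mult
proof (intro allI impI sum.neutral ballI)
  fix i j assume *: "\<forall>i. D < int i \<longrightarrow> coeff p i = 0" "\<forall>i. E < int i \<longrightarrow> coeff q i = 0"
    "D + E < int i" "j \<in> {..i}"
  then have "D < int j \<or> E < int (i - j)" by auto
  then show "coeff p j * coeff q (i - j) = 0" using * by auto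
qed
lemma dle_neg: "dle D p \<Longrightarrow> D < 0 \<Longrightarrow> p = 0" by (auto simp: dle_def poly_eq_iff)
lemma dle_degree: "dle (int D) p \<longleftrightarrow> degree p \<le> D"
proof
  show "degree p \<le> D" if "dle (int D) p" using that unfolding dle_def by (intro degree_le) auto
  show "dle (int D) p" if "degree p \<le> D" using that unfolding dle_def by (auto intro: coeff_eq_0)
qed

lemma pf_coeff_linear:
  assumes "pf n D a" "pf n (D - 1) b"
  shows "pf n (D - int i) (\<lambda>z. coeff [:a z, b z:] i)"
proof -
  consider "i = 0" | "i = 1" | k where "i = Suc (Suc k)" by (metis One_nat_def not0_implies_Suc)
  then show ?thesis using assms by cases (auto intro: pf_zero)
qed

lemma dle_linear: "1 \<le> D \<Longrightarrow> dle D [:a, b:]"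
  by (auto simp: dle_def coeff_pCons split: nat.splits)

lemma pf_line:
  assumes "pf n D F"
  obtains q where "dle D q" "\<And>t. poly q t = F (\<lambda>i. u i + t * v i)"
proof -
  have "\<exists>A. dle D (A ()) \<and> (\<forall>z t. poly (A z) t = F (\<lambda>i. poly ((\<lambda>i _. [:u i, v i:]) i z) t))"
    by (rule pf_lift[where R = "\<lambda>D A. dle D (A ())", OF assms])
      (auto intro: dle_add dle_mult dle_const dle_linear)
  then show thesis using that by auto
qed

text \<open>Reading \<open>F\<close> as a polynomial in its last variable splits the bound
  \<open>D\<close> between the exponent \<open>i\<close> and the coefficient. The coefficients are
  functions of the first \<open>n\<close> variables only, so \<open>Q z\<close> ignores
  \<open>z n\<close>.\<close>

lemma pf_last:
  assumes "pf (Suc n) D F"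
  obtains Q where "\<And>z. F z = poly (Q z) (z n)" "\<And>i. pf n (D - int i) (\<lambda>z. coeff (Q z) i)"
    "\<And>z. dle D (Q z)"
proof -
  let ?R = "\<lambda>D A. \<forall>i. pf n (D - int i) (\<lambda>z. coeff (A z) i)"
  let ?P = "\<lambda>i z. if i = n then [:0, 1:] else [:z i:]"
  have "\<exists>A. ?R D A \<and> (\<forall>z t. poly (A z) t = F (\<lambda>i. poly (?P i z) t))"
  proof (rule pf_lift[where R = ?R, OF assms])
    fix D :: int and c :: 'a assume "0 \<le> D"
    then show "\<forall>i. pf n (D - int i) (\<lambda>z. coeff [:c:] i)"
      by (auto simp: coeff_pCons intro: pf.intros split: nat.splits)
  next
    fix D :: int and j assume "j < Suc n" "1 \<le> D"
    then show "\<forall>i. pf n (D - int i) (\<lambda>z. coeff (?P j z) i)"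
      using pf_coeff_linear[OF pf_zero pf_const, of D n]
        pf_coeff_linear[OF pf_var pf_zero, of j n D] by (cases "j = n") auto
  next
    fix D E :: int and A B :: "(nat \<Rightarrow> 'a) \<Rightarrow> 'a poly"
    assume *: "\<forall>i. pf n (D - int i) (\<lambda>z. coeff (A z) i)" "\<forall>i. pf n (E - int i) (\<lambda>z. coeff (B z) i)"
    show "\<forall>i. pf n (D + E - int i) (\<lambda>z. coeff (A z * B z) i)"
    proof
      fix i
      have "pf n (D + E - int i) (\<lambda>z. coeff (A z) j * coeff (B z) (i - j))" if "j \<le> i" for j
        using pf_mult[OF *(1)[rule_format, of j] *(2)[rule_format, of "i - j"]] that
        by (simp add: of_nat_diff algebra_simps)
      then show "pf n (D + E - int i) (\<lambda>z. coeff (A z * B z) i)"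
        unfolding coeff_mult by (intro pf_sum) auto
    qed
  qed (auto intro: pf.intros)
  then obtain A where A: "?R D A" "\<And>z t. poly (A z) t = F (\<lambda>i. poly (?P i z) t)" by blast
  show thesis
  proof (rule that[of A])
    show "F z = poly (A z) (z n)" for z
      unfolding A(2) by (rule arg_cong[of _ _ F]) auto
    show "pf n (D - int i) (\<lambda>z. coeff (A z) i)" for i using A(1) by auto
    show "dle D (A z)" for z unfolding dle_def
    proof (intro allI impI)
      fix i assume "D < int i"
      then have "(\<lambda>z. coeff (A z) i) = (\<lambda>_. 0)" using pf_neg[OF A(1)[rule_format]] by auto
      then show "coeff (A z) i = 0" by (rule fun_cong)
    qed
  qed
qed

text \<open>Here the direction \<open>w\<close> is fixed and the base point \<open>x\<close> varies,
  so a power \<open>t ^ i\<close> uses up \<open>i\<close> of the total degree.\<close>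

lemma pf_line_base:
  assumes "pf n D F"
  obtains Q where "\<And>x t. poly (Q x) t = F (\<lambda>i. x i + t * w i)" "\<And>i. pf n (D - int i) (\<lambda>x. coeff (Q x) i)"
    "\<And>x. dle D (Q x)"
proof -
  let ?R = "\<lambda>D A. \<forall>i. pf n (D - int i) (\<lambda>z. coeff (A z) i)"
  let ?P = "\<lambda>i z. [:z i, w i:]"
  have "\<exists>A. ?R D A \<and> (\<forall>z t. poly (A z) t = F (\<lambda>i. poly (?P i z) t))"
  proof (rule pf_lift[where R = ?R, OF assms])
    fix D :: int and c :: 'a assume "0 \<le> D"
    then show "\<forall>i. pf n (D - int i) (\<lambda>z. coeff [:c:] i)"
      by (auto simp: coeff_pCons intro: pf.intros split: nat.splits)
  next
    fix D :: int and j assume "j < n" "1 \<le> D"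
    then show "\<forall>i. pf n (D - int i) (\<lambda>z. coeff (?P j z) i)"
      by (intro allI pf_coeff_linear pf_var pf_const) auto
  next
    fix D E :: int and A B :: "(nat \<Rightarrow> 'a) \<Rightarrow> 'a poly"
    assume *: "\<forall>i. pf n (D - int i) (\<lambda>z. coeff (A z) i)" "\<forall>i. pf n (E - int i) (\<lambda>z. coeff (B z) i)"
    show "\<forall>i. pf n (D + E - int i) (\<lambda>z. coeff (A z * B z) i)"
    proof
      fix i
      have "pf n (D + E - int i) (\<lambda>z. coeff (A z) j * coeff (B z) (i - j))" if "j \<le> i" for j
        using pf_mult[OF *(1)[rule_format, of j] *(2)[rule_format, of "i - j"]] that
        by (simp add: of_nat_diff algebra_simps)
      then show "pf n (D + E - int i) (\<lambda>z. coeff (A z * B z) i)"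
        unfolding coeff_mult by (intro pf_sum) auto
    qed
  qed (auto intro: pf.intros)
  then obtain A where A: "?R D A" "\<And>z t. poly (A z) t = F (\<lambda>i. poly (?P i z) t)" by blast
  show thesis
  proof (rule that[of A])
    show "poly (A x) t = F (\<lambda>i. x i + t * w i)" for x t unfolding A(2) by simp
    show "pf n (D - int i) (\<lambda>z. coeff (A z) i)" for i using A(1) by auto
    show "dle D (A z)" for z unfolding dle_def
    proof (intro allI impI)
      fix i assume "D < int i"
      then have "(\<lambda>z. coeff (A z) i) = (\<lambda>_. 0)" using pf_neg[OF A(1)[rule_format]] by auto
      then show "coeff (A z) i = 0" by (rule fun_cong)
    qed
  qed
qed

text \<open>Here the base point is fixed and the direction varies. As \<open>t\<close> and
  \<open>v\<close> occur only in the products \<open>t * v i\<close>, the coefficient of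
  \<open>t ^ i\<close> has degree at most \<open>i\<close> in \<open>v\<close>, whatever
  \<open>D\<close> is.\<close>

lemma pf_line_dir:
  assumes "pf n D F"
  obtains Q where "\<And>v t. poly (Q v) t = F (\<lambda>i. u i + t * v i)" "\<And>i. pf n (int i) (\<lambda>v. coeff (Q v) i)"
    "\<And>v. dle D (Q v)"
proof -
  let ?R = "\<lambda>D A. (\<forall>i. pf n (int i) (\<lambda>z. coeff (A z) i)) \<and> (\<forall>z. dle D (A z))"
  let ?P = "\<lambda>i v. [:u i, v i:]"
  have "\<exists>A. ?R D A \<and> (\<forall>z t. poly (A z) t = F (\<lambda>i. poly (?P i z) t))"
  proof (rule pf_lift[where R = ?R, OF assms])
    fix D :: int and c :: 'a assume "0 \<le> D"
    then show "?R D (\<lambda>z. [:c:])"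
      by (auto simp: coeff_pCons dle_const intro: pf.intros split: nat.splits)
  next
    fix D :: int and j assume "j < n" "1 \<le> D"
    have "pf n (int i) (\<lambda>v. coeff [:u j, v j:] i)" for i
    proof -
      consider "i = 0" | "i = 1" | k where "i = Suc (Suc k)" by (metis One_nat_def not0_implies_Suc)
      then show ?thesis using \<open>j < n\<close> by cases (auto intro: pf.intros)
    qed
    then show "?R D (?P j)" using \<open>1 \<le> D\<close> by (auto intro: dle_linear)
  next
    fix D E :: int and A B :: "(nat \<Rightarrow> 'a) \<Rightarrow> 'a poly"
    assume *: "?R D A" "?R E B"
    have "pf n (int i) (\<lambda>z. coeff (A z * B z) i)" for i
    proof -
      have "pf n (int i) (\<lambda>z. coeff (A z) j * coeff (B z) (i - j))" if "j \<le> i" for j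
      proof -
        have "int j + int (i - j) = int i" using that by simp
        then show ?thesis
          using pf_mult[of n "int j" "\<lambda>z. coeff (A z) j" "int (i - j)" "\<lambda>z. coeff (B z) (i - j)"] * by metis
      qed
      then show "pf n (int i) (\<lambda>z. coeff (A z * B z) i)"
        unfolding coeff_mult by (intro pf_sum) auto
    qed
    then show "?R (D + E) (\<lambda>z. A z * B z)" using * by (auto intro: dle_mult)
  qed (auto intro: pf.intros dle_add)
  then obtain A where A: "?R D A" "\<And>z t. poly (A z) t = F (\<lambda>i. poly (?P i z) t)" by blast
  show thesis by (rule that[of A]) (use A in auto)
qed

text \<open>The coordinates are moved into \<open>S\<close> one at a time: on the line along
  coordinate \<open>j\<close> the function restricts to a nonzero polynomial of degree at most
  \<open>D\<close>, which cannot vanish on all of \<open>S\<close>. With \<open>S\<close> the prime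
  field this supplies rational points.\<close>

lemma pf_nonzero_grid:
  fixes F :: "(nat \<Rightarrow> 'k::field) \<Rightarrow> 'k"
  assumes F: "pf n D F" "F z \<noteq> 0" and S: "finite S" "D < int (card S)"
  shows "\<exists>a. (\<forall>i<n. a i \<in> S) \<and> (\<forall>i\<ge>n. a i = 0) \<and> F a \<noteq> 0"
proof -
  have "\<exists>a. (\<forall>i<j. a i \<in> S) \<and> F a \<noteq> 0" if "j \<le> n" for j
    using that
  proof (induction j)
    case 0 then show ?case using F by auto
  next
    case (Suc j)
    then obtain a where a: "\<forall>i<j. a i \<in> S" "F a \<noteq> 0" by auto
    obtain q where q: "dle D q" "\<And>t. poly q t = F (\<lambda>i. (a(j := 0)) i + t * (if i = j then 1 else 0))"
      using pf_line[OF F(1)] by metis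
    have *: "poly q t = F (a(j := t))" for t unfolding q(2) by (rule arg_cong[of _ _ F]) auto
    have "poly q (a j) \<noteq> 0" using * a by simp
    then have "q \<noteq> 0" by auto
    have "D \<ge> 0" using pf_neg[OF F(1)] F(2) by (metis linorder_not_le)
    then have "degree q \<le> nat D" using q(1) dle_degree[of "nat D" q] by simp
    then have "card {t. poly q t = 0} < card S"
      using card_poly_roots_bound[OF \<open>q \<noteq> 0\<close>] S(2) \<open>D \<ge> 0\<close> by linarith
    then have "\<not> S \<subseteq> {t. poly q t = 0}"
      using card_mono[OF poly_roots_finite[OF \<open>q \<noteq> 0\<close>], of S] by linarith
    then obtain t where "t \<in> S" "poly q t \<noteq> 0" by auto
    then have "F (a(j := t)) \<noteq> 0" using * by simp
    moreover have "\<forall>i<Suc j. (a(j := t)) i \<in> S" using a \<open>t \<in> S\<close> by simp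
    ultimately show ?case by blast
  qed
  then obtain a where a: "\<forall>i<n. a i \<in> S" "F a \<noteq> 0" by blast
  have "F (\<lambda>i. if i < n then a i else 0) = F a" by (rule pf_cong[OF F(1)]) auto
  then show ?thesis using a by (intro exI[of _ "\<lambda>i. if i < n then a i else 0"]) auto
qed

text \<open>Affine space over an infinite field is irreducible: on the line through \<open>u\<close>
  and \<open>w\<close> both functions are nonzero polynomials in one variable, so their product has
  only finitely many zeros.\<close>

lemma PF_common_nonzero:
  fixes F G :: "(nat \<Rightarrow> 'k::field) \<Rightarrow> 'k"
  assumes "infinite (UNIV :: 'k set)" "PF n F" "PF n G" "F u \<noteq> 0" "G w \<noteq> 0"
  shows "\<exists>z. F z \<noteq> 0 \<and> G z \<noteq> 0"
proof -
  obtain D E where "pf n D F" "pf n E G" using assms by (auto simp: PF_def)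
  obtain p where p: "\<And>t. poly p t = F (\<lambda>i. u i + t * (w i - u i))" using pf_line[OF \<open>pf n D F\<close>] by metis
  obtain q where q: "\<And>t. poly q t = G (\<lambda>i. u i + t * (w i - u i))" using pf_line[OF \<open>pf n E G\<close>] by metis
  have "poly p 0 \<noteq> 0" "poly q 1 \<noteq> 0" unfolding p q using assms by simp_all
  then have "p * q \<noteq> 0" by auto
  then have "finite {t. poly (p * q) t = 0}" by (rule poly_roots_finite)
  then have "{t. poly (p * q) t = 0} \<noteq> UNIV" using assms(1) by metis
  then obtain t where "poly (p * q) t \<noteq> 0" by blast
  then show ?thesis using p q by auto
qed

text \<open>Rank over the ring of polynomial functions, without fractions. By induction there is a
  solution in \<open>N\<close> unknowns or a nonzero minor of size \<open>N\<close>; if every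
  enlargement of this minor by a row vanishes identically, the cofactors along the new row solve the
  whole system.\<close>

lemma generic_kernel:
  fixes C :: "'i \<Rightarrow> nat \<Rightarrow> (nat \<Rightarrow> 'k::field) \<Rightarrow> 'k"
  assumes "\<And>i j. i \<in> I \<Longrightarrow> j < N \<Longrightarrow> PF n (C i j)"
  shows "(\<exists>g. (\<forall>a<N. g a \<in> I) \<and> (\<exists>z. det (mat N N (\<lambda>(a,j). C (g a) j z)) \<noteq> 0)) \<or>
    (\<exists>s. (\<forall>j<N. PF n (s j)) \<and> (\<exists>j<N. \<exists>z. s j z \<noteq> 0) \<and> (\<forall>i\<in>I. \<forall>z. (\<Sum>j<N. C i j z * s j z) = 0))"
  using assms
proof (induction N)
  case 0 then show ?case by (auto simp: det_def)
next
  case (Suc N)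
  have "(\<exists>g. (\<forall>a<N. g a \<in> I) \<and> (\<exists>z. det (mat N N (\<lambda>(a,j). C (g a) j z)) \<noteq> 0)) \<or>
    (\<exists>s. (\<forall>j<N. PF n (s j)) \<and> (\<exists>j<N. \<exists>z. s j z \<noteq> 0) \<and> (\<forall>i\<in>I. \<forall>z. (\<Sum>j<N. C i j z * s j z) = 0))"
    by (rule Suc.IH) (rule Suc.prems, auto)
  then consider
    (s) s where "\<forall>j<N. PF n (s j)" "\<exists>j<N. \<exists>z. s j z \<noteq> 0" "\<forall>i\<in>I. \<forall>z. (\<Sum>j<N. C i j z * s j z) = 0"
  | (g) g z0 where "\<forall>a<N. g a \<in> I" "det (mat N N (\<lambda>(a,j). C (g a) j z0)) \<noteq> 0"
    by (elim disjE exE conjE; blast)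
  then show ?case
  proof cases
    case s
    then show ?thesis by (intro disjI2 exI[of _ "\<lambda>j. if j < N then s j else (\<lambda>_. 0)"]) (auto intro: less_SucI)
  next
    case g
    let ?A = "\<lambda>i z. mat (Suc N) (Suc N) (\<lambda>(a,j). C (if a < N then g a else i) j z)"
    show ?thesis
    proof (cases "\<exists>i\<in>I. \<exists>z. det (?A i z) \<noteq> 0")
      case True
      then obtain i z where "i \<in> I" "det (?A i z) \<noteq> 0" by blast
      then show ?thesis using g by (intro disjI1 exI[of _ "\<lambda>a. if a < N then g a else i"]) auto
    next
      case False
      \<comment> \<open>These are the cofactors along the appended row. They do not involve that
        row, so one vector serves all \<open>i\<close>, and \<open>s N\<close> is the given nonzero
        minor.\<close>
      define s where "s j z = (-1) ^ (N + j) * det (mat N N (\<lambda>(a,b). C (g a) (if b < j then b else Suc b) z))" for j z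
      have cof: "cofactor (?A i z) N j = s j z" if "j < Suc N" for i j z
      proof -
        have "mat_delete (?A i z) N j = mat N N (\<lambda>(a,b). C (g a) (if b < j then b else Suc b) z)"
          by (rule eq_matI) (use that in \<open>auto simp: mat_delete_def\<close>)
        then show ?thesis by (simp add: cofactor_def s_def)
      qed
      have "(\<Sum>j<Suc N. C i j z * s j z) = 0" if "i \<in> I" for i z
      proof -
        have "det (?A i z) = (\<Sum>j<Suc N. ?A i z $$ (N, j) * cofactor (?A i z) N j)"
          by (rule laplace_expansion_row[of _ "Suc N"]) auto
        also have "\<dots> = (\<Sum>j<Suc N. C i j z * s j z)"
          by (rule sum.cong) (auto simp: cof)
        finally show ?thesis using False that by simp
      qed
      moreover have "PF n (s j)" if "j < Suc N" for j
      proof -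
        have "PF n (\<lambda>z. s j z)" unfolding s_def
          by (intro PF_cmult PF_det) (use g Suc.prems in auto)
        then show ?thesis by simp
      qed
      moreover have "s N z0 \<noteq> 0"
      proof -
        have "mat N N (\<lambda>(a,b). C (g a) (if b < N then b else Suc b) z0) = mat N N (\<lambda>(a,j). C (g a) j z0)"
          by (rule eq_matI) auto
        then show ?thesis using g(2) by (simp add: s_def)
      qed
      ultimately show ?thesis by (intro disjI2 exI[of _ s]) auto
    qed
  qed
qed

subsection \<open>The algebraic closure of the prime field\<close>

locale Fpbar =
  fixes p :: nat and T :: "'k::field itself"
  assumes acl: "is_alg_closure_Fp p T"
begin

abbreviation Fp :: "'k set" where "Fp \<equiv> prime_subfield"

lemma prime_p: "prime p" and of_nat_p: "of_nat p = (0::'k)"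
  and alg_root: "\<And>q::'k poly. degree q \<ge> 1 \<Longrightarrow> \<exists>x. poly q x = 0"
  using acl by (auto simp: is_alg_closure_Fp_def)

lemma p_gt_1: "p > 1" using prime_p by (rule prime_gt_1_nat)

lemma char_k: "CHAR('k) = p"
proof -
  have "CHAR('k) dvd p" using of_nat_p of_nat_eq_0_iff_char_dvd[where 'a = 'k, of p] by simp
  moreover have "CHAR('k) \<noteq> 1"
  proof
    assume "CHAR('k) = 1"
    then have "of_nat 1 = (0::'k)" using of_nat_eq_0_iff_char_dvd[where 'a = 'k, of 1] by simp
    then show False by simp
  qed
  ultimately show ?thesis using prime_p by (auto simp: prime_nat_iff)
qed

lemma frob_add: "(x + y :: 'k) ^ p = x ^ p + y ^ p"
  by (rule freshmans_dream) (simp_all add: char_k prime_p)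

lemma frob_sum: "(\<Sum>i\<in>A. f i :: 'k) ^ p = (\<Sum>i\<in>A. f i ^ p)"
  by (rule freshmans_dream_sum) (simp_all add: char_k prime_p)

lemma frob_uminus: "(- x :: 'k) ^ p = - (x ^ p)"
proof -
  have "x ^ p + (- x) ^ p = 0" using frob_add[of x "- x"] p_gt_1 by (simp add: zero_power)
  then show ?thesis by (simp add: add_eq_0_iff2)
qed

lemma frob_diff: "(x - y :: 'k) ^ p = x ^ p - y ^ p"
  using frob_add[of x "- y"] frob_uminus by simp

lemma frob_surj: "\<exists>y::'k. y ^ p = x"
proof -
  have "\<exists>y. poly (monom 1 p - [:x:]) y = 0"
  proof (rule alg_root)
    have "coeff (monom 1 p - [:x:]) p \<noteq> 0" using p_gt_1 by (simp add: coeff_pCons split: nat.splits)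
    then have "p \<le> degree (monom 1 p - [:x:])" by (rule le_degree)
    then show "1 \<le> degree (monom 1 p - [:x:])" using p_gt_1 by linarith
  qed
  then show ?thesis by (auto simp: poly_monom)
qed

lemma infinite_k: "infinite (UNIV :: 'k set)"
proof
  assume fin: "finite (UNIV :: 'k set)"
  let ?q = "(\<Prod>a\<in>(UNIV::'k set). [:-a, 1:])"
  have "degree ?q = card (UNIV :: 'k set)"
    by (subst degree_prod_eq_sum_degree) auto
  then have "degree ?q \<ge> 1" using fin by (simp add: Suc_leI card_gt_0_iff)
  moreover have "degree (?q + [:1:]) = degree ?q" by (rule degree_add_eq_left) (use \<open>degree ?q \<ge> 1\<close> in auto)
  ultimately obtain x where "poly (?q + [:1:]) x = 0" using alg_root[of "?q + [:1:]"] by auto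
  moreover have "poly ?q x = 0" using fin by (simp add: poly_prod prod_zero_iff)
  ultimately show False by simp
qed

lemma Fp_iff_aux: "a \<in> Fp \<Longrightarrow> a ^ p = (a::'k)"
proof -
  have "(of_nat m :: 'k) ^ p = of_nat m" for m
    by (induction m) (use p_gt_1 in \<open>auto simp: frob_add\<close>)
  then show "a \<in> Fp \<Longrightarrow> a ^ p = a" by (auto simp: prime_subfield_def)
qed

lemma card_Fp_roots: "finite Fp" "card Fp = p" "Fp = {a::'k. a ^ p = a}"
proof -
  let ?q = "monom 1 p - [:0, 1::'k:]"
  have deg: "degree ?q \<le> p"
    using p_gt_1 by (intro degree_diff_le) (auto simp: degree_monom_le)
  have "coeff ?q p \<noteq> 0" using p_gt_1 by (auto simp: coeff_pCons split: nat.splits)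
  then have "?q \<noteq> 0" by (metis coeff_0)
  have roots: "{a. poly ?q a = 0} = {a::'k. a ^ p = a}" by (auto simp: poly_monom)
  have fin: "finite {a::'k. a ^ p = a}" and card: "card {a::'k. a ^ p = a} \<le> p"
    using poly_roots_finite[OF \<open>?q \<noteq> 0\<close>] card_poly_roots_bound[OF \<open>?q \<noteq> 0\<close>] deg roots by auto
  have sub: "Fp \<subseteq> {a::'k. a ^ p = a}" using Fp_iff_aux by auto
  have inj: "inj_on (of_nat :: nat \<Rightarrow> 'k) {..<p}"
  proof (rule inj_onI)
    fix x y assume "x \<in> {..<p}" "y \<in> {..<p}" "(of_nat x :: 'k) = of_nat y"
    moreover have False if "x < y" "y < p" "(of_nat x :: 'k) = of_nat y" for x y
    proof -
      have "of_nat (y - x) = (0::'k)" using that by (simp add: of_nat_diff)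
      then have "p dvd y - x" using of_nat_eq_0_iff_char_dvd[where 'a = 'k, of "y - x"] char_k by simp
      then show False using that nat_dvd_not_less[of "y - x" p] by simp
    qed
    ultimately show "x = y" by (metis lessThan_iff linorder_neqE_nat)
  qed
  have "p = card ((of_nat :: nat \<Rightarrow> 'k) ` {..<p})" using card_image[OF inj] by simp
  also have "\<dots> \<le> card Fp"
    by (rule card_mono) (use finite_subset[OF sub fin] in \<open>auto simp: prime_subfield_def\<close>)
  finally have "p \<le> card Fp" .
  then show "Fp = {a::'k. a ^ p = a}" using card_seteq[OF fin sub] card by linarith
  then show "finite Fp" "card Fp = p" using fin card \<open>p \<le> card Fp\<close> by auto
qed

lemma mem_Fp: "a \<in> Fp \<longleftrightarrow> a ^ p = (a::'k)" using card_Fp_roots(3) by blast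

lemma Fp_closed: "0 \<in> Fp" "1 \<in> Fp" "a \<in> Fp \<Longrightarrow> b \<in> Fp \<Longrightarrow> a + b \<in> Fp" "a \<in> Fp \<Longrightarrow> b \<in> Fp \<Longrightarrow> a * b \<in> Fp"
  "a \<in> Fp \<Longrightarrow> b \<in> Fp \<Longrightarrow> a - b \<in> Fp" "a \<in> Fp \<Longrightarrow> - a \<in> Fp" "a \<in> Fp \<Longrightarrow> inverse a \<in> Fp"
  "a \<in> Fp \<Longrightarrow> b \<in> Fp \<Longrightarrow> a / b \<in> Fp"
  for a b :: 'k
  using p_gt_1 by (auto simp: mem_Fp frob_add frob_diff frob_uminus power_mult_distrib power_inverse power_divide)

end

subsection \<open>Polynomial functions and the polynomials of the definitions\<close>

definition mv :: "(nat \<Rightarrow>\<^sub>0 nat) \<Rightarrow> (nat \<Rightarrow> 'k::comm_ring_1) \<Rightarrow> 'k" where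
  "mv m x = (\<Prod>i\<in>Poly_Mapping.keys m. x i ^ Poly_Mapping.lookup m i)"

lemma mv_superset: "finite A \<Longrightarrow> Poly_Mapping.keys m \<subseteq> A \<Longrightarrow> mv m x = (\<Prod>i\<in>A. x i ^ Poly_Mapping.lookup m i)"
  unfolding mv_def by (rule prod.mono_neutral_left) (auto simp: in_keys_iff)

lemma mv_add: "mv (m + m') x = mv m x * mv m' x"
proof -
  let ?A = "Poly_Mapping.keys m \<union> Poly_Mapping.keys m'"
  have "mv (m + m') x = (\<Prod>i\<in>?A. x i ^ Poly_Mapping.lookup (m + m') i)"
    by (rule mv_superset) (use keys_add[of m m'] in auto)
  also have "\<dots> = (\<Prod>i\<in>?A. x i ^ Poly_Mapping.lookup m i) * (\<Prod>i\<in>?A. x i ^ Poly_Mapping.lookup m' i)"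
    by (simp add: lookup_add power_add prod.distrib)
  also have "\<dots> = mv m x * mv m' x"
    by (simp add: mv_superset[of ?A m] mv_superset[of ?A m'])
  finally show ?thesis .
qed

lemma mpeval_superset: "finite A \<Longrightarrow> Poly_Mapping.keys f \<subseteq> A \<Longrightarrow> mpeval f x = (\<Sum>m\<in>A. Poly_Mapping.lookup f m * mv m x)"
  unfolding mpeval_def mv_def by (rule sum.mono_neutral_left) (auto simp: in_keys_iff)

lemma mpeval_add: "mpeval (f + g) x = mpeval f x + mpeval g x"
proof -
  let ?A = "Poly_Mapping.keys f \<union> Poly_Mapping.keys g"
  have "mpeval (f + g) x = (\<Sum>m\<in>?A. Poly_Mapping.lookup (f + g) m * mv m x)"
    by (rule mpeval_superset) (use keys_add[of f g] in auto)
  also have "\<dots> = (\<Sum>m\<in>?A. Poly_Mapping.lookup f m * mv m x) + (\<Sum>m\<in>?A. Poly_Mapping.lookup g m * mv m x)"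
    by (simp add: lookup_add algebra_simps sum.distrib)
  also have "\<dots> = mpeval f x + mpeval g x"
    by (simp add: mpeval_superset[of ?A f] mpeval_superset[of ?A g])
  finally show ?thesis .
qed

lemma mpeval_0: "mpeval 0 x = 0" by (simp add: mpeval_def)

lemma mpeval_single: "mpeval (Poly_Mapping.single m c) x = c * mv m x"
  by (subst mpeval_superset[of "{m}"]) auto

lemma mv_single: "mv (Poly_Mapping.single i 1) x = x i"
  by (subst mv_superset[of "{i}"]) (auto simp: lookup_single)

lemma mv_0: "mv 0 x = 1" by (simp add: mv_def)

lemma pf_monomials:
  assumes "pf n D F"
  shows "\<exists>L. \<forall>z. F z = (\<Sum>(c,m)\<leftarrow>L. c * mv m z)"
  using assms
proof (induction rule: pf.induct)
  case (pf_zero D) show ?case by (rule exI[of _ "[]"]) simp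
next
  case (pf_const D c) show ?case by (rule exI[of _ "[(c, 0)]"]) (simp add: mv_0)
next
  case (pf_var i D) show ?case by (rule exI[of _ "[(1, Poly_Mapping.single i 1)]"]) (simp add: mv_single del: One_nat_def)
next
  case (pf_add D F G)
  then obtain L M where "\<forall>z. F z = (\<Sum>(c,m)\<leftarrow>L. c * mv m z)" "\<forall>z. G z = (\<Sum>(c,m)\<leftarrow>M. c * mv m z)" by blast
  then show ?case by (intro exI[of _ "L @ M"]) simp
next
  case (pf_mult D F E G)
  then obtain L M where L: "\<forall>z. F z = (\<Sum>(c,m)\<leftarrow>L. c * mv m z)" and M: "\<forall>z. G z = (\<Sum>(c,m)\<leftarrow>M. c * mv m z)" by blast
  have M': "(\<Sum>(c',m')\<leftarrow>map (\<lambda>(c',m'). (c * c', m + m')) M. c' * mv m' z) = c * mv m z * (\<Sum>(c,m)\<leftarrow>M. c * mv m z)"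
    for c m z by (induction M) (auto simp: mv_add algebra_simps)
  have "(\<Sum>(c,m)\<leftarrow>concat (map (\<lambda>(c,m). map (\<lambda>(c',m'). (c * c', m + m')) M) L). c * mv m z)
      = (\<Sum>(c,m)\<leftarrow>L. c * mv m z) * (\<Sum>(c,m)\<leftarrow>M. c * mv m z)" for z
  proof (induction L)
    case (Cons x L)
    obtain c m where x: "x = (c, m)" by fastforce
    show ?case by (simp only: x list.map concat.simps map_append sum_list_append sum_list.Cons prod.case Cons.IH M' distrib_right)
  qed simp
  then show ?case using L M by (intro exI[of _ "concat (map (\<lambda>(c,m). map (\<lambda>(c',m'). (c * c', m + m')) M) L)"]) simp
qed

lemma PF_mpeval:
  assumes "PF n F"
  obtains f where "\<And>z. mpeval f z = F z"
proof -
  obtain D where "pf n D F" using assms by (auto simp: PF_def)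
  then obtain L where L: "\<And>z. F z = (\<Sum>(c,m)\<leftarrow>L. c * mv m z)" using pf_monomials by blast
  have "mpeval (\<Sum>(c,m)\<leftarrow>L. Poly_Mapping.single m c) z = (\<Sum>(c,m)\<leftarrow>L. c * mv m z)" for z
    by (induction L) (auto simp: mpeval_add mpeval_single mpeval_0)
  then show thesis by (intro that) (simp only: L)
qed

lemma mpeval_PF:
  obtains F where "PF n F" "\<And>z. z \<in> affine_space n \<Longrightarrow> mpeval f z = F z"
proof
  \<comment> \<open>A polynomial of the definitions may contain variables beyond the
    \<open>n\<close>-th. Setting them to 0 changes nothing on \<open>affine_space n\<close> and
    leaves a function of \<open>n\<close> variables.\<close>
  let ?F = "\<lambda>z. mpeval f (\<lambda>i. if i < n then z i else 0)"
  have "PF n (\<lambda>z. (if i < n then z i else 0))" for i by (cases "i < n") (auto intro: PF_var)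
  then show "PF n ?F" unfolding mpeval_def by (intro PF_sum PF_mult PF_prod PF_power) auto
  show "mpeval f z = ?F z" if "z \<in> affine_space n" for z
    using that by (intro arg_cong[of _ _ "mpeval f"]) (auto simp: affine_space_def)
qed

definition zeros :: "nat \<Rightarrow> ((nat \<Rightarrow> 'k::field) \<Rightarrow> 'k) set \<Rightarrow> (nat \<Rightarrow> 'k) set" where
  "zeros n S = {z \<in> affine_space n. \<forall>F\<in>S. F z = 0}"

lemma zariski_closed_iff:
  fixes Z :: "(nat \<Rightarrow> 'k::field) set"
  shows "zariski_closed n Z \<longleftrightarrow> (\<exists>S. (\<forall>F\<in>S. PF n F) \<and> Z = zeros n S)"
proof
  assume "zariski_closed n Z"
  then obtain S where S: "Z = zero_set n S" by (auto simp: zariski_closed_def)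
  have "\<forall>f :: 'k mpoly_rep. \<exists>F. PF n F \<and> (\<forall>z\<in>affine_space n. mpeval f z = F z)"
  proof
    fix f :: "'k mpoly_rep"
    show "\<exists>F. PF n F \<and> (\<forall>z\<in>affine_space n. mpeval f z = F z)" by (rule mpeval_PF[of n f]) blast
  qed
  from choice[OF this] obtain \<Phi> where "\<forall>f :: 'k mpoly_rep. PF n (\<Phi> f) \<and> (\<forall>z\<in>affine_space n. mpeval f z = \<Phi> f z)" ..
  then have \<Phi>: "PF n (\<Phi> f)" "z \<in> affine_space n \<Longrightarrow> mpeval f z = \<Phi> f z" for f z by auto
  have "Z = zeros n (\<Phi> ` S)"
    unfolding S zero_set_def zeros_def by (rule Collect_cong) (simp add: \<Phi>(2) cong: conj_cong)
  moreover have "\<forall>F\<in>\<Phi> ` S. PF n F" using \<Phi>(1) by blast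
  ultimately show "\<exists>S. (\<forall>F\<in>S. PF n F) \<and> Z = zeros n S" by blast
next
  assume "\<exists>S. (\<forall>F\<in>S. PF n F) \<and> Z = zeros n S"
  then obtain S where S: "\<forall>F\<in>S. PF n F" "Z = zeros n S" by blast
  have "\<forall>F. \<exists>f. F \<in> S \<longrightarrow> (\<forall>z. mpeval f z = F z)"
  proof (intro allI)
    fix F show "\<exists>f. F \<in> S \<longrightarrow> (\<forall>z. mpeval f z = F z)"
    proof (cases "F \<in> S")
      case True
      then have "PF n F" using S(1) by blast
      then obtain f where "\<And>z. mpeval f z = F z" by (rule PF_mpeval) blast
      then show ?thesis by (intro exI) auto
    qed simp
  qed
  from choice[OF this] obtain \<phi> where "\<forall>F. F \<in> S \<longrightarrow> (\<forall>z. mpeval (\<phi> F) z = F z)" ..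
  then have "Z = zero_set n (\<phi> ` S)" using S(2) by (auto simp: zero_set_def zeros_def)
  then show "zariski_closed n Z" by (auto simp: zariski_closed_def)
qed

lemma zariski_closed_cut:
  assumes "zariski_closed n Z" "PF n F"
  shows "zariski_closed n {z \<in> Z. F z = 0}"
proof -
  obtain S where S: "\<forall>F\<in>S. PF n F" "Z = zeros n S" using assms(1)[unfolded zariski_closed_iff] by blast
  have "{z \<in> Z. F z = 0} = zeros n (insert F S)" using S(2) by (auto simp: zeros_def)
  moreover have "\<forall>G\<in>insert F S. PF n G" using S assms(2) by blast
  ultimately show ?thesis unfolding zariski_closed_iff by blast
qed

lemma zariski_closed_subset: "zariski_closed n Z \<Longrightarrow> Z \<subseteq> affine_space n"
  by (auto simp: zariski_closed_def zero_set_def)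

lemma zariski_separate:
  assumes "zariski_closed n Z" "z \<in> affine_space n" "z \<notin> Z"
  obtains F where "PF n F" "\<And>x. x \<in> Z \<Longrightarrow> F x = 0" "F z \<noteq> 0"
proof -
  obtain S where S: "\<forall>F\<in>S. PF n F" "Z = zeros n S" using assms(1)[unfolded zariski_closed_iff] by blast
  then obtain F where F: "F \<in> S" "F z \<noteq> 0" using assms(2,3) by (auto simp: zeros_def)
  show thesis by (rule that[of F]) (use F S in \<open>auto simp: zeros_def\<close>)
qed

text \<open>The vanishing ideal of an irreducible set is prime: \<open>X\<close> is the union of its
  two closed cuts by \<open>F\<close> and \<open>G\<close>.\<close>

lemma irreducible_mult:
  assumes "irreducible_closed n X" "PF n F" "PF n G" "\<And>z. z \<in> X \<Longrightarrow> F z * G z = 0"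
  shows "(\<forall>z\<in>X. F z = 0) \<or> (\<forall>z\<in>X. G z = 0)"
proof -
  have X: "zariski_closed n X" using assms by (auto simp: irreducible_closed_def)
  have split: "X = Z1 \<or> X = Z2" if "zariski_closed n Z1" "zariski_closed n Z2" "X = Z1 \<union> Z2" for Z1 Z2
    using assms(1) that unfolding irreducible_closed_def by simp
  have "X = {z \<in> X. F z = 0} \<or> X = {z \<in> X. G z = 0}"
    by (rule split[OF zariski_closed_cut[OF X assms(2)] zariski_closed_cut[OF X assms(3)]]) (use assms(4) in auto)
  then show ?thesis by blast
qed

subsection \<open>Determinants and kernels\<close>

lemma det_kernel_zero:
  fixes f :: "nat \<Rightarrow> nat \<Rightarrow> 'a::idom"
  assumes "j0 < N" "v j0 \<noteq> 0" "\<And>i. i < N \<Longrightarrow> (\<Sum>j<N. f i j * v j) = 0"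
  shows "det (mat N N (\<lambda>(i,j). f i j)) = 0"
proof -
  let ?A = "mat N N (\<lambda>(i,j). f i j)"
  have "vec N v \<noteq> 0\<^sub>v N"
  proof
    assume "vec N v = 0\<^sub>v N"
    then have "vec_index (vec N v) j0 = vec_index (0\<^sub>v N) j0" by simp
    then show False using assms by simp
  qed
  moreover have "?A *\<^sub>v vec N v = 0\<^sub>v N"
  proof (rule eq_vecI)
    fix i assume "i < dim_vec (0\<^sub>v N :: 'a vec)"
    then have i: "i < N" by simp
    have "vec_index (?A *\<^sub>v vec N v) i = (\<Sum>j<N. f i j * v j)"
      using i by (simp add: scalar_prod_def lessThan_atLeast0)
    then show "vec_index (?A *\<^sub>v vec N v) i = vec_index (0\<^sub>v N) i" using assms(3)[OF i] i by simp
  qed simp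
  ultimately show ?thesis
    by (subst det_0_iff_vec_prod_zero[of _ N]) (auto intro!: exI[of _ "vec N v"])
qed

lemma det_zero_kernel:
  fixes f :: "nat \<Rightarrow> nat \<Rightarrow> 'a::idom"
  assumes "det (mat N N (\<lambda>(i,j). f i j)) = 0"
  obtains v where "\<exists>j<N. v j \<noteq> 0" "\<And>i. i < N \<Longrightarrow> (\<Sum>j<N. f i j * v j) = 0"
proof -
  let ?A = "mat N N (\<lambda>(i,j). f i j)"
  have "?A \<in> carrier_mat N N" by simp
  from det_0_iff_vec_prod_zero[OF this] assms obtain v where
    v: "v \<in> carrier_vec N" "v \<noteq> 0\<^sub>v N" "?A *\<^sub>v v = 0\<^sub>v N" by auto
  show thesis
  proof (rule that[of "\<lambda>j. vec_index v j"])
    show "\<exists>j<N. vec_index v j \<noteq> 0"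
    proof (rule ccontr)
      assume "\<not> ?thesis"
      then have "v = 0\<^sub>v N" using v(1) by (intro eq_vecI) auto
      then show False using v by simp
    qed
    fix i assume i: "i < N"
    have "vec_index (?A *\<^sub>v v) i = (\<Sum>j<N. f i j * vec_index v j)"
      using i v(1) by (simp add: scalar_prod_def lessThan_atLeast0)
    then show "(\<Sum>j<N. f i j * vec_index v j) = 0" using v(3) i by simp
  qed
qed

lemma poly_char_poly_mat:
  fixes f :: "nat \<Rightarrow> nat \<Rightarrow> 'a::field"
  shows "poly (char_poly (mat N N (\<lambda>(i,j). f i j))) Y = det (mat N N (\<lambda>(i,j). (if i = j then Y else 0) - f i j))"
  unfolding char_poly_def
  by (rule poly_det_cong[of _ N]) (auto simp: char_poly_matrix_def)

lemma sum_atMost_split: "(\<Sum>i\<le>N. f i) = (\<Sum>i<N. f i) + f (N::nat)" for f :: "nat \<Rightarrow> 'a::comm_monoid_add"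
  by (simp add: lessThan_Suc_atMost[symmetric])

subsection \<open>Reduction of powers modulo a polynomial relation\<close>

text \<open>Coefficient of \<open>y ^ j\<close> in the pseudo-remainder of \<open>y ^ n\<close>
  modulo \<open>\<Sum>j\<le>D. w j * y ^ j\<close>, that is, after multiplication by
  \<open>w D ^ n\<close>. Each step multiplies by \<open>y\<close> and removes the new term in
  \<open>y ^ D\<close> without dividing by \<open>w D\<close>.\<close>

fun red :: "(nat \<Rightarrow> 'a::comm_ring_1) \<Rightarrow> nat \<Rightarrow> nat \<Rightarrow> nat \<Rightarrow> 'a" where
  "red w D 0 j = (if j = 0 then 1 else 0)"
| "red w D (Suc n) j = w D * (if j = 0 then 0 else red w D n (j - 1)) - red w D n (D - 1) * w j"

lemma red_dvd:
  fixes w :: "nat \<Rightarrow> 'a::comm_ring_1"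
  assumes "D > 0"
  shows "(\<Sum>j\<le>D. w j * y ^ j) dvd w D ^ n * y ^ n - (\<Sum>j<D. red w D n j * y ^ j)"
proof (induction n)
  case 0
  have "(\<Sum>j<D. red w D 0 j * y ^ j) = 1"
    using assms by (simp add: if_distrib[of "\<lambda>x. x * _"] cong: if_cong)
  then show ?case by simp
next
  case (Suc n)
  obtain d where D: "D = Suc d" using assms not0_implies_Suc by blast
  have "(\<Sum>j<D. red w D (Suc n) j * y ^ j) =
      w D * (\<Sum>j<D. (if j = 0 then 0 else red w D n (j - 1)) * y ^ j) - red w D n d * (\<Sum>j<D. w j * y ^ j)"
    by (simp only: red.simps D diff_Suc_1 left_diff_distrib sum_subtractf sum_distrib_left mult.assoc)
  also have "(\<Sum>j<D. (if j = 0 then 0 else red w D n (j - 1)) * y ^ j) = y * (\<Sum>j<d. red w D n j * y ^ j)"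
    unfolding D sum.lessThan_Suc_shift by (simp add: sum_distrib_left algebra_simps)
  also have "(\<Sum>j<d. red w D n j * y ^ j) = (\<Sum>j<D. red w D n j * y ^ j) - red w D n d * y ^ d"
    by (simp add: D)
  also have "(\<Sum>j<D. w j * y ^ j) = (\<Sum>j\<le>D. w j * y ^ j) - w D * y ^ D"
    by (simp add: lessThan_Suc_atMost[symmetric])
  finally have "w D ^ Suc n * y ^ Suc n - (\<Sum>j<D. red w D (Suc n) j * y ^ j) =
     w D * y * (w D ^ n * y ^ n - (\<Sum>j<D. red w D n j * y ^ j)) + red w D n d * (\<Sum>j\<le>D. w j * y ^ j)"
    by (simp add: D algebra_simps)
  then show ?case using Suc.IH by (auto intro!: dvd_add dvd_mult)
qed

lemma red_eval:
  fixes w :: "nat \<Rightarrow> 'a::comm_ring_1"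
  assumes "D > 0" "(\<Sum>j\<le>D. w j * y ^ j) = 0"
  shows "w D ^ n * y ^ n = (\<Sum>j<D. red w D n j * y ^ j)"
  using red_dvd[OF assms(1), of w y n] assms(2) by simp

text \<open>Counted with \<open>y\<close> of weight 1 and \<open>w j\<close> of weight
  \<open>D - j\<close>, both terms of the recursion have the same weight; a constant
  \<open>w D\<close> adds nothing.\<close>

lemma red_pf:
  assumes "\<And>j. j < D \<Longrightarrow> pf m (int D - int j) (w j)" "pf m 0 (w D)" "D > 0" "j < D"
  shows "pf m (int n - int j) (\<lambda>a. red (\<lambda>j. w j a) D n j)"
  using assms(4)
proof (induction n arbitrary: j)
  case 0
  then show ?case by (cases "j = 0") (auto intro: pf.intros)
next
  case (Suc n)
  have "pf m (int (Suc n) - int j) (\<lambda>a. w D a * (if j = 0 then 0 else red (\<lambda>j. w j a) D n (j - 1)))"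
  proof (cases "j = 0")
    case False
    then have "pf m (int n - int (j - 1)) (\<lambda>a. red (\<lambda>j. w j a) D n (j - 1))"
      using Suc.prems by (intro Suc.IH) auto
    from pf_mult[OF assms(2) this] show ?thesis using False by (simp add: of_nat_diff algebra_simps)
  qed (simp add: pf_zero)
  moreover have "pf m (int (Suc n) - int j) (\<lambda>a. red (\<lambda>j. w j a) D n (D - 1) * w j a)"
    using pf_mult[OF Suc.IH[of "D - 1"] assms(1)[OF Suc.prems]] assms(3) by (simp add: of_nat_diff algebra_simps)
  ultimately show ?case by (simp add: pf_diff)
qed

lemma red_PF:
  assumes "\<And>j. j \<le> D \<Longrightarrow> PF m (w j)" "D > 0" "j < D"
  shows "PF m (\<lambda>a. red (\<lambda>j. w j a) D n j)"
  using assms(3)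
proof (induction n arbitrary: j)
  case (Suc n)
  have "PF m (\<lambda>a. if j = 0 then 0 else red (\<lambda>j. w j a) D n (j - 1))"
    using Suc by (cases "j = 0") auto
  then show ?case using Suc assms by (auto intro!: PF_diff PF_mult)
qed simp

subsection \<open>Finite linear projections\<close>

text \<open>The module of functions on \<open>X\<close> is generated over the functions of \<open>\<pi>\<close> by finitely many
  generators \<open>b \<beta>\<close>; giving \<open>b \<beta>\<close> the weight \<open>\<omega> \<beta>\<close> expresses that no point at infinity of \<open>X\<close> is
  contracted by \<open>\<pi>\<close>, and makes all integral equations have total degree equal to their degree.\<close>

definition sfin :: "(nat \<Rightarrow> 'k::field) set \<Rightarrow> nat \<Rightarrow> nat \<Rightarrow> ((nat \<Rightarrow> 'k) \<Rightarrow> nat \<Rightarrow> 'k) \<Rightarrow> bool" where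
  "sfin X n m \<pi> \<longleftrightarrow> (\<exists>N (b :: nat \<Rightarrow> (nat \<Rightarrow> 'k) \<Rightarrow> 'k) (\<omega> :: nat \<Rightarrow> int). 0 < N \<and> \<omega> 0 = 0 \<and> b 0 = (\<lambda>_. 1) \<and>
     (\<forall>i<n. \<forall>\<beta><N. \<exists>c. (\<forall>\<gamma><N. pf m (\<omega> \<beta> + 1 - \<omega> \<gamma>) (c \<gamma>)) \<and>
        (\<forall>z\<in>X. z i * b \<beta> z = (\<Sum>\<gamma><N. c \<gamma> (\<pi> z) * b \<gamma> z))))"

definition proj :: "nat \<Rightarrow> nat \<Rightarrow> ((nat \<Rightarrow> 'k::field) \<Rightarrow> nat \<Rightarrow> 'k) \<Rightarrow> bool" where
  "proj n m \<pi> \<longleftrightarrow> (\<forall>j<m. pf n 1 (\<lambda>z. \<pi> z j))"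

text \<open>Algebraic independence of the coordinates of \<open>\<pi>\<close> on \<open>X\<close>;
  in geometric terms, the map \<open>\<pi>\<close> from \<open>X\<close> to affine
  \<open>m\<close>-space is dominant.\<close>

definition indep :: "(nat \<Rightarrow> 'k::field) set \<Rightarrow> nat \<Rightarrow> ((nat \<Rightarrow> 'k) \<Rightarrow> nat \<Rightarrow> 'k) \<Rightarrow> bool" where
  "indep X m \<pi> \<longleftrightarrow> (\<forall>F. PF m F \<longrightarrow> (\<forall>z\<in>X. F (\<pi> z) = 0) \<longrightarrow> (\<forall>a. F a = 0))"

lemma sfin_id: "sfin X n n (\<lambda>z. z)"
  unfolding sfin_def
proof (rule exI[of _ "Suc 0"], rule exI[of _ "\<lambda>_ _. 1"], rule exI[of _ "\<lambda>_. 0"], intro conjI allI impI)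
  fix i \<beta> assume i: "i < n" and "\<beta> < Suc 0"
  show "\<exists>c. (\<forall>\<gamma><Suc 0. pf n (0 + 1 - 0) (c \<gamma>)) \<and> (\<forall>z\<in>X. z i * 1 = (\<Sum>\<gamma><Suc 0. c \<gamma> z * 1))"
    by (rule exI[of _ "\<lambda>_ z. z i"]) (use i in \<open>simp add: pf_var\<close>)
qed auto

lemma sfin_subset: "sfin X n m \<pi> \<Longrightarrow> Y \<subseteq> X \<Longrightarrow> sfin Y n m \<pi>"
  unfolding sfin_def
  by (elim ex_forward conj_forward all_forward imp_forward) (auto dest: subsetD)

text \<open>The definition of \<open>sfin\<close> speaks only of multiplication by coordinates.
  Composing these matrices along the construction of \<open>F\<close> gives multiplication by any
  \<open>F\<close> of bound \<open>D\<close>, and the weights \<open>\<omega>\<close> telescope to a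
  shift by \<open>D\<close>.\<close>

lemma sfin_module:
  assumes "sfin X n m \<pi>"
  obtains N :: nat and b :: "nat \<Rightarrow> (nat \<Rightarrow> 'k::field) \<Rightarrow> 'k" and \<omega> :: "nat \<Rightarrow> int" where "0 < N" "b 0 = (\<lambda>_. 1)"
    "\<And>D F \<beta>. pf n D F \<Longrightarrow> \<beta> < N \<Longrightarrow> \<exists>c. (\<forall>\<gamma><N. pf m (\<omega> \<beta> + D - \<omega> \<gamma>) (c \<gamma>)) \<and>
        (\<forall>z\<in>X. F z * b \<beta> z = (\<Sum>\<gamma><N. c \<gamma> (\<pi> z) * b \<gamma> z))"
proof -
  obtain N and b :: "nat \<Rightarrow> (nat \<Rightarrow> 'k::field) \<Rightarrow> 'k" and \<omega> where N: "0 < N" "b 0 = (\<lambda>_. 1)"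
    and gen: "\<forall>i<n. \<forall>\<beta><N. \<exists>c. (\<forall>\<gamma><N. pf m (\<omega> \<beta> + 1 - \<omega> \<gamma>) (c \<gamma>)) \<and>
        (\<forall>z\<in>X. z i * b \<beta> z = (\<Sum>\<gamma><N. c \<gamma> (\<pi> z) * b \<gamma> z))"
    using assms unfolding sfin_def by (elim exE conjE) (rule that)
  have "\<exists>c. (\<forall>\<gamma><N. pf m (\<omega> \<beta> + D - \<omega> \<gamma>) (c \<gamma>)) \<and> (\<forall>z\<in>X. F z * b \<beta> z = (\<Sum>\<gamma><N. c \<gamma> (\<pi> z) * b \<gamma> z))"
    if "pf n D F" "\<beta> < N" for D F \<beta>
    using that
  proof (induction arbitrary: \<beta> rule: pf.induct)
    case (pf_zero D)
    show ?case by (rule exI[of _ "\<lambda>_ _. 0"]) (auto intro: pf.intros)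
  next
    case (pf_const D k)
    show ?case
      by (rule exI[of _ "\<lambda>\<gamma> _. if \<gamma> = \<beta> then k else 0"])
        (use pf_const in \<open>auto intro: pf.intros simp: if_distrib[of "\<lambda>x. x * _"] cong: if_cong\<close>)
  next
    case (pf_var i D)
    obtain c where c: "\<forall>\<gamma><N. pf m (\<omega> \<beta> + 1 - \<omega> \<gamma>) (c \<gamma>)" "\<forall>z\<in>X. z i * b \<beta> z = (\<Sum>\<gamma><N. c \<gamma> (\<pi> z) * b \<gamma> z)"
      using gen pf_var(1,3) by blast
    have "\<forall>\<gamma><N. pf m (\<omega> \<beta> + D - \<omega> \<gamma>) (c \<gamma>)" using c(1) pf_var(2) by (auto elim!: pf_mono)
    then show ?case using c(2) by blast
  next
    case (pf_add D F G)
    from pf_add.IH(1)[OF pf_add.prems] obtain c where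
      c: "\<forall>\<gamma><N. pf m (\<omega> \<beta> + D - \<omega> \<gamma>) (c \<gamma>)" "\<forall>z\<in>X. F z * b \<beta> z = (\<Sum>\<gamma><N. c \<gamma> (\<pi> z) * b \<gamma> z)" by blast
    from pf_add.IH(2)[OF pf_add.prems] obtain d where
      d: "\<forall>\<gamma><N. pf m (\<omega> \<beta> + D - \<omega> \<gamma>) (d \<gamma>)" "\<forall>z\<in>X. G z * b \<beta> z = (\<Sum>\<gamma><N. d \<gamma> (\<pi> z) * b \<gamma> z)" by blast
    show ?case
      by (rule exI[of _ "\<lambda>\<gamma> a. c \<gamma> a + d \<gamma> a"])
        (use c d in \<open>auto intro: pf.pf_add simp: distrib_right sum.distrib\<close>)
  next
    case (pf_mult D F E G)
    from pf_mult.IH(2)[OF pf_mult.prems] obtain c where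
      c: "\<forall>\<gamma><N. pf m (\<omega> \<beta> + E - \<omega> \<gamma>) (c \<gamma>)" "\<forall>z\<in>X. G z * b \<beta> z = (\<Sum>\<gamma><N. c \<gamma> (\<pi> z) * b \<gamma> z)" by blast
    have "\<forall>\<gamma>. \<exists>d. \<gamma> < N \<longrightarrow> (\<forall>\<delta><N. pf m (\<omega> \<gamma> + D - \<omega> \<delta>) (d \<delta>)) \<and> (\<forall>z\<in>X. F z * b \<gamma> z = (\<Sum>\<delta><N. d \<delta> (\<pi> z) * b \<delta> z))"
      using pf_mult.IH(1) by blast
    from choice[OF this] obtain d where
      d: "\<forall>\<gamma>. \<gamma> < N \<longrightarrow> (\<forall>\<delta><N. pf m (\<omega> \<gamma> + D - \<omega> \<delta>) (d \<gamma> \<delta>)) \<and> (\<forall>z\<in>X. F z * b \<gamma> z = (\<Sum>\<delta><N. d \<gamma> \<delta> (\<pi> z) * b \<delta> z))" ..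
    show ?case
    proof (intro exI[of _ "\<lambda>\<delta> a. \<Sum>\<gamma><N. c \<gamma> a * d \<gamma> \<delta> a"] conjI allI impI ballI)
      fix \<delta> assume \<delta>: "\<delta> < N"
      have "pf m (\<omega> \<beta> + (D + E) - \<omega> \<delta>) (\<lambda>a. c \<gamma> a * d \<gamma> \<delta> a)" if "\<gamma> < N" for \<gamma>
      proof -
        have "pf m ((\<omega> \<beta> + E - \<omega> \<gamma>) + (\<omega> \<gamma> + D - \<omega> \<delta>)) (\<lambda>a. c \<gamma> a * d \<gamma> \<delta> a)"
          by (rule pf.pf_mult) (use c d \<delta> that in auto)
        then show ?thesis by (simp add: algebra_simps)
      qed
      then show "pf m (\<omega> \<beta> + (D + E) - \<omega> \<delta>) (\<lambda>a. \<Sum>\<gamma><N. c \<gamma> a * d \<gamma> \<delta> a)" by (intro pf_sum) auto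
    next
      fix z assume z: "z \<in> X"
      have "F z * G z * b \<beta> z = F z * (\<Sum>\<gamma><N. c \<gamma> (\<pi> z) * b \<gamma> z)" using c(2) z by (simp add: mult.assoc)
      also have "\<dots> = (\<Sum>\<gamma><N. c \<gamma> (\<pi> z) * (F z * b \<gamma> z))" by (simp add: sum_distrib_left algebra_simps)
      also have "\<dots> = (\<Sum>\<gamma><N. c \<gamma> (\<pi> z) * (\<Sum>\<delta><N. d \<gamma> \<delta> (\<pi> z) * b \<delta> z))"
        by (rule sum.cong) (use d z in auto)
      also have "\<dots> = (\<Sum>\<delta><N. (\<Sum>\<gamma><N. c \<gamma> (\<pi> z) * d \<gamma> \<delta> (\<pi> z)) * b \<delta> z)"
        unfolding sum_distrib_left sum_distrib_right by (subst sum.swap) (simp add: mult.assoc)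
      finally show "F z * G z * b \<beta> z = (\<Sum>\<delta><N. (\<Sum>\<gamma><N. c \<gamma> (\<pi> z) * d \<gamma> \<delta> (\<pi> z)) * b \<delta> z)" .
    qed
  qed
  then show thesis by (intro that[of N b \<omega>] N) auto
qed

context Fpbar
begin

lemma poly_ext: "(\<And>t::'k. poly f t = poly g t) \<Longrightarrow> f = g"
proof (rule ccontr)
  assume *: "\<And>t::'k. poly f t = poly g t" "f \<noteq> g"
  then have "finite {t. poly (f - g) t = 0}" by (intro poly_roots_finite) simp
  then show False using * infinite_k by simp
qed

text \<open>Cayley-Hamilton: the vector of generators \<open>b \<gamma> z\<close> is annihilated by
  \<open>F z\<close> minus the matrix of multiplication by \<open>F\<close>, and it is nonzero
  because \<open>b 0 = 1\<close>. In the determinant the weights \<open>\<omega>\<close> of rows and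
  columns cancel, which leaves \<open>N * D\<close>.\<close>

lemma sfin_charpoly:
  fixes F :: "(nat \<Rightarrow> 'k) \<Rightarrow> 'k"
  assumes "sfin X n m \<pi>" "pf n D F" "D \<ge> 1"
  obtains N c where "0 < N" "\<And>j. j < N \<Longrightarrow> pf m (int N * D - int j) (c j)"
    "\<And>z. z \<in> X \<Longrightarrow> F z ^ N + (\<Sum>j<N. c j (\<pi> z) * F z ^ j) = 0"
proof -
  obtain N and b :: "nat \<Rightarrow> (nat \<Rightarrow> 'k::field) \<Rightarrow> 'k" and \<omega> where N: "0 < N" "b 0 = (\<lambda>_. 1)"
    and mod: "\<And>D F \<beta>. pf n D F \<Longrightarrow> \<beta> < N \<Longrightarrow> \<exists>c. (\<forall>\<gamma><N. pf m (\<omega> \<beta> + D - \<omega> \<gamma>) (c \<gamma>)) \<and>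
        (\<forall>z\<in>X. F z * b \<beta> z = (\<Sum>\<gamma><N. c \<gamma> (\<pi> z) * b \<gamma> z))"
    by (rule sfin_module[OF assms(1)], rule that)
  have "\<forall>\<beta>. \<exists>c. \<beta> < N \<longrightarrow> (\<forall>\<gamma><N. pf m (\<omega> \<beta> + D - \<omega> \<gamma>) (c \<gamma>)) \<and>
        (\<forall>z\<in>X. F z * b \<beta> z = (\<Sum>\<gamma><N. c \<gamma> (\<pi> z) * b \<gamma> z))"
    using mod[OF assms(2)] by blast
  from choice[OF this] obtain C where
    C: "\<forall>\<beta>. \<beta> < N \<longrightarrow> (\<forall>\<gamma><N. pf m (\<omega> \<beta> + D - \<omega> \<gamma>) (C \<beta> \<gamma>)) \<and>
        (\<forall>z\<in>X. F z * b \<beta> z = (\<Sum>\<gamma><N. C \<beta> \<gamma> (\<pi> z) * b \<gamma> z))" ..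
  \<comment> \<open>The eigenvalue becomes an additional variable \<open>w m\<close>. Then
    \<open>pf_last\<close> turns one bound on the determinant into weighted bounds on its
    coefficients.\<close>
  let ?H = "\<lambda>w. det (mat N N (\<lambda>(\<beta>,\<gamma>). (if \<beta> = \<gamma> then w m else 0) - C \<beta> \<gamma> w))"
  have ent: "pf (Suc m) ((\<omega> \<beta> + D) + (- \<omega> \<gamma>)) (\<lambda>w. (if \<beta> = \<gamma> then w m else 0) - C \<beta> \<gamma> w)"
    if "\<beta> < N" "\<gamma> < N" for \<beta> \<gamma>
  proof -
    have "pf m (\<omega> \<beta> + D - \<omega> \<gamma>) (C \<beta> \<gamma>)" using C that by blast
    then have "pf (Suc m) (\<omega> \<beta> + D - \<omega> \<gamma>) (C \<beta> \<gamma>)" by (rule pf_extend) simp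
    moreover have "pf (Suc m) (\<omega> \<beta> + D - \<omega> \<gamma>) (\<lambda>w. if \<beta> = \<gamma> then w m else 0)"
      using assms(3) by (cases "\<beta> = \<gamma>") (auto intro: pf.intros)
    ultimately show ?thesis using pf_diff by fastforce
  qed
  have "pf (Suc m) ((\<Sum>\<beta><N. \<omega> \<beta> + D) + (\<Sum>\<gamma><N. - \<omega> \<gamma>)) ?H" by (rule pf_det) (rule ent)
  then have "pf (Suc m) (int N * D) ?H" by (simp add: sum.distrib sum_negf)
  obtain Q where Q: "\<And>z. ?H z = poly (Q z) (z m)" "\<And>i. pf m (int N * D - int i) (\<lambda>z. coeff (Q z) i)"
    "\<And>z. dle (int N * D) (Q z)" by (rule pf_last[OF \<open>pf (Suc m) (int N * D) ?H\<close>], rule that)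
  have Qdep: "Q z = Q z'" if "\<And>i. i < m \<Longrightarrow> z i = z' i" for z z'
    by (rule poly_eqI) (rule pf_cong[OF Q(2)], rule that)
  have Qchar: "Q a = char_poly (mat N N (\<lambda>(\<beta>,\<gamma>). C \<beta> \<gamma> a))" for a
  proof (rule poly_ext)
    fix t
    have "C \<beta> \<gamma> (a(m := t)) = C \<beta> \<gamma> a" if "\<beta> < N" "\<gamma> < N" for \<beta> \<gamma>
      by (rule pf_cong[where n = m]) (use C that in auto)
    then have "mat N N (\<lambda>(\<beta>,\<gamma>). (if \<beta> = \<gamma> then (a(m := t)) m else 0) - C \<beta> \<gamma> (a(m := t)))
       = mat N N (\<lambda>(\<beta>,\<gamma>). (if \<beta> = \<gamma> then t else 0) - C \<beta> \<gamma> a)"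
      by (intro eq_matI) auto
    then have "poly (Q (a(m := t))) t = poly (char_poly (mat N N (\<lambda>(\<beta>,\<gamma>). C \<beta> \<gamma> a))) t"
      using Q(1)[of "a(m := t)"] by (simp add: poly_char_poly_mat)
    then show "poly (Q a) t = poly (char_poly (mat N N (\<lambda>(\<beta>,\<gamma>). C \<beta> \<gamma> a))) t"
      using Qdep[of a "a(m := t)"] by simp
  qed
  have deg: "degree (Q a) = N \<and> coeff (Q a) N = 1" for a
    unfolding Qchar by (rule degree_monic_char_poly) simp
  show thesis
  proof (rule that[of N "\<lambda>j a. coeff (Q a) j"])
    fix z assume z: "z \<in> X"
    let ?w = "(\<pi> z)(m := F z)"
    have "?H ?w = 0"
    proof (rule det_kernel_zero[of 0 N "\<lambda>\<gamma>. b \<gamma> z"])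
      fix \<beta> assume \<beta>: "\<beta> < N"
      have "C \<beta> \<gamma> ?w = C \<beta> \<gamma> (\<pi> z)" if "\<gamma> < N" for \<gamma>
        by (rule pf_cong[where n = m]) (use C that \<beta> in auto)
      then have "(\<Sum>\<gamma><N. ((if \<beta> = \<gamma> then ?w m else 0) - C \<beta> \<gamma> ?w) * b \<gamma> z)
        = (\<Sum>\<gamma><N. (if \<beta> = \<gamma> then F z else 0) * b \<gamma> z - C \<beta> \<gamma> (\<pi> z) * b \<gamma> z)"
        by (intro sum.cong) (auto simp: left_diff_distrib)
      also have "\<dots> = F z * b \<beta> z - (\<Sum>\<gamma><N. C \<beta> \<gamma> (\<pi> z) * b \<gamma> z)"
        using \<beta> by (simp add: sum_subtractf if_distrib[of "\<lambda>x. x * _"] cong: if_cong)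
      also have "\<dots> = 0" using C \<beta> z by simp
      finally show "(\<Sum>\<gamma><N. ((if \<beta> = \<gamma> then ?w m else 0) - C \<beta> \<gamma> ?w) * b \<gamma> z) = 0" .
    qed (use N in auto)
    then have "poly (Q ?w) (F z) = 0" using Q(1)[of ?w] by simp
    then have "poly (Q (\<pi> z)) (F z) = 0" using Qdep[of "\<pi> z" ?w] by simp
    then show "F z ^ N + (\<Sum>j<N. coeff (Q (\<pi> z)) j * F z ^ j) = 0"
      using deg[of "\<pi> z"] by (simp add: poly_altdef sum_atMost_split add.commute)
  qed (use N Q(2) in auto)
qed

lemma monic_roots_finite:
  fixes c :: "nat \<Rightarrow> 'k"
  shows "finite {y. y ^ N + (\<Sum>j<N. c j * y ^ j) = 0}"
proof -
  let ?h = "monom 1 N + (\<Sum>j<N. monom (c j) j)"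
  have "coeff ?h N = 1" by (simp add: coeff_sum)
  then have "?h \<noteq> 0" by (metis coeff_0 zero_neq_one)
  from poly_roots_finite[OF this] show ?thesis by (simp add: poly_monom poly_sum)
qed

text \<open>Every coordinate of a point in the fibre is a root of a monic polynomial whose
  coefficients depend only on \<open>a\<close>.\<close>

lemma sfin_finite_fibre:
  fixes X :: "(nat \<Rightarrow> 'k) set"
  assumes "sfin X n m \<pi>" "X \<subseteq> affine_space n"
  shows "finite {z \<in> X. \<forall>j<m. \<pi> z j = a j}"
proof -
  have "\<exists>S. finite S \<and> (\<forall>z\<in>X. (\<forall>j<m. \<pi> z j = a j) \<longrightarrow> z i \<in> S)" if i: "i < n" for i
  proof -
    obtain N c where c: "0 < N" "\<And>j. j < N \<Longrightarrow> pf m (int N * 1 - int j) (c j)"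
      "\<And>z. z \<in> X \<Longrightarrow> z i ^ N + (\<Sum>j<N. c j (\<pi> z) * z i ^ j) = 0"
      by (rule sfin_charpoly[OF assms(1) pf_var[OF i order_refl] order_refl], rule that)
    have "z i \<in> {y. y ^ N + (\<Sum>j<N. c j a * y ^ j) = 0}" if "z \<in> X" "\<forall>j<m. \<pi> z j = a j" for z
    proof -
      have "c j (\<pi> z) = c j a" if "j < N" for j
        by (rule pf_cong[OF c(2)[OF that]]) (use \<open>\<forall>j<m. \<pi> z j = a j\<close> in auto)
      then show ?thesis using c(3)[OF that(1)] by simp
    qed
    then show ?thesis
      by (intro exI[of _ "{y. y ^ N + (\<Sum>j<N. c j a * y ^ j) = 0}"] conjI monic_roots_finite ballI impI)
  qed
  then have "\<forall>i. \<exists>S. i < n \<longrightarrow> finite S \<and> (\<forall>z\<in>X. (\<forall>j<m. \<pi> z j = a j) \<longrightarrow> z i \<in> S)" by blast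
  from choice[OF this] obtain S where
    S: "\<forall>i. i < n \<longrightarrow> finite (S i) \<and> (\<forall>z\<in>X. (\<forall>j<m. \<pi> z j = a j) \<longrightarrow> z i \<in> S i)" ..
  have "{z \<in> X. \<forall>j<m. \<pi> z j = a j} \<subseteq> {f. \<forall>x. (x \<in> {..<n} \<longrightarrow> f x \<in> (\<Union>i<n. S i)) \<and> (x \<notin> {..<n} \<longrightarrow> f x = 0)}"
    using S assms(2) by (auto simp: affine_space_def)
  moreover have "finite {f. \<forall>x. (x \<in> {..<n} \<longrightarrow> f x \<in> (\<Union>i<n. S i)) \<and> (x \<notin> {..<n} \<longrightarrow> f x = 0)}"
    by (rule finite_set_of_finite_funs) (use S in auto)
  ultimately show ?thesis by (rule finite_subset)
qed

end

subsection \<open>Lying over\<close>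

definition pideal :: "nat \<Rightarrow> ((nat \<Rightarrow> 'k::field) \<Rightarrow> 'k) set \<Rightarrow> bool" where
  "pideal n J \<longleftrightarrow> (\<forall>G\<in>J. PF n G) \<and> (\<lambda>_. 0) \<in> J \<and> (\<forall>G\<in>J. \<forall>H\<in>J. (\<lambda>z. G z + H z) \<in> J) \<and>
     (\<forall>G\<in>J. \<forall>H. PF n H \<longrightarrow> (\<lambda>z. H z * G z) \<in> J)"

lemma pidealD:
  assumes "pideal n J"
  shows "G \<in> J \<Longrightarrow> PF n G" "(\<lambda>_. 0) \<in> J" "G \<in> J \<Longrightarrow> H \<in> J \<Longrightarrow> (\<lambda>z. G z + H z) \<in> J"
    "PF n H \<Longrightarrow> G \<in> J \<Longrightarrow> (\<lambda>z. H z * G z) \<in> J"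
  using assms unfolding pideal_def by simp_all

lemma pideal_diff:
  assumes "pideal n J" "G \<in> J" "H \<in> J" shows "(\<lambda>z. G z - H z) \<in> J"
  using pidealD(3)[OF assms(1,2) pidealD(4)[OF assms(1) PF_const[of n "-1"] assms(3)]] by simp

lemma pideal_sum:
  assumes "pideal n J" "\<And>i. i \<in> A \<Longrightarrow> G i \<in> J" shows "(\<lambda>z. \<Sum>i\<in>A. G i z) \<in> J"
  using assms(2)
  by (induction A rule: infinite_finite_induct) (auto intro: pidealD(2)[OF assms(1)] pidealD(3)[OF assms(1)])

lemma pideal_unit:
  assumes "pideal n J" "(\<lambda>_. c) \<in> J" "c \<noteq> 0" shows "(\<lambda>_. 1) \<in> J"
  using pidealD(4)[OF assms(1) PF_const[of n "inverse c"] assms(2)] assms(3) by simp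

lemma pideal_extend:
  fixes J :: "((nat \<Rightarrow> 'k::field) \<Rightarrow> 'k) set"
  assumes "pideal n J" "i < n"
  shows "pideal n {H. \<exists>G u. G \<in> J \<and> PF n u \<and> H = (\<lambda>z. G z + (z i - \<beta>) * u z)}" (is "pideal n ?J'")
  unfolding pideal_def
proof (intro conjI ballI allI impI)
  fix H assume "H \<in> ?J'"
  then obtain G u where "G \<in> J" "PF n u" "H = (\<lambda>z. G z + (z i - \<beta>) * u z)" by blast
  then show "PF n H" using pidealD(1)[OF assms(1)] assms(2) by (auto intro!: PF_intros)
next
  show "(\<lambda>_. 0) \<in> ?J'" using pidealD(2)[OF assms(1)]
    by (intro CollectI exI[of _ "\<lambda>_. 0"]) auto
next
  fix H H' assume "H \<in> ?J'" "H' \<in> ?J'"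
  then obtain G u G' u' where "G \<in> J" "PF n u" "H = (\<lambda>z. G z + (z i - \<beta>) * u z)"
    "G' \<in> J" "PF n u'" "H' = (\<lambda>z. G' z + (z i - \<beta>) * u' z)" by blast
  then show "(\<lambda>z. H z + H' z) \<in> ?J'" using pidealD(3)[OF assms(1), of G G']
    by (intro CollectI exI[of _ "\<lambda>z. G z + G' z"] exI[of _ "\<lambda>z. u z + u' z"]) (auto simp: algebra_simps intro: PF_add)
next
  fix H and K :: "(nat \<Rightarrow> 'k) \<Rightarrow> 'k" assume "H \<in> ?J'" "PF n K"
  then obtain G u where "G \<in> J" "PF n u" "H = (\<lambda>z. G z + (z i - \<beta>) * u z)" by blast
  then show "(\<lambda>z. K z * H z) \<in> ?J'" using pidealD(4)[OF assms(1) \<open>PF n K\<close>, of G] \<open>PF n K\<close>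
    by (intro CollectI exI[of _ "\<lambda>z. K z * G z"] exI[of _ "\<lambda>z. K z * u z"]) (auto simp: algebra_simps intro: PF_mult)
qed

context Fpbar
begin

text \<open>If adjoining \<open>z i - \<beta>\<close> produced 1 for every root
  \<open>\<beta>\<close> of \<open>h\<close>, the roots could be divided out of \<open>h\<close> one
  after another without leaving \<open>J\<close>, until a nonzero constant remained in
  \<open>J\<close>.\<close>

lemma pideal_root:
  fixes h :: "'k poly"
  assumes "pideal n J" "(\<lambda>_. 1) \<notin> J" "i < n" "h \<noteq> 0" "(\<lambda>z. poly h (z i)) \<in> J"
  shows "\<exists>\<beta>. (\<lambda>_. 1) \<notin> {H. \<exists>G u. G \<in> J \<and> PF n u \<and> H = (\<lambda>z. G z + (z i - \<beta>) * u z)}"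
  using assms(4,5)
proof (induction "degree h" arbitrary: h rule: less_induct)
  case less
  show ?case
  proof (cases "degree h = 0")
    case True
    then obtain c where "h = [:c:]" by (rule degree_eq_zeroE)
    then have "(\<lambda>_. c) \<in> J" "c \<noteq> 0" using less.prems by auto
    then show ?thesis using pideal_unit[OF assms(1)] assms(2) by blast
  next
    case False
    then obtain \<beta> where "poly h \<beta> = 0" using alg_root[of h] by auto
    then obtain h1 where h1: "h = [:-\<beta>, 1:] * h1" by (auto simp: poly_eq_0_iff_dvd)
    then have "h1 \<noteq> 0" using less.prems by auto
    then have deg: "degree h1 < degree h" unfolding h1 by (subst degree_mult_eq) auto
    show ?thesis
    proof (cases "(\<lambda>_. 1) \<in> {H. \<exists>G u. G \<in> J \<and> PF n u \<and> H = (\<lambda>z. G z + (z i - \<beta>) * u z)}")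
      case False then show ?thesis by blast
    next
      case True
      then obtain G u where G: "G \<in> J" "PF n u" "(\<lambda>_. 1) = (\<lambda>z. G z + (z i - \<beta>) * u z)" by blast
      have h1PF: "PF n (\<lambda>z. poly h1 (z i))"
        unfolding poly_altdef using assms(3) by (intro PF_intros) auto
      have "(\<lambda>z. poly h1 (z i) * G z + u z * poly h (z i)) \<in> J"
        by (intro pidealD(3)[OF assms(1)] pidealD(4)[OF assms(1)] h1PF G less.prems)
      moreover have "poly h1 (z i) * G z + u z * poly h (z i) = poly h1 (z i)" for z
      proof -
        have "poly h1 (z i) * G z + u z * poly h (z i) = poly h1 (z i) * (G z + (z i - \<beta>) * u z)"
          unfolding h1 by (simp add: algebra_simps)
        also have "G z + (z i - \<beta>) * u z = 1" using fun_cong[OF G(3), of z] by simp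
        finally show ?thesis by simp
      qed
      ultimately have "(\<lambda>z. poly h1 (z i)) \<in> J" by simp
      then show ?thesis using less.hyps[OF deg \<open>h1 \<noteq> 0\<close>] by blast
    qed
  qed
qed

text \<open>Weak Nullstellensatz for an ideal that contains a polynomial in each single variable.
  The differences \<open>z i - \<beta> i\<close> are adjoined one variable at a time, keeping 1 out;
  afterwards each \<open>F\<close> is congruent to the constant \<open>F P\<close>.\<close>

lemma pideal_point:
  fixes J :: "((nat \<Rightarrow> 'k) \<Rightarrow> 'k) set"
  assumes "pideal n J" "(\<lambda>_. 1) \<notin> J"
    and "\<And>i. i < n \<Longrightarrow> \<exists>h::'k poly. h \<noteq> 0 \<and> (\<lambda>z. poly h (z i)) \<in> J"
  obtains P where "P \<in> affine_space n" "\<And>G. G \<in> J \<Longrightarrow> G P = 0"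
proof -
  have "\<exists>J' \<beta>. pideal n J' \<and> J \<subseteq> J' \<and> (\<lambda>_. 1) \<notin> J' \<and> (\<forall>i<k. (\<lambda>z. z i - \<beta> i) \<in> J')" if "k \<le> n" for k
    using that
  proof (induction k)
    case 0 then show ?case using assms by blast
  next
    case (Suc k)
    then obtain J' \<beta> where J': "pideal n J'" "J \<subseteq> J'" "(\<lambda>_. 1) \<notin> J'" "\<forall>i<k. (\<lambda>z. z i - \<beta> i) \<in> J'" by auto
    have "k < n" using Suc by simp
    obtain h :: "'k poly" where "h \<noteq> 0" "(\<lambda>z. poly h (z k)) \<in> J" using assms(3)[OF \<open>k < n\<close>] by blast
    then obtain b where b: "(\<lambda>_. 1) \<notin> {H. \<exists>G u. G \<in> J' \<and> PF n u \<and> H = (\<lambda>z. G z + (z k - b) * u z)}" (is "_ \<notin> ?K")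
      using pideal_root[OF J'(1,3) \<open>k < n\<close>] J'(2) by blast
    have sub: "J' \<subseteq> ?K"
    proof
      fix G assume "G \<in> J'"
      then show "G \<in> ?K" by (intro CollectI exI[of _ G] exI[of _ "\<lambda>_. 0"]) auto
    qed
    have "(\<lambda>z. z k - b) \<in> ?K" using pidealD(2)[OF J'(1)]
      by (intro CollectI exI[of _ "\<lambda>_. 0"] exI[of _ "\<lambda>_. 1"]) auto
    then have "\<forall>i<Suc k. (\<lambda>z. z i - (\<beta>(k := b)) i) \<in> ?K" using J'(4) sub by (auto simp: less_Suc_eq)
    then show ?case using pideal_extend[OF J'(1) \<open>k < n\<close>, of b] sub J'(2) b by blast
  qed
  from this[OF order_refl] obtain J' \<beta> where
    J': "pideal n J'" "J \<subseteq> J'" "(\<lambda>_. 1) \<notin> J'" "\<forall>i<n. (\<lambda>z. z i - \<beta> i) \<in> J'" by blast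
  define P where "P = (\<lambda>i. if i < n then \<beta> i else 0)"
  have cong: "(\<lambda>z. F z - F P) \<in> J'" if "pf n D F" for D F
    using that
  proof (induction rule: pf.induct)
    case (pf_var i D) then show ?case using J'(4) by (auto simp: P_def)
  next
    case (pf_add D F G)
    from pidealD(3)[OF J'(1) pf_add.IH] show ?case by (simp add: algebra_simps)
  next
    case (pf_mult D F E G)
    have "(\<lambda>z. F z * (G z - G P) + G P * (F z - F P)) \<in> J'"
      by (intro pidealD(3)[OF J'(1)] pidealD(4)[OF J'(1)] pf_mult.IH PF_const PF_I[OF pf_mult.hyps(1)])
    then show ?case by (simp add: algebra_simps)
  qed (use pidealD(2)[OF J'(1)] in auto)
  show thesis
  proof (rule that[of P])
    show "P \<in> affine_space n" by (simp add: P_def affine_space_def)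
    fix G assume "G \<in> J"
    then have "G \<in> J'" "PF n G" using J'(2) pidealD(1)[OF assms(1)] by auto
    then obtain D where "pf n D G" by (auto simp: PF_def)
    from pideal_diff[OF J'(1) \<open>G \<in> J'\<close> cong[OF this]] have "(\<lambda>_. G P) \<in> J'" by simp
    then show "G P = 0" using pideal_unit[OF J'(1)] J'(3) by blast
  qed
qed

text \<open>Nakayama: if no point of \<open>X\<close> lay over \<open>c\<close>, the determinant trick would give a function of \<open>\<pi>\<close> that
  vanishes on \<open>X\<close> but not at \<open>c\<close>.\<close>

theorem lying_over:
  fixes X :: "(nat \<Rightarrow> 'k) set"
  assumes fin: "sfin X n m \<pi>" and X: "zariski_closed n X" and \<pi>: "proj n m \<pi>"
    and c: "\<And>F. PF m F \<Longrightarrow> (\<And>z. z \<in> X \<Longrightarrow> F (\<pi> z) = 0) \<Longrightarrow> F c = 0"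
  obtains P where "P \<in> X" "\<And>j. j < m \<Longrightarrow> \<pi> P j = c j"
proof -
  \<comment> \<open>The ideal generated by the \<open>\<pi> z j - c j\<close> together with all
    functions vanishing on \<open>X\<close>: the equation is required on \<open>X\<close>
    only.\<close>
  define J where "J = {G. PF n G \<and> (\<exists>u. (\<forall>j<m. PF n (u j)) \<and> (\<forall>z\<in>X. G z = (\<Sum>j<m. (\<pi> z j - c j) * u j z)))}"
  have JI: "G \<in> J" if "PF n G" "\<And>j. j < m \<Longrightarrow> PF n (u j)" "\<And>z. z \<in> X \<Longrightarrow> G z = (\<Sum>j<m. (\<pi> z j - c j) * u j z)" for G u
    unfolding J_def using that by blast
  have JE: "\<exists>u. (\<forall>j<m. PF n (u j)) \<and> (\<forall>z\<in>X. G z = (\<Sum>j<m. (\<pi> z j - c j) * u j z))" if "G \<in> J" for G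
    using that unfolding J_def by blast
  have JPF: "PF n G" if "G \<in> J" for G using that unfolding J_def by blast
  have ideal: "pideal n J"
    unfolding pideal_def
  proof (intro conjI ballI allI impI)
    show "(\<lambda>_. 0) \<in> J" by (rule JI[of _ "\<lambda>_ _. 0"]) auto
  next
    fix G H assume GH: "G \<in> J" "H \<in> J"
    obtain u where u: "\<forall>j<m. PF n (u j)" "\<forall>z\<in>X. G z = (\<Sum>j<m. (\<pi> z j - c j) * u j z)" using JE[OF GH(1)] by blast
    obtain v where v: "\<forall>j<m. PF n (v j)" "\<forall>z\<in>X. H z = (\<Sum>j<m. (\<pi> z j - c j) * v j z)" using JE[OF GH(2)] by blast
    show "(\<lambda>z. G z + H z) \<in> J"
    proof (rule JI[of _ "\<lambda>j z. u j z + v j z"])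
      show "PF n (\<lambda>z. G z + H z)" using JPF GH by (intro PF_add)
      show "PF n (\<lambda>z. u j z + v j z)" if "j < m" for j using u v that by (intro PF_add) auto
      show "G z + H z = (\<Sum>j<m. (\<pi> z j - c j) * (u j z + v j z))" if "z \<in> X" for z
        using u v that by (simp add: distrib_left sum.distrib)
    qed
  next
    fix G and H :: "(nat \<Rightarrow> 'k) \<Rightarrow> 'k" assume G: "G \<in> J" and H: "PF n H"
    obtain u where u: "\<forall>j<m. PF n (u j)" "\<forall>z\<in>X. G z = (\<Sum>j<m. (\<pi> z j - c j) * u j z)" using JE[OF G] by blast
    show "(\<lambda>z. H z * G z) \<in> J"
    proof (rule JI[of _ "\<lambda>j z. H z * u j z"])
      show "PF n (\<lambda>z. H z * G z)" using JPF[OF G] H by (intro PF_mult)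
      show "PF n (\<lambda>z. H z * u j z)" if "j < m" for j using u H that by (intro PF_mult) auto
      show "H z * G z = (\<Sum>j<m. (\<pi> z j - c j) * (H z * u j z))" if "z \<in> X" for z
        using u that by (simp add: sum_distrib_left algebra_simps)
    qed
  qed (rule JPF)
  have \<pi>PF: "PF n (\<lambda>z. \<pi> z j)" if "j < m" for j using \<pi> that unfolding proj_def by (blast intro: PF_I)
  have \<pi>J: "(\<lambda>z. \<pi> z j - c j) \<in> J" if j: "j < m" for j
  proof (rule JI[of _ "\<lambda>i _. if i = j then 1 else 0"])
    show "PF n (\<lambda>z. \<pi> z j - c j)" by (intro PF_diff \<pi>PF j) auto
    show "\<pi> z j - c j = (\<Sum>i<m. (\<pi> z i - c i) * (if i = j then 1 else 0))" for z
      using j by (simp add: if_distrib cong: if_cong)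
  qed auto
  have cong: "(\<lambda>z. F (\<pi> z) - F c) \<in> J" if "pf m D F" for D F
    using that
  proof (induction rule: pf.induct)
    case (pf_var i D) then show ?case using \<pi>J by auto
  next
    case (pf_add D F G)
    from pidealD(3)[OF ideal pf_add.IH] show ?case by (simp add: algebra_simps)
  next
    case (pf_mult D F E G)
    have "PF n (\<lambda>z. F (\<pi> z))" using PF_comp[OF PF_I[OF pf_mult.hyps(1)], of n \<pi>] \<pi> by (simp add: proj_def)
    then have "(\<lambda>z. F (\<pi> z) * (G (\<pi> z) - G c) + G c * (F (\<pi> z) - F c)) \<in> J"
      by (intro pidealD(3)[OF ideal] pidealD(4)[OF ideal] pf_mult.IH PF_const)
    then show ?case by (simp add: algebra_simps)
  qed (use pidealD(2)[OF ideal] in auto)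
  have one: "(\<lambda>_. 1) \<notin> J"
  proof
    assume "(\<lambda>_. 1) \<in> J"
    then obtain u where u: "\<forall>j<m. PF n (u j)" "\<forall>z\<in>X. 1 = (\<Sum>j<m. (\<pi> z j - c j) * u j z)" using JE by blast
    obtain N and b :: "nat \<Rightarrow> (nat \<Rightarrow> 'k::field) \<Rightarrow> 'k" and \<omega> where N: "0 < N" "b 0 = (\<lambda>_. 1)"
      and mod: "\<And>D F \<beta>. pf n D F \<Longrightarrow> \<beta> < N \<Longrightarrow> \<exists>c. (\<forall>\<gamma><N. pf m (\<omega> \<beta> + D - \<omega> \<gamma>) (c \<gamma>)) \<and>
          (\<forall>z\<in>X. F z * b \<beta> z = (\<Sum>\<gamma><N. c \<gamma> (\<pi> z) * b \<gamma> z))"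
      by (rule sfin_module[OF fin], rule that)
    have "\<forall>x. \<exists>C. fst x < m \<longrightarrow> snd x < N \<longrightarrow> (\<forall>\<gamma><N. PF m (C \<gamma>)) \<and>
        (\<forall>z\<in>X. u (fst x) z * b (snd x) z = (\<Sum>\<gamma><N. C \<gamma> (\<pi> z) * b \<gamma> z))"
    proof
      fix x :: "nat \<times> nat"
      show "\<exists>C. fst x < m \<longrightarrow> snd x < N \<longrightarrow> (\<forall>\<gamma><N. PF m (C \<gamma>)) \<and>
        (\<forall>z\<in>X. u (fst x) z * b (snd x) z = (\<Sum>\<gamma><N. C \<gamma> (\<pi> z) * b \<gamma> z))"
      proof (cases "fst x < m \<and> snd x < N")
        case True
        then obtain D where "pf n D (u (fst x))" using u(1) by (auto simp: PF_def)
        from mod[OF this, of "snd x"] True obtain C where "\<forall>\<gamma><N. pf m (\<omega> (snd x) + D - \<omega> \<gamma>) (C \<gamma>)"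
          "\<forall>z\<in>X. u (fst x) z * b (snd x) z = (\<Sum>\<gamma><N. C \<gamma> (\<pi> z) * b \<gamma> z)" by blast
        then show ?thesis by (intro exI[of _ C]) (auto intro: PF_I)
      qed auto
    qed
    from choice[OF this] obtain C where C: "\<forall>x. fst x < m \<longrightarrow> snd x < N \<longrightarrow> (\<forall>\<gamma><N. PF m (C x \<gamma>)) \<and>
        (\<forall>z\<in>X. u (fst x) z * b (snd x) z = (\<Sum>\<gamma><N. C x \<gamma> (\<pi> z) * b \<gamma> z))" ..
    then have CPF: "PF m (C (j, \<beta>) \<gamma>)" if "j < m" "\<beta> < N" "\<gamma> < N" for j \<beta> \<gamma> using that by simp
    have Ceq: "u j z * b \<beta> z = (\<Sum>\<gamma><N. C (j, \<beta>) \<gamma> (\<pi> z) * b \<gamma> z)" if "j < m" "\<beta> < N" "z \<in> X" for j \<beta> z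
      using C[rule_format, of "(j, \<beta>)"] that by simp
    \<comment> \<open>Identity minus the matrix of multiplication by
      \<open>1 = (\<Sum>j<m. (\<pi> z j - c j) * u j z)\<close>. On \<open>X\<close> it kills the
      generators, so \<open>H\<close> vanishes on the image of \<open>\<pi>\<close>, while at
      \<open>c\<close> the matrix is the identity.\<close>
    define H where "H a = det (mat N N (\<lambda>(\<beta>,\<gamma>). (if \<beta> = \<gamma> then 1 else 0) - (\<Sum>j<m. (a j - c j) * C (j,\<beta>) \<gamma> a)))" for a
    have "PF m H" unfolding H_def
    proof (rule PF_det)
      fix \<beta> \<gamma> assume "\<beta> < N" "\<gamma> < N"
      then show "PF m (\<lambda>a. (if \<beta> = \<gamma> then 1 else 0) - (\<Sum>j<m. (a j - c j) * C (j,\<beta>) \<gamma> a))"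
        by (intro PF_diff PF_sum PF_mult PF_var CPF) auto
    qed
    moreover have "H (\<pi> z) = 0" if z: "z \<in> X" for z
      unfolding H_def
    proof (rule det_kernel_zero[of 0 N "\<lambda>\<gamma>. b \<gamma> z"])
      fix \<beta> assume \<beta>: "\<beta> < N"
      have "(\<Sum>\<gamma><N. (\<Sum>j<m. (\<pi> z j - c j) * C (j,\<beta>) \<gamma> (\<pi> z)) * b \<gamma> z)
          = (\<Sum>j<m. (\<pi> z j - c j) * (\<Sum>\<gamma><N. C (j,\<beta>) \<gamma> (\<pi> z) * b \<gamma> z))"
        unfolding sum_distrib_left sum_distrib_right by (subst sum.swap) (simp add: mult.assoc)
      also have "\<dots> = (\<Sum>j<m. (\<pi> z j - c j) * (u j z * b \<beta> z))"
        by (rule sum.cong) (use Ceq[OF _ \<beta> z] in auto)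
      also have "\<dots> = (\<Sum>j<m. (\<pi> z j - c j) * u j z) * b \<beta> z"
        by (simp add: sum_distrib_right mult.assoc)
      also have "\<dots> = b \<beta> z" using u(2) z by (metis mult_1)
      finally have "(\<Sum>\<gamma><N. (\<Sum>j<m. (\<pi> z j - c j) * C (j,\<beta>) \<gamma> (\<pi> z)) * b \<gamma> z) = b \<beta> z" .
      then show "(\<Sum>\<gamma><N. ((if \<beta> = \<gamma> then 1 else 0) - (\<Sum>j<m. (\<pi> z j - c j) * C (j,\<beta>) \<gamma> (\<pi> z))) * b \<gamma> z) = 0"
        using \<beta> by (simp add: left_diff_distrib sum_subtractf if_distrib[of "\<lambda>x. x * _"] cong: if_cong)
    qed (use N in auto)
    ultimately have "H c = 0" by (rule c)
    moreover have "H c = 1"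
    proof -
      have "mat N N (\<lambda>(\<beta>,\<gamma>). (if \<beta> = \<gamma> then 1 else 0) - (\<Sum>j<m. (c j - c j) * C (j,\<beta>) \<gamma> c)) = 1\<^sub>m N"
        by (rule eq_matI) auto
      then show ?thesis unfolding H_def by simp
    qed
    ultimately show False by simp
  qed
  \<comment> \<open>Modulo \<open>J\<close> a function of \<open>\<pi>\<close> is congruent to its
    value at \<open>c\<close>, so the integral equation of \<open>z i\<close> turns into a
    polynomial in \<open>z i\<close> with constant coefficients.\<close>
  have uni: "\<exists>h::'k poly. h \<noteq> 0 \<and> (\<lambda>z. poly h (z i)) \<in> J" if i: "i < n" for i
  proof -
    obtain N d where d: "0 < N" "\<And>j. j < N \<Longrightarrow> pf m (int N * 1 - int j) (d j)"
      "\<And>z. z \<in> X \<Longrightarrow> z i ^ N + (\<Sum>j<N. d j (\<pi> z) * z i ^ j) = 0"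
      by (rule sfin_charpoly[OF fin pf_var[OF i order_refl] order_refl], rule that)
    let ?h = "monom 1 N + (\<Sum>j<N. monom (d j c) j)"
    have "coeff ?h N = 1" by (simp add: coeff_sum)
    then have "?h \<noteq> 0" by (metis coeff_0 zero_neq_one)
    have "(\<lambda>z. \<Sum>j<N. (- (z i ^ j)) * (d j (\<pi> z) - d j c)) \<in> J"
      by (intro pideal_sum[OF ideal] pidealD(4)[OF ideal] cong PF_intros i) (auto intro: d(2))
    from JE[OF this] obtain u where u: "\<forall>j<m. PF n (u j)"
      "\<forall>z\<in>X. (\<Sum>j<N. (- (z i ^ j)) * (d j (\<pi> z) - d j c)) = (\<Sum>j<m. (\<pi> z j - c j) * u j z)" by blast
    have eq: "poly ?h (z i) = (\<Sum>j<N. (- (z i ^ j)) * (d j (\<pi> z) - d j c))" if "z \<in> X" for z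
    proof -
      have "poly ?h (z i) = z i ^ N + (\<Sum>j<N. d j c * z i ^ j)"
        by (simp add: poly_monom poly_sum)
      also have "\<dots> = (z i ^ N + (\<Sum>j<N. d j (\<pi> z) * z i ^ j)) + (\<Sum>j<N. (- (z i ^ j)) * (d j (\<pi> z) - d j c))"
        by (simp add: algebra_simps sum.distrib[symmetric] sum_subtractf)
      finally show ?thesis using d(3)[OF that] by simp
    qed
    have "(\<lambda>z. poly ?h (z i)) \<in> J"
    proof (rule JI[of _ u])
      show "PF n (\<lambda>z. poly ?h (z i))" unfolding poly_altdef using i by (intro PF_intros) auto
    qed (use u eq in auto)
    then show ?thesis using \<open>?h \<noteq> 0\<close> by blast
  qed
  obtain P where P: "P \<in> affine_space n" "\<And>G. G \<in> J \<Longrightarrow> G P = 0"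
    by (rule pideal_point[OF ideal one uni], assumption, rule that)
  have "P \<in> X"
  proof (rule ccontr)
    assume "P \<notin> X"
    obtain F where F: "PF n F" "\<And>x. x \<in> X \<Longrightarrow> F x = 0" "F P \<noteq> 0"
      by (rule zariski_separate[OF X P(1) \<open>P \<notin> X\<close>], rule that)
    have "F \<in> J" by (rule JI[of _ "\<lambda>_ _. 0"]) (use F in auto)
    then show False using P(2) F(3) by blast
  qed
  moreover have "\<pi> P j = c j" if "j < m" for j using P(2)[OF \<pi>J[OF that]] by simp
  ultimately show thesis by (rule that)
qed

end

subsection \<open>Noether normalisation steps\<close>

lemma sum_div_mod:
  fixes f :: "nat \<Rightarrow> nat \<Rightarrow> 'a::comm_monoid_add"
  assumes "D > 0"
  shows "(\<Sum>k<N * D. f (k div D) (k mod D)) = (\<Sum>\<gamma><N. \<Sum>i<D. f \<gamma> i)"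
proof -
  have "(\<Sum>k<N * D. f (k div D) (k mod D)) = (\<Sum>\<gamma><N. \<Sum>k = \<gamma> * D..<\<gamma> * D + D. f (k div D) (k mod D))"
    by (rule sum.nat_group[symmetric])
  also have "\<dots> = (\<Sum>\<gamma><N. \<Sum>i<D. f \<gamma> i)"
  proof (rule sum.cong[OF refl])
    fix \<gamma>
    have "(\<Sum>k = \<gamma> * D..<\<gamma> * D + D. f (k div D) (k mod D)) = (\<Sum>i = 0..<D. f ((i + \<gamma> * D) div D) ((i + \<gamma> * D) mod D))"
      using sum.shift_bounds_nat_ivl[of "\<lambda>k. f (k div D) (k mod D)" 0 "\<gamma> * D" D] by (simp add: add.commute)
    also have "\<dots> = (\<Sum>i<D. f \<gamma> i)"
      unfolding lessThan_atLeast0 by (rule sum.cong) (use assms in auto)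
    finally show "(\<Sum>k = \<gamma> * D..<\<gamma> * D + D. f (k div D) (k mod D)) = (\<Sum>i<D. f \<gamma> i)" .
  qed
  finally show ?thesis .
qed

lemma poly_sum_atMost:
  fixes q :: "'a::comm_ring_1 poly"
  assumes "dle (int D) q"
  shows "poly q t = (\<Sum>j\<le>D. coeff q j * t ^ j)"
  unfolding poly_altdef
  by (rule sum.mono_neutral_left) (use assms in \<open>auto simp: dle_degree coeff_eq_0\<close>)

context Fpbar
begin

text \<open>\<open>L\<close> is the leading form, obtained as the coefficient of
  \<open>t ^ D\<close> on lines through the origin. If it were zero, \<open>F\<close> would be the
  sum of its parts of degree below \<open>D\<close>. The last clause recognises it in any expansion
  of \<open>F\<close> along direction \<open>w\<close>.\<close>

lemma pf_top:
  fixes F :: "(nat \<Rightarrow> 'k) \<Rightarrow> 'k"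
  assumes F: "pf n (int D) F" "\<not> pf n (int D - 1) F"
  obtains L where "pf n (int D) L" "\<exists>w. L w \<noteq> 0" "\<And>c w. L (\<lambda>i. c * w i) = c ^ D * L w"
    "\<forall>w Q. (\<forall>x t. poly (Q x) t = F (\<lambda>i. x i + t * w i)) \<longrightarrow> coeff (Q (\<lambda>_. 0)) D = L w"
proof -
  obtain R where R: "\<And>v t. poly (R v) t = F (\<lambda>i. 0 + t * v i)" "\<And>i. pf n (int i) (\<lambda>v. coeff (R v) i)"
    "\<And>v. dle (int D) (R v)" by (rule pf_line_dir[OF F(1), of "\<lambda>_. 0"], rule that)
  show thesis
  proof (rule that[of "\<lambda>v. coeff (R v) D"])
    show "pf n (int D) (\<lambda>v. coeff (R v) D)" by (rule R(2))
    show "\<exists>w. coeff (R w) D \<noteq> 0"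
    proof (rule ccontr)
      assume "\<not> ?thesis"
      then have z: "coeff (R w) D = 0" for w by simp
      have "F v = (\<Sum>j<D. coeff (R v) j)" for v
        using R(1)[of v 1] poly_sum_atMost[OF R(3), of v 1] z by (simp add: sum_atMost_split)
      then have "F = (\<lambda>v. \<Sum>j<D. coeff (R v) j)" by auto
      moreover have "pf n (int D - 1) (\<lambda>v. \<Sum>j<D. coeff (R v) j)"
        by (intro pf_sum pf_mono[OF R(2)]) auto
      ultimately show False using F(2) by simp
    qed
    show "coeff (R (\<lambda>i. c * w i)) D = c ^ D * coeff (R w) D" for c w
    proof -
      have "R (\<lambda>i. c * w i) = pcompose (R w) [:0, c:]"
        by (rule poly_ext) (simp add: R(1) poly_pcompose mult_ac)
      then show ?thesis by (simp add: coeff_pcompose_linear)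
    qed
    show "\<forall>w Q. (\<forall>x t. poly (Q x) t = F (\<lambda>i. x i + t * w i)) \<longrightarrow> coeff (Q (\<lambda>_. 0)) D = coeff (R w) D"
    proof (intro allI impI)
      fix w Q assume "\<forall>x t. poly (Q x) t = F (\<lambda>i. x i + t * w i)"
      then have "Q (\<lambda>_. 0) = R w" by (intro poly_ext) (simp add: R(1))
      then show "coeff (Q (\<lambda>_. 0)) D = coeff (R w) D" by simp
    qed
  qed
qed

text \<open>One step of Noether normalisation: projecting along \<open>w\<close>, where the leading
  form of the relation \<open>F\<close> does not vanish, makes \<open>y = \<pi> z m\<close> satisfy
  a monic equation of degree \<open>D\<close> over the new coordinates. The generators
  \<open>b \<gamma>\<close> are replaced by the products \<open>b \<gamma> * y ^ e\<close> with
  \<open>e < D\<close>, of weight \<open>\<omega> \<gamma> + e\<close>.\<close>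

lemma sfin_reduce:
  fixes X :: "(nat \<Rightarrow> 'k) set"
  assumes fin: "sfin X n (Suc m) \<pi>" and "X \<noteq> {}"
    and F: "\<And>z. z \<in> X \<Longrightarrow> F (\<pi> z) = 0" "pf (Suc m) (int D) F"
    and Q: "\<And>x t. poly (Q x) t = F (\<lambda>i. x i + t * w i)" "\<And>i. pf (Suc m) (int D - int i) (\<lambda>x. coeff (Q x) i)"
      "\<And>x. dle (int D) (Q x)" and lead: "coeff (Q (\<lambda>_. 0)) D \<noteq> 0" and w: "w m = 1"
  shows "sfin X n m (\<lambda>z j. \<pi> z j - w j * \<pi> z m)"
proof -
  define \<pi>' where "\<pi>' = (\<lambda>z j. \<pi> z j - w j * \<pi> z m)"
  define y where "y = (\<lambda>z. \<pi> z m)"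
  define ext :: "(nat \<Rightarrow> 'k) \<Rightarrow> nat \<Rightarrow> 'k" where "ext a = (\<lambda>i. if i < m then a i else 0)" for a
  define l where "l = coeff (Q (\<lambda>_. 0)) D"
  \<comment> \<open>The bound for the coefficient of \<open>t ^ D\<close> is 0, so this coefficient
    does not depend on the base point, and dividing by it keeps everything polynomial.\<close>
  obtain l' where "(\<lambda>x. coeff (Q x) D) = (\<lambda>_. l')" using pf_nonpos_const[OF Q(2)[of D]] by auto
  then have QD: "coeff (Q x) D = l" for x unfolding l_def by metis
  define w' where "w' j a = coeff (Q (ext a)) j / l" for j a
  have "l \<noteq> 0" using lead by (simp add: l_def)
  have w'pf: "pf m (int D - int j) (w' j)" for j
  proof -
    have "pf m (int D - int j) (\<lambda>a. coeff (Q (ext a)) j)"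
    proof (rule pf_comp[OF Q(2)])
      fix i show "pf m 1 (\<lambda>z. ext z i)" by (cases "i < m") (auto simp: ext_def intro: pf.intros)
    qed
    from pf_cmult[OF this, of "inverse l"] show ?thesis unfolding w'_def by (simp add: field_simps)
  qed
  have w'D: "w' D a = 1" for a using QD \<open>l \<noteq> 0\<close> by (simp add: w'_def)
  have rel: "(\<Sum>j\<le>D. w' j (\<pi>' z) * y z ^ j) = 0" if "z \<in> X" for z
  proof -
    have "(\<Sum>j\<le>D. coeff (Q (ext (\<pi>' z))) j * y z ^ j) = F (\<lambda>i. ext (\<pi>' z) i + y z * w i)"
      using poly_sum_atMost[OF Q(3)] Q(1) by metis
    also have "\<dots> = F (\<pi> z)"
    proof (rule pf_cong[OF F(2)])
      fix i assume "i < Suc m"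
      then show "ext (\<pi>' z) i + y z * w i = \<pi> z i"
        using w by (cases "i < m") (auto simp: ext_def \<pi>'_def y_def less_Suc_eq)
    qed
    finally have "(\<Sum>j\<le>D. coeff (Q (ext (\<pi>' z))) j * y z ^ j) / l = 0" using F(1)[OF that] by simp
    then show ?thesis by (simp add: w'_def sum_divide_distrib)
  qed
  have "D > 0"
  proof (rule ccontr)
    assume "\<not> D > 0"
    moreover obtain z where "z \<in> X" using \<open>X \<noteq> {}\<close> by blast
    ultimately show False using rel[of z] w'D[of "\<pi>' z"] by simp
  qed
  define r where "r k j = (\<lambda>a. red (\<lambda>j. w' j a) D k j)" for k j
  have rpf: "pf m (int k - int j) (r k j)" if "j < D" for k j
    unfolding r_def
  proof (rule red_pf[OF w'pf _ \<open>D > 0\<close> that])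
    show "pf m 0 (w' D)" using w'pf[of D] by simp
  qed
  have ypow: "y z ^ k = (\<Sum>j<D. r k j (\<pi>' z) * y z ^ j)" if "z \<in> X" for z k
    using red_eval[OF \<open>D > 0\<close> rel[OF that], of k] unfolding r_def w'D power_one mult_1 .
  obtain N and b :: "nat \<Rightarrow> (nat \<Rightarrow> 'k) \<Rightarrow> 'k" and \<omega> where N: "0 < N" "\<omega> 0 = 0" "b 0 = (\<lambda>_. 1)"
    and gen: "\<forall>i<n. \<forall>\<beta><N. \<exists>c. (\<forall>\<gamma><N. pf (Suc m) (\<omega> \<beta> + 1 - \<omega> \<gamma>) (c \<gamma>)) \<and>
        (\<forall>z\<in>X. z i * b \<beta> z = (\<Sum>\<gamma><N. c \<gamma> (\<pi> z) * b \<gamma> z))"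
    using fin unfolding sfin_def by (elim exE conjE) (rule that)
  \<comment> \<open>The pair \<open>(\<gamma>, e)\<close> is coded as
    \<open>\<gamma> * D + e\<close> and decoded by \<open>div\<close> and
    \<open>mod\<close>.\<close>
  define b' where "b' k = (\<lambda>z. b (k div D) z * y z ^ (k mod D))" for k
  define \<omega>' where "\<omega>' k = \<omega> (k div D) + int (k mod D)" for k
  have main: "\<exists>c. (\<forall>\<gamma><N * D. pf m (\<omega>' \<beta> + 1 - \<omega>' \<gamma>) (c \<gamma>)) \<and>
        (\<forall>z\<in>X. z i * b' \<beta> z = (\<Sum>\<gamma><N * D. c \<gamma> (\<pi>' z) * b' \<gamma> z))" if i: "i < n" and k: "\<beta> < N * D" for i \<beta>
  proof -
    let ?\<beta> = "\<beta> div D" and ?e = "\<beta> mod D"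
    have "?\<beta> < N" using k by (simp add: less_mult_imp_div_less)
    from gen[rule_format, OF i this] obtain c where c0: "(\<forall>\<gamma><N. pf (Suc m) (\<omega> ?\<beta> + 1 - \<omega> \<gamma>) (c \<gamma>)) \<and>
      (\<forall>z\<in>X. z i * b ?\<beta> z = (\<Sum>\<gamma><N. c \<gamma> (\<pi> z) * b \<gamma> z))" ..
    note c = conjunct1[OF c0] conjunct2[OF c0]
    \<comment> \<open>The inverse of the shear: it expresses the old coordinates by the new ones and
      \<open>y\<close>.\<close>
    define \<phi> where "\<phi> v = (\<lambda>j. if j < m then v j + w j * v m else v j)" for v :: "nat \<Rightarrow> 'k"
    have \<phi>: "pf (Suc m) 1 (\<lambda>z. \<phi> z j)" if "j < Suc m" for j
    proof (cases "j < m")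
      case True
      have "pf (Suc m) 1 (\<lambda>z. z j + w j * z m)" by (rule pf_add[OF pf_var pf_cmult[OF pf_var]]) (use that in auto)
      then show ?thesis using True by (simp add: \<phi>_def)
    next
      case False
      then show ?thesis using that by (simp add: \<phi>_def pf_var)
    qed
    have "\<forall>\<gamma>. \<exists>R. \<gamma> < N \<longrightarrow> (\<forall>v. c \<gamma> (\<phi> v) = poly (R v) (v m)) \<and>
       (\<forall>l. pf m (\<omega> ?\<beta> + 1 - \<omega> \<gamma> - int l) (\<lambda>v. coeff (R v) l)) \<and> (\<forall>v. dle (\<omega> ?\<beta> + 1 - \<omega> \<gamma>) (R v))"
    proof
      fix \<gamma>
      show "\<exists>R. \<gamma> < N \<longrightarrow> (\<forall>v. c \<gamma> (\<phi> v) = poly (R v) (v m)) \<and>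
       (\<forall>l. pf m (\<omega> ?\<beta> + 1 - \<omega> \<gamma> - int l) (\<lambda>v. coeff (R v) l)) \<and> (\<forall>v. dle (\<omega> ?\<beta> + 1 - \<omega> \<gamma>) (R v))"
      proof (cases "\<gamma> < N")
        case True
        then have "pf (Suc m) (\<omega> ?\<beta> + 1 - \<omega> \<gamma>) (\<lambda>v. c \<gamma> (\<phi> v))"
          by (intro pf_comp[OF c(1)[rule_format] \<phi>])
        then obtain R where "\<And>v. c \<gamma> (\<phi> v) = poly (R v) (v m)"
          "\<And>l. pf m (\<omega> ?\<beta> + 1 - \<omega> \<gamma> - int l) (\<lambda>v. coeff (R v) l)" "\<And>v. dle (\<omega> ?\<beta> + 1 - \<omega> \<gamma>) (R v)"
          by (rule pf_last) (rule that)
        then show ?thesis by (intro exI[of _ R]) simp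
      qed simp
    qed
    from choice[OF this] obtain R where R: "\<forall>\<gamma>. \<gamma> < N \<longrightarrow> (\<forall>v. c \<gamma> (\<phi> v) = poly (R \<gamma> v) (v m)) \<and>
       (\<forall>l. pf m (\<omega> ?\<beta> + 1 - \<omega> \<gamma> - int l) (\<lambda>v. coeff (R \<gamma> v) l)) \<and> (\<forall>v. dle (\<omega> ?\<beta> + 1 - \<omega> \<gamma>) (R \<gamma> v))" ..
    define L where "L = (\<Sum>\<gamma><N. nat \<bar>\<omega> ?\<beta> + 1 - \<omega> \<gamma>\<bar>)"
    have cz: "c \<gamma> (\<pi> z) = (\<Sum>l\<le>L. coeff (R \<gamma> (\<pi>' z)) l * y z ^ l)" if \<gamma>: "\<gamma> < N" for \<gamma> z
    proof -
      let ?v = "(\<pi>' z)(m := y z)"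
      have "c \<gamma> (\<pi> z) = c \<gamma> (\<phi> ?v)"
        by (rule pf_cong[where n = "Suc m"]) (use c \<gamma> in \<open>auto simp: \<phi>_def \<pi>'_def y_def less_Suc_eq\<close>)
      also have "\<dots> = poly (R \<gamma> ?v) (y z)" using R \<gamma> by simp
      also have "R \<gamma> ?v = R \<gamma> (\<pi>' z)"
      proof (rule poly_eqI)
        fix l show "coeff (R \<gamma> ?v) l = coeff (R \<gamma> (\<pi>' z)) l"
          by (rule pf_cong[where F = "\<lambda>v. coeff (R \<gamma> v) l" and n = m]) (use R \<gamma> in auto)
      qed
      also have "poly (R \<gamma> (\<pi>' z)) (y z) = (\<Sum>l\<le>L. coeff (R \<gamma> (\<pi>' z)) l * y z ^ l)"
      proof (rule poly_sum_atMost)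
        have "nat \<bar>\<omega> ?\<beta> + 1 - \<omega> \<gamma>\<bar> \<le> L" unfolding L_def by (rule member_le_sum) (use \<gamma> in auto)
        moreover have "dle (\<omega> ?\<beta> + 1 - \<omega> \<gamma>) (R \<gamma> (\<pi>' z))" using R \<gamma> by blast
        ultimately show "dle (int L) (R \<gamma> (\<pi>' z))" by (elim dle_mono) linarith
      qed
      finally show ?thesis .
    qed
    define C where "C k = (\<lambda>a. \<Sum>l\<le>L. coeff (R (k div D) a) l * r (l + ?e) (k mod D) a)" for k
    have "pf m (\<omega>' \<beta> + 1 - \<omega>' k) (C k)" if "k < N * D" for k
    proof -
      have "k div D < N" using that by (simp add: less_mult_imp_div_less)
      then have 1: "pf m (\<omega> ?\<beta> + 1 - \<omega> (k div D) - int l) (\<lambda>v. coeff (R (k div D) v) l)" for l using R by blast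
      have 2: "pf m (int (l + ?e) - int (k mod D)) (r (l + ?e) (k mod D))" for l
        by (rule rpf) (use \<open>D > 0\<close> in simp)
      have "pf m (\<omega>' \<beta> + 1 - \<omega>' k) (\<lambda>a. coeff (R (k div D) a) l * r (l + ?e) (k mod D) a)" for l
        using pf_mult[OF 1[of l] 2[of l]] by (simp add: \<omega>'_def algebra_simps)
      then show ?thesis unfolding C_def by (intro pf_sum)
    qed
    moreover have "z i * b' \<beta> z = (\<Sum>k<N * D. C k (\<pi>' z) * b' k z)" if z: "z \<in> X" for z
    proof -
      have "z i * b' \<beta> z = (\<Sum>\<gamma><N. c \<gamma> (\<pi> z) * b \<gamma> z) * y z ^ ?e"
        using c(2) z unfolding b'_def by (metis mult.assoc)
      also have "\<dots> = (\<Sum>\<gamma><N. \<Sum>l\<le>L. coeff (R \<gamma> (\<pi>' z)) l * b \<gamma> z * y z ^ (l + ?e))"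
        by (simp add: cz sum_distrib_left sum_distrib_right power_add mult_ac)
      also have "\<dots> = (\<Sum>\<gamma><N. \<Sum>l\<le>L. coeff (R \<gamma> (\<pi>' z)) l * b \<gamma> z * (\<Sum>j<D. r (l + ?e) j (\<pi>' z) * y z ^ j))"
        by (simp only: ypow[OF z, symmetric])
      also have "\<dots> = (\<Sum>\<gamma><N. \<Sum>j<D. \<Sum>l\<le>L. coeff (R \<gamma> (\<pi>' z)) l * r (l + ?e) j (\<pi>' z) * (b \<gamma> z * y z ^ j))"
        unfolding sum_distrib_left
        by (rule sum.cong[OF refl], subst sum.swap) (simp add: mult_ac)
      also have "\<dots> = (\<Sum>\<gamma><N. \<Sum>j<D. (\<Sum>l\<le>L. coeff (R \<gamma> (\<pi>' z)) l * r (l + ?e) j (\<pi>' z)) * (b \<gamma> z * y z ^ j))"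
        by (simp add: sum_distrib_right)
      also have "\<dots> = (\<Sum>k<N * D. C k (\<pi>' z) * b' k z)"
        unfolding C_def b'_def
        by (rule sum_div_mod[OF \<open>D > 0\<close>, symmetric,
           where f = "\<lambda>\<gamma> j. (\<Sum>l\<le>L. coeff (R \<gamma> (\<pi>' z)) l * r (l + ?e) j (\<pi>' z)) * (b \<gamma> z * y z ^ j)"])
      finally show ?thesis .
    qed
    ultimately show ?thesis by (intro exI[of _ C]) blast
  qed
  show ?thesis
    unfolding sfin_def \<pi>'_def[symmetric]
  proof (rule exI[of _ "N * D"], rule exI[of _ b'], rule exI[of _ \<omega>'], intro conjI allI impI)
    show "0 < N * D" using N \<open>D > 0\<close> by simp
    show "\<omega>' 0 = 0" using N by (simp add: \<omega>'_def)
    show "b' 0 = (\<lambda>_. 1)" using N by (simp add: b'_def)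
  qed (rule main)
qed

text \<open>For a relation \<open>F\<close> the bound \<open>D\<close> is chosen least, which is
  what makes its leading form nonzero.\<close>

lemma dependent_top:
  assumes "\<not> indep X m \<pi>"
  obtains D F where "pf m (int D) F" "\<not> pf m (int D - 1) F" "\<And>z. z \<in> X \<Longrightarrow> F (\<pi> z) = 0"
proof -
  obtain F a where F: "PF m F" "\<And>z. z \<in> X \<Longrightarrow> F (\<pi> z) = 0" "F a \<noteq> 0"
    using assms unfolding indep_def not_all not_imp by (elim exE conjE) (erule (1) that[rotated 2], blast)
  obtain D0 where D0: "pf m (int D0) F" using F(1) by (rule PF_pfE)
  define D where "D = (LEAST D. pf m (int D) F)"
  have D: "pf m (int D) F" unfolding D_def using D0 by (rule LeastI)
  have "\<not> pf m (int D - 1) F"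
  proof
    assume *: "pf m (int D - 1) F"
    show False
    proof (cases D)
      case 0
      then have "F = (\<lambda>_. 0)" using pf_neg[OF *] by simp
      then show False using F(3) by simp
    next
      case (Suc d)
      then have "pf m (int d) F" using * by simp
      then have "D \<le> d" unfolding D_def by (rule Least_le)
      then show False using Suc by simp
    qed
  qed
  then show thesis by (intro that[OF D _ F(2)])
qed

lemma proj_sub:
  assumes "proj n (Suc m) \<pi>" shows "proj n m (\<lambda>z j. \<pi> z j - w j * \<pi> z m)"
  unfolding proj_def
proof (intro allI impI)
  fix j assume "j < m"
  then have "pf n 1 (\<lambda>z. \<pi> z j)" "pf n 1 (\<lambda>z. \<pi> z m)" using assms by (simp_all add: proj_def)
  then show "pf n 1 (\<lambda>z. \<pi> z j - w j * \<pi> z m)" by (intro pf_diff pf_cmult)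
qed

text \<open>Homogeneity of the leading form allows \<open>w\<close> to be scaled to last coordinate
  1, as \<open>sfin_reduce\<close> requires.\<close>

lemma top_dir_step:
  fixes X :: "(nat \<Rightarrow> 'k) set"
  assumes "sfin X n (Suc m) \<pi>" "X \<noteq> {}" "\<And>z. z \<in> X \<Longrightarrow> F (\<pi> z) = 0"
    and F: "pf (Suc m) (int D) F" and L: "\<And>c w. L (\<lambda>i. c * w i) = c ^ D * L w"
    "\<forall>w Q. (\<forall>x t. poly (Q x) t = F (\<lambda>i. x i + t * w i)) \<longrightarrow> coeff (Q (\<lambda>_. 0)) D = L w"
    and w: "L w \<noteq> 0" "w m \<noteq> 0"
  shows "sfin X n m (\<lambda>z j. \<pi> z j - (w j / w m) * \<pi> z m)"
proof -
  define w' where "w' = (\<lambda>i. inverse (w m) * w i)"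
  obtain Q where Q: "\<And>x t. poly (Q x) t = F (\<lambda>i. x i + t * w' i)" "\<And>i. pf (Suc m) (int D - int i) (\<lambda>x. coeff (Q x) i)"
    "\<And>x. dle (int D) (Q x)" by (rule pf_line_base[OF F], rule that)
  have "coeff (Q (\<lambda>_. 0)) D = L w'" using L(2) Q(1) by simp
  also have "\<dots> \<noteq> 0" unfolding w'_def L(1) using w by simp
  finally have "coeff (Q (\<lambda>_. 0)) D \<noteq> 0" .
  from sfin_reduce[OF assms(1,2) assms(3) F Q this] have "sfin X n m (\<lambda>z j. \<pi> z j - w' j * \<pi> z m)"
    using w by (simp add: w'_def)
  then show ?thesis by (simp add: w'_def divide_inverse mult.commute)
qed

text \<open>A generic direction avoids both the leading form and the hyperplane
  \<open>w m' = 0\<close>; it exists because the field is infinite. For \<open>m = 0\<close> a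
  relation would be a nonzero constant vanishing at a point of \<open>X\<close>.\<close>

lemma sfin_dependent_reduce:
  fixes X :: "(nat \<Rightarrow> 'k) set"
  assumes fin: "sfin X n m \<pi>" and "X \<noteq> {}" and dep: "\<not> indep X m \<pi>"
  obtains m' w where "m = Suc m'" "w m' = 1" "sfin X n m' (\<lambda>z j. \<pi> z j - w j * \<pi> z m')"
proof -
  obtain D F where F: "pf m (int D) F" "\<not> pf m (int D - 1) F" "\<And>z. z \<in> X \<Longrightarrow> F (\<pi> z) = 0"
    by (rule dependent_top[OF dep], rule that)
  obtain L where L: "pf m (int D) L" "\<exists>w. L w \<noteq> 0" "\<And>c w. L (\<lambda>i. c * w i) = c ^ D * L w"
    "\<forall>w Q. (\<forall>x t. poly (Q x) t = F (\<lambda>i. x i + t * w i)) \<longrightarrow> coeff (Q (\<lambda>_. 0)) D = L w"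
    by (rule pf_top[OF F(1,2)], rule that)
  show ?thesis
  proof (cases m)
    case 0
    obtain w where "L w \<noteq> 0" using L(2) by blast
    have Fc: "F u = F v" for u v by (rule pf_cong[OF F(1)]) (simp add: 0)
    obtain z where "z \<in> X" using \<open>X \<noteq> {}\<close> by blast
    then have "F u = 0" for u using F(3) Fc by metis
    then have "F = (\<lambda>_. 0)" by auto
    then show thesis using F(2) pf_zero by metis
  next
    case (Suc m')
    obtain w0 where "L w0 \<noteq> 0" using L(2) by blast
    have "\<exists>w. L w \<noteq> 0 \<and> w m' \<noteq> 0"
      by (rule PF_common_nonzero[OF infinite_k PF_I[OF L(1)] PF_var \<open>L w0 \<noteq> 0\<close>, of m' "\<lambda>_. 1"]) (auto simp: Suc)
    then obtain w where w: "L w \<noteq> 0" "w m' \<noteq> 0" by blast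
    have "sfin X n m' (\<lambda>z j. \<pi> z j - (w j / w m') * \<pi> z m')"
      by (rule top_dir_step[OF fin[unfolded Suc] \<open>X \<noteq> {}\<close> F(3) F(1)[unfolded Suc] L(3,4) w])
    then show thesis using that[of m' "\<lambda>j. w j / w m'"] Suc w by simp
  qed
qed

end

subsection \<open>Descending chains of closed sets\<close>

definition gen :: "nat \<Rightarrow> (nat \<Rightarrow> (nat \<Rightarrow> 'k::field) \<Rightarrow> 'k) \<Rightarrow> nat \<Rightarrow> ((nat \<Rightarrow> 'k) \<Rightarrow> 'k) \<Rightarrow> bool" where
  "gen n f m G \<longleftrightarrow> (\<exists>u. (\<forall>i<m. PF n (u i)) \<and> (\<forall>z. G z = (\<Sum>i<m. u i z * f i z)))"

lemma gen_zero: "gen n f m (\<lambda>_. 0)"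
  unfolding gen_def by (rule exI[of _ "\<lambda>_ _. 0"]) simp

lemma gen_add:
  assumes "gen n f m G" "gen n f m H" shows "gen n f m (\<lambda>z. G z + H z)"
proof -
  obtain u where u: "(\<forall>i<m. PF n (u i)) \<and> (\<forall>z. G z = (\<Sum>i<m. u i z * f i z))" using assms(1) unfolding gen_def ..
  obtain v where v: "(\<forall>i<m. PF n (v i)) \<and> (\<forall>z. H z = (\<Sum>i<m. v i z * f i z))" using assms(2) unfolding gen_def ..
  show ?thesis unfolding gen_def
    by (rule exI[of _ "\<lambda>i z. u i z + v i z"]) (use u v in \<open>auto simp: distrib_right sum.distrib intro: PF_add\<close>)
qed

lemma gen_mult:
  assumes "PF n H" "gen n f m G" shows "gen n f m (\<lambda>z. H z * G z)"
proof -
  obtain u where u: "(\<forall>i<m. PF n (u i)) \<and> (\<forall>z. G z = (\<Sum>i<m. u i z * f i z))" using assms(2) unfolding gen_def ..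
  show ?thesis unfolding gen_def
    by (rule exI[of _ "\<lambda>i z. H z * u i z"]) (use u assms(1) in \<open>auto simp: sum_distrib_left mult.assoc intro: PF_mult\<close>)
qed

lemma gen_sum: "(\<And>i. i \<in> A \<Longrightarrow> gen n f m (G i)) \<Longrightarrow> gen n f m (\<lambda>z. \<Sum>i\<in>A. G i z)"
  by (induction A rule: infinite_finite_induct) (auto intro: gen_zero gen_add)

lemma gen_diff: "gen n f m G \<Longrightarrow> gen n f m H \<Longrightarrow> gen n f m (\<lambda>z. G z - H z)"
  using gen_add[of n f m G "\<lambda>z. - 1 * H z"] gen_mult[of n "\<lambda>_. -1" f m H] by simp

lemma gen_self:
  assumes "i < m" shows "gen n f m (f i)"
  unfolding gen_def
  by (rule exI[of _ "\<lambda>j _. if j = i then 1 else 0"])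
    (use assms in \<open>auto simp: if_distrib[of "\<lambda>x. x * _"] cong: if_cong\<close>)

lemma gen_trans:
  assumes "\<And>i. i < m \<Longrightarrow> gen n f M (g i)" "gen n g m G" shows "gen n f M G"
proof -
  obtain u where u: "(\<forall>i<m. PF n (u i)) \<and> (\<forall>z. G z = (\<Sum>i<m. u i z * g i z))" using assms(2) unfolding gen_def ..
  have "gen n f M (\<lambda>z. \<Sum>i<m. u i z * g i z)"
    by (intro gen_sum gen_mult assms(1)) (use u in auto)
  then show ?thesis using u by (simp add: gen_def)
qed

lemma gen_mono: "gen n f m G \<Longrightarrow> m \<le> M \<Longrightarrow> gen n f M G"
  by (rule gen_trans[of m n f M f]) (auto intro: gen_self)

lemma gen_cong: "(\<And>i. i < m \<Longrightarrow> f i = g i) \<Longrightarrow> gen n f m G \<longleftrightarrow> gen n g m G"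
  unfolding gen_def by simp

lemma gen_PF: "(\<And>i. i < m \<Longrightarrow> PF n (f i)) \<Longrightarrow> gen n f m G \<Longrightarrow> PF n G"
proof -
  assume f: "\<And>i. i < m \<Longrightarrow> PF n (f i)" and "gen n f m G"
  then obtain u where u: "(\<forall>i<m. PF n (u i)) \<and> (\<forall>z. G z = (\<Sum>i<m. u i z * f i z))" unfolding gen_def by (elim exE)
  have "PF n (\<lambda>z. \<Sum>i<m. u i z * f i z)" by (intro PF_sum PF_mult) (use u f in auto)
  moreover have "G = (\<lambda>z. \<Sum>i<m. u i z * f i z)" using u by auto
  ultimately show ?thesis by simp
qed

text \<open>Expansion in the last variable; \<open>d\<close> is an upper bound for the degree, not
  necessarily the degree itself.\<close>

definition ldeg :: "nat \<Rightarrow> nat \<Rightarrow> ((nat \<Rightarrow> 'k::field) \<Rightarrow> 'k) \<Rightarrow> ((nat \<Rightarrow> 'k) \<Rightarrow> 'k poly) \<Rightarrow> bool" where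
  "ldeg n d G Q \<longleftrightarrow> (\<forall>z. G z = poly (Q z) (z n)) \<and> (\<forall>i. PF n (\<lambda>z. coeff (Q z) i)) \<and> (\<forall>z. degree (Q z) \<le> d)"

lemma ldeg_ex:
  assumes "PF (Suc n) G" obtains d Q where "ldeg n d G Q"
proof -
  obtain D where D: "pf (Suc n) (int D) G" by (rule PF_pfE[OF assms])
  obtain Q where "\<And>z. G z = poly (Q z) (z n)" "\<And>i. pf n (int D - int i) (\<lambda>z. coeff (Q z) i)"
    "\<And>z. dle (int D) (Q z)" by (rule pf_last[OF D], rule that)
  then have "ldeg n D G Q" unfolding ldeg_def by (auto simp: dle_degree intro: PF_I)
  then show thesis by (rule that)
qed

text \<open>Hilbert's argument, by contradiction. Choose \<open>g m\<close> outside the ideal of its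
  predecessors with least degree \<open>d m\<close> in the last variable. By induction one of the
  coefficients at \<open>d m\<close> is a combination of the earlier ones; subtracting the
  corresponding multiples from \<open>g m\<close> lowers the degree but stays outside that
  ideal.\<close>

lemma hilbert_basis_step:
  fixes f :: "nat \<Rightarrow> (nat \<Rightarrow> 'k::field) \<Rightarrow> 'k"
  assumes IH: "\<And>a :: nat \<Rightarrow> (nat \<Rightarrow> 'k) \<Rightarrow> 'k. (\<And>i. PF n (a i)) \<Longrightarrow> \<exists>m. gen n a m (a m)"
    and f: "\<And>i. PF (Suc n) (f i)"
  shows "\<exists>m. gen (Suc n) f m (f m)"
proof (rule ccontr)
  assume "\<not> ?thesis"
  then have bad: "\<not> gen (Suc n) f m (f m)" for m by simp
  define I where "I = {G. \<exists>M. gen (Suc n) f M G}"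
  define L where "L xs G \<longleftrightarrow> gen (Suc n) (\<lambda>i. xs ! i) (length xs) G" for xs and G :: "(nat \<Rightarrow> 'k) \<Rightarrow> 'k"
  have IPF: "PF (Suc n) G" if "G \<in> I" for G
    using that unfolding I_def by (auto intro: gen_PF f)
  have Iadd: "(\<lambda>z. G z - H z) \<in> I" if GH: "G \<in> I" "H \<in> I" for G H
  proof -
    obtain M M' where "gen (Suc n) f M G" "gen (Suc n) f M' H" using GH unfolding I_def by auto
    then have "gen (Suc n) f (max M M') G" "gen (Suc n) f (max M M') H" by (auto elim: gen_mono)
    then show ?thesis unfolding I_def by (auto intro: gen_diff)
  qed
  have Imult: "(\<lambda>z. H z * G z) \<in> I" if "PF (Suc n) H" "G \<in> I" for G H
    using that unfolding I_def by (auto intro: gen_mult)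
  have Izero: "(\<lambda>_. 0) \<in> I" unfolding I_def using gen_zero by blast
  have Isum: "(\<lambda>z. \<Sum>i\<in>A. G i z) \<in> I" if "\<And>i. i \<in> A \<Longrightarrow> G i \<in> I" "finite A" for A :: "nat set" and G
    using that(2,1)
  proof (induction A rule: finite_induct)
    case (insert x A)
    have 1: "(\<lambda>z. \<Sum>i\<in>A. G i z) \<in> I" by (rule insert.IH) (use insert.prems in auto)
    have "G x \<in> I" using insert.prems by simp
    from Iadd[OF this Imult[OF PF_const[of "Suc n" "-1"] 1]] show ?case using insert by simp
  qed (use Izero in simp)
  have ex: "\<exists>G. G \<in> I \<and> \<not> L xs G" if xs: "set xs \<subseteq> I" for xs
  proof -
    have "\<exists>M. \<forall>i<length xs. gen (Suc n) f M (xs ! i)"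
      using xs
    proof (induction xs rule: rev_induct)
      case (snoc x xs)
      then obtain M where M: "\<forall>i<length xs. gen (Suc n) f M (xs ! i)" by auto
      obtain M' where M': "gen (Suc n) f M' x" using snoc.prems unfolding I_def by auto
      show ?case
        by (rule exI[of _ "max M M'"])
          (use M M' in \<open>auto simp: nth_append less_Suc_eq intro: gen_mono[of _ _ M] gen_mono[of _ _ M']\<close>)
    qed simp
    then obtain M where M: "\<And>i. i < length xs \<Longrightarrow> gen (Suc n) f M (xs ! i)" by blast
    have "\<not> L xs (f M)"
    proof
      assume "L xs (f M)"
      then have "gen (Suc n) ((!) xs) (length xs) (f M)" by (simp add: L_def)
      then have "gen (Suc n) f M (f M)"
        by (rule gen_trans[where g = "(!) xs" and m = "length xs", rotated]) (rule M)
      then show False using bad by blast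
    qed
    moreover have "f M \<in> I" unfolding I_def using gen_self[of M "Suc M"] by blast
    ultimately show ?thesis by blast
  qed
  define P where "P xs G d Q \<longleftrightarrow> G \<in> I \<and> \<not> L xs G \<and> ldeg n d G Q \<and>
      (\<forall>G' d' Q'. G' \<in> I \<longrightarrow> \<not> L xs G' \<longrightarrow> ldeg n d' G' Q' \<longrightarrow> d \<le> d')" for xs G d Q
  have exP: "\<exists>G d Q. P xs G d Q" if xs: "set xs \<subseteq> I" for xs
  proof -
    let ?S = "\<lambda>d. \<exists>G Q. G \<in> I \<and> \<not> L xs G \<and> ldeg n d G Q"
    obtain G where G: "G \<in> I" "\<not> L xs G" using ex[OF xs] by blast
    obtain d Q where "ldeg n d G Q" by (rule ldeg_ex[OF IPF[OF G(1)]])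
    then have "?S d" using G by blast
    then have least: "?S (LEAST d. ?S d)" by (rule LeastI)
    have min: "(LEAST d. ?S d) \<le> d'" if "G' \<in> I" "\<not> L xs G'" "ldeg n d' G' Q'" for G' d' Q'
      by (rule Least_le) (use that in blast)
    from least obtain G Q where "G \<in> I" "\<not> L xs G" "ldeg n (LEAST d. ?S d) G Q" by blast
    then have "P xs G (LEAST d. ?S d) Q" unfolding P_def using min by blast
    then show ?thesis by blast
  qed
  define nx where "nx xs = (SOME G. \<exists>d Q. P xs G d Q)" for xs
  have nx: "\<exists>d Q. P xs (nx xs) d Q" if "set xs \<subseteq> I" for xs
    unfolding nx_def by (rule someI_ex[of "\<lambda>G. \<exists>d Q. P xs G d Q"]) (rule exP[OF that])
  define gs where "gs = rec_nat [] (\<lambda>_ xs. xs @ [nx xs])"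
  have gs: "gs 0 = []" "gs (Suc m) = gs m @ [nx (gs m)]" for m by (simp_all add: gs_def)
  define g where "g m = nx (gs m)" for m
  have len: "length (gs m) = m" for m by (induction m) (simp_all add: gs)
  have nth: "gs m ! i = g i" if "i < m" for m i
    using that by (induction m) (auto simp: gs nth_append len less_Suc_eq g_def)
  have sub: "set (gs m) \<subseteq> I" for m
  proof (induction m)
    case (Suc m)
    then show ?case using nx[OF Suc] by (auto simp: gs P_def)
  qed (simp add: gs)
  have Lg: "L (gs m) G \<longleftrightarrow> gen (Suc n) g m G" for m G
    unfolding L_def len by (rule gen_cong) (simp add: nth)
  have "\<forall>m. \<exists>x. P (gs m) (g m) (fst x) (snd x)" using nx[OF sub] by (simp add: g_def)
  from choice[OF this] obtain x where "\<forall>m. P (gs m) (g m) (fst (x m)) (snd (x m))" ..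
  define d Q where "d m = fst (x m)" and "Q m = snd (x m)" for m
  have P: "P (gs m) (g m) (d m) (Q m)" for m using \<open>\<forall>m. P _ _ _ _\<close> by (simp add: d_def Q_def)
  note Pm = P[unfolded P_def Lg]
  have gI: "g m \<in> I" for m by (rule conjunct1[OF Pm])
  have ng: "\<not> gen (Suc n) g m (g m)" for m by (rule conjunct1[OF conjunct2[OF Pm]])
  have ld: "ldeg n (d m) (g m) (Q m)" for m by (rule conjunct1[OF conjunct2[OF conjunct2[OF Pm]]])
  have mini: "d m \<le> d'" if "G' \<in> I" "\<not> gen (Suc n) g m G'" "ldeg n d' G' Q'" for m G' d' Q'
    by (rule conjunct2[OF conjunct2[OF conjunct2[OF Pm[of m]]], rule_format, OF that])
  \<comment> \<open>For \<open>i \<le> m\<close> the element \<open>g m\<close> was already a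
    candidate at stage \<open>i\<close>.\<close>
  have dmono: "d i \<le> d m" if "i \<le> m" for i m
  proof (rule mini[OF gI _ ld])
    show "\<not> gen (Suc n) g i (g m)"
    proof
      assume "gen (Suc n) g i (g m)"
      from gen_mono[OF this that] show False using ng[of m] by contradiction
    qed
  qed
  note ldm = ld[unfolded ldeg_def]
  have ldv1: "g i z = poly (Q i z) (z n)" for i z by (rule spec[OF conjunct1[OF ldm]])
  have ldv2: "PF n (\<lambda>z. coeff (Q i z) j)" for i j by (rule spec[OF conjunct1[OF conjunct2[OF ldm]]])
  have ldv3: "degree (Q i z) \<le> d i" for i z by (rule spec[OF conjunct2[OF conjunct2[OF ldm]]])
  have "\<exists>m. gen n (\<lambda>m z. coeff (Q m z) (d m)) m (\<lambda>z. coeff (Q m z) (d m))"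
  proof (rule IH[of "\<lambda>m z. coeff (Q m z) (d m)"])
    fix i show "PF n (\<lambda>z. coeff (Q i z) (d i))" by (rule ldv2)
  qed
  then obtain m where m: "gen n (\<lambda>m z. coeff (Q m z) (d m)) m (\<lambda>z. coeff (Q m z) (d m))" ..
  then obtain u where u: "(\<forall>i<m. PF n (u i)) \<and> (\<forall>z. coeff (Q m z) (d m) = (\<Sum>i<m. u i z * coeff (Q i z) (d i)))"
    unfolding gen_def ..
  \<comment> \<open>The powers of \<open>z n\<close> raise each \<open>g i\<close> to degree
    \<open>d m\<close>, so that the coefficients of \<open>z n ^ d m\<close> cancel.\<close>
  define G where "G z = g m z - (\<Sum>i<m. (u i z * z n ^ (d m - d i)) * g i z)" for z
  have cPF: "PF (Suc n) (\<lambda>z. u i z * z n ^ (d m - d i))" if "i < m" for i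
  proof -
    have "PF n (u i)" using u that by blast
    then have "PF (Suc n) (\<lambda>z. u i z)" by (rule PF_extend) simp
    then show ?thesis by (rule PF_mult) (rule PF_power[OF PF_var], simp)
  qed
  have "(\<lambda>z. \<Sum>i<m. (u i z * z n ^ (d m - d i)) * g i z) \<in> I"
  proof (rule Isum[of "{..<m}" "\<lambda>i z. (u i z * z n ^ (d m - d i)) * g i z"])
    fix i assume "i \<in> {..<m}"
    then have "i < m" by simp
    show "(\<lambda>z. (u i z * z n ^ (d m - d i)) * g i z) \<in> I" by (rule Imult[OF cPF[OF \<open>i < m\<close>] gI])
  qed simp
  from Iadd[OF gI this] have "G \<in> I" by (simp add: G_def[abs_def])
  have "\<not> gen (Suc n) g m G"
  proof
    assume "gen (Suc n) g m G"
    moreover have "gen (Suc n) g m (\<lambda>z. \<Sum>i<m. (u i z * z n ^ (d m - d i)) * g i z)"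
    proof (rule gen_sum)
      fix i assume "i \<in> {..<m}"
      then have "i < m" by simp
      show "gen (Suc n) g m (\<lambda>z. (u i z * z n ^ (d m - d i)) * g i z)"
        by (rule gen_mult[OF cPF[OF \<open>i < m\<close>] gen_self[OF \<open>i < m\<close>]])
    qed
    ultimately have "gen (Suc n) g m (\<lambda>z. G z + (\<Sum>i<m. (u i z * z n ^ (d m - d i)) * g i z))" by (rule gen_add)
    then show False using ng[of m] by (simp add: G_def)
  qed
  define R where "R z = Q m z - (\<Sum>i<m. monom (u i z) (d m - d i) * Q i z)" for z
  have R1: "G z = poly (R z) (z n)" for z
    by (simp add: G_def R_def ldv1 poly_sum poly_monom)
  have R2: "PF n (\<lambda>z. coeff (R z) j)" for j
  proof -
    have "PF n (\<lambda>z. coeff (monom (u i z) k * Q i z) j)" if "i < m" for i k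
      unfolding coeff_monom_mult using u that by (cases "k \<le> j") (auto intro!: PF_mult ldv2)
    then show ?thesis unfolding R_def coeff_diff coeff_sum by (intro PF_diff PF_sum ldv2) auto
  qed
  have Rdeg: "degree (R z) \<le> d m" for z
    unfolding R_def
  proof (intro degree_diff_le degree_sum_le)
    fix i assume "i \<in> {..<m}"
    then have "degree (monom (u i z) (d m - d i) * Q i z) \<le> (d m - d i) + d i"
      by (intro order_trans[OF degree_mult_le] add_mono ldv3 degree_monom_le)
    then show "degree (monom (u i z) (d m - d i) * Q i z) \<le> d m"
      using dmono[of i m] \<open>i \<in> {..<m}\<close> by simp
  qed (use ldv3 in auto)
  have Rtop: "coeff (R z) (d m) = 0" for z
  proof -
    have "coeff (monom (u i z) (d m - d i) * Q i z) (d m) = u i z * coeff (Q i z) (d i)" if "i < m" for i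
      using dmono[of i m] that by (simp add: coeff_monom_mult)
    then show ?thesis using u by (simp add: R_def coeff_sum)
  qed
  show False
  proof (cases "d m")
    case 0
    have "R z = 0" for z
    proof -
      have "degree (R z) = 0" using Rdeg[of z] 0 by simp
      then obtain c where "R z = [:c:]" by (rule degree_eq_zeroE)
      then show ?thesis using Rtop[of z] 0 by simp
    qed
    then have "G = (\<lambda>_. 0)" using R1 by auto
    then show False using \<open>\<not> gen (Suc n) g m G\<close> gen_zero[of "Suc n" g m] by simp
  next
    case (Suc d')
    have "degree (R z) \<le> d'" for z
    proof (rule degree_le, intro allI impI)
      fix i assume "d' < i"
      then show "coeff (R z) i = 0"
        using Rtop[of z] Rdeg[of z] Suc by (cases "i = d m") (auto intro: coeff_eq_0)
    qed
    then have "ldeg n d' G R" unfolding ldeg_def using R1 R2 by simp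
    from mini[OF \<open>G \<in> I\<close> \<open>\<not> gen (Suc n) g m G\<close> this] show False using Suc by simp
  qed
qed

lemma hilbert_basis:
  fixes f :: "nat \<Rightarrow> (nat \<Rightarrow> 'k::field) \<Rightarrow> 'k"
  assumes "\<And>i. PF n (f i)"
  shows "\<exists>m. gen n f m (f m)"
  using assms
proof (induction n arbitrary: f)
  case 0
  have const: "f i z = f i (\<lambda>_. 0)" for i z by (rule PF_cong[OF 0]) simp
  show ?case
  proof (cases "f 0 (\<lambda>_. 0) = 0")
    case True
    then have "gen 0 f 0 (f 0)" unfolding gen_def using const by (intro exI[of _ "\<lambda>_ _. 0"]) (simp, metis)
    then show ?thesis by blast
  next
    case False
    have "gen 0 f 1 (f 1)" unfolding gen_def
    proof (rule exI[of _ "\<lambda>_ _. f 1 (\<lambda>_. 0) / f 0 (\<lambda>_. 0)"], intro conjI allI)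
      fix z
      have "f 1 z = f 1 (\<lambda>_. 0) / f 0 (\<lambda>_. 0) * f 0 z" using const[of 1 z] const[of 0 z] False by simp
      then show "f 1 z = (\<Sum>i<1. f 1 (\<lambda>_. 0) / f 0 (\<lambda>_. 0) * f i z)" by (simp add: lessThan_Suc)
    qed simp
    then show ?thesis by blast
  qed
next
  case (Suc n)
  then show ?case by (intro hilbert_basis_step) auto
qed

text \<open>In a strictly descending chain choose \<open>f i\<close> vanishing on
  \<open>Z (Suc i)\<close> but not on \<open>Z i\<close>. Some \<open>f m\<close> is a combination
  of the earlier \<open>f i\<close>; then it vanishes on \<open>Z m\<close>, a
  contradiction.\<close>

lemma wf_zariski: "wf {(Z', Z :: (nat \<Rightarrow> 'k::field) set). Z' \<subset> Z \<and> zariski_closed n Z' \<and> zariski_closed n Z}"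
  unfolding wf_iff_no_infinite_down_chain
proof
  assume "\<exists>Z. \<forall>i. (Z (Suc i), Z i) \<in> {(Z', Z :: (nat \<Rightarrow> 'k) set). Z' \<subset> Z \<and> zariski_closed n Z' \<and> zariski_closed n Z}"
  then obtain Z :: "nat \<Rightarrow> (nat \<Rightarrow> 'k) set" where
    "\<forall>i. (Z (Suc i), Z i) \<in> {(Z', Z). Z' \<subset> Z \<and> zariski_closed n Z' \<and> zariski_closed n Z}" ..
  then have Z: "\<And>i. Z (Suc i) \<subset> Z i" "\<And>i. zariski_closed n (Z i)" by auto
  have "\<forall>i. \<exists>F. PF n F \<and> (\<forall>x\<in>Z (Suc i). F x = 0) \<and> (\<exists>z\<in>Z i. F z \<noteq> 0)"
  proof
    fix i
    obtain z where z: "z \<in> Z i" "z \<notin> Z (Suc i)" using Z(1)[of i] by blast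
    then have "z \<in> affine_space n" using zariski_closed_subset[OF Z(2)] by blast
    obtain F where "PF n F" "\<And>x. x \<in> Z (Suc i) \<Longrightarrow> F x = 0" "F z \<noteq> 0"
      by (rule zariski_separate[OF Z(2) \<open>z \<in> affine_space n\<close> z(2)], rule that)
    then show "\<exists>F. PF n F \<and> (\<forall>x\<in>Z (Suc i). F x = 0) \<and> (\<exists>z\<in>Z i. F z \<noteq> 0)" using z(1) by blast
  qed
  from choice[OF this] obtain f where
    f: "\<forall>i. PF n (f i) \<and> (\<forall>x\<in>Z (Suc i). f i x = 0) \<and> (\<exists>z\<in>Z i. f i z \<noteq> 0)" ..
  obtain m where "gen n f m (f m)" using hilbert_basis[of n f] f by blast
  then obtain u where u: "(\<forall>i<m. PF n (u i)) \<and> (\<forall>z. f m z = (\<Sum>i<m. u i z * f i z))" unfolding gen_def ..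
  obtain z where z: "z \<in> Z m" "f m z \<noteq> 0" using f by blast
  have anti: "Z j \<subseteq> Z i" if "i \<le> j" for i j
    using that by (induction j rule: dec_induct) (use Z(1) in auto)
  have "f i z = 0" if "i < m" for i
    using f anti[of "Suc i" m] that z(1) by (metis Suc_leI subsetD)
  then have "f m z = 0" using u by simp
  then show False using z(2) by simp
qed

subsection \<open>Dimension\<close>

context Fpbar
begin

lemma indepD: "indep X m \<pi> \<Longrightarrow> PF m F \<Longrightarrow> (\<And>z. z \<in> X \<Longrightarrow> F (\<pi> z) = 0) \<Longrightarrow> F a = 0"
  by (simp add: indep_def)

lemma indep_nonempty: "indep X m \<pi> \<Longrightarrow> X \<noteq> {}"
  using indepD[of X m \<pi> "\<lambda>_. 1" undefined] by auto

text \<open>If the coordinates of \<open>\<pi>\<close> are dependent on \<open>X\<close>,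
  \<open>m\<close> can be lowered at once. Otherwise they become dependent on the next smaller
  member \<open>Z\<close> of the chain: a function \<open>g\<close> vanishing on \<open>Z\<close>
  but not on \<open>X\<close> has an integral equation whose lowest nonzero coefficient vanishes on
  \<open>Z\<close>.\<close>

lemma chain_le:
  fixes X :: "(nat \<Rightarrow> 'k) set"
  assumes "irr_chain n C M X" "sfin X n m \<pi>" "proj n m \<pi>"
  shows "M \<le> m"
  using assms
proof (induction m arbitrary: X M C \<pi> rule: less_induct)
  case (less m)
  have X: "irreducible_closed n X" using less.prems(1) by (auto simp: irr_chain_def)
  then have "X \<noteq> {}" and Xc: "zariski_closed n X" by (auto simp: irreducible_closed_def)
  show ?case
  proof (cases "indep X m \<pi>")
    case False
    obtain m' w where m': "m = Suc m'" "w m' = 1" "sfin X n m' (\<lambda>z j. \<pi> z j - w j * \<pi> z m')"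
      by (rule sfin_dependent_reduce[OF less.prems(2) \<open>X \<noteq> {}\<close> False], rule that)
    have "M \<le> m'"
      by (rule less.IH[OF _ less.prems(1) m'(3)]) (use m'(1) less.prems(3) proj_sub in auto)
    then show ?thesis using m' by simp
  next
    case True
    show ?thesis
    proof (cases M)
      case (Suc M')
      define Z where "Z = C M'"
      have "irreducible_closed n Z" "Z \<subset> X" using less.prems(1) Suc by (auto simp: irr_chain_def Z_def)
      then have Z: "zariski_closed n Z" "Z \<noteq> {}" by (auto simp: irreducible_closed_def)
      have chain: "irr_chain n C M' Z" using less.prems(1) Suc by (auto simp: irr_chain_def Z_def)
      obtain x where x: "x \<in> X" "x \<notin> Z" using \<open>Z \<subset> X\<close> by blast
      have "x \<in> affine_space n" using x(1) zariski_closed_subset[OF Xc] by blast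
      obtain g where g: "PF n g" "\<And>z. z \<in> Z \<Longrightarrow> g z = 0" "g x \<noteq> 0"
        by (rule zariski_separate[OF Z(1) \<open>x \<in> affine_space n\<close> x(2)], rule that)
      obtain D where "pf n (int D) g" by (rule PF_pfE[OF g(1)])
      then have g': "pf n (int (Suc D)) g" by (rule pf_mono) simp
      obtain N c where c: "0 < N" "\<And>j. j < N \<Longrightarrow> pf m (int N * int (Suc D) - int j) (c j)"
        "\<And>z. z \<in> X \<Longrightarrow> g z ^ N + (\<Sum>j<N. c j (\<pi> z) * g z ^ j) = 0"
        by (rule sfin_charpoly[OF less.prems(2) g'], simp, rule that)
      define c' where "c' j = (if j < N then c j else (\<lambda>_. 1))" for j
      have c'PF: "PF m (c' j)" for j
      proof (cases "j < N")
        case True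
        from PF_I[OF c(2)[OF True]] show ?thesis using True by (simp add: c'_def)
      qed (simp add: c'_def)
      have c'rel: "(\<Sum>j\<le>N. c' j (\<pi> z) * g z ^ j) = 0" if "z \<in> X" for z
        using c(3)[OF that] by (simp add: sum_atMost_split c'_def add.commute)
      \<comment> \<open>Below \<open>k\<close> all coefficients are zero, so \<open>g ^ k\<close>
        factors out of the equation. Primality removes it, and on \<open>Z\<close>, where
        \<open>g = 0\<close>, only the coefficient \<open>c' k\<close> survives.\<close>
      define k where "k = (LEAST j. c' j \<noteq> (\<lambda>_. 0))"
      have c'N: "c' N \<noteq> (\<lambda>_. 0)"
      proof
        assume "c' N = (\<lambda>_. 0)"
        then have "c' N undefined = 0" by simp
        then show False by (simp add: c'_def)
      qed
      have ck: "c' k \<noteq> (\<lambda>_. 0)"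
        using LeastI[of "\<lambda>j. c' j \<noteq> (\<lambda>_. 0)" N, OF c'N] unfolding k_def .
      have "k \<le> N" using Least_le[of "\<lambda>j. c' j \<noteq> (\<lambda>_. 0)" N, OF c'N] unfolding k_def .
      have small: "c' j = (\<lambda>_. 0)" if "j < k" for j using not_less_Least[of j "\<lambda>j. c' j \<noteq> (\<lambda>_. 0)"] that unfolding k_def by blast
      define H where "H z = (\<Sum>j\<in>{k..N}. c' j (\<pi> z) * g z ^ (j - k))" for z
      have "PF n (\<lambda>z. c' j (\<pi> z))" for j
        using PF_comp[OF c'PF[of j], of n \<pi>] less.prems(3) by (simp add: proj_def)
      then have HPF: "PF n H" unfolding H_def[abs_def] by (rule PF_sum[OF PF_mult[OF _ PF_power[OF g(1)]]])
      have "g z ^ k * H z = 0" if "z \<in> X" for z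
      proof -
        have "g z ^ k * H z = (\<Sum>j\<in>{k..N}. c' j (\<pi> z) * g z ^ j)"
          unfolding H_def sum_distrib_left by (rule sum.cong) (auto simp: power_add[symmetric] mult.left_commute)
        also have "\<dots> = (\<Sum>j\<le>N. c' j (\<pi> z) * g z ^ j)"
          by (rule sum.mono_neutral_left) (auto simp: small)
        finally show ?thesis using c'rel[OF that] by simp
      qed
      from irreducible_mult[OF X PF_power[OF g(1)] HPF this]
      have "(\<forall>z\<in>X. g z ^ k = 0) \<or> (\<forall>z\<in>X. H z = 0)" .
      moreover have "g x ^ k \<noteq> 0" using g(3) by simp
      ultimately have "\<forall>z\<in>X. H z = 0" using x(1) by blast
      moreover have "H z = c' k (\<pi> z)" if "z \<in> Z" for z
      proof -
        have "H z = (\<Sum>j\<in>{k}. c' j (\<pi> z) * g z ^ (j - k))"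
          unfolding H_def by (rule sum.mono_neutral_right) (use \<open>k \<le> N\<close> g(2)[OF that] in auto)
        then show ?thesis by simp
      qed
      ultimately have van: "c' k (\<pi> z) = 0" if "z \<in> Z" for z
      proof -
        have "z \<in> X" using that \<open>Z \<subset> X\<close> by blast
        then show ?thesis using \<open>\<forall>z\<in>X. H z = 0\<close> \<open>\<And>z. z \<in> Z \<Longrightarrow> H z = c' k (\<pi> z)\<close>[OF that] by simp
      qed
      have "\<not> indep Z m \<pi>"
      proof
        assume "indep Z m \<pi>"
        then have "c' k a = 0" for a by (rule indepD[where F = "c' k" and \<pi> = \<pi> and a = a]) (rule c'PF, rule van)
        then show False using ck by auto
      qed
      have "sfin Z n m \<pi>" by (rule sfin_subset[OF less.prems(2)]) (use \<open>Z \<subset> X\<close> in auto)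
      obtain m' w where m': "m = Suc m'" "w m' = 1" "sfin Z n m' (\<lambda>z j. \<pi> z j - w j * \<pi> z m')"
        by (rule sfin_dependent_reduce[OF \<open>sfin Z n m \<pi>\<close> Z(2) \<open>\<not> indep Z m \<pi>\<close>], rule that)
      have "M' \<le> m'"
        by (rule less.IH[OF _ chain m'(3)]) (use m'(1) less.prems(3) proj_sub in auto)
      then show ?thesis using Suc m' by simp
    qed simp
  qed
qed

text \<open>The section \<open>W\<close> by \<open>\<pi> z t = 0\<close> still dominates the
  remaining \<open>t\<close> coordinates, by lying over. A closed subset \<open>Z\<close> of
  \<open>W\<close> minimal with that property is irreducible, since relations on two proper pieces
  would multiply to a relation on \<open>Z\<close>. The chain is continued inside
  \<open>Z\<close>.\<close>

lemma chain_exists: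
  fixes X :: "(nat \<Rightarrow> 'k) set"
  assumes "irreducible_closed n X" "sfin X n t \<pi>" "proj n t \<pi>" "indep X t \<pi>"
  shows "\<exists>C. irr_chain n C t X"
  using assms
proof (induction t arbitrary: X)
  case 0
  then show ?case by (intro exI[of _ "\<lambda>_. X"]) (simp add: irr_chain_def)
next
  case (Suc t)
  have Xc: "zariski_closed n X" using Suc.prems(1) by (simp add: irreducible_closed_def)
  define W where "W = {z \<in> X. \<pi> z t = 0}"
  have "PF n (\<lambda>z. \<pi> z t)" using Suc.prems(3) by (auto simp: proj_def intro: PF_I)
  then have Wc: "zariski_closed n W" unfolding W_def by (rule zariski_closed_cut[OF Xc])
  have Wind: "indep W t \<pi>"
    unfolding indep_def
  proof (intro allI impI)
    fix F :: "(nat \<Rightarrow> 'k) \<Rightarrow> 'k" and a assume F: "PF t F" "\<forall>z\<in>W. F (\<pi> z) = 0"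
    obtain P where P: "P \<in> X" "\<And>j. j < Suc t \<Longrightarrow> \<pi> P j = (a(t := 0)) j"
      by (rule lying_over[OF Suc.prems(2) Xc Suc.prems(3), where c = "a(t := 0)"],
        rule indepD[OF Suc.prems(4)], assumption, blast, rule that)
    have "P \<in> W" using P by (simp add: W_def)
    have "F a = F (\<pi> P)" by (rule PF_cong[OF F(1)]) (use P(2) in auto)
    then show "F a = 0" using F(2) \<open>P \<in> W\<close> by simp
  qed
  obtain Z where Z: "zariski_closed n Z" "Z \<subseteq> W" "indep Z t \<pi>"
    and min: "\<And>Z'. zariski_closed n Z' \<Longrightarrow> Z' \<subset> Z \<Longrightarrow> \<not> indep Z' t \<pi>"
  proof -
    let ?Q = "{Z. zariski_closed n Z \<and> Z \<subseteq> W \<and> indep Z t \<pi>}"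
    have "W \<in> ?Q" using Wc Wind by simp
    obtain Z where Z: "Z \<in> ?Q"
      "\<And>Z'. (Z', Z) \<in> {(Z', Z). Z' \<subset> Z \<and> zariski_closed n Z' \<and> zariski_closed n Z} \<Longrightarrow> Z' \<notin> ?Q"
      by (rule wfE_min[OF wf_zariski \<open>W \<in> ?Q\<close>], rule that)
    then show thesis using that[of Z] by auto
  qed
  have "Z \<noteq> {}" using indep_nonempty[OF Z(3)] .
  have irr: "irreducible_closed n Z"
    unfolding irreducible_closed_def
  proof (intro conjI allI impI)
    fix Z1 Z2 assume *: "zariski_closed n Z1 \<and> zariski_closed n Z2 \<and> Z = Z1 \<union> Z2"
    show "Z = Z1 \<or> Z = Z2"
    proof (rule ccontr)
      assume "\<not> ?thesis"
      then have "Z1 \<subset> Z" "Z2 \<subset> Z" using * by auto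
      then have "\<not> indep Z1 t \<pi>" "\<not> indep Z2 t \<pi>" using min * by auto
      obtain F1 a1 where F1: "PF t F1" "\<forall>z\<in>Z1. F1 (\<pi> z) = 0" "F1 a1 \<noteq> 0"
        using \<open>\<not> indep Z1 t \<pi>\<close> unfolding indep_def by auto
      obtain F2 a2 where F2: "PF t F2" "\<forall>z\<in>Z2. F2 (\<pi> z) = 0" "F2 a2 \<noteq> 0"
        using \<open>\<not> indep Z2 t \<pi>\<close> unfolding indep_def by auto
      obtain a where a: "F1 a \<noteq> 0" "F2 a \<noteq> 0"
        using PF_common_nonzero[OF infinite_k F1(1) F2(1) F1(3) F2(3)] by blast
      have "PF t (\<lambda>a. F1 a * F2 a)" by (rule PF_mult[OF F1(1) F2(1)])
      moreover have "F1 (\<pi> z) * F2 (\<pi> z) = 0" if "z \<in> Z" for z using F1(2) F2(2) * that by auto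
      ultimately have "F1 a * F2 a = 0" by (rule indepD[OF Z(3)])
      then show False using a by simp
    qed
  qed (use Z \<open>Z \<noteq> {}\<close> in auto)
  \<comment> \<open>On \<open>Z\<close> the last coordinate of \<open>\<pi>\<close> is 0, and this
    value can be substituted into the coefficients.\<close>
  have fin: "sfin Z n t \<pi>"
  proof -
    obtain N and b :: "nat \<Rightarrow> (nat \<Rightarrow> 'k) \<Rightarrow> 'k" and \<omega> where N: "0 < N" "\<omega> 0 = 0" "b 0 = (\<lambda>_. 1)"
      and gen: "\<forall>i<n. \<forall>\<beta><N. \<exists>c. (\<forall>\<gamma><N. pf (Suc t) (\<omega> \<beta> + 1 - \<omega> \<gamma>) (c \<gamma>)) \<and>
          (\<forall>z\<in>X. z i * b \<beta> z = (\<Sum>\<gamma><N. c \<gamma> (\<pi> z) * b \<gamma> z))"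
      using Suc.prems(2) unfolding sfin_def by (elim exE conjE) (rule that)
    show ?thesis
      unfolding sfin_def
    proof (rule exI[of _ N], rule exI[of _ b], rule exI[of _ \<omega>], intro conjI allI impI N)
      fix i \<beta> assume "i < n" "\<beta> < N"
      from gen[rule_format, OF this] obtain c where
        c: "(\<forall>\<gamma><N. pf (Suc t) (\<omega> \<beta> + 1 - \<omega> \<gamma>) (c \<gamma>)) \<and> (\<forall>z\<in>X. z i * b \<beta> z = (\<Sum>\<gamma><N. c \<gamma> (\<pi> z) * b \<gamma> z))" ..
      show "\<exists>c. (\<forall>\<gamma><N. pf t (\<omega> \<beta> + 1 - \<omega> \<gamma>) (c \<gamma>)) \<and> (\<forall>z\<in>Z. z i * b \<beta> z = (\<Sum>\<gamma><N. c \<gamma> (\<pi> z) * b \<gamma> z))"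
      proof (rule exI[of _ "\<lambda>\<gamma> a. c \<gamma> (\<lambda>j. if j < t then a j else 0)"], intro conjI allI impI ballI)
        fix \<gamma> assume \<gamma>: "\<gamma> < N"
        have ext: "pf t 1 (\<lambda>z. if j < t then z j else 0)" for j by (cases "j < t") (auto intro: pf.intros)
        show "pf t (\<omega> \<beta> + 1 - \<omega> \<gamma>) (\<lambda>a. c \<gamma> (\<lambda>j. if j < t then a j else 0))"
          by (rule pf_comp[where m = "Suc t" and F = "c \<gamma>" and \<phi> = "\<lambda>a j. if j < t then a j else 0"])
            (use c \<gamma> ext in auto)
      next
        fix z assume z: "z \<in> Z"
        have "c \<gamma> (\<lambda>j. if j < t then \<pi> z j else 0) = c \<gamma> (\<pi> z)" if "\<gamma> < N" for \<gamma>
        proof (rule pf_cong[where n = "Suc t" and F = "c \<gamma>" and D = "\<omega> \<beta> + 1 - \<omega> \<gamma>"])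
          show "pf (Suc t) (\<omega> \<beta> + 1 - \<omega> \<gamma>) (c \<gamma>)" using c that by blast
          show "(if j < t then \<pi> z j else 0) = \<pi> z j" if "j < Suc t" for j
            using that z Z(2) by (auto simp: W_def less_Suc_eq)
        qed
        then have "(\<Sum>\<gamma><N. c \<gamma> (\<lambda>j. if j < t then \<pi> z j else 0) * b \<gamma> z) = (\<Sum>\<gamma><N. c \<gamma> (\<pi> z) * b \<gamma> z)"
          by (intro sum.cong) auto
        moreover have "z \<in> X" using z Z(2) by (auto simp: W_def)
        ultimately show "z i * b \<beta> z = (\<Sum>\<gamma><N. c \<gamma> (\<lambda>j. if j < t then \<pi> z j else 0) * b \<gamma> z)"
          using conjunct2[OF c] by simp
      qed
    qed
  qed
  have proj: "proj n t \<pi>" using Suc.prems(3) by (simp add: proj_def)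
  obtain C where C: "irr_chain n C t Z" using Suc.IH[OF irr fin proj Z(3)] by blast
  have "Z \<noteq> X"
  proof
    assume "Z = X"
    then have van: "\<pi> z t = 0" if "z \<in> X" for z using that Z(2) by (auto simp: W_def)
    have "PF (Suc t) (\<lambda>a. a t)" by (rule PF_var) simp
    from indepD[OF Suc.prems(4) this van, of "\<lambda>_. 1"] have "(1 :: 'k) = 0" by simp
    then show False by simp
  qed
  then have "Z \<subset> X" using Z(2) by (auto simp: W_def)
  have "irr_chain n (\<lambda>j. if j \<le> t then C j else X) (Suc t) X"
    unfolding irr_chain_def
  proof (intro conjI allI impI)
    fix j assume "j < Suc t"
    then show "(if j \<le> t then C j else X) \<subset> (if Suc j \<le> t then C (Suc j) else X)"
      using C \<open>Z \<subset> X\<close> by (cases "j = t") (auto simp: irr_chain_def)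
  qed (use C Suc.prems(1) in \<open>auto simp: irr_chain_def\<close>)
  then show ?case by blast
qed

lemma dim_le_sfin:
  fixes X :: "(nat \<Rightarrow> 'k) set"
  assumes "has_dim n X r" "sfin X n m \<pi>" "proj n m \<pi>"
  shows "r \<le> m"
proof -
  obtain C where "irr_chain n C r X" using assms(1) by (auto simp: has_dim_def)
  then show ?thesis using chain_le assms by blast
qed

text \<open>A relation would allow one more projection and leave \<open>r - 1\<close> coordinates,
  too few by \<open>dim_le_sfin\<close>.\<close>

lemma dim_indep:
  fixes X :: "(nat \<Rightarrow> 'k) set"
  assumes "irreducible_closed n X" "has_dim n X r" "sfin X n r \<pi>" "proj n r \<pi>"
  shows "indep X r \<pi>"
proof (rule ccontr)
  assume *: "\<not> ?thesis"
  have "X \<noteq> {}" using assms(1) by (simp add: irreducible_closed_def)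
  obtain m' w where m': "r = Suc m'" "w m' = 1" "sfin X n m' (\<lambda>z j. \<pi> z j - w j * \<pi> z m')"
    by (rule sfin_dependent_reduce[OF assms(3) \<open>X \<noteq> {}\<close> *], rule that)
  have "r \<le> m'" by (rule dim_le_sfin[OF assms(2) m'(3)]) (use assms(4) m'(1) proj_sub in auto)
  then show False using m' by simp
qed

lemma indep_dim:
  fixes X :: "(nat \<Rightarrow> 'k) set"
  assumes "irreducible_closed n X" "has_dim n X r" "sfin X n m \<pi>" "proj n m \<pi>" "indep X m \<pi>"
  shows "m = r"
proof -
  obtain C where "irr_chain n C m X" using chain_exists[OF assms(1,3,4,5)] by blast
  then have "m \<le> r" using assms(2) by (auto simp: has_dim_def)
  then show ?thesis using dim_le_sfin[OF assms(2,3,4)] by simp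
qed

text \<open>Besides the projection \<open>la\<close> a nonzero direction \<open>e\<close> in its
  kernel is recorded. Along \<open>e\<close> the values of \<open>la\<close> stay fixed while some
  coordinate moves; \<open>rational_noether\<close> uses this to see that a relation is not
  identically zero.\<close>

lemma noether_linear:
  fixes X :: "(nat \<Rightarrow> 'k) set"
  assumes irr: "irreducible_closed n X" and dim: "has_dim n X r" and "sfin X n m \<pi>" "proj n m \<pi>" "r < m"
  shows "\<exists>la e. sfin X n r (\<lambda>z. la (\<pi> z)) \<and> (\<forall>j<r. pf m 1 (\<lambda>c. la c j)) \<and> (\<exists>j<m. e j \<noteq> (0::'k)) \<and>
     (\<forall>c t. la (\<lambda>i. c i + t * e i) = la c)"
  using assms(3-5)
proof (induction m arbitrary: \<pi>)
  case (Suc m)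
  have "X \<noteq> {}" using assms(1) by (simp add: irreducible_closed_def)
  have "\<not> indep X (Suc m) \<pi>" using indep_dim[OF irr dim Suc.prems(1,2)] Suc.prems(3) by auto
  obtain m' w where m': "Suc m = Suc m'" "w m' = 1" "sfin X n m' (\<lambda>z j. \<pi> z j - w j * \<pi> z m')"
    by (rule sfin_dependent_reduce[OF Suc.prems(1) \<open>X \<noteq> {}\<close> \<open>\<not> indep X (Suc m) \<pi>\<close>], rule that)
  have [simp]: "m' = m" using m'(1) by simp
  define \<rho> where "\<rho> c = (\<lambda>j. c j - w j * c m)" for c :: "nat \<Rightarrow> 'k"
  have \<rho>w: "\<rho> (\<lambda>i. c i + t * w i) = \<rho> c" for c t
    using m'(2) by (auto simp: \<rho>_def algebra_simps)
  have \<rho>pf: "pf (Suc m) 1 (\<lambda>c. \<rho> c j)" if "j < m" for j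
    unfolding \<rho>_def by (rule pf_diff[OF pf_var pf_cmult[OF pf_var]]) (use that in auto)
  have fin: "sfin X n m (\<lambda>z. \<rho> (\<pi> z))" using m'(3) by (simp add: \<rho>_def)
  have wne: "\<exists>j<Suc m. w j \<noteq> 0" using m'(2) by (intro exI[of _ m]) simp
  show ?case
  proof (cases "r = m")
    case True
    show ?thesis
      by (rule exI[of _ \<rho>], rule exI[of _ w]) (use fin \<rho>w \<rho>pf wne True in simp)
  next
    case False
    then have "r < m" using Suc.prems(3) by simp
    have "proj n m (\<lambda>z. \<rho> (\<pi> z))" unfolding \<rho>_def by (rule proj_sub[OF Suc.prems(2)])
    from Suc.IH[OF fin this \<open>r < m\<close>] obtain la e where
      l: "sfin X n r (\<lambda>z. la (\<rho> (\<pi> z)))" "\<forall>j<r. pf m 1 (\<lambda>c. la c j)" by (elim exE conjE) (rule that)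
    have lp: "\<forall>j<r. pf (Suc m) 1 (\<lambda>c. la (\<rho> c) j)"
    proof (intro allI impI)
      fix j assume "j < r"
      then have "pf m 1 (\<lambda>c. la c j)" using l(2) by blast
      then show "pf (Suc m) 1 (\<lambda>c. la (\<rho> c) j)"
        by (rule pf_comp[where m = m and F = "\<lambda>c. la c j" and \<phi> = \<rho>]) (rule \<rho>pf)
    qed
    show ?thesis
      by (rule exI[of _ "\<lambda>c. la (\<rho> c)"], rule exI[of _ w]) (use l(1) \<rho>w wne lp in simp)
  qed
qed simp

end

subsection \<open>Weights of polynomials over a polynomial ring\<close>

text \<open>Total degree at most \<open>\<mu>\<close> of a polynomial in \<open>x\<close> and
  \<open>y\<close>, with \<open>x\<close> the inner and \<open>y\<close> the outer variable.\<close>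

definition wt :: "int \<Rightarrow> 'a::comm_ring_1 poly poly \<Rightarrow> bool" where
  "wt \<mu> A \<longleftrightarrow> (\<forall>i. dle (\<mu> - int i) (coeff A i))"

text \<open>The form of degree \<open>\<mu>\<close> with \<open>x\<close> set to 1.\<close>

definition topf :: "nat \<Rightarrow> 'a::comm_ring_1 poly poly \<Rightarrow> 'a poly" where
  "topf \<mu> A = (\<Sum>i\<le>\<mu>. monom (coeff (coeff A i) (\<mu> - i)) i)"

lemma coeff_topf: "coeff (topf \<mu> A) i = (if i \<le> \<mu> then coeff (coeff A i) (\<mu> - i) else 0)"
  by (simp add: topf_def coeff_sum if_distrib cong: if_cong)

lemma coeff_mult_dle:
  fixes p q :: "'a::comm_ring_1 poly"
  assumes "degree p \<le> a" "degree q \<le> b"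
  shows "coeff (p * q) (a + b) = coeff p a * coeff q b"
proof -
  have "coeff (p * q) (a + b) = (\<Sum>i\<le>a + b. coeff p i * coeff q (a + b - i))" by (rule coeff_mult)
  also have "\<dots> = (\<Sum>i\<in>{a}. coeff p i * coeff q (a + b - i))"
  proof (rule sum.mono_neutral_right)
    show "\<forall>i\<in>{..a + b} - {a}. coeff p i * coeff q (a + b - i) = 0"
    proof
      fix i assume "i \<in> {..a + b} - {a}"
      then have "a < i \<or> b < a + b - i" by auto
      then show "coeff p i * coeff q (a + b - i) = 0"
        using assms by (auto simp: coeff_eq_0)
    qed
  qed auto
  finally show ?thesis by simp
qed

lemma topf_mult:
  fixes A B :: "'a::comm_ring_1 poly poly"
  assumes A: "wt (int \<mu>) A" and B: "wt (int \<nu>) B"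
  shows "topf (\<mu> + \<nu>) (A * B) = topf \<mu> A * topf \<nu> B"
proof (rule poly_eqI)
  fix n
  have zA: "coeff A i = 0" if "\<mu> < i" for i using A that unfolding wt_def by (auto intro: dle_neg)
  have zB: "coeff B i = 0" if "\<nu> < i" for i using B that unfolding wt_def by (auto intro: dle_neg)
  have dA: "degree (coeff A i) \<le> \<mu> - i" if "i \<le> \<mu>" for i
    using A that unfolding wt_def by (metis dle_degree of_nat_diff)
  have dB: "degree (coeff B i) \<le> \<nu> - i" if "i \<le> \<nu>" for i
    using B that unfolding wt_def by (metis dle_degree of_nat_diff)
  show "coeff (topf (\<mu> + \<nu>) (A * B)) n = coeff (topf \<mu> A * topf \<nu> B) n"
  proof (cases "n \<le> \<mu> + \<nu>")
    case True
    have "coeff (coeff A i * coeff B (n - i)) (\<mu> + \<nu> - n) = coeff (topf \<mu> A) i * coeff (topf \<nu> B) (n - i)"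
      if "i \<le> n" for i
    proof (cases "i \<le> \<mu> \<and> n - i \<le> \<nu>")
      case True
      then have "(\<mu> - i) + (\<nu> - (n - i)) = \<mu> + \<nu> - n" using that by linarith
      moreover have "coeff (coeff A i * coeff B (n - i)) ((\<mu> - i) + (\<nu> - (n - i))) = coeff (coeff A i) (\<mu> - i) * coeff (coeff B (n - i)) (\<nu> - (n - i))"
        by (rule coeff_mult_dle) (use True dA dB in auto)
      ultimately show ?thesis using True by (simp add: coeff_topf)
    next
      case False
      then show ?thesis using zA[of i] zB[of "n - i"] by (auto simp: coeff_topf)
    qed
    then show ?thesis using True by (simp add: coeff_topf coeff_mult coeff_sum)
  next
    case False
    have "coeff (topf \<mu> A) i * coeff (topf \<nu> B) (n - i) = 0" if "i \<le> n" for i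
      using False that by (auto simp: coeff_topf)
    then show ?thesis using False by (simp add: coeff_topf coeff_mult)
  qed
qed

lemma wt_exists:
  fixes A :: "'a::comm_ring_1 poly poly"
  assumes "A \<noteq> 0"
  obtains \<mu> where "wt (int \<mu>) A" "topf \<mu> A \<noteq> 0"
proof -
  let ?S = "(\<lambda>i. i + degree (coeff A i)) ` {i. i \<le> degree A \<and> coeff A i \<noteq> 0}"
  define \<mu> where "\<mu> = Max ?S"
  have fin: "finite ?S" by simp
  have "?S \<noteq> {}" using assms leading_coeff_0_iff by blast
  then have "\<mu> \<in> ?S" unfolding \<mu>_def using fin by (rule Max_in[rotated])
  then obtain i where i: "\<mu> = i + degree (coeff A i)" "coeff A i \<noteq> 0" by auto
  have le: "j + degree (coeff A j) \<le> \<mu>" if "coeff A j \<noteq> 0" for j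
    unfolding \<mu>_def by (rule Max_ge[OF fin]) (use that le_degree in blast)
  have "wt (int \<mu>) A"
    unfolding wt_def
  proof
    fix j show "dle (int \<mu> - int j) (coeff A j)"
    proof (cases "coeff A j = 0")
      case False
      then show ?thesis using le[OF False] dle_mono[of "int (degree (coeff A j))" "coeff A j" "int \<mu> - int j"]
        by (simp add: dle_degree)
    qed simp
  qed
  moreover have "coeff (topf \<mu> A) i \<noteq> 0" using i by (simp add: coeff_topf)
  then have "topf \<mu> A \<noteq> 0" by auto
  ultimately show thesis by (rule that)
qed

lemma wt_monic_ge:
  fixes A :: "'a::comm_ring_1 poly poly"
  assumes "lead_coeff A = 1" "wt \<mu> A" shows "int (degree A) \<le> \<mu>"
proof (rule ccontr)
  assume "\<not> ?thesis"
  then have "coeff A (degree A) = 0" using assms(2) unfolding wt_def by (intro dle_neg[of "\<mu> - int (degree A)"]) auto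
  then show False using assms(1) by simp
qed

text \<open>Total degrees add, because leading forms multiply without zero divisors. A monic factor
  has total degree at least its degree in the outer variable, and the hypothesis leaves no room for
  an excess in either factor.\<close>

lemma wt_factor:
  fixes A B :: "'a::idom poly poly"
  assumes "lead_coeff A = 1" "lead_coeff B = 1" "wt (int (degree A + degree B)) (A * B)"
  shows "wt (int (degree A)) A"
proof -
  obtain \<mu> where \<mu>: "wt (int \<mu>) A" "topf \<mu> A \<noteq> 0" by (rule wt_exists[of A]) (use assms in auto)
  obtain \<nu> where \<nu>: "wt (int \<nu>) B" "topf \<nu> B \<noteq> 0" by (rule wt_exists[of B]) (use assms in auto)
  have "topf (\<mu> + \<nu>) (A * B) \<noteq> 0" unfolding topf_mult[OF \<mu>(1) \<nu>(1)] using \<mu>(2) \<nu>(2) by simp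
  moreover have "topf (\<mu> + \<nu>) (A * B) = 0" if "degree A + degree B < \<mu> + \<nu>"
  proof (rule poly_eqI)
    fix i
    have "coeff (coeff (A * B) i) (\<mu> + \<nu> - i) = 0" if "i \<le> \<mu> + \<nu>"
      using assms(3) that \<open>degree A + degree B < \<mu> + \<nu>\<close> unfolding wt_def dle_def by auto
    then show "coeff (topf (\<mu> + \<nu>) (A * B)) i = coeff 0 i" by (simp add: coeff_topf)
  qed
  ultimately have "\<mu> + \<nu> \<le> degree A + degree B" by (meson not_le)
  moreover have "degree A \<le> \<mu>" "degree B \<le> \<nu>" using wt_monic_ge[OF assms(1) \<mu>(1)] wt_monic_ge[OF assms(2) \<nu>(1)] by simp_all
  ultimately have "\<mu> = degree A" by simp
  then show ?thesis using \<mu>(1) by simp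
qed

context Fpbar
begin

text \<open>Gauss' lemma: over an algebraically closed field the constant \<open>c\<close> is split off one root at a time.\<close>

lemma gauss_monic:
  fixes g W Q :: "'k poly poly"
  assumes "c \<noteq> 0" "smult c g = W * Q" "lead_coeff g = 1"
  shows "\<exists>W' Q'. W = smult (lead_coeff W) W' \<and> lead_coeff W' = 1 \<and> lead_coeff Q' = 1 \<and> g = W' * Q'"
  using assms
proof (induction "degree c" arbitrary: c W Q rule: less_induct)
  case less
  have "W \<noteq> 0" "Q \<noteq> 0" using less.prems by auto
  have lc: "lead_coeff W * lead_coeff Q = c" using less.prems(2,3) lead_coeff_mult[of W Q] lead_coeff_smult[of c g] by simp
  show ?case
  proof (cases "degree c = 0")
    case True
    then obtain c0 where c0: "c = [:c0:]" by (rule degree_eq_zeroE)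
    then have "c0 \<noteq> 0" using less.prems by auto
    have "degree (lead_coeff W) + degree (lead_coeff Q) = degree c"
      unfolding lc[symmetric] by (rule degree_mult_eq[symmetric]) (use \<open>W \<noteq> 0\<close> \<open>Q \<noteq> 0\<close> in auto)
    then have "degree (lead_coeff W) = 0" "degree (lead_coeff Q) = 0" using True by auto
    then obtain w q where wq: "lead_coeff W = [:w:]" "lead_coeff Q = [:q:]" by (metis degree_eq_zeroE)
    then have "w * q = c0" using lc c0 by (simp add: mult.commute)
    then have nz: "w \<noteq> 0" "q \<noteq> 0" using \<open>c0 \<noteq> 0\<close> by auto
    let ?W = "smult [:1/w:] W" and ?Q = "smult [:1/q:] Q"
    have "[:w:] * [:1/w:] = 1" "[:q:] * [:1/q:] = 1" using nz by simp_all
    then have "W = smult (lead_coeff W) ?W" unfolding wq by (simp only: smult_smult smult_1_left)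
    moreover have "lead_coeff ?W = 1" "lead_coeff ?Q = 1"
      using wq nz by (simp_all only: lead_coeff_smult) simp_all
    moreover have "g = ?W * ?Q"
    proof -
      have "?W * ?Q = smult ([:1/w:] * [:1/q:]) (W * Q)" by (simp add: mult.commute)
      also have "\<dots> = smult ([:1/w:] * [:1/q:] * c) g" using less.prems(2) by (metis smult_smult)
      also have "[:1/w:] * [:1/q:] * c = 1" using c0 \<open>w * q = c0\<close> nz by auto
      finally show ?thesis by simp
    qed
    ultimately show ?thesis by blast
  next
    case False
    then obtain \<tau> where "poly c \<tau> = 0" using alg_root[of c] by auto
    then obtain c1 where c1: "c = [:-\<tau>, 1:] * c1" by (auto simp: poly_eq_0_iff_dvd)
    then have "c1 \<noteq> 0" using less.prems by auto
    then have deg: "degree c1 < degree c" unfolding c1 by (subst degree_mult_eq) auto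
    interpret h: map_poly_comm_ring_hom "\<lambda>q::'k poly. poly q \<tau>" ..
    have "map_poly (\<lambda>q. poly q \<tau>) W * map_poly (\<lambda>q. poly q \<tau>) Q = map_poly (\<lambda>q. poly q \<tau>) ([:c:] * g)"
      using less.prems(2) by (simp add: h.hom_mult[symmetric])
    also have "\<dots> = map_poly (\<lambda>q. poly q \<tau>) [:c:] * map_poly (\<lambda>q. poly q \<tau>) g" by (rule h.hom_mult)
    also have "map_poly (\<lambda>q. poly q \<tau>) [:c:] = 0"
      by (rule poly_eqI) (use \<open>poly c \<tau> = 0\<close> in \<open>simp add: coeff_map_poly coeff_pCons split: nat.splits\<close>)
    finally have "map_poly (\<lambda>q. poly q \<tau>) W = 0 \<or> map_poly (\<lambda>q. poly q \<tau>) Q = 0" by simp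
    moreover have div: "\<exists>V'. V = smult [:-\<tau>, 1:] V'" if "map_poly (\<lambda>q. poly q \<tau>) V = 0" for V
    proof -
      have "poly (coeff V i) \<tau> = 0" for i using that coeff_map_poly[of "\<lambda>q. poly q \<tau>" V i] by simp
      then have "[:-\<tau>, 1:] dvd coeff V i" for i by (simp add: poly_eq_0_iff_dvd)
      then have "[:[:-\<tau>, 1:]:] dvd V" by (simp add: const_poly_dvd_iff)
      then obtain V' where "V = [:[:-\<tau>, 1:]:] * V'" by (rule dvdE)
      then have "V = smult [:-\<tau>, 1:] V'" by simp
      then show ?thesis ..
    qed
    ultimately show ?thesis
    proof (elim disjE)
      assume "map_poly (\<lambda>q. poly q \<tau>) W = 0"
      then obtain V where V: "W = smult [:-\<tau>, 1:] V" using div by blast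
      have "smult [:-\<tau>, 1:] (smult c1 g) = smult [:-\<tau>, 1:] (V * Q)"
        using less.prems(2) unfolding c1 V by simp
      then have "smult c1 g = V * Q" by (rule smult_cancel[rotated]) simp
      from less.hyps[OF deg \<open>c1 \<noteq> 0\<close> this less.prems(3)] obtain W' Q' where
        *: "V = smult (lead_coeff V) W'" "lead_coeff W' = 1" "lead_coeff Q' = 1" "g = W' * Q'" by blast
      have "W = smult (lead_coeff W) W'"
        unfolding V lead_coeff_smult smult_smult[symmetric] by (rule arg_cong[OF *(1)])
      then show ?thesis using * by blast
    next
      assume "map_poly (\<lambda>q. poly q \<tau>) Q = 0"
      then obtain V where V: "Q = smult [:-\<tau>, 1:] V" using div by blast
      have "smult [:-\<tau>, 1:] (smult c1 g) = smult [:-\<tau>, 1:] (W * V)"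
        using less.prems(2) unfolding c1 V by simp
      then have "smult c1 g = W * V" by (rule smult_cancel[rotated]) simp
      from less.hyps[OF deg \<open>c1 \<noteq> 0\<close> this less.prems(3)] show ?thesis .
    qed
  qed
qed

lemma gauss_weight:
  fixes g W Q :: "'k poly poly"
  assumes "c \<noteq> 0" "smult c g = W * Q" "lead_coeff g = 1" "wt (int (degree g)) g"
  shows "\<exists>W'. W = smult (lead_coeff W) W' \<and> lead_coeff W' = 1 \<and> wt (int (degree W)) W' \<and> degree W' = degree W"
proof -
  obtain W' Q' where *: "W = smult (lead_coeff W) W'" "lead_coeff W' = 1" "lead_coeff Q' = 1" "g = W' * Q'"
    using gauss_monic[OF assms(1-3)] by blast
  have "W' \<noteq> 0" "Q' \<noteq> 0" using * by auto
  then have "degree g = degree W' + degree Q'" unfolding *(4) by (rule degree_mult_eq)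
  then have "wt (int (degree W')) W'" using assms(4) wt_factor[OF *(2,3)] *(4) by simp
  moreover have "W \<noteq> 0" using assms by auto
  then have "degree W = degree W'" using *(1) by (metis degree_smult_eq leading_coeff_0_iff)
  ultimately show ?thesis using * by auto
qed

end

subsection \<open>Norm matrices\<close>

text \<open>Row \<open>k\<close> holds the coordinates of \<open>h * y ^ k\<close> in the basis
  \<open>1, ..., y ^ (D - 1)\<close> modulo the monic polynomial with coefficients \<open>w\<close>;
  the determinant is the norm of \<open>h\<close>. The length \<open>L\<close> of \<open>h\<close>
  may exceed \<open>D\<close>.\<close>

definition norm_mat :: "(nat \<Rightarrow> 'a::comm_ring_1) \<Rightarrow> nat \<Rightarrow> (nat \<Rightarrow> 'a) \<Rightarrow> nat \<Rightarrow> nat \<Rightarrow> nat \<Rightarrow> 'a" where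
  "norm_mat w D h L k j = (\<Sum>i<L. h i * red w D (i + k) j)"

lemma norm_mat_eval:
  fixes w :: "nat \<Rightarrow> 'a::comm_ring_1"
  assumes "D > 0" "w D = 1" "(\<Sum>j\<le>D. w j * y ^ j) = 0"
  shows "(\<Sum>j<D. norm_mat w D h L k j * y ^ j) = (\<Sum>i<L. h i * y ^ i) * y ^ k"
proof -
  have "(\<Sum>j<D. norm_mat w D h L k j * y ^ j) = (\<Sum>i<L. h i * (\<Sum>j<D. red w D (i + k) j * y ^ j))"
    unfolding norm_mat_def sum_distrib_left sum_distrib_right by (subst sum.swap) (simp only: mult.assoc)
  also have "\<dots> = (\<Sum>i<L. h i * y ^ (i + k))"
    using red_eval[OF assms(1,3), symmetric] assms(2) by simp
  also have "\<dots> = (\<Sum>i<L. h i * y ^ i) * y ^ k" by (simp add: sum_distrib_right power_add mult.assoc)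
  finally show ?thesis .
qed

lemma norm_mat_pf:
  assumes w: "\<And>j. j < D \<Longrightarrow> pf m (int D - int j) (w j)" "w D = (\<lambda>_. 1)" and "D > 0" "j < D"
    and h: "\<And>i. i < L \<Longrightarrow> pf m (e - int i) (h i)"
  shows "pf m (e + int k - int j) (\<lambda>a. norm_mat (\<lambda>j. w j a) D (\<lambda>i. h i a) L k j)"
  unfolding norm_mat_def
proof (rule pf_sum)
  fix i assume "i \<in> {..<L}"
  then have 1: "pf m (e - int i) (h i)" using h by simp
  have 2: "pf m (int (i + k) - int j) (\<lambda>a. red (\<lambda>j. w j a) D (i + k) j)"
    by (rule red_pf) (use assms in \<open>auto intro: pf_const\<close>)
  show "pf m (e + int k - int j) (\<lambda>a. h i a * red (\<lambda>j. w j a) D (i + k) j)"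
    using pf_mult[OF 1 2] by (simp add: algebra_simps)
qed

subsection \<open>The equation of a projection to a hypersurface\<close>

definition mcoeff :: "nat \<Rightarrow> (nat \<Rightarrow> 'a \<Rightarrow> 'k::comm_ring_1) \<Rightarrow> 'a \<Rightarrow> nat \<Rightarrow> 'k" where
  "mcoeff D c a j = (if j < D then c j a else 1)"

lemma mcoeff_simps [simp]: "j < D \<Longrightarrow> mcoeff D c a j = c j a" "mcoeff D c a D = 1"
  by (simp_all add: mcoeff_def)

lemma mcoeff_eval: "(\<Sum>j\<le>D. mcoeff D c a j * y ^ j) = y ^ D + (\<Sum>j<D. c j a * y ^ j)"
  by (simp add: sum_atMost_split add.commute)

definition fpoly :: "nat \<Rightarrow> (nat \<Rightarrow> 'a \<Rightarrow> 'k::comm_ring_1) \<Rightarrow> 'a \<Rightarrow> 'k poly" where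
  "fpoly D c a = (\<Sum>j\<le>D. monom (mcoeff D c a j) j)"

lemma poly_fpoly: "poly (fpoly D c a) y = y ^ D + (\<Sum>j<D. c j a * y ^ j)"
  by (simp add: fpoly_def poly_sum poly_monom mcoeff_eval)

lemma coeff_fpoly: "coeff (fpoly D c a) j = (if j \<le> D then mcoeff D c a j else 0)"
  by (simp add: fpoly_def coeff_sum if_distrib cong: if_cong)

lemma degree_fpoly: "degree (fpoly D c a) = D" and lead_coeff_fpoly: "lead_coeff (fpoly D c a) = 1"
  for c :: "nat \<Rightarrow> 'a \<Rightarrow> 'k::field"
proof -
  show "degree (fpoly D c a) = D"
    by (rule antisym[OF degree_le le_degree]) (auto simp: coeff_fpoly)
  then show "lead_coeff (fpoly D c a) = 1" by (simp add: coeff_fpoly)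
qed

definition rem_poly :: "nat \<Rightarrow> (nat \<Rightarrow> 'a \<Rightarrow> 'k::comm_ring_1) \<Rightarrow> 'a \<Rightarrow> 'k poly" where
  "rem_poly L h a = (\<Sum>i<L. monom (h i a) i)"

lemma poly_rem_poly: "poly (rem_poly L h a) y = (\<Sum>i<L. h i a * y ^ i)"
  by (simp add: rem_poly_def poly_sum poly_monom)

lemma red_const_poly: "red (\<lambda>j. [:w j:]) D n j = [:red w D n j:]"
  by (induction n arbitrary: j) (auto simp: one_pCons)

lemma fpoly_dvd_red:
  fixes c :: "nat \<Rightarrow> 'a \<Rightarrow> 'k::field"
  assumes "D > 0"
  shows "fpoly D c a dvd monom 1 n - (\<Sum>j<D. monom (red (mcoeff D c a) D n j) j)"
proof -
  have "fpoly D c a = (\<Sum>j\<le>D. [:mcoeff D c a j:] * [:0, 1:] ^ j)"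
    unfolding fpoly_def by (simp add: monom_altdef)
  moreover have "monom 1 n = [:mcoeff D c a D:] ^ n * [:0, 1:] ^ n"
    by (simp add: monom_altdef one_pCons[symmetric])
  moreover have "(\<Sum>j<D. monom (red (mcoeff D c a) D n j) j) = (\<Sum>j<D. red (\<lambda>j. [:mcoeff D c a j:]) D n j * [:0, 1:] ^ j)"
    by (simp add: red_const_poly monom_altdef)
  ultimately show ?thesis using red_dvd[OF assms, of "\<lambda>j. [:mcoeff D c a j:]" "[:0, 1:]" n] by metis
qed

text \<open>As \<open>fpoly D c\<close> is monic, divisibility at every \<open>a\<close> is divisibility over the ring of polynomial
  functions of \<open>a\<close>; so the equation generates a prime ideal there.\<close>

definition prime_eqn :: "nat \<Rightarrow> nat \<Rightarrow> (nat \<Rightarrow> (nat \<Rightarrow> 'k::field) \<Rightarrow> 'k) \<Rightarrow> bool" where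
  "prime_eqn r D c \<longleftrightarrow> 0 < D \<and> (\<forall>j<D. pf r (int D - int j) (c j)) \<and>
    (\<forall>s h. (\<forall>j<D. PF r (s j) \<and> PF r (h j)) \<longrightarrow> (\<forall>a. fpoly D c a dvd rem_poly D s a * rem_poly D h a) \<longrightarrow>
       (\<forall>j<D. \<forall>a. s j a = 0) \<or> (\<forall>j<D. \<forall>a. h j a = 0))"

text \<open>If the norm of \<open>h\<close> vanished identically, a nonzero polynomial combination
  \<open>s\<close> of the rows would vanish; so \<open>s * h\<close> would be divisible by the
  equation, and primality would make \<open>s\<close> or \<open>h\<close> zero.\<close>

lemma norm_nonzero:
  assumes irr: "prime_eqn r D c" and h: "\<And>j. j < D \<Longrightarrow> PF r (h j)" and nz: "\<exists>j<D. \<exists>a. h j a \<noteq> 0"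
  shows "\<exists>a. det (mat D D (\<lambda>(k,j). norm_mat (mcoeff D c a) D (\<lambda>i. h i a) D k j)) \<noteq> 0"
proof -
  have "D > 0" and c: "\<And>j. j < D \<Longrightarrow> pf r (int D - int j) (c j)"
    and prime: "\<And>s h. (\<forall>j<D. PF r (s j) \<and> PF r (h j)) \<Longrightarrow> (\<forall>a. fpoly D c a dvd rem_poly D s a * rem_poly D h a) \<Longrightarrow>
       (\<forall>j<D. \<forall>a. s j a = 0) \<or> (\<forall>j<D. \<forall>a. h j a = 0)"
    using irr unfolding prime_eqn_def by simp_all
  define C where "C j k a = norm_mat (mcoeff D c a) D (\<lambda>i. h i a) D k j" for j k a
  have CPF: "PF r (C j k)" if "j < D" for j k
  proof -
    have "PF r (\<lambda>a. red (\<lambda>j. mcoeff D c a j) D n j)" for n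
    proof (rule red_PF)
      fix i assume "i \<le> D"
      show "PF r (\<lambda>a. mcoeff D c a i)"
        using c by (cases "i < D") (auto simp: mcoeff_def intro: PF_I)
    qed (use \<open>D > 0\<close> that in auto)
    then show ?thesis unfolding C_def norm_mat_def using h by (intro PF_sum PF_mult) auto
  qed
  have "(\<exists>g. (\<forall>a<D. g a \<in> {..<D}) \<and> (\<exists>z. det (mat D D (\<lambda>(a,j). C (g a) j z)) \<noteq> 0)) \<or>
    (\<exists>s. (\<forall>j<D. PF r (s j)) \<and> (\<exists>j<D. \<exists>z. s j z \<noteq> 0) \<and> (\<forall>i\<in>{..<D}. \<forall>z. (\<Sum>j<D. C i j z * s j z) = 0))"
    by (rule generic_kernel) (use CPF in auto)
  then show ?thesis
  proof (elim disjE exE conjE)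
    fix g z assume g: "\<forall>a<D. g a \<in> {..<D}" and det: "det (mat D D (\<lambda>(a,j). C (g a) j z)) \<noteq> 0"
    \<comment> \<open>A nonzero minor cannot repeat a row and there are only \<open>D\<close> rows,
      so the minor is the norm up to sign.\<close>
    have "inj_on g {0..<D}"
    proof (rule inj_onI)
      fix x y assume xy: "x \<in> {0..<D}" "y \<in> {0..<D}" "g x = g y"
      show "x = y"
      proof (rule ccontr)
        assume "x \<noteq> y"
        then have "det (mat D D (\<lambda>(a,j). C (g a) j z)) = 0"
          by (rule det_identical_rows[of _ D x y, rotated]) (use xy in \<open>auto intro!: eq_vecI\<close>)
        then show False using det by simp
      qed
    qed
    define q where "q a = (if a < D then g a else a)" for a
    have "inj_on q {0..<D}" using \<open>inj_on g {0..<D}\<close> by (auto simp: q_def inj_on_def)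
    moreover have "q ` {0..<D} \<subseteq> {0..<D}" using g by (auto simp: q_def)
    ultimately have "bij_betw q {0..<D} {0..<D}" unfolding bij_betw_def by (simp only: endo_inj_surj finite_atLeastLessThan)
    then have "q permutes {0..<D}"
      by (rule bij_imp_permutes) (simp add: q_def)
    have eq: "mat D D (\<lambda>(a,j). C (g a) j z) = mat D D (\<lambda>(a,j). mat D D (\<lambda>(a,j). C a j z) $$ (q a, j))"
      by (rule eq_matI) (use g in \<open>auto simp: q_def\<close>)
    have "det (mat D D (\<lambda>(a,j). C (g a) j z)) = signof q * det (mat D D (\<lambda>(a,j). C a j z))"
      unfolding eq by (rule det_permute_rows) (use \<open>q permutes _\<close> in auto)
    then have "det (mat D D (\<lambda>(j,k). C j k z)) \<noteq> 0" using det by auto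
    moreover have "transpose_mat (mat D D (\<lambda>(j,k). C j k z)) = mat D D (\<lambda>(k,j). norm_mat (mcoeff D c z) D (\<lambda>i. h i z) D k j)"
      by (rule eq_matI) (auto simp: C_def)
    ultimately show ?thesis
      using det_transpose[of "mat D D (\<lambda>(j,k). C j k z)" D] by (intro exI[of _ z]) simp
  next
    fix s j z assume s: "\<forall>j<D. PF r (s j)" "\<forall>i\<in>{..<D}. \<forall>z. (\<Sum>j<D. C i j z * s j z) = 0"
      and "j < D" "s j z \<noteq> 0"
    have "fpoly D c a dvd rem_poly D s a * rem_poly D h a" for a
    proof -
      let ?M = "\<lambda>n. monom 1 n - (\<Sum>j<D. monom (red (mcoeff D c a) D n j) j)"
      have "rem_poly D s a * rem_poly D h a = (\<Sum>k<D. \<Sum>i<D. smult (s k a * h i a) (monom 1 (i + k)))"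
        unfolding rem_poly_def sum_product by (simp add: mult_monom smult_monom add.commute)
      also have "\<dots> = (\<Sum>k<D. \<Sum>i<D. smult (s k a * h i a) (?M (i + k))) +
          (\<Sum>k<D. \<Sum>i<D. smult (s k a * h i a) (\<Sum>j<D. monom (red (mcoeff D c a) D (i + k) j) j))"
        by (simp add: smult_diff_right sum_subtractf)
      also have "(\<Sum>k<D. \<Sum>i<D. smult (s k a * h i a) (\<Sum>j<D. monom (red (mcoeff D c a) D (i + k) j) j))
          = (\<Sum>j<D. monom (\<Sum>k<D. C j k a * s k a) j)"
      proof (rule poly_eqI)
        fix l
        show "coeff (\<Sum>k<D. \<Sum>i<D. smult (s k a * h i a) (\<Sum>j<D. monom (red (mcoeff D c a) D (i + k) j) j)) l
          = coeff (\<Sum>j<D. monom (\<Sum>k<D. C j k a * s k a) j) l"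
          by (cases "l < D")
            (simp_all add: coeff_sum C_def norm_mat_def sum_distrib_left sum_distrib_right mult_ac if_distrib cong: if_cong)
      qed
      also have "\<dots> = 0" using s(2) by simp
      finally show ?thesis
        by (auto intro!: dvd_sum dvd_smult fpoly_dvd_red \<open>D > 0\<close>)
    qed
    then have "(\<forall>j<D. \<forall>a. s j a = 0) \<or> (\<forall>j<D. \<forall>a. h j a = 0)"
      by (intro prime) (use s(1) h in auto)
    then show ?thesis using \<open>j < D\<close> \<open>s j z \<noteq> 0\<close> nz by blast
  qed
qed

lemma norm_root:
  fixes c :: "nat \<Rightarrow> 'a \<Rightarrow> 'k::field"
  assumes "D > 0" "poly (fpoly D c a) y = 0" "(\<Sum>i<L. h i * y ^ i) = 0"
  shows "det (mat D D (\<lambda>(k,j). norm_mat (mcoeff D c a) D h L k j)) = 0"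
proof (rule det_kernel_zero[of 0 D "\<lambda>j. y ^ j"])
  fix k
  have "(\<Sum>j\<le>D. mcoeff D c a j * y ^ j) = 0" using assms(2) by (simp add: poly_fpoly mcoeff_eval)
  then show "(\<Sum>j<D. norm_mat (mcoeff D c a) D h L k j * y ^ j) = 0"
    using norm_mat_eval[of D "mcoeff D c a" y h L k] assms by simp
qed (use assms in auto)

text \<open>Row \<open>k\<close> has weight \<open>e + k\<close> and column \<open>j\<close> weight
  \<open>- j\<close>; the indices cancel in the sum.\<close>

lemma norm_pf:
  assumes D: "D > 0" and c: "\<And>j. j < D \<Longrightarrow> pf r (int D - int j) (c j)" and h: "\<And>i. i < L \<Longrightarrow> pf r (e - int i) (h i)"
  shows "pf r (int D * e) (\<lambda>a. det (mat D D (\<lambda>(k,j). norm_mat (mcoeff D c a) D (\<lambda>i. h i a) L k j)))"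
proof -
  have "pf r ((e + int k) + (- int j)) (\<lambda>a. norm_mat (mcoeff D c a) D (\<lambda>i. h i a) L k j)" if "j < D" for k j
  proof -
    have "pf r (e + int k - int j) (\<lambda>a. norm_mat (\<lambda>i. (\<lambda>i a. mcoeff D c a i) i a) D (\<lambda>i. h i a) L k j)"
    proof (rule norm_mat_pf)
      fix i assume "i < D"
      then show "pf r (int D - int i) (\<lambda>a. mcoeff D c a i)" using c by simp
    qed (use D that h in auto)
    then show ?thesis by simp
  qed
  from pf_det[where N = D and \<alpha> = "\<lambda>k. e + int k" and \<beta> = "\<lambda>j. - int j"
      and m = "\<lambda>k j a. norm_mat (mcoeff D c a) D (\<lambda>i. h i a) L k j", OF this]
  show ?thesis by (simp add: sum.distrib sum_negf)
qed

subsection \<open>The minimal polynomial of a linear form\<close>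

text \<open>The last conjunct is minimality: \<open>1, ..., y ^ (D - 1)\<close> are linearly
  independent over the functions of \<open>x\<close>. As the equation is monic, this also makes it
  unique.\<close>

definition min_eqn :: "(nat \<Rightarrow> 'k::field) set \<Rightarrow> nat \<Rightarrow> ((nat \<Rightarrow> 'k) \<Rightarrow> nat \<Rightarrow> 'k) \<Rightarrow> ((nat \<Rightarrow> 'k) \<Rightarrow> 'k) \<Rightarrow> nat \<Rightarrow>
    (nat \<Rightarrow> (nat \<Rightarrow> 'k) \<Rightarrow> 'k) \<Rightarrow> bool" where
  "min_eqn X r x y D c \<longleftrightarrow> 0 < D \<and> (\<forall>j<D. pf r (int D - int j) (c j)) \<and>
    (\<forall>z\<in>X. y z ^ D + (\<Sum>j<D. c j (x z) * y z ^ j) = 0) \<and>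
    (\<forall>h. (\<forall>j<D. PF r (h j)) \<longrightarrow> (\<forall>z\<in>X. (\<Sum>j<D. h j (x z) * y z ^ j) = 0) \<longrightarrow> (\<forall>j<D. \<forall>a. h j a = 0))"

lemma min_eqnD:
  assumes "min_eqn X r x y D c"
  shows "0 < D" "\<And>j. j < D \<Longrightarrow> pf r (int D - int j) (c j)"
    "\<And>z. z \<in> X \<Longrightarrow> y z ^ D + (\<Sum>j<D. c j (x z) * y z ^ j) = 0"
    "\<And>h j a. (\<And>j. j < D \<Longrightarrow> PF r (h j)) \<Longrightarrow> (\<And>z. z \<in> X \<Longrightarrow> (\<Sum>j<D. h j (x z) * y z ^ j) = 0) \<Longrightarrow> j < D \<Longrightarrow> h j a = 0"
  using assms unfolding min_eqn_def by simp_all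

lemma poly_red: "poly (red w D n j) t = red (\<lambda>j. poly (w j) t) D n j"
  for w :: "nat \<Rightarrow> 'a::comm_ring_1 poly"
  by (induction n arbitrary: j) auto

text \<open>The hypothesis says that the pseudo-remainder of the first polynomial modulo the second
  is zero; the factor \<open>W D ^ N\<close> is removed afterwards by Gauss' lemma.\<close>

lemma pseudo_division:
  fixes W H :: "nat \<Rightarrow> 'a::comm_ring_1"
  assumes "0 < D" "\<And>j. j < D \<Longrightarrow> (\<Sum>i\<le>N. H i * W D ^ (N - i) * red W D i j) = 0"
  shows "\<exists>Q. smult (W D ^ N) (\<Sum>i\<le>N. monom (H i) i) = (\<Sum>j\<le>D. monom (W j) j) * Q"
proof -
  let ?Wp = "\<Sum>j\<le>D. monom (W j) j"
  have Wp: "?Wp = (\<Sum>j\<le>D. [:W j:] * [:0, 1:] ^ j)" by (simp add: monom_altdef)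
  let ?R = "\<lambda>i. [:W D:] ^ i * [:0, 1:] ^ i - (\<Sum>j<D. red (\<lambda>j. [:W j:]) D i j * [:0, 1:] ^ j)"
  have "?Wp dvd (\<Sum>i\<le>N. [:H i * W D ^ (N - i):] * ?R i)"
    unfolding Wp by (intro dvd_sum dvd_mult red_dvd assms(1))
  also have "(\<Sum>i\<le>N. [:H i * W D ^ (N - i):] * ?R i)
    = (\<Sum>i\<le>N. [:H i * W D ^ (N - i):] * ([:W D:] ^ i * [:0, 1:] ^ i))
      - (\<Sum>j<D. [:\<Sum>i\<le>N. H i * W D ^ (N - i) * red (\<lambda>j. W j) D i j:] * [:0, 1:] ^ j)"
  proof -
    have "(\<Sum>i\<le>N. [:H i * W D ^ (N - i):] * (\<Sum>j<D. red (\<lambda>j. [:W j:]) D i j * [:0, 1:] ^ j))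
      = (\<Sum>i\<le>N. \<Sum>j<D. [:H i * W D ^ (N - i) * red (\<lambda>j. W j) D i j:] * [:0, 1:] ^ j)"
      unfolding red_const_poly sum_distrib_left by (simp add: mult.commute)
    also have "\<dots> = (\<Sum>j<D. \<Sum>i\<le>N. [:H i * W D ^ (N - i) * red (\<lambda>j. W j) D i j:] * [:0, 1:] ^ j)"
      by (rule sum.swap)
    also have "\<dots> = (\<Sum>j<D. [:\<Sum>i\<le>N. H i * W D ^ (N - i) * red (\<lambda>j. W j) D i j:] * [:0, 1:] ^ j)"
    proof (rule sum.cong[OF refl])
      fix j
      have "(\<Sum>i\<le>N. [:f i:]) = [:\<Sum>i\<le>N. f i:]" for f :: "nat \<Rightarrow> 'a"
        by (induction N) auto
      then show "(\<Sum>i\<le>N. [:H i * W D ^ (N - i) * red (\<lambda>j. W j) D i j:] * [:0, 1:] ^ j)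
        = [:\<Sum>i\<le>N. H i * W D ^ (N - i) * red (\<lambda>j. W j) D i j:] * [:0, 1:] ^ j"
        unfolding sum_distrib_right[symmetric] by simp
    qed
    finally show ?thesis by (simp only: right_diff_distrib sum_subtractf)
  qed
  also have "(\<Sum>j<D. [:\<Sum>i\<le>N. H i * W D ^ (N - i) * red (\<lambda>j. W j) D i j:] * [:0, 1:] ^ j) = 0"
    using assms(2) by simp
  also have "(\<Sum>i\<le>N. [:H i * W D ^ (N - i):] * ([:W D:] ^ i * [:0, 1:] ^ i)) = smult (W D ^ N) (\<Sum>i\<le>N. monom (H i) i)"
    unfolding smult_sum2
  proof (rule sum.cong[OF refl])
    fix i assume "i \<in> {..N}"
    then have e: "W D ^ N = W D ^ (N - i) * W D ^ i" by (simp add: power_add[symmetric])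
    show "[:H i * W D ^ (N - i):] * ([:W D:] ^ i * [:0, 1:] ^ i) = smult (W D ^ N) (monom (H i) i)"
      unfolding e by (simp add: monom_altdef poly_const_pow mult_ac)
  qed
  finally show ?thesis by (auto simp: dvd_def)
qed

text \<open>Division of power series, coefficient by coefficient. The only division is by the
  constant term \<open>s\<close>, which is the same for all \<open>v\<close>, so the coefficients of
  the quotient stay polynomial in \<open>v\<close>.\<close>

lemma pf_coeff_quotient:
  fixes W A q :: "(nat \<Rightarrow> 'k::field) \<Rightarrow> 'k poly"
  assumes eq: "\<And>v. A v = q v * W v" and s: "s \<noteq> 0" "\<And>v. coeff (W v) 0 = s"
    and A: "\<And>i. pf r (int i) (\<lambda>v. coeff (A v) i)" and W: "\<And>i. pf r (int i) (\<lambda>v. coeff (W v) i)"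
  shows "pf r (int i) (\<lambda>v. coeff (q v) i)"
proof (induction i rule: less_induct)
  case (less i)
  have "coeff (q v) i = (1 / s) * (coeff (A v) i - (\<Sum>l<i. coeff (q v) l * coeff (W v) (i - l)))" for v
  proof -
    have "coeff (A v) i = (\<Sum>l\<le>i. coeff (q v) l * coeff (W v) (i - l))" unfolding eq by (rule coeff_mult)
    also have "\<dots> = (\<Sum>l<i. coeff (q v) l * coeff (W v) (i - l)) + coeff (q v) i * s"
      by (simp add: sum_atMost_split s)
    finally show ?thesis using s(1) by (simp add: field_simps)
  qed
  moreover have "pf r (int i) (\<lambda>v. (1 / s) * (coeff (A v) i - (\<Sum>l<i. coeff (q v) l * coeff (W v) (i - l))))"
  proof (intro pf_cmult pf_diff pf_sum A)
    fix l assume "l \<in> {..<i}"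
    then have l: "l < i" by simp
    show "pf r (int i) (\<lambda>v. coeff (q v) l * coeff (W v) (i - l))"
      using pf_mult[OF less.IH[OF l] W[of "i - l"]] l by simp
  qed
  ultimately show ?case by simp
qed

lemma PF_cm: "(\<And>j. j < D \<Longrightarrow> PF r (c j)) \<Longrightarrow> PF r (\<lambda>a. mcoeff D c a j)"
  unfolding mcoeff_def by (cases "j < D") simp_all

definition adj :: "nat \<Rightarrow> ('a \<Rightarrow> nat \<Rightarrow> 'k) \<Rightarrow> ('a \<Rightarrow> 'k) \<Rightarrow> 'a \<Rightarrow> nat \<Rightarrow> 'k" where
  "adj r x y z j = (if j = r then y z else x z j)"

lemma proj_adj: "proj n r x \<Longrightarrow> pf n 1 y \<Longrightarrow> proj n (Suc r) (adj r x y)"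
  unfolding proj_def adj_def by (auto simp: less_Suc_eq)

lemma sfin_adj:
  fixes X :: "(nat \<Rightarrow> 'k::field) set"
  assumes fin: "sfin X n r x"
  shows "sfin X n (Suc r) (adj r x y)"
proof -
  have eq: "F (adj r x y z) = F (x z)" if "pf r E F" for E F z
    by (rule pf_cong[OF that]) (simp add: adj_def)
  from fin obtain N :: nat and b :: "nat \<Rightarrow> (nat \<Rightarrow> 'k) \<Rightarrow> 'k" and \<omega> :: "nat \<Rightarrow> int" where N: "0 < N" "\<omega> 0 = (0::int)" "b 0 = (\<lambda>_. 1)" and
    H: "\<forall>i<n. \<forall>\<beta><N. \<exists>c. (\<forall>\<gamma><N. pf r (\<omega> \<beta> + 1 - \<omega> \<gamma>) (c \<gamma>)) \<and>
      (\<forall>z\<in>X. z i * b \<beta> z = (\<Sum>\<gamma><N. c \<gamma> (x z) * b \<gamma> z))" unfolding sfin_def by blast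
  have "\<exists>c. (\<forall>\<gamma><N. pf (Suc r) (\<omega> \<beta> + 1 - \<omega> \<gamma>) (c \<gamma>)) \<and>
      (\<forall>z\<in>X. z i * b \<beta> z = (\<Sum>\<gamma><N. c \<gamma> (adj r x y z) * b \<gamma> z))" if "i < n" "\<beta> < N" for i \<beta>
  proof -
    from H that obtain c where c: "\<And>\<gamma>. \<gamma> < N \<Longrightarrow> pf r (\<omega> \<beta> + 1 - \<omega> \<gamma>) (c \<gamma>)"
      "\<And>z. z \<in> X \<Longrightarrow> z i * b \<beta> z = (\<Sum>\<gamma><N. c \<gamma> (x z) * b \<gamma> z)" by blast
    have "pf (Suc r) (\<omega> \<beta> + 1 - \<omega> \<gamma>) (c \<gamma>)" if "\<gamma> < N" for \<gamma>
      by (rule pf_extend[OF c(1)[OF that]]) simp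
    moreover have "z i * b \<beta> z = (\<Sum>\<gamma><N. c \<gamma> (adj r x y z) * b \<gamma> z)" if "z \<in> X" for z
      unfolding c(2)[OF that] by (rule sum.cong[OF refl]) (use eq[OF c(1)] in auto)
    ultimately show ?thesis by blast
  qed
  then show ?thesis unfolding sfin_def using N by blast
qed

context Fpbar
begin

text \<open>A relation of least degree \<open>D\<close> in \<open>y\<close> has a leading
  coefficient \<open>w D\<close> that need not be constant. An integral equation of \<open>y\<close>
  is pseudo-divisible by it, so on each line through a point \<open>a0\<close> with
  \<open>w D a0 \<noteq> 0\<close> Gauss' lemma shows that \<open>w D\<close> divides every
  \<open>w j\<close> with a quotient of the right weighted degree. The quotients depend polynomially
  on the direction of the line and assemble to the coefficients \<open>c\<close>.\<close>

theorem min_eqn_exists: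
  fixes X :: "(nat \<Rightarrow> 'k) set"
  assumes irr: "irreducible_closed n X" and fin: "sfin X n r x" and x: "proj n r x" and ind: "indep X r x"
    and y: "pf n 1 y"
  obtains D c where "min_eqn X r x y D c"
proof -
  obtain N g where N: "0 < N" and g: "\<And>j. j < N \<Longrightarrow> pf r (int N * 1 - int j) (g j)"
    and gX: "\<And>z. z \<in> X \<Longrightarrow> y z ^ N + (\<Sum>j<N. g j (x z) * y z ^ j) = 0"
    by (rule sfin_charpoly[OF fin y]) (simp, rule that)
  define P where "P e \<longleftrightarrow> (\<exists>w. (\<forall>j\<le>e. PF r (w j)) \<and> (\<exists>a. w e a \<noteq> 0) \<and> (\<forall>z\<in>X. (\<Sum>j\<le>e. w j (x z) * y z ^ j) = 0))" for e
  have "P N"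
    unfolding P_def
  proof (intro exI[of _ "\<lambda>j a. mcoeff N g a j"] conjI allI impI ballI)
    fix j show "PF r (\<lambda>a. mcoeff N g a j)" by (rule PF_cm[OF PF_I[OF g]])
  qed (use gX in \<open>auto simp: mcoeff_eval\<close>)
  define D where "D = (LEAST e. P e)"
  have "P D" unfolding D_def using \<open>P N\<close> by (rule LeastI)
  have leastD: "\<not> P e" if "e < D" for e using that not_less_Least unfolding D_def by blast
  from \<open>P D\<close> obtain w a0 where w: "\<And>j. j \<le> D \<Longrightarrow> PF r (w j)" and a0: "w D a0 \<noteq> 0"
    and wX: "\<And>z. z \<in> X \<Longrightarrow> (\<Sum>j\<le>D. w j (x z) * y z ^ j) = 0" unfolding P_def by blast
  have "0 < D"
  proof (rule ccontr)
    assume "\<not> 0 < D"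
    then have "D = 0" by simp
    then have "w D (x z) = 0" if "z \<in> X" for z using wX[OF that] by simp
    then have "w D a0 = 0" using indepD[OF ind, where F = "w D"] w[of D] by simp
    then show False using a0 by simp
  qed
  have minD: "h j a = 0" if h: "\<And>j. j < D \<Longrightarrow> PF r (h j)" "\<And>z. z \<in> X \<Longrightarrow> (\<Sum>j<D. h j (x z) * y z ^ j) = 0" and "j < D"
    for h :: "nat \<Rightarrow> (nat \<Rightarrow> 'k) \<Rightarrow> 'k" and j a
  proof (rule ccontr)
    assume nz: "h j a \<noteq> 0"
    define S where "S = {e. e < D \<and> (\<exists>a. h e a \<noteq> 0)}"
    have S: "finite S" "S \<noteq> {}" unfolding S_def using nz \<open>j < D\<close> by auto
    define e where "e = Max S"
    have e: "e < D" "\<exists>a. h e a \<noteq> 0" using Max_in[OF S] unfolding e_def S_def by auto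
    have big: "h i b = 0" if "e < i" "i < D" for i b
    proof (rule ccontr)
      assume "h i b \<noteq> 0"
      then have "i \<in> S" using that by (auto simp: S_def)
      then have "i \<le> e" unfolding e_def using S by simp
      then show False using that by simp
    qed
    have "(\<Sum>j\<le>e. h j (x z) * y z ^ j) = 0" if "z \<in> X" for z
    proof -
      have "(\<Sum>j<D. h j (x z) * y z ^ j) = (\<Sum>j\<le>e. h j (x z) * y z ^ j)"
        by (rule sum.mono_neutral_right) (use e big in auto)
      then show ?thesis using h(2)[OF that] by simp
    qed
    then have "P e" unfolding P_def using e h(1) by (intro exI[of _ h]) auto
    then show False using leastD[OF e(1)] by simp
  qed
  define G where "G j a = mcoeff N g a j" for j a
  have GPF: "PF r (G j)" if "j \<le> N" for j
    unfolding G_def by (rule PF_cm[OF PF_I[OF g]])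
  have GN: "G N a = 1" for a by (simp add: G_def)
  \<comment> \<open>Coefficients of the pseudo-remainder of the integral equation modulo the minimal
    relation. Being a relation of degree below \<open>D\<close>, it is zero.\<close>
  define S where "S j a = (\<Sum>i\<le>N. G i a * w D a ^ (N - i) * red (\<lambda>j. w j a) D i j)" for j a
  have S0: "S j a = 0" if "j < D" for j a
  proof (rule minD[where h = S, OF _ _ that])
    fix j assume "j < D"
    have "PF r (\<lambda>a. G i a * w D a ^ (N - i) * red (\<lambda>j. w j a) D i j)" if "i \<le> N" for i
      by (rule PF_mult[OF PF_mult[OF GPF[OF that] PF_power[OF w[OF order_refl]]] red_PF[OF w]])
        (use \<open>0 < D\<close> \<open>j < D\<close> in auto)
    then show "PF r (S j)" unfolding S_def by (intro PF_sum) auto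
  next
    fix z assume z: "z \<in> X"
    have "(\<Sum>j<D. S j (x z) * y z ^ j)
        = (\<Sum>i\<le>N. G i (x z) * w D (x z) ^ (N - i) * (\<Sum>j<D. red (\<lambda>j. w j (x z)) D i j * y z ^ j))"
      unfolding S_def sum_distrib_left sum_distrib_right by (subst sum.swap) (simp only: mult.assoc)
    also have "\<dots> = (\<Sum>i\<le>N. w D (x z) ^ N * (G i (x z) * y z ^ i))"
    proof (rule sum.cong[OF refl])
      fix i assume "i \<in> {..N}"
      then have "w D (x z) ^ N = w D (x z) ^ (N - i) * w D (x z) ^ i" by (simp add: power_add[symmetric])
      then show "G i (x z) * w D (x z) ^ (N - i) * (\<Sum>j<D. red (\<lambda>j. w j (x z)) D i j * y z ^ j) = w D (x z) ^ N * (G i (x z) * y z ^ i)"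
        using red_eval[OF \<open>0 < D\<close> wX[OF z], of i, symmetric] by (simp add: mult_ac)
    qed
    also have "\<dots> = w D (x z) ^ N * (\<Sum>i\<le>N. G i (x z) * y z ^ i)" by (rule sum_distrib_left[symmetric])
    also have "(\<Sum>i\<le>N. G i (x z) * y z ^ i) = 0" unfolding G_def mcoeff_eval using gX[OF z] .
    finally show "(\<Sum>j<D. S j (x z) * y z ^ j) = 0" by simp
  qed
  have "\<forall>j\<in>{..D}. \<exists>Q. (\<forall>v t. poly (Q v) t = w j (\<lambda>i. a0 i + t * v i)) \<and> (\<forall>i. pf r (int i) (\<lambda>v. coeff (Q v) i))"
  proof
    fix j assume "j \<in> {..D}"
    then obtain E where E: "pf r (int E) (w j)" using w by (auto elim: PF_pfE)
    obtain Q where "\<And>v t. poly (Q v) t = w j (\<lambda>i. a0 i + t * v i)" "\<And>i. pf r (int i) (\<lambda>v. coeff (Q v) i)"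
      by (rule pf_line_dir[OF E, of a0]) (rule that)
    then show "\<exists>Q. (\<forall>v t. poly (Q v) t = w j (\<lambda>i. a0 i + t * v i)) \<and> (\<forall>i. pf r (int i) (\<lambda>v. coeff (Q v) i))" by blast
  qed
  from bchoice[OF this] obtain W where
    "\<forall>j\<in>{..D}. (\<forall>v t. poly (W j v) t = w j (\<lambda>i. a0 i + t * v i)) \<and> (\<forall>i. pf r (int i) (\<lambda>v. coeff (W j v) i))" ..
  then have W: "\<And>j v t. j \<le> D \<Longrightarrow> poly (W j v) t = w j (\<lambda>i. a0 i + t * v i)"
    and Wpf: "\<And>j i. j \<le> D \<Longrightarrow> pf r (int i) (\<lambda>v. coeff (W j v) i)" by simp_all
  have W0: "coeff (W D v) 0 = w D a0" for v using W[of D v 0] by (simp add: poly_0_coeff_0)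
  have "\<forall>v. \<exists>q. \<forall>j<D. W j v = W D v * q j \<and> dle (int D - int j) (q j)"
  proof
    fix v
    have "\<forall>j\<in>{..<N}. \<exists>Q. dle (int N - int j) Q \<and> (\<forall>t. poly Q t = G j (\<lambda>i. a0 i + t * v i))"
    proof
      fix j assume "j \<in> {..<N}"
      then have E: "pf r (int N - int j) (G j)" using g[of j] by (simp add: G_def[abs_def])
      obtain Q where "dle (int N - int j) Q" "\<And>t. poly Q t = G j (\<lambda>i. a0 i + t * v i)"
        by (rule pf_line[OF E]) (rule that)
      then show "\<exists>Q. dle (int N - int j) Q \<and> (\<forall>t. poly Q t = G j (\<lambda>i. a0 i + t * v i))" by blast
    qed
    from bchoice[OF this] obtain H0 where
      "\<forall>j\<in>{..<N}. dle (int N - int j) (H0 j) \<and> (\<forall>t. poly (H0 j) t = G j (\<lambda>i. a0 i + t * v i))" ..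
    then have H0: "\<And>j. j < N \<Longrightarrow> dle (int N - int j) (H0 j)"
      "\<And>j t. j < N \<Longrightarrow> poly (H0 j) t = G j (\<lambda>i. a0 i + t * v i)" by simp_all
    define H where "H j = (if j < N then H0 j else 1)" for j
    have H: "dle (int N - int j) (H j)" "poly (H j) t = G j (\<lambda>i. a0 i + t * v i)" if "j \<le> N" for j t
      using that H0 by (auto simp: H_def G_def mcoeff_def dle_1 not_less)
    define gp where "gp = (\<Sum>i\<le>N. monom (H i) i)"
    define Wp where "Wp = (\<Sum>j\<le>D. monom (W j v) j)"
    have cgp: "coeff gp i = (if i \<le> N then H i else 0)" for i
      by (simp add: gp_def coeff_sum if_distrib cong: if_cong)
    have cWp: "coeff Wp i = (if i \<le> D then W i v else 0)" for i
      by (simp add: Wp_def coeff_sum if_distrib cong: if_cong)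
    have WD: "W D v \<noteq> 0" using W0[of v] a0 by auto
    have dgp: "degree gp = N" by (rule antisym[OF degree_le le_degree]) (auto simp: cgp H_def)
    have dWp: "degree Wp = D" by (rule antisym[OF degree_le le_degree]) (auto simp: cWp WD)
    have "wt (int (degree gp)) gp" unfolding wt_def dgp using H(1) by (auto simp: cgp)
    moreover have "lead_coeff gp = 1" by (simp add: dgp cgp H_def)
    moreover have "\<exists>Q. smult (W D v ^ N) gp = Wp * Q"
    proof -
      have inner: "(\<Sum>i\<le>N. H i * W D v ^ (N - i) * red (\<lambda>j. W j v) D i j) = 0" if "j < D" for j
      proof (rule poly_ext)
        fix t
        have "poly (\<Sum>i\<le>N. H i * W D v ^ (N - i) * red (\<lambda>j. W j v) D i j) t
          = (\<Sum>i\<le>N. poly (H i) t * poly (W D v) t ^ (N - i) * red (\<lambda>j. poly (W j v) t) D i j)"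
          by (simp add: poly_sum poly_red)
        also have "\<dots> = S j (\<lambda>i. a0 i + t * v i)"
          unfolding S_def
        proof (rule sum.cong[OF refl])
          fix i assume "i \<in> {..N}"
          have "red (\<lambda>j. poly (W j v) t) D i j = red (\<lambda>j. w j (\<lambda>i. a0 i + t * v i)) D i j"
            using that
          proof (induction i arbitrary: j)
            case (Suc i)
            then show ?case using \<open>0 < D\<close> W[of j v t] W[of D v t] by simp
          qed simp
          then show "poly (H i) t * poly (W D v) t ^ (N - i) * red (\<lambda>j. poly (W j v) t) D i j =
             G i (\<lambda>i. a0 i + t * v i) * w D (\<lambda>i. a0 i + t * v i) ^ (N - i) * red (\<lambda>j. w j (\<lambda>i. a0 i + t * v i)) D i j"
            using H(2) \<open>i \<in> {..N}\<close> W[of D v t] by simp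
        qed
        finally show "poly (\<Sum>i\<le>N. H i * W D v ^ (N - i) * red (\<lambda>j. W j v) D i j) t = poly 0 t"
          using S0[OF that] by simp
      qed
      show ?thesis unfolding gp_def Wp_def by (rule pseudo_division[OF \<open>0 < D\<close> inner])
    qed
    ultimately obtain W' where W': "Wp = smult (lead_coeff Wp) W'" "wt (int (degree Wp)) W'"
      using gauss_weight[of "W D v ^ N" gp Wp] WD by (metis power_not_zero)
    have "W j v = W D v * coeff W' j" if "j < D" for j
      using arg_cong[OF W'(1), of "\<lambda>q. coeff q j"] that by (simp add: dWp cWp)
    moreover have "dle (int D - int j) (coeff W' j)" for j using W'(2) by (simp add: wt_def dWp)
    ultimately show "\<exists>q. \<forall>j<D. W j v = W D v * q j \<and> dle (int D - int j) (q j)" by blast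
  qed
  from choice[OF this] obtain q where
    "\<forall>v. \<forall>j<D. W j v = W D v * q v j \<and> dle (int D - int j) (q v j)" ..
  then have q: "\<And>v j. j < D \<Longrightarrow> W j v = W D v * q v j" and qd: "\<And>v j. j < D \<Longrightarrow> dle (int D - int j) (q v j)"
    by simp_all
  have qpf: "pf r (int i) (\<lambda>v. coeff (q v j) i)" if "j < D" for i j
  proof (rule pf_coeff_quotient[where A = "W j" and W = "W D" and s = "w D a0"])
    fix v show "W j v = q v j * W D v" using q[OF that, of v] by (simp add: mult.commute)
  qed (use a0 W0 Wpf that in auto)
  \<comment> \<open>The point \<open>a\<close> is reached at \<open>t = 1\<close> on the line in
    direction \<open>a - a0\<close>, where the quotient is the sum of its coefficients.\<close>
  define c where "c j a = (\<Sum>i\<le>D - j. coeff (q (\<lambda>l. a l - a0 l) j) i)" for j a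
  have cpf: "pf r (int D - int j) (c j)" if "j < D" for j
    unfolding c_def
  proof (rule pf_sum)
    fix i assume i: "i \<in> {..D - j}"
    have "pf r (int i) (\<lambda>a. coeff (q (\<lambda>l. a l - a0 l) j) i)"
      by (rule pf_comp[where F = "\<lambda>v. coeff (q v j) i" and \<phi> = "\<lambda>a l. a l - a0 l", OF qpf[OF that]])
        (auto intro!: pf_diff pf_var pf_const)
    then show "pf r (int D - int j) (\<lambda>a. coeff (q (\<lambda>l. a l - a0 l) j) i)"
      by (rule pf_mono) (use i that in auto)
  qed
  have wc: "w j a = w D a * c j a" if "j < D" for j a
  proof -
    define v where "v = (\<lambda>l. a l - a0 l)"
    have 1: "poly (W l v) 1 = w l a" if "l \<le> D" for l using W[OF that, of v 1] by (simp add: v_def)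
    have "dle (int (D - j)) (q v j)" using qd[OF that, of v] that by (simp add: of_nat_diff)
    then have "poly (q v j) 1 = c j a" by (simp add: poly_sum_atMost c_def v_def)
    then show ?thesis using q[OF that, of v] 1[of j] 1[of D] that by (metis less_imp_le order_refl poly_mult)
  qed
  have xz: "\<And>j. j < r \<Longrightarrow> pf n 1 (\<lambda>z. x z j)" using x unfolding proj_def by simp
  have "w D (x z) * (y z ^ D + (\<Sum>j<D. c j (x z) * y z ^ j)) = 0" if "z \<in> X" for z
  proof -
    have "w D (x z) * (y z ^ D + (\<Sum>j<D. c j (x z) * y z ^ j)) = (\<Sum>j<D. w j (x z) * y z ^ j) + w D (x z) * y z ^ D"
      by (simp add: wc sum_distrib_left algebra_simps)
    then show ?thesis using wX[OF that] by (simp add: sum_atMost_split)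
  qed
  moreover have "PF n (\<lambda>z. w D (x z))" by (rule PF_comp[OF w[OF order_refl] xz])
  moreover have "PF n (\<lambda>z. y z ^ D + (\<Sum>j<D. c j (x z) * y z ^ j))"
  proof (intro PF_add PF_power PF_sum PF_mult)
    show "PF n y" using y by (rule PF_I)
    then show "PF n y" .
    fix j assume "j \<in> {..<D}"
    then show "PF n (\<lambda>z. c j (x z))" by (intro PF_comp[OF PF_I[OF cpf] xz]) auto
  qed
  ultimately have "(\<forall>z\<in>X. w D (x z) = 0) \<or> (\<forall>z\<in>X. y z ^ D + (\<Sum>j<D. c j (x z) * y z ^ j) = 0)"
    using irreducible_mult[OF irr] by blast
  moreover have "\<not> (\<forall>z\<in>X. w D (x z) = 0)"
    using indepD[OF ind w[OF order_refl], of a0] a0 by blast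
  ultimately have "\<forall>z\<in>X. y z ^ D + (\<Sum>j<D. c j (x z) * y z ^ j) = 0" by blast
  then have "min_eqn X r x y D c" unfolding min_eqn_def using \<open>0 < D\<close> cpf minD by blast
  then show thesis by (rule that)
qed

lemma min_eqn_prime:
  fixes X :: "(nat \<Rightarrow> 'k) set"
  assumes irr: "irreducible_closed n X" and x: "proj n r x" and y: "pf n 1 y" and m: "min_eqn X r x y D c"
  shows "prime_eqn r D c"
  unfolding prime_eqn_def
proof (intro conjI allI impI)
  show "0 < D" by (rule min_eqnD(1)[OF m])
  fix j assume "j < D" then show "pf r (int D - int j) (c j)" by (rule min_eqnD(2)[OF m])
next
  fix s h :: "nat \<Rightarrow> (nat \<Rightarrow> 'k) \<Rightarrow> 'k"
  assume sh: "\<forall>j<D. PF r (s j) \<and> PF r (h j)" and dvd: "\<forall>a. fpoly D c a dvd rem_poly D s a * rem_poly D h a"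
  have xz: "\<And>j. j < r \<Longrightarrow> pf n 1 (\<lambda>z. x z j)" using x unfolding proj_def by simp
  have PF: "PF n (\<lambda>z. \<Sum>j<D. e j (x z) * y z ^ j)" if "\<forall>j<D. PF r (e j)" for e
    by (intro PF_sum PF_mult PF_power PF_comp[OF _ xz] PF_I[OF y]) (use that in auto)
  have "(\<Sum>j<D. s j (x z) * y z ^ j) * (\<Sum>j<D. h j (x z) * y z ^ j) = 0" if "z \<in> X" for z
  proof -
    have "poly (fpoly D c (x z)) (y z) = 0" unfolding poly_fpoly by (rule min_eqnD(3)[OF m that])
    then have "poly (rem_poly D s (x z) * rem_poly D h (x z)) (y z) = 0" using dvd by (metis poly_eq_0_iff_dvd dvd_trans)
    then show ?thesis by (simp add: poly_rem_poly)
  qed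
  then have "(\<forall>z\<in>X. (\<Sum>j<D. s j (x z) * y z ^ j) = 0) \<or> (\<forall>z\<in>X. (\<Sum>j<D. h j (x z) * y z ^ j) = 0)"
    using irreducible_mult[OF irr PF PF, of s h] sh by blast
  then show "(\<forall>j<D. \<forall>a. s j a = 0) \<or> (\<forall>j<D. \<forall>a. h j a = 0)"
    using min_eqnD(4)[OF m, of s] min_eqnD(4)[OF m, of h] sh by blast
qed

text \<open>Lying over for the projection \<open>(x, y)\<close>. A function vanishing on the image
  reduces modulo the monic equation to a remainder of degree below \<open>D\<close> in
  \<open>y\<close>, which is zero by minimality; so the function vanishes at every root
  \<open>(a, b)\<close>.\<close>

lemma min_eqn_lift:
  fixes X :: "(nat \<Rightarrow> 'k) set"
  assumes X: "zariski_closed n X" and fin: "sfin X n r x" and x: "proj n r x" and y: "pf n 1 y"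
    and m: "min_eqn X r x y D c" and root: "b ^ D + (\<Sum>j<D. c j a * b ^ j) = 0"
  obtains P where "P \<in> X" "\<And>j. j < r \<Longrightarrow> x P j = a j" "y P = b"
proof -
  have 1: "sfin X n (Suc r) (adj r x y)" by (rule sfin_adj[OF fin])
  have 2: "proj n (Suc r) (adj r x y)" by (rule proj_adj[OF x y])
  define e where "e j = (if j = r then b else a j)" for j
  have Fe: "F e = 0" if F: "PF (Suc r) F" "\<And>z. z \<in> X \<Longrightarrow> F (adj r x y z) = 0" for F
  proof -
    obtain E where E: "pf (Suc r) (int E) F" using F(1) by (rule PF_pfE)
    obtain Q where Q: "\<And>z. F z = poly (Q z) (z r)" "\<And>i. pf r (int E - int i) (\<lambda>z. coeff (Q z) i)"
      "\<And>z. dle (int E) (Q z)" by (rule pf_last[OF E]) (rule that)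
    have FQ: "F z = (\<Sum>i<Suc E. coeff (Q z) i * z r ^ i)" for z
      using poly_sum_atMost[OF Q(3), of z "z r"] Q(1)[of z] by (simp add: lessThan_Suc_atMost)
    define h where "h j a = norm_mat (mcoeff D c a) D (\<lambda>i. coeff (Q a) i) (Suc E) 0 j" for j a
    have FX: "F z = (\<Sum>j<D. h j a * z r ^ j)" if "\<And>j. j < r \<Longrightarrow> z j = a j" "z r ^ D + (\<Sum>j<D. c j a * z r ^ j) = 0" for z a
    proof -
      have "(\<Sum>j<D. h j a * z r ^ j) = (\<Sum>i<Suc E. coeff (Q a) i * z r ^ i)"
        unfolding h_def using norm_mat_eval[OF min_eqnD(1)[OF m], of "mcoeff D c a" "z r" "\<lambda>i. coeff (Q a) i" "Suc E" 0] that(2)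
        by (simp add: mcoeff_eval)
      also have "\<dots> = F z" unfolding FQ
        by (rule sum.cong[OF refl]) (use pf_cong[OF Q(2), of z a] that(1) in auto)
      finally show ?thesis by simp
    qed
    have "h j a = 0" if "j < D" for j a
    proof (rule min_eqnD(4)[where h = h, OF m _ _ that])
      fix j assume "j < D"
      have "pf r (int E + int 0 - int j) (\<lambda>a. norm_mat (\<lambda>i. (\<lambda>i a. mcoeff D c a i) i a) D (\<lambda>i. (\<lambda>i a. coeff (Q a) i) i a) (Suc E) 0 j)"
        by (rule norm_mat_pf) (use min_eqnD(1,2)[OF m] Q(2) \<open>j < D\<close> in \<open>auto simp: mcoeff_def\<close>)
      then show "PF r (h j)" unfolding h_def by (auto intro: PF_I)
    next
      fix z assume z: "z \<in> X"
      show "(\<Sum>j<D. h j (x z) * y z ^ j) = 0"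
        using FX[of "adj r x y z" "x z"] min_eqnD(3)[OF m z] F(2)[OF z] by (simp add: adj_def)
    qed
    then show ?thesis using FX[of e a] root by (simp add: e_def)
  qed
  obtain P where P: "P \<in> X" "\<And>j. j < Suc r \<Longrightarrow> adj r x y P j = e j"
    by (rule lying_over[where c = e, OF 1 X 2]) (erule Fe, assumption, rule that)
  show thesis
  proof (rule that[OF P(1)])
    fix j assume "j < r" then show "x P j = a j" using P(2)[of j] by (simp add: adj_def e_def)
  next
    show "y P = b" using P(2)[of r] by (simp add: adj_def e_def)
  qed
qed

end

subsection \<open>The degree bounds the degree of a minimal polynomial\<close>

lemma pf_restrict_const: "pf 0 D F \<Longrightarrow> F z = F z'"
  by (rule pf_cong) auto

lemma min_eqn_min_deg:
  assumes m: "min_eqn X r x y D c" and h: "\<And>j. j \<le> e \<Longrightarrow> PF r (h j)" "\<And>z. z \<in> X \<Longrightarrow> (\<Sum>j\<le>e. h j (x z) * y z ^ j) = 0"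
    and nz: "i \<le> e" "h i a \<noteq> 0"
  shows "D \<le> e"
proof (rule ccontr)
  assume "\<not> D \<le> e"
  define g where "g j = (if j \<le> e then h j else (\<lambda>_. 0))" for j
  have "g i a = 0"
  proof (rule min_eqnD(4)[where h = g, OF m])
    fix j show "PF r (g j)" using h(1) by (simp add: g_def)
  next
    fix z assume "z \<in> X"
    have "(\<Sum>j<D. g j (x z) * y z ^ j) = (\<Sum>j\<le>e. h j (x z) * y z ^ j)"
      by (rule sum.mono_neutral_cong_right) (use \<open>\<not> D \<le> e\<close> in \<open>auto simp: g_def\<close>)
    then show "(\<Sum>j<D. g j (x z) * y z ^ j) = 0" using h(2)[OF \<open>z \<in> X\<close>] by simp
  qed (use \<open>\<not> D \<le> e\<close> nz in simp)
  then show False using nz by (simp add: g_def)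
qed

context Fpbar
begin

lemma simple_roots_card:
  fixes f :: "'k poly"
  assumes "f \<noteq> 0" "\<And>x. poly f x = 0 \<Longrightarrow> poly (pderiv f) x \<noteq> 0"
  shows "card {x. poly f x = 0} = degree f"
  using assms
proof (induction "degree f" arbitrary: f)
  case 0
  then obtain c where "f = [:c:]" by (metis degree_eq_zeroE)
  then show ?case using 0 by auto
next
  case (Suc d)
  then obtain a where a: "poly f a = 0" using alg_root[of f] by auto
  then obtain q where q: "f = [:-a, 1:] * q" by (auto simp: poly_eq_0_iff_dvd)
  then have "q \<noteq> 0" using Suc.prems by auto
  then have dq: "degree f = Suc (degree q)" unfolding q by (subst degree_mult_eq) auto
  have d: "poly (pderiv f) x = poly q x + (x - a) * poly (pderiv q) x" for x
    unfolding q pderiv_mult by (simp add: pderiv_pCons algebra_simps)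
  have qa: "poly q a \<noteq> 0" using Suc.prems(2)[OF a] d[of a] by simp
  have "card {x. poly q x = 0} = degree q"
  proof (rule Suc.hyps(1))
    show "d = degree q" using Suc.hyps(2) dq by simp
    show "poly (pderiv q) x \<noteq> 0" if "poly q x = 0" for x
      using Suc.prems(2)[of x] that d[of x] unfolding q by auto
  qed fact
  moreover have "{x. poly f x = 0} = insert a {x. poly q x = 0}" unfolding q by auto
  ultimately show ?case using qa dq poly_roots_finite[OF \<open>q \<noteq> 0\<close>] by simp
qed

text \<open>In the last variable only exponents divisible by \<open>p\<close> occur, because the
  derivative vanishes. The coefficients inherit the hypothesis and are \<open>p\<close>-th powers by
  induction, and a sum of \<open>p\<close>-th powers is a \<open>p\<close>-th power in
  characteristic \<open>p\<close>.\<close>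

lemma pth_power:
  fixes F :: "(nat \<Rightarrow> 'k) \<Rightarrow> 'k"
  assumes "PF m F" "\<And>j x Q. j < m \<Longrightarrow> (\<And>t. poly Q t = F (x(j := t))) \<Longrightarrow> pderiv Q = 0"
  shows "\<exists>G. PF m G \<and> (\<forall>z. F z = G z ^ p)"
  using assms
proof (induction m arbitrary: F)
  case 0
  obtain g where g: "g ^ p = F (\<lambda>_. 0)" using frob_surj by blast
  have "F z = g ^ p" for z unfolding g by (rule PF_cong[OF 0(1)]) auto
  then show ?case by (intro exI[of _ "\<lambda>_. g"]) auto
next
  case (Suc m)
  obtain E where E: "pf (Suc m) (int E) F" using Suc.prems(1) by (rule PF_pfE)
  obtain Q where Q: "\<And>z. F z = poly (Q z) (z m)" "\<And>i. pf m (int E - int i) (\<lambda>z. coeff (Q z) i)"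
      "\<And>z. dle (int E) (Q z)" by (rule pf_last[OF E]) (rule that)
  have Qc: "Q z = Q z'" if "\<And>i. i < m \<Longrightarrow> z i = z' i" for z z'
    by (rule poly_eqI) (rule pf_cong[OF Q(2)], rule that)
  define C where "C i z = coeff (Q z) i" for i z
  have C0: "C i z = 0" if npi: "\<not> p dvd i" for i z
  proof -
    have "pderiv (Q z) = 0"
    proof (rule Suc.prems(2)[of m])
      fix t show "poly (Q z) t = F (z(m := t))" unfolding Q(1) using Qc[of z "z(m := t)"] by simp
    qed simp
    moreover obtain i' where i: "i = Suc i'" using npi by (cases i) auto
    ultimately have "of_nat i * coeff (Q z) i = 0" using coeff_pderiv[of "Q z" i'] by simp
    moreover have "(of_nat i :: 'k) \<noteq> 0" using npi by (simp add: of_nat_eq_0_iff_char_dvd char_k)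
    ultimately show ?thesis by (simp add: C_def)
  qed
  have "\<exists>G. PF m G \<and> (\<forall>z. C i z = G z ^ p)" for i
  proof (rule Suc.IH)
    show "PF m (C i)" unfolding C_def by (rule PF_I[OF Q(2)])
    fix j x R assume j: "j < m" and R: "\<And>t. poly R t = C i (x(j := t))"
    have "\<forall>l. \<exists>S. \<forall>t. poly S t = C l (x(j := t))"
    proof
      fix l
      obtain S where S: "\<And>t. poly S t = C l (\<lambda>k. (x(j := 0)) k + t * ((\<lambda>_. 0)(j := 1)) k)"
        unfolding C_def by (rule pf_line[OF Q(2)[of l], of "x(j := 0)" "(\<lambda>_. 0)(j := 1)"]) blast
      have "(\<lambda>k. (x(j := 0)) k + t * ((\<lambda>_. 0)(j := 1)) k) = x(j := t)" for t by auto
      then show "\<exists>S. \<forall>t. poly S t = C l (x(j := t))" using S by auto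
    qed
    from choice[OF this] obtain S where S: "\<forall>l t. poly (S l) t = C l (x(j := t))" ..
    \<comment> \<open>Each coefficient function has zero derivative along coordinate
      \<open>j\<close>, since this holds for their combination at every value \<open>s\<close> of
      the last variable.\<close>
    have pd: "pderiv (\<Sum>l\<le>E. smult (s ^ l) (S l)) = 0" for s
    proof (rule Suc.prems(2)[of j _ "x(m := s)"])
      fix t
      have "F ((x(m := s))(j := t)) = poly (Q (x(j := t))) s"
        unfolding Q(1) using Qc[of "(x(m := s))(j := t)" "x(j := t)"] j by simp
      then show "poly (\<Sum>l\<le>E. smult (s ^ l) (S l)) t = F ((x(m := s))(j := t))"
        unfolding poly_sum_atMost[OF Q(3)] using S by (simp add: poly_sum C_def mult.commute)
    qed (use j in simp)
    have "coeff (pderiv (S l)) k = 0" if "l \<le> E" for l k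
    proof -
      have "(\<Sum>l\<le>E. monom (coeff (pderiv (S l)) k) l) = 0"
      proof (rule poly_ext)
        fix s
        show "poly (\<Sum>l\<le>E. monom (coeff (pderiv (S l)) k) l) s = poly 0 s"
          using arg_cong[OF pd[of s], of "\<lambda>q. coeff q k"]
          by (simp add: higher_pderiv_sum pderiv_sum pderiv_smult coeff_sum poly_sum poly_monom mult.commute)
      qed
      from arg_cong[OF this, of "\<lambda>q. coeff q l"] show ?thesis using that
        by (simp add: coeff_sum if_distrib cong: if_cong)
    qed
    moreover have "S i = R" by (rule poly_ext) (use S R in simp)
    moreover have "R = 0" if "\<not> i \<le> E"
    proof (rule poly_ext)
      fix t show "poly R t = poly 0 t" using R[of t] Q(3) that by (simp add: C_def dle_def)
    qed
    ultimately show "pderiv R = 0" by (cases "i \<le> E") (auto intro: poly_eqI)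
  qed
  then have "\<forall>i. \<exists>G. PF m G \<and> (\<forall>z. C i z = G z ^ p)" ..
  from choice[OF this] obtain g where g: "\<forall>i. PF m (g i) \<and> (\<forall>z. C i z = g i z ^ p)" ..
  have p0: "p > 0" using p_gt_1 by simp
  have "F z = (\<Sum>l\<le>E. g (p * l) z * z m ^ l) ^ p" for z
  proof -
    have "dle (int (p * E)) (Q z)" by (rule dle_mono[OF Q(3)]) (use p0 in \<open>simp only: of_nat_le_iff\<close>, simp)
    then have "F z = (\<Sum>i\<le>p * E. C i z * z m ^ i)" unfolding Q(1) C_def by (rule poly_sum_atMost)
    also have "\<dots> = (\<Sum>i\<in>(\<lambda>l. p * l) ` {..E}. C i z * z m ^ i)"
    proof (rule sum.mono_neutral_right)
      show "\<forall>i\<in>{..p * E} - (\<lambda>l. p * l) ` {..E}. C i z * z m ^ i = 0"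
      proof
        fix i assume i: "i \<in> {..p * E} - (\<lambda>l. p * l) ` {..E}"
        have "\<not> p dvd i" using i p0 by (auto simp: dvd_def)
        then show "C i z * z m ^ i = 0" using C0 by simp
      qed
    qed (use p0 in auto)
    also have "\<dots> = (\<Sum>l\<le>E. C (p * l) z * z m ^ (p * l))"
      by (subst sum.reindex) (use p0 in \<open>auto simp: inj_on_def\<close>)
    also have "\<dots> = (\<Sum>l\<le>E. (g (p * l) z * z m ^ l) ^ p)"
      using g by (simp add: power_mult_distrib power_mult[symmetric] mult.commute)
    finally show ?thesis by (simp add: frob_sum)
  qed
  moreover have "PF (Suc m) (\<lambda>z. \<Sum>l\<le>E. g (p * l) z * z m ^ l)"
  proof (rule PF_sum)
    fix l
    have "PF (Suc m) (g (p * l))" by (rule PF_extend[of m]) (use g in auto)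
    then show "PF (Suc m) (\<lambda>z. g (p * l) z * z m ^ l)" by (intro PF_mult PF_power PF_var) auto
  qed
  ultimately show ?case by blast
qed

text \<open>A linear dependence between the linear parts would be an algebraic relation between the
  coordinates of \<open>x\<close> on \<open>X\<close>. The independence is the codimension condition
  in the definition of degree.\<close>

lemma form_independent:
  fixes X :: "(nat \<Rightarrow> 'k) set"
  assumes "indep X r x" "proj n r x"
  obtains a b where "\<And>z j. j < r \<Longrightarrow> x z j = b j + (\<Sum>i<n. a j i * z i)"
    "\<And>lam. \<forall>i<n. (\<Sum>j<r. lam j * a j i) = 0 \<Longrightarrow> \<forall>j<r. lam j = 0"
proof -
  have "\<forall>j. \<exists>c. j < r \<longrightarrow> (\<forall>z. x z j = fst c + (\<Sum>i<n. snd c i * z i))"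
  proof
    fix j
    show "\<exists>c. j < r \<longrightarrow> (\<forall>z. x z j = fst c + (\<Sum>i<n. snd c i * z i))"
    proof (cases "j < r")
      case True
      then have "pf n 1 (\<lambda>z. x z j)" using assms(2) unfolding proj_def by simp
      from pf_affine[OF this] obtain c0 c where "\<forall>z. x z j = c0 + (\<Sum>i<n. c i * z i)" by auto
      then show ?thesis by (intro exI[of _ "(c0, c)"]) simp
    qed simp
  qed
  from choice[OF this] obtain c where
    c: "\<forall>j<r. \<forall>z. x z j = fst (c j) + (\<Sum>i<n. snd (c j) i * z i)" by blast
  show thesis
  proof (rule that)
    fix z j assume "j < r"
    then show "x z j = fst (c j) + (\<Sum>i<n. snd (c j) i * z i)" using c by simp
  next
    fix lam :: "nat \<Rightarrow> 'k"
    assume lam: "\<forall>i<n. (\<Sum>j<r. lam j * snd (c j) i) = 0"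
    define F where "F a = (\<Sum>j<r. lam j * (a j - fst (c j)))" for a
    have "PF r F" unfolding F_def by (intro PF_sum PF_cmult PF_diff PF_var PF_const) auto
    moreover have "F (x z) = 0" for z
    proof -
      have "F (x z) = (\<Sum>j<r. \<Sum>i<n. lam j * snd (c j) i * z i)"
        unfolding F_def using c by (simp add: sum_distrib_left mult.assoc)
      also have "\<dots> = (\<Sum>i<n. (\<Sum>j<r. lam j * snd (c j) i) * z i)"
        unfolding sum_distrib_right by (rule sum.swap)
      finally show ?thesis using lam by simp
    qed
    ultimately have F0: "F a = 0" for a using indepD[OF assms(1), where F = F] by blast
    show "\<forall>j<r. lam j = 0"
    proof (intro allI impI)
      fix j assume "j < r"
      have "F (\<lambda>i. fst (c i) + (if i = j then 1 else 0)) = lam j"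
      proof -
        have "F (\<lambda>i. fst (c i) + (if i = j then 1 else 0)) = (\<Sum>i<r. if i = j then lam i else 0)"
          unfolding F_def by (rule sum.cong) auto
        then show ?thesis using \<open>j < r\<close> by simp
      qed
      then show "lam j = 0" using F0 by simp
    qed
  qed
qed

text \<open>A fibre of \<open>x\<close> is a finite section of \<open>X\<close> by an affine
  subspace of codimension \<open>r\<close>, so the definition of degree applies.\<close>

lemma fibre_card_le:
  fixes X :: "(nat \<Rightarrow> 'k) set"
  assumes X: "X \<subseteq> affine_space n" and deg: "has_degree n X r d"
    and "sfin X n r x" "indep X r x" "proj n r x"
  shows "card {z \<in> X. \<forall>j<r. x z j = a j} \<le> d"
proof -
  obtain A b where A: "\<And>z j. j < r \<Longrightarrow> x z j = b j + (\<Sum>i<n. A j i * z i)"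
    "\<And>lam. \<forall>i<n. (\<Sum>j<r. lam j * A j i) = 0 \<Longrightarrow> \<forall>j<r. lam j = 0"
    by (rule form_independent[OF assms(4,5)], rule that)
  define L where "L = {z \<in> affine_space n. \<forall>j<r. (\<Sum>i<n. A j i * z i) = a j - b j}"
  have "affine_subspace_codim n r L" unfolding affine_subspace_codim_def L_def
    by (intro exI[of _ A] exI[of _ "\<lambda>j. a j - b j"]) (use A(2) in auto)
  moreover have eq: "X \<inter> L = {z \<in> X. \<forall>j<r. x z j = a j}"
    unfolding L_def using X A(1) by (auto simp: algebra_simps)
  moreover have "finite (X \<inter> L)" unfolding eq by (rule sfin_finite_fibre[OF assms(3) X])
  ultimately show ?thesis using deg unfolding has_degree_def by metis
qed

lemma coeff_1_shift: "coeff (pcompose Q [:s, 1:]) 1 = poly (pderiv Q) s" for Q :: "'k poly"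
proof -
  have "coeff (pcompose Q [:s, 1:]) 1 = poly (pderiv (pcompose Q [:s, 1:])) 0"
    by (simp add: poly_0_coeff_0 coeff_pderiv)
  then show ?thesis by (simp add: pderiv_pcompose poly_pcompose pderiv_pCons)
qed

text \<open>A generic shear \<open>x \<mapsto> x - \<beta> y\<close> keeps the degree of the minimal polynomial and makes it
  separable: otherwise all partial derivatives of the equation vanish and it is a \<open>p\<close>-th power.\<close>

theorem min_eqn_shear:
  fixes X :: "(nat \<Rightarrow> 'k) set"
  assumes irr: "irreducible_closed n X" and dim: "has_dim n X r" and fin: "sfin X n r x" and x: "proj n r x"
    and y: "pf n 1 y" and m: "min_eqn X r x y D c"
  obtains x' c' where "sfin X n r x'" "proj n r x'" "indep X r x'" "min_eqn X r x' y D c'" "\<exists>a. pderiv (fpoly D c' a) \<noteq> 0"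
proof -
  have "0 < D" by (rule min_eqnD(1)[OF m])
  have "X \<noteq> {}" using irr unfolding irreducible_closed_def by simp
  define F where "F e = e r ^ D + (\<Sum>j<D. c j e * e r ^ j)" for e
  have Ff: "poly (fpoly D c e) t = F (e(r := t))" for e t
  proof -
    have "c j (e(r := t)) = c j e" if "j < D" for j by (rule pf_cong[OF min_eqnD(2)[OF m that]]) auto
    then show ?thesis unfolding poly_fpoly F_def by simp
  qed
  have Fpf: "pf (Suc r) (int D) F"
    unfolding F_def
  proof (intro pf_add pf_sum)
    show "pf (Suc r) (int D) (\<lambda>e. e r ^ D)" using pf_power[OF pf_var[of r "Suc r" 1], of D] by simp
    fix j assume "j \<in> {..<D}"
    then have "pf (Suc r) (int D - int j) (c j)" by (intro pf_extend[OF min_eqnD(2)[OF m]]) auto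
    from pf_mult[OF this pf_power[OF pf_var[of r "Suc r" 1], of j]]
    show "pf (Suc r) (int D) (\<lambda>e. c j e * e r ^ j)" by simp
  qed
  have FX: "F (adj r x y z) = 0" if "z \<in> X" for z
  proof -
    have "c j (adj r x y z) = c j (x z)" if "j < D" for j
      by (rule pf_cong[OF min_eqnD(2)[OF m that]]) (auto simp: adj_def)
    then show ?thesis using min_eqnD(3)[OF m that] unfolding F_def by (simp add: adj_def)
  qed
  have line: "\<exists>Q. \<forall>t. poly Q t = F (\<lambda>i. e i + t * w i)" for e w
    by (rule pf_line[OF Fpf, of e w]) auto
  have notpf: "\<not> pf (Suc r) (int D - 1) F"
  proof
    assume "pf (Suc r) (int D - 1) F"
    then obtain q where q: "dle (int D - 1) q" "\<And>t. poly q t = F (\<lambda>i. 0 + t * (if i = r then 1 else 0))"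
      by (rule pf_line) (rule that)
    have "q = fpoly D c (\<lambda>_. 0)"
    proof (rule poly_ext)
      fix t :: 'k
      have "(\<lambda>i. 0 + t * (if i = r then 1 else 0)) = (\<lambda>_. 0)(r := t)" by (rule ext) simp
      then show "poly q t = poly (fpoly D c (\<lambda>_. 0)) t" unfolding q(2) Ff by simp
    qed
    then have "coeff q D = 1" by (simp add: coeff_fpoly)
    then show False using q(1) by (simp add: dle_def)
  qed
  obtain L where L: "pf (Suc r) (int D) L" "\<exists>w. L w \<noteq> 0" "\<And>c w. L (\<lambda>i. c * w i) = c ^ D * L w"
    "\<forall>w Q. (\<forall>x t. poly (Q x) t = F (\<lambda>i. x i + t * w i)) \<longrightarrow> coeff (Q (\<lambda>_. 0)) D = L w"
    by (rule pf_top[OF Fpf notpf]) (rule that)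
  \<comment> \<open>Some directional derivative of \<open>F\<close> is nonzero somewhere. Otherwise
    \<open>F = G ^ p\<close>, and \<open>G\<close> would give a relation of degree
    \<open>D / p\<close> in \<open>y\<close>, against the minimality of \<open>D\<close>.\<close>
  have "\<exists>e w Q. (\<forall>t. poly Q t = F (\<lambda>i. e i + t * w i)) \<and> coeff Q 1 \<noteq> 0"
  proof (rule ccontr)
    assume neg: "\<not> ?thesis"
    have "\<exists>G. PF (Suc r) G \<and> (\<forall>z. F z = G z ^ p)"
    proof (rule pth_power[OF PF_I[OF Fpf]])
      fix j e and Q :: "'k poly" assume "j < Suc r" and Q: "\<And>t. poly Q t = F (e(j := t))"
      show "pderiv Q = 0"
      proof (rule poly_ext)
        fix s
        have "poly (pcompose Q [:s, 1:]) t = F (\<lambda>i. (e(j := s)) i + t * ((\<lambda>_. 0)(j := 1)) i)" for t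
        proof -
          have "(\<lambda>i. (e(j := s)) i + t * ((\<lambda>_. 0)(j := 1)) i) = e(j := s + t)" by auto
          then show ?thesis by (simp add: poly_pcompose Q)
        qed
        then have "coeff (pcompose Q [:s, 1:]) 1 = 0" using neg by blast
        then show "poly (pderiv Q) s = poly 0 s" unfolding coeff_1_shift by simp
      qed
    qed
    then obtain G where G: "PF (Suc r) G" "\<And>z. F z = G z ^ p" by blast
    obtain E where E: "pf (Suc r) (int E) G" using G(1) by (rule PF_pfE)
    obtain Q where Q: "\<And>z. G z = poly (Q z) (z r)" "\<And>i. pf r (int E - int i) (\<lambda>z. coeff (Q z) i)"
      "\<And>z. dle (int E) (Q z)" by (rule pf_last[OF E]) (rule that)
    have Qc: "Q z = Q z'" if "\<And>i. i < r \<Longrightarrow> z i = z' i" for z z'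
      by (rule poly_eqI) (rule pf_cong[OF Q(2)], rule that)
    have fQ: "fpoly D c z = Q z ^ p" for z
    proof (rule poly_ext)
      fix t show "poly (fpoly D c z) t = poly (Q z ^ p) t"
        unfolding Ff G(2) Q(1) using Qc[of "z(r := t)" z] by simp
    qed
    define e where "e = degree (Q (\<lambda>_. 0))"
    have dQ: "D = p * degree (Q z)" for z
    proof -
      have "Q z \<noteq> 0" using fQ[of z] lead_coeff_fpoly[of D c z] p_gt_1 by (auto simp: zero_power)
      then show ?thesis using arg_cong[OF fQ[of z], of degree] by (simp add: degree_fpoly degree_power_eq)
    qed
    have de: "degree (Q z) = e" for z using dQ[of z] dQ[of "\<lambda>_. 0"] p_gt_1 unfolding e_def by simp
    have "e > 0" using dQ[of "\<lambda>_. 0"] \<open>0 < D\<close> unfolding e_def by (metis mult_0_right gr0I not_gr_zero)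
    have "D \<le> e"
    proof (rule min_eqn_min_deg[where h = "\<lambda>j z. coeff (Q z) j" and a = "\<lambda>_. 0" and i = e, OF m])
      fix j show "PF r (\<lambda>z. coeff (Q z) j)" by (rule PF_I[OF Q(2)])
    next
      fix z assume "z \<in> X"
      have "G (adj r x y z) = 0" using FX[OF \<open>z \<in> X\<close>] G(2)[of "adj r x y z"] p_gt_1 by simp
      moreover have "Q (adj r x y z) = Q (x z)" by (rule Qc) (simp add: adj_def)
      ultimately have "poly (Q (x z)) (y z) = 0" using Q(1)[of "adj r x y z"] by (simp add: adj_def)
      then show "(\<Sum>j\<le>e. coeff (Q (x z)) j * y z ^ j) = 0" by (simp add: poly_altdef de)
    next
      have "Q (\<lambda>_. 0) \<noteq> 0" using \<open>e > 0\<close> unfolding e_def by auto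
      then show "coeff (Q (\<lambda>_. 0)) e \<noteq> 0" unfolding e_def by simp
    qed simp
    moreover have "e < D" using dQ[of "\<lambda>_. 0"] \<open>e > 0\<close> p_gt_1 unfolding e_def by simp
    ultimately show False by simp
  qed
  then obtain e0 w0 Q0 where e0: "\<And>t. poly Q0 t = F (\<lambda>i. e0 i + t * w0 i)" "coeff Q0 1 \<noteq> 0" by blast
  obtain K where K: "\<And>v t. poly (K v) t = F (\<lambda>i. e0 i + t * v i)" "\<And>i. pf (Suc r) (int i) (\<lambda>v. coeff (K v) i)"
    by (rule pf_line_dir[OF Fpf, of e0]) (rule that)
  have "K w0 = Q0" by (rule poly_ext) (simp add: K e0)
  then have K0: "coeff (K w0) 1 \<noteq> 0" using e0 by simp
  have Khom: "coeff (K (\<lambda>i. s * v i)) 1 = s * coeff (K v) 1" for s v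
  proof -
    have "K (\<lambda>i. s * v i) = pcompose (K v) [:0, s:]"
      by (rule poly_ext) (simp add: K poly_pcompose mult_ac)
    then show ?thesis by (simp add: coeff_pcompose_linear)
  qed
  \<comment> \<open>One direction has to meet three conditions: nonzero derivative at
    \<open>e0\<close>, nonzero leading form and nonzero last coordinate.\<close>
  obtain w1 where "L w1 \<noteq> 0" using L(2) by blast
  then obtain w2 where w2: "coeff (K w2) 1 \<noteq> 0" "L w2 \<noteq> 0"
    using PF_common_nonzero[OF infinite_k PF_I[OF K(2)] PF_I[OF L(1)] K0] by blast
  have "PF (Suc r) (\<lambda>v. coeff (K v) 1 * L v)" by (rule PF_mult[OF PF_I[OF K(2)] PF_I[OF L(1)]])
  moreover have "PF (Suc r) (\<lambda>v :: nat \<Rightarrow> 'k. v r)" by (rule PF_var) simp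
  ultimately have "\<exists>v. coeff (K v) 1 * L v \<noteq> 0 \<and> v r \<noteq> 0"
    by (rule PF_common_nonzero[OF infinite_k, where u = w2 and w = "\<lambda>_. 1"]) (use w2 in auto)
  then obtain w3 where w3: "coeff (K w3) 1 \<noteq> 0" "L w3 \<noteq> 0" "w3 r \<noteq> 0" by auto
  define w where "w j = w3 j / w3 r" for j
  have w': "w = (\<lambda>j. (1 / w3 r) * w3 j)" by (auto simp: w_def)
  have wr: "w r = 1" using w3 by (simp add: w_def)
  have Kw: "coeff (K w) 1 \<noteq> 0" and Lw: "L w \<noteq> 0"
    unfolding w' Khom L(3) using w3 by simp_all
  define x' where "x' z j = adj r x y z j - w j * adj r x y z r" for z j
  have x'_def': "x' = (\<lambda>z j. adj r x y z j - (w3 j / w3 r) * adj r x y z r)" by (intro ext) (simp add: x'_def w_def)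
  have fin': "sfin X n r x'" unfolding x'_def'
    by (rule top_dir_step[OF sfin_adj[OF fin] \<open>X \<noteq> {}\<close> FX Fpf L(3) L(4)]) (use w3 in auto)
  have x': "proj n r x'" unfolding x'_def by (rule proj_sub[OF proj_adj[OF x y]])
  have ind': "indep X r x'" by (rule dim_indep[OF irr dim fin' x'])
  obtain D' c' where m': "min_eqn X r x' y D' c'" by (rule min_eqn_exists[OF irr fin' x' ind' y])
  \<comment> \<open>Substituting the shear back turns the equation over \<open>x'\<close> into a
    nonzero relation over \<open>x\<close>, to which the minimality of \<open>D\<close>
    applies.\<close>
  have "D \<le> D'"
  proof -
    define H where "H e = e r ^ D' + (\<Sum>j<D'. c' j (\<lambda>i. e i - w i * e r) * e r ^ j)" for e
    have "pf (Suc r) (int D') H"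
      unfolding H_def
    proof (intro pf_add pf_sum)
      show "pf (Suc r) (int D') (\<lambda>e. e r ^ D')" using pf_power[OF pf_var[of r "Suc r" 1], of D'] by simp
      fix j assume "j \<in> {..<D'}"
      then have "pf (Suc r) (int D' - int j) (\<lambda>e. c' j (\<lambda>i. e i - w i * e r))"
        by (intro pf_comp[where F = "c' j" and \<phi> = "\<lambda>e i. e i - w i * e r", OF min_eqnD(2)[OF m']])
          (auto intro!: pf_diff pf_cmult pf_var)
      from pf_mult[OF this pf_power[OF pf_var[of r "Suc r" 1], of j]]
      show "pf (Suc r) (int D') (\<lambda>e. c' j (\<lambda>i. e i - w i * e r) * e r ^ j)" by simp
    qed
    then obtain Q where Q: "\<And>z. H z = poly (Q z) (z r)" "\<And>i. pf r (int D' - int i) (\<lambda>z. coeff (Q z) i)"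
      "\<And>z. dle (int D') (Q z)" by (rule pf_last) (rule that)
    have Qc: "Q z = Q z'" if "\<And>i. i < r \<Longrightarrow> z i = z' i" for z z'
      by (rule poly_eqI) (rule pf_cong[OF Q(2)], rule that)
    obtain b where b: "poly (fpoly D' c' (\<lambda>_. 0)) b \<noteq> 0"
      using poly_ext[of "fpoly D' c' (\<lambda>_. 0)" 0] lead_coeff_fpoly[of D' c' "\<lambda>_. 0"] by force
    have "H (\<lambda>i. w i * b) = poly (fpoly D' c' (\<lambda>_. 0)) b" unfolding H_def poly_fpoly by (simp add: wr)
    then have "Q (\<lambda>i. w i * b) \<noteq> 0" using b Q(1)[of "\<lambda>i. w i * b"] by auto
    then obtain i where i: "coeff (Q (\<lambda>i. w i * b)) i \<noteq> 0" by (meson leading_coeff_0_iff)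
    show ?thesis
    proof (rule min_eqn_min_deg[where h = "\<lambda>j z. coeff (Q z) j" and a = "\<lambda>i. w i * b" and i = i, OF m])
      fix j show "PF r (\<lambda>z. coeff (Q z) j)" by (rule PF_I[OF Q(2)])
    next
      fix z assume "z \<in> X"
      have "c' j (\<lambda>i. adj r x y z i - w i * adj r x y z r) = c' j (x' z)" for j by (rule arg_cong[where f = "c' j"], rule ext) (simp add: x'_def)
      then have "H (adj r x y z) = 0" using min_eqnD(3)[OF m' \<open>z \<in> X\<close>] unfolding H_def by (simp add: adj_def)
      moreover have "Q (adj r x y z) = Q (x z)" by (rule Qc) (simp add: adj_def)
      ultimately have "poly (Q (x z)) (y z) = 0" using Q(1)[of "adj r x y z"] by (simp add: adj_def)
      then show "(\<Sum>j\<le>D'. coeff (Q (x z)) j * y z ^ j) = 0" by (simp add: poly_sum_atMost[OF Q(3)])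
    next
      show "i \<le> D'" using i Q(3)[of "\<lambda>i. w i * b"] unfolding dle_def by (meson not_less of_nat_less_iff)
    qed (rule i)
  qed
  obtain Q where Q: "\<And>x t. poly (Q x) t = F (\<lambda>i. x i + t * w i)" "\<And>i. pf (Suc r) (int D - int i) (\<lambda>x. coeff (Q x) i)"
    "\<And>x. dle (int D) (Q x)" by (rule pf_line_base[OF Fpf, of w]) (rule that)
  have "coeff (Q (\<lambda>_. 0)) D = L w" using L(4) Q(1) by blast
  moreover obtain q where "(\<lambda>x. coeff (Q x) D) = (\<lambda>_. q)" using pf_nonpos_const[OF Q(2)[of D]] by auto
  ultimately have QD: "coeff (Q x) D = L w" for x by metis
  \<comment> \<open>The new equation is \<open>F\<close> along direction \<open>w\<close>, with the
    last coordinate of the base point set to 0, divided by its constant leading coefficient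
    \<open>L w\<close>.\<close>
  define C where "C j a = (1 / L w) * coeff (Q (a(r := 0))) j" for j a
  have Cpf: "pf r (int D - int j) (C j)" for j
    unfolding C_def
    by (rule pf_cmult, rule pf_comp[where F = "\<lambda>x. coeff (Q x) j" and \<phi> = "\<lambda>a. a(r := 0)", OF Q(2)])
      (auto simp: less_Suc_eq intro: pf_var pf_zero)
  have CF: "poly (fpoly D C a) b = (1 / L w) * F (\<lambda>i. (a(r := 0)) i + b * w i)" for a b
  proof -
    have "F (\<lambda>i. (a(r := 0)) i + b * w i) = (\<Sum>j\<le>D. coeff (Q (a(r := 0))) j * b ^ j)"
      unfolding Q(1)[symmetric] by (rule poly_sum_atMost[OF Q(3)])
    then show ?thesis unfolding poly_fpoly C_def using Lw
      by (simp add: sum_atMost_split QD sum_distrib_left algebra_simps)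
  qed
  have "min_eqn X r x' y D C"
    unfolding min_eqn_def
  proof (intro conjI allI impI ballI)
    fix z assume "z \<in> X"
    have "F (\<lambda>i. ((x' z)(r := 0)) i + y z * w i) = F (adj r x y z)"
      by (rule pf_cong[OF Fpf]) (auto simp: x'_def adj_def wr)
    then have "poly (fpoly D C (x' z)) (y z) = 0" unfolding CF using FX[OF \<open>z \<in> X\<close>] by simp
    then show "y z ^ D + (\<Sum>j<D. C j (x' z) * y z ^ j) = 0" by (simp add: poly_fpoly)
  next
    fix h :: "nat \<Rightarrow> (nat \<Rightarrow> 'k) \<Rightarrow> 'k" and j a
    assume h: "\<forall>j<D. PF r (h j)" "\<forall>z\<in>X. (\<Sum>j<D. h j (x' z) * y z ^ j) = 0" and "j < D"
    show "h j a = 0"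
    proof (rule ccontr)
      assume nz: "h j a \<noteq> 0"
      have D: "{..<D} = {..D - 1}" using \<open>0 < D\<close> by auto
      have "D' \<le> D - 1"
        by (rule min_eqn_min_deg[where h = h and a = a and i = j, OF m']) (use h nz \<open>j < D\<close> \<open>0 < D\<close> D in auto)
      then show False using \<open>D \<le> D'\<close> \<open>0 < D\<close> by simp
    qed
  qed (use \<open>0 < D\<close> Cpf in auto)
  \<comment> \<open>The line through \<open>e0\<close> in direction \<open>w\<close> has last
    coordinate 0 at this argument; on it the derivative in \<open>y\<close> is the directional
    derivative chosen above.\<close>
  moreover have "pderiv (fpoly D C (\<lambda>i. e0 i - e0 r * w i)) \<noteq> 0"
  proof -
    let ?f = "fpoly D C (\<lambda>i. e0 i - e0 r * w i)"
    have "smult (1 / L w) (K w) = pcompose ?f [:e0 r, 1:]"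
    proof (rule poly_ext)
      fix t
      have "F (\<lambda>i. ((\<lambda>i. e0 i - e0 r * w i)(r := 0)) i + (e0 r + t) * w i) = F (\<lambda>i. e0 i + t * w i)"
        by (rule pf_cong[OF Fpf]) (auto simp: wr algebra_simps)
      then show "poly (smult (1 / L w) (K w)) t = poly (pcompose ?f [:e0 r, 1:]) t"
        by (simp add: poly_pcompose CF K)
    qed
    then have "coeff (pcompose ?f [:e0 r, 1:]) 1 \<noteq> 0" using Kw Lw by (metis coeff_smult divide_eq_0_iff mult_eq_0_iff zero_neq_one)
    then show ?thesis unfolding coeff_1_shift by auto
  qed
  ultimately show thesis using fin' x' ind' by (intro that) auto
qed

section \<open>Discriminants and the bound for the degree of a minimal equation\<close>

lemma card_roots_fpoly:
  assumes "\<And>b. poly (fpoly D c a) b = 0 \<Longrightarrow> poly (pderiv (fpoly D c a)) b \<noteq> 0"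
  shows "card {b. poly (fpoly D c a) b = (0::'k)} = D"
  using simple_roots_card[of "fpoly D c a", OF _ assms] lead_coeff_fpoly[of D c a] by (force simp: degree_fpoly)

lemma rem_poly_pderiv: "rem_poly D (\<lambda>j a. of_nat (Suc j) * mcoeff D c a (Suc j)) a = pderiv (fpoly D c a)"
  by (rule poly_eqI) (auto simp: rem_poly_def coeff_sum coeff_pderiv coeff_fpoly if_distrib cong: if_cong)

text \<open>The norm of the derivative, which for a monic polynomial is the discriminant up to
  sign.\<close>

definition disc :: "nat \<Rightarrow> (nat \<Rightarrow> (nat \<Rightarrow> 'k) \<Rightarrow> 'k) \<Rightarrow> (nat \<Rightarrow> 'k) \<Rightarrow> 'k" where
  "disc D c a = det (mat D D (\<lambda>(k,j). norm_mat (mcoeff D c a) D (\<lambda>i. of_nat (Suc i) * mcoeff D c a (Suc i)) D k j))"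

lemma discriminant:
  fixes c :: "nat \<Rightarrow> (nat \<Rightarrow> 'k) \<Rightarrow> 'k"
  assumes irr: "prime_eqn r D c"
  shows disc_pf: "pf r (int D * (int D - 1)) (disc D c)"
    and disc_nonzero: "\<exists>a. pderiv (fpoly D c a) \<noteq> 0 \<Longrightarrow> \<exists>a. disc D c a \<noteq> 0"
    and disc_root: "disc D c a \<noteq> 0 \<Longrightarrow> poly (fpoly D c a) b = 0 \<Longrightarrow> poly (pderiv (fpoly D c a)) b \<noteq> 0"
proof -
  have "0 < D" and c: "\<And>j. j < D \<Longrightarrow> pf r (int D - int j) (c j)" using irr unfolding prime_eqn_def by simp_all
  have hpf: "pf r (int D - 1 - int i) (\<lambda>a. of_nat (Suc i) * mcoeff D c a (Suc i))" if "i < D" for i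
  proof (rule pf_cmult)
    show "pf r (int D - 1 - int i) (\<lambda>a. mcoeff D c a (Suc i))"
    proof (cases "Suc i < D")
      case True
      then show ?thesis using c[of "Suc i"] by (simp add: algebra_simps)
    next
      case False
      then have "Suc i = D" using that by simp
      then show ?thesis by (auto intro: pf_const)
    qed
  qed
  show "pf r (int D * (int D - 1)) (disc D c)" unfolding disc_def by (rule norm_pf[OF \<open>0 < D\<close>]) (erule c, erule hpf)
  show "\<exists>a. disc D c a \<noteq> 0" if ex: "\<exists>a. pderiv (fpoly D c a) \<noteq> 0"
    unfolding disc_def
  proof (rule norm_nonzero[OF irr])
    fix j assume "j < D" then show "PF r (\<lambda>a. of_nat (Suc j) * mcoeff D c a (Suc j))" by (rule PF_I[OF hpf])
  next
    from ex obtain a where "rem_poly D (\<lambda>j a. of_nat (Suc j) * mcoeff D c a (Suc j)) a \<noteq> 0" unfolding rem_poly_pderiv by blast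
    then show "\<exists>j<D. \<exists>a. of_nat (Suc j) * mcoeff D c a (Suc j) \<noteq> 0" unfolding rem_poly_def
      by (metis (no_types, lifting) sum.neutral lessThan_iff monom_eq_0)
  qed
  show "poly (pderiv (fpoly D c a)) b \<noteq> 0" if "disc D c a \<noteq> 0" "poly (fpoly D c a) b = 0"
  proof
    assume "poly (pderiv (fpoly D c a)) b = 0"
    then have "(\<Sum>i<D. of_nat (Suc i) * mcoeff D c a (Suc i) * b ^ i) = 0" unfolding rem_poly_pderiv[symmetric] poly_rem_poly .
    from norm_root[OF \<open>0 < D\<close> that(2) this] show False using that(1) unfolding disc_def by simp
  qed
qed

text \<open>After the shear some \<open>a\<close> has nonzero discriminant, hence \<open>D\<close>
  distinct roots. They lift to points of one fibre of \<open>x'\<close> with different values of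
  \<open>y\<close>, and a fibre has at most \<open>d\<close> points.\<close>

theorem min_eqn_degree_le:
  fixes X :: "(nat \<Rightarrow> 'k) set"
  assumes irr: "irreducible_closed n X" and dim: "has_dim n X r" and deg: "has_degree n X r d"
    and fin: "sfin X n r x" and x: "proj n r x" and y: "pf n 1 y" and m: "min_eqn X r x y D c"
  shows "D \<le> d"
proof -
  obtain x' c' where fin': "sfin X n r x'" and x': "proj n r x'" and ind': "indep X r x'"
    and m': "min_eqn X r x' y D c'" and ex: "\<exists>a. pderiv (fpoly D c' a) \<noteq> 0"
    by (rule min_eqn_shear[OF irr dim fin x y m]) (rule that)
  have closed: "zariski_closed n X" using irr unfolding irreducible_closed_def by simp
  have sub: "X \<subseteq> affine_space n" by (rule zariski_closed_subset[OF closed])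
  note irr' = min_eqn_prime[OF irr x' y m']
  obtain a where a: "\<And>b. poly (fpoly D c' a) b = 0 \<Longrightarrow> poly (pderiv (fpoly D c' a)) b \<noteq> 0"
    using disc_nonzero[OF irr' ex] disc_root[OF irr'] by blast
  have "card {b. poly (fpoly D c' a) b = 0} = D" by (rule card_roots_fpoly[OF a])
  moreover have "{b. poly (fpoly D c' a) b = 0} \<subseteq> y ` {z \<in> X. \<forall>j<r. x' z j = a j}"
  proof
    fix b assume "b \<in> {b. poly (fpoly D c' a) b = 0}"
    then have "b ^ D + (\<Sum>j<D. c' j a * b ^ j) = 0" by (simp add: poly_fpoly)
    then obtain P where "P \<in> X" "\<And>j. j < r \<Longrightarrow> x' P j = a j" "y P = b"
      by (rule min_eqn_lift[OF closed fin' x' y m']) (rule that)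
    then show "b \<in> y ` {z \<in> X. \<forall>j<r. x' z j = a j}" by blast
  qed
  then have "card {b. poly (fpoly D c' a) b = 0} \<le> card {z \<in> X. \<forall>j<r. x' z j = a j}"
    using sfin_finite_fibre[OF fin' sub, of a] by (meson card_image_le card_mono finite_imageI le_trans)
  ultimately show ?thesis using fibre_card_le[OF sub deg fin' ind' x', of a] by simp
qed

end

subsection \<open>Rational projections\<close>

definition ratform :: "nat \<Rightarrow> ((nat \<Rightarrow> 'k::field) \<Rightarrow> 'k) \<Rightarrow> bool" where
  "ratform n F \<longleftrightarrow> (\<exists>a. (\<forall>i. a i \<in> prime_subfield) \<and> (\<forall>z. F z = (\<Sum>i<n. a i * z i)))"

lemma ratform_pf: "ratform n F \<Longrightarrow> pf n 1 F"
proof -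
  assume "ratform n F"
  then obtain a where "F = (\<lambda>z. \<Sum>i<n. a i * z i)" unfolding ratform_def by blast
  then show ?thesis using pf_linear by metis
qed

context Fpbar
begin

lemma ratform_var: "i < n \<Longrightarrow> ratform n (\<lambda>z. z i :: 'k)"
  unfolding ratform_def
  by (rule exI[of _ "\<lambda>j. if j = i then 1 else 0"]) (simp add: Fp_closed if_distrib[of "\<lambda>x. x * _"] cong: if_cong)

lemma ratform_comb:
  assumes "ratform n F" "ratform n G" "b \<in> Fp"
  shows "ratform n (\<lambda>z. F z - b * G z)"
proof -
  obtain a a' where "\<forall>i. a i \<in> Fp" "\<forall>z. F z = (\<Sum>i<n. a i * z i)" "\<forall>i. a' i \<in> Fp" "\<forall>z. G z = (\<Sum>i<n. a' i * z i)"
    using assms(1,2) unfolding ratform_def by blast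
  then show ?thesis unfolding ratform_def using assms(3)
    by (intro exI[of _ "\<lambda>i. a i - b * a' i"]) (simp add: Fp_closed sum_distrib_left sum_subtractf algebra_simps)
qed

lemma ratform_frob: "ratform n F \<Longrightarrow> F (\<lambda>i. z i ^ p) = (F z :: 'k) ^ p"
proof -
  assume "ratform n F"
  then obtain a where "\<forall>i. a i \<in> Fp" "\<forall>z. F z = (\<Sum>i<n. a i * z i)" unfolding ratform_def by blast
  then show ?thesis by (simp add: frob_sum power_mult_distrib mem_Fp)
qed

text \<open>Each elimination uses a relation of degree at most \<open>d\<close> between the current forms, found as the equation of
  a hypersurface projection over the big field; its leading form has a nonzero rational point since \<open>d + 1 < p\<close>.\<close>

theorem rational_noether:
  fixes X :: "(nat \<Rightarrow> 'k) set"
  assumes irr: "irreducible_closed n X" and dim: "has_dim n X r" and deg: "has_degree n X r d" and dp: "d + 1 < p"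
  shows "\<exists>x. (\<forall>j<r. ratform n (\<lambda>z. x z j)) \<and> sfin X n r x"
proof -
  have "X \<noteq> {}" using irr unfolding irreducible_closed_def by simp
  have elim: "\<exists>x. (\<forall>j<m. ratform n (\<lambda>z. x z j)) \<and> sfin X n m x"
    if rm: "r \<le> m" and rat: "\<forall>j<Suc m. ratform n (\<lambda>z. \<pi> z j)" and fin: "sfin X n (Suc m) \<pi>" for m \<pi>
  proof -
    have \<pi>: "proj n (Suc m) \<pi>" unfolding proj_def using rat ratform_pf by blast
    have "r < Suc m" using rm by simp
    from noether_linear[OF irr dim fin \<pi> this] obtain la e where
      "sfin X n r (\<lambda>z. la (\<pi> z)) \<and> (\<forall>j<r. pf (Suc m) 1 (\<lambda>c. la c j)) \<and> (\<exists>j<Suc m. e j \<noteq> (0::'k)) \<and>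
        (\<forall>c t. la (\<lambda>i. c i + t * e i) = la c)" by (elim exE)
    then obtain j where la: "sfin X n r (\<lambda>z. la (\<pi> z))" "\<And>j. j < r \<Longrightarrow> pf (Suc m) 1 (\<lambda>c. la c j)"
      and e: "j < Suc m" "e j \<noteq> (0::'k)" "\<And>c t. la (\<lambda>i. c i + t * e i) = la c"
      by (elim conjE exE) simp
    define x where "x z = la (\<pi> z)" for z
    have x: "proj n r x" unfolding proj_def x_def
    proof (intro allI impI)
      fix j assume "j < r"
      show "pf n 1 (\<lambda>z. la (\<pi> z) j)"
        by (rule pf_comp[where F = "\<lambda>c. la c j" and \<phi> = \<pi>, OF la(2)[OF \<open>j < r\<close>]]) (use \<pi> in \<open>simp add: proj_def\<close>)
    qed
    have fin': "sfin X n r x" unfolding x_def by (rule la(1))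
    have y: "pf n 1 (\<lambda>z. \<pi> z j)" using \<pi> e(1) unfolding proj_def by simp
    obtain D c where m: "min_eqn X r x (\<lambda>z. \<pi> z j) D c"
      by (rule min_eqn_exists[OF irr fin' x dim_indep[OF irr dim fin' x] y])
    have "D \<le> d" by (rule min_eqn_degree_le[OF irr dim deg fin' x y m])
    define P where "P E \<longleftrightarrow> (\<exists>F. pf (Suc m) (int E) F \<and> (\<forall>z\<in>X. F (\<pi> z) = 0) \<and> (\<exists>a. F a \<noteq> 0))" for E
    obtain t where t: "poly (fpoly D c (la (\<lambda>_. 0))) t \<noteq> 0"
      using poly_ext[of "fpoly D c (la (\<lambda>_. 0))" 0] lead_coeff_fpoly[of D c "la (\<lambda>_. 0)"] by force
    \<comment> \<open>The minimal equation of \<open>\<pi> z j\<close> over the projection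
      \<open>la\<close> is such a relation. It is not identically zero: along \<open>e\<close> the
      arguments of the coefficients are fixed, while coordinate \<open>j\<close> can be given the
      value \<open>t\<close>.\<close>
    have "P D"
      unfolding P_def
    proof (intro exI conjI ballI)
      let ?F = "\<lambda>b. b j ^ D + (\<Sum>i<D. c i (la b) * b j ^ i)"
      show "pf (Suc m) (int D) ?F"
      proof (intro pf_add pf_sum)
        show "pf (Suc m) (int D) (\<lambda>b. b j ^ D)" using pf_power[OF pf_var[of j "Suc m" 1], of D] e(1) by simp
        fix i assume "i \<in> {..<D}"
        then have "pf (Suc m) (int D - int i) (\<lambda>b. c i (la b))"
          by (intro pf_comp[where F = "c i" and \<phi> = la, OF min_eqnD(2)[OF m]] la(2)) auto
        from pf_mult[OF this pf_power[OF pf_var[of j "Suc m" 1], of i]]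
        show "pf (Suc m) (int D) (\<lambda>b. c i (la b) * b j ^ i)" using e(1) by simp
      qed
      show "?F (\<pi> z) = 0" if "z \<in> X" for z using min_eqnD(3)[OF m that] by (simp add: x_def)
      have "la (\<lambda>i. t / e j * e i) = la (\<lambda>_. 0)" using e(3)[of "\<lambda>_. 0" "t / e j"] by simp
      then show "?F (\<lambda>i. t / e j * e i) \<noteq> 0" using t e(2) by (simp add: poly_fpoly)
    qed
    define E where "E = (LEAST E. P E)"
    have "P E" unfolding E_def using \<open>P D\<close> by (rule LeastI)
    have least: "\<not> P E'" if "E' < E" for E' using that not_less_Least unfolding E_def by blast
    have "E \<le> d" using Least_le[of P, OF \<open>P D\<close>] \<open>D \<le> d\<close> unfolding E_def by simp
    from \<open>P E\<close> obtain F a where F: "pf (Suc m) (int E) F" "\<And>z. z \<in> X \<Longrightarrow> F (\<pi> z) = 0" "F a \<noteq> 0"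
      unfolding P_def by blast
    have "\<not> pf (Suc m) (int E - 1) F"
    proof
      assume pf: "pf (Suc m) (int E - 1) F"
      show False
      proof (cases E)
        case 0
        then show False using pf_neg[OF pf] F(3) by simp
      next
        case (Suc E')
        then have "P E'" unfolding P_def using pf F(2,3) by auto
        then show False using least[of E'] Suc by simp
      qed
    qed
    then obtain L where L: "pf (Suc m) (int E) L" "\<exists>w. L w \<noteq> 0" "\<And>c w. L (\<lambda>i. c * w i) = c ^ E * L w"
      "\<forall>w Q. (\<forall>x t. poly (Q x) t = F (\<lambda>i. x i + t * w i)) \<longrightarrow> coeff (Q (\<lambda>_. 0)) E = L w"
      by (rule pf_top[OF F(1)]) (rule that)
    have var: "pf (Suc m) 1 (\<lambda>w :: nat \<Rightarrow> 'k. w m)" by (rule pf_var) simp_all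
    obtain w0 where "L w0 \<noteq> 0" using L(2) by blast
    then have "\<exists>w. L w \<noteq> 0 \<and> w m \<noteq> 0"
      by (rule PF_common_nonzero[OF infinite_k PF_I[OF L(1)] PF_I[OF var], where w = "\<lambda>_. 1"]) simp
    then obtain w1 where "L w1 * w1 m \<noteq> 0" by auto
    have "int E + 1 < int (card Fp)" using \<open>E \<le> d\<close> dp card_Fp_roots(2) by simp
    from pf_nonzero_grid[OF pf_mult[OF L(1) var] \<open>L w1 * w1 m \<noteq> 0\<close> card_Fp_roots(1) this]
    obtain w where w: "\<forall>i<Suc m. w i \<in> Fp" "L w * w m \<noteq> 0" by blast
    have "sfin X n m (\<lambda>z j. \<pi> z j - (w j / w m) * \<pi> z m)"
      by (rule top_dir_step[OF fin \<open>X \<noteq> {}\<close> F(2) F(1) L(3) L(4)]) (use w in auto)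
    moreover have "ratform n (\<lambda>z. \<pi> z j - (w j / w m) * \<pi> z m)" if "j < m" for j
      by (rule ratform_comb[where F = "\<lambda>z. \<pi> z j" and G = "\<lambda>z. \<pi> z m" and b = "w j / w m"])
        (use rat that w(1) in \<open>simp_all add: Fp_closed\<close>)
    ultimately show ?thesis by (intro exI[of _ "\<lambda>z j. \<pi> z j - (w j / w m) * \<pi> z m"] conjI) auto
  qed
  have "r \<le> n" by (rule dim_le_sfin[OF dim sfin_id]) (simp add: proj_def pf_var)
  have "r \<le> m \<longrightarrow> (\<exists>x. (\<forall>j<m. ratform n (\<lambda>z. x z j)) \<and> sfin X n m x)" if "m \<le> n" for m
    using that
  proof (induction m rule: inc_induct)
    case base
    show ?case by (intro impI exI[of _ "\<lambda>z. z"] conjI allI) (simp_all add: sfin_id ratform_var)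
  next
    case (step m)
    show ?case
    proof
      assume "r \<le> m"
      with step.IH obtain \<pi> where "\<forall>j<Suc m. ratform n (\<lambda>z. \<pi> z j)" "sfin X n (Suc m) \<pi>" by auto
      from elim[OF \<open>r \<le> m\<close> this] show "\<exists>x. (\<forall>j<m. ratform n (\<lambda>z. x z j)) \<and> sfin X n m x" .
    qed
  qed
  then show ?thesis using \<open>r \<le> n\<close> by blast
qed

end

subsection \<open>A rational hypersurface model\<close>

context Fpbar
begin

lemma Fp_points_iff: "z \<in> Fp_points n \<longleftrightarrow> z \<in> affine_space n \<and> (\<forall>i. (z i :: 'k) \<in> Fp)"
proof
  assume z: "z \<in> Fp_points n"
  have "z i \<in> Fp" for i
  proof (cases "i < n")
    case False
    then have "z i = 0" using z unfolding Fp_points_def affine_space_def by simp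
    then show ?thesis using Fp_closed(1) by simp
  qed (use z in \<open>simp add: Fp_points_def\<close>)
  then show "z \<in> affine_space n \<and> (\<forall>i. z i \<in> Fp)" using z by (simp add: Fp_points_def)
qed (simp add: Fp_points_def)

lemma finite_Fp_points: "finite (Fp_points n :: (nat \<Rightarrow> 'k) set)" (is ?fin)
  and card_Fp_points: "card (Fp_points n :: (nat \<Rightarrow> 'k) set) = p ^ n" (is ?card)
proof -
  define h where "h g i = (if i < n then g i else (0::'k))" for g i
  have inj: "inj_on h ({..<n} \<rightarrow>\<^sub>E Fp)"
  proof (rule inj_onI)
    fix f g assume fg: "f \<in> {..<n} \<rightarrow>\<^sub>E Fp" "g \<in> {..<n} \<rightarrow>\<^sub>E Fp" "h f = h g"
    show "f = g"
    proof (rule PiE_ext[OF fg(1,2)])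
      fix i assume "i \<in> {..<n}" then show "f i = g i" using fun_cong[OF fg(3), of i] by (simp add: h_def)
    qed
  qed
  have im: "h ` ({..<n} \<rightarrow>\<^sub>E Fp) = Fp_points n"
  proof
    show "h ` ({..<n} \<rightarrow>\<^sub>E Fp) \<subseteq> Fp_points n"
      unfolding Fp_points_def affine_space_def h_def by (auto simp: PiE_def Pi_def)
    show "Fp_points n \<subseteq> h ` ({..<n} \<rightarrow>\<^sub>E Fp)"
    proof
      fix z :: "nat \<Rightarrow> 'k" assume z: "z \<in> Fp_points n"
      have "z = h (restrict z {..<n})"
        using z unfolding Fp_points_def affine_space_def h_def by (intro ext) auto
      moreover have "restrict z {..<n} \<in> {..<n} \<rightarrow>\<^sub>E Fp" using z unfolding Fp_points_def by auto
      ultimately show "z \<in> h ` ({..<n} \<rightarrow>\<^sub>E Fp)" by blast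
    qed
  qed
  have "finite ({..<n} \<rightarrow>\<^sub>E (Fp :: 'k set))" by (rule finite_PiE) (use card_Fp_roots in auto)
  then show ?fin unfolding im[symmetric] by (rule finite_imageI)
  show ?card unfolding im[symmetric] card_image[OF inj] by (simp add: card_PiE card_Fp_roots(2))
qed

lemma pf_prod_nonzero:
  fixes F :: "'a \<Rightarrow> (nat \<Rightarrow> 'k) \<Rightarrow> 'k"
  assumes "finite A" "\<And>i. i \<in> A \<Longrightarrow> PF n (F i)" "\<And>i. i \<in> A \<Longrightarrow> \<exists>z. F i z \<noteq> 0"
  shows "\<exists>z. (\<Prod>i\<in>A. F i z) \<noteq> 0"
  using assms
proof (induction A rule: finite_induct)
  case (insert i A)
  then obtain z where z: "(\<Prod>i\<in>A. F i z) \<noteq> 0" by blast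
  obtain w where w: "F i w \<noteq> 0" using insert.prems(2) by blast
  have "PF n (\<lambda>z. \<Prod>i\<in>A. F i z)" by (rule PF_prod) (use insert.prems(1) in blast)
  from PF_common_nonzero[OF infinite_k this insert.prems(1)[of i] z w] show ?case
    using insert.hyps by auto
qed simp

text \<open>\<open>G\<close> carries the \<open>p\<close>-th roots of the coefficients of
  \<open>F\<close>. Comparing the two on a set stable under Frobenius will show that a rational
  minimal equation is compatible with Frobenius.\<close>

lemma pf_twist:
  fixes F :: "(nat \<Rightarrow> 'k) \<Rightarrow> 'k"
  assumes "pf n D F" shows "\<exists>G. pf n D G \<and> (\<forall>z. F (\<lambda>i. z i ^ p) = G z ^ p)"
  using assms
proof induction
  case (pf_zero D)
  show ?case by (intro exI[of _ "\<lambda>_. 0"] conjI pf.pf_zero) (use p_gt_1 in auto)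
next
  case (pf_const D c)
  obtain g where "g ^ p = c" using frob_surj by blast
  then show ?case using pf_const by (intro exI[of _ "\<lambda>_. g"] conjI pf.pf_const) auto
next
  case (pf_var i D)
  then show ?case by (intro exI[of _ "\<lambda>z. z i"] conjI pf.pf_var) auto
next
  case (pf_add D F G)
  then obtain F' G' where "pf n D F'" "\<forall>z. F (\<lambda>i. z i ^ p) = F' z ^ p" "pf n D G'" "\<forall>z. G (\<lambda>i. z i ^ p) = G' z ^ p"
    by blast
  then show ?case by (intro exI[of _ "\<lambda>z. F' z + G' z"] conjI pf.pf_add) (auto simp: frob_add)
next
  case (pf_mult D F E G)
  then obtain F' G' where "pf n D F'" "\<forall>z. F (\<lambda>i. z i ^ p) = F' z ^ p" "pf n E G'" "\<forall>z. G (\<lambda>i. z i ^ p) = G' z ^ p"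
    by blast
  then show ?case by (intro exI[of _ "\<lambda>z. F' z * G' z"] conjI pf.pf_mult) (auto simp: power_mult_distrib)
qed

lemma frob_variety:
  fixes X :: "(nat \<Rightarrow> 'k) set"
  assumes "Fp_variety n X" "z \<in> X"
  shows "(\<lambda>i. z i ^ p) \<in> X"
proof -
  obtain S where S: "\<forall>f\<in>S. \<forall>m. Poly_Mapping.lookup f m \<in> Fp" and X: "X = zero_set n S"
    using assms(1) unfolding Fp_variety_def by blast
  have "mpeval f (\<lambda>i. z i ^ p) = mpeval f z ^ p" if "f \<in> S" for f
  proof -
    have "(Poly_Mapping.lookup f m * (\<Prod>i\<in>Poly_Mapping.keys m. z i ^ Poly_Mapping.lookup m i)) ^ p
      = Poly_Mapping.lookup f m * (\<Prod>i\<in>Poly_Mapping.keys m. (z i ^ p) ^ Poly_Mapping.lookup m i)" for m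
    proof -
      have "Poly_Mapping.lookup f m ^ p = Poly_Mapping.lookup f m" using S that mem_Fp by blast
      then show ?thesis by (simp add: power_mult_distrib prod_power_distrib power_mult[symmetric] mult.commute)
    qed
    then show ?thesis unfolding mpeval_def frob_sum by simp
  qed
  then show ?thesis using assms(2) p_gt_1 unfolding X zero_set_def affine_space_def by auto
qed

text \<open>The hypersurface \<open>f(a, b) = 0\<close> is the image of \<open>X\<close> under a rational projection \<open>(x, y)\<close> which is
  injective on the largest fibre of \<open>x\<close>. Hence \<open>D\<close> is the generic size of the fibres, a point with nonvanishing
  discriminant has a unique preimage, and this preimage is rational if the point is.\<close>

theorem rational_model:
  fixes X :: "(nat \<Rightarrow> 'k) set"
  assumes irr: "irreducible_closed n X" and Fp: "Fp_variety n X" and dim: "has_dim n X r"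
    and deg: "has_degree n X r d" and dp: "d + 1 < p" "d * d < p"
  obtains D c where "prime_eqn r D c" "D \<le> d" "\<And>j a. j < D \<Longrightarrow> c j (\<lambda>i. a i ^ p) = c j a ^ p" "\<exists>a. disc D c a \<noteq> 0"
    "card {(a, b). a \<in> Fp_points r \<and> b \<in> Fp \<and> disc D c a \<noteq> 0 \<and> poly (fpoly D c a) b = 0} \<le> card (X \<inter> Fp_points n)"
proof -
  have closed: "zariski_closed n X" and "X \<noteq> {}" using irr unfolding irreducible_closed_def by simp_all
  have sub: "X \<subseteq> affine_space n" by (rule zariski_closed_subset[OF closed])
  obtain x where rat: "\<forall>j<r. ratform n (\<lambda>z. x z j)" and fin: "sfin X n r x"
    using rational_noether[OF irr dim deg dp(1)] by blast
  have x: "proj n r x" unfolding proj_def using rat ratform_pf by blast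
  have ind: "indep X r x" by (rule dim_indep[OF irr dim fin x])
  define fib where "fib a = {z \<in> X. \<forall>j<r. x z j = a j}" for a
  have fibfin: "finite (fib a)" for a unfolding fib_def by (rule sfin_finite_fibre[OF fin sub])
  have fibd: "card (fib a) \<le> d" for a unfolding fib_def by (rule fibre_card_le[OF sub deg fin ind x])
  have "\<exists>a. \<forall>b. card (fib b) \<le> card (fib a)"
  proof -
    have f: "finite (range (\<lambda>a. card (fib a)))" by (rule finite_subset[of _ "{..d}"]) (use fibd in auto)
    then have "Max (range (\<lambda>a. card (fib a))) \<in> range (\<lambda>a. card (fib a))" by (rule Max_in) simp
    then obtain a where a: "Max (range (\<lambda>a. card (fib a))) = card (fib a)" by blast
    have "card (fib b) \<le> card (fib a)" for b unfolding a[symmetric] by (rule Max_ge[OF f]) blast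
    then show ?thesis by blast
  qed
  then obtain a0 where a0: "\<And>b. card (fib b) \<le> card (fib a0)" by blast
  obtain w where w: "\<And>i. w i \<in> Fp" and sep: "\<And>z z'. z \<in> fib a0 \<Longrightarrow> z' \<in> fib a0 \<Longrightarrow> z \<noteq> z' \<Longrightarrow>
    (\<Sum>i<n. w i * z i) \<noteq> (\<Sum>i<n. w i * z' i)"
  proof -
    \<comment> \<open>Each pair of distinct points of the fibre excludes the forms \<open>w\<close>
      in one hyperplane. There are at most \<open>d * d < p\<close> pairs, so some rational form
      separates all of them.\<close>
    define A where "A = {(z, z') \<in> fib a0 \<times> fib a0. z \<noteq> z'}"
    have A: "finite A" "card A \<le> d * d"
    proof -
      have s: "A \<subseteq> fib a0 \<times> fib a0" unfolding A_def by auto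
      then show "finite A" using fibfin by (meson finite_SigmaI finite_subset)
      have "card A \<le> card (fib a0 \<times> fib a0)" by (rule card_mono[OF _ s]) (use fibfin in auto)
      also have "\<dots> \<le> d * d" unfolding card_cartesian_product by (rule mult_le_mono) (use fibd in auto)
      finally show "card A \<le> d * d" .
    qed
    define \<delta> where "\<delta> q w = (\<Sum>i<n. (fst q i - snd q i) * w i)" for q :: "(nat \<Rightarrow> 'k) \<times> (nat \<Rightarrow> 'k)" and w
    have \<delta>pf: "pf n 1 (\<delta> q)" for q unfolding \<delta>_def by (rule pf_linear)
    have pf: "pf n (int (card A)) (\<lambda>w. \<Prod>q\<in>A. \<delta> q w)" using pf_prod[OF A(1), of n "\<lambda>_. 1" \<delta>] \<delta>pf by simp
    have "\<exists>w. \<delta> q w \<noteq> 0" if "q \<in> A" for q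
    proof -
      have aff: "fst q \<in> affine_space n" "snd q \<in> affine_space n" and ne: "fst q \<noteq> snd q"
        using that sub unfolding A_def fib_def by auto
      have "\<exists>i<n. fst q i \<noteq> snd q i"
      proof (rule ccontr)
        assume neg: "\<not> ?thesis"
        have "fst q i = snd q i" for i
          by (cases "i < n") (use neg aff in \<open>auto simp: affine_space_def\<close>)
        then show False using ne by blast
      qed
      then obtain i where i: "i < n" "fst q i \<noteq> snd q i" by blast
      have "\<delta> q (\<lambda>j. if j = i then 1 else 0) = fst q i - snd q i"
        unfolding \<delta>_def using i(1) by (simp add: if_distrib cong: if_cong)
      then show ?thesis using i(2) by (intro exI[of _ "\<lambda>j. if j = i then 1 else 0"]) simp
    qed
    then have "\<exists>w. (\<Prod>q\<in>A. \<delta> q w) \<noteq> 0" by (rule pf_prod_nonzero[where F = \<delta>, OF A(1) PF_I[OF \<delta>pf]])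
    then obtain w0 where "(\<Prod>q\<in>A. \<delta> q w0) \<noteq> 0" ..
    moreover have "int (card A) < int (card Fp)" using A(2) dp(2) card_Fp_roots(2) by linarith
    ultimately obtain w where w: "\<forall>i<n. w i \<in> Fp" "\<forall>i\<ge>n. w i = 0" "(\<Prod>q\<in>A. \<delta> q w) \<noteq> 0"
      using pf_nonzero_grid[OF pf, of w0 Fp] card_Fp_roots(1) by auto
    show thesis
    proof (rule that)
      show "w i \<in> Fp" for i using w(1,2) Fp_closed(1) by (cases "i < n") auto
      fix z z' assume "z \<in> fib a0" "z' \<in> fib a0" "z \<noteq> z'"
      then have "\<delta> (z, z') w \<noteq> 0" using w(3) A(1) by (auto simp: A_def)
      then show "(\<Sum>i<n. w i * z i) \<noteq> (\<Sum>i<n. w i * z' i)"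
        unfolding \<delta>_def by (auto simp: left_diff_distrib sum_subtractf mult.commute[of "w _"])
    qed
  qed
  define y where "y z = (\<Sum>i<n. w i * z i)" for z
  have yrat: "ratform n y" unfolding ratform_def y_def using w by blast
  have y: "pf n 1 y" by (rule ratform_pf[OF yrat])
  obtain D c where m: "min_eqn X r x y D c" by (rule min_eqn_exists[OF irr fin x ind y])
  have "D \<le> d" by (rule min_eqn_degree_le[OF irr dim deg fin x y m])
  have "0 < D" by (rule min_eqnD(1)[OF m])
  note prime_eqn = min_eqn_prime[OF irr x y m]
  have root: "poly (fpoly D c a) (y z) = 0" if "z \<in> fib a" for a z
  proof -
    have "z \<in> X" and xz: "\<And>j. j < r \<Longrightarrow> x z j = a j" using that unfolding fib_def by auto
    have "c j (x z) = c j a" if "j < D" for j by (rule pf_cong[OF min_eqnD(2)[OF m that] xz])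
    then show ?thesis using min_eqnD(3)[OF m \<open>z \<in> X\<close>] by (simp add: poly_fpoly)
  qed
  have onto: "\<exists>P\<in>fib a. y P = b" if "poly (fpoly D c a) b = 0" for a b
  proof -
    have "b ^ D + (\<Sum>j<D. c j a * b ^ j) = 0" using that by (simp add: poly_fpoly)
    then obtain P where "P \<in> X" "\<And>j. j < r \<Longrightarrow> x P j = a j" "y P = b"
      by (rule min_eqn_lift[OF closed fin x y m]) (rule that)
    then show ?thesis unfolding fib_def by blast
  qed
  have nzf: "fpoly D c a \<noteq> 0" for a using lead_coeff_fpoly[of D c a] by auto
  have "card (fib a0) \<le> D"
  proof -
    have "inj_on y (fib a0)" using sep unfolding inj_on_def y_def by blast
    then have "card (fib a0) = card (y ` fib a0)" by (simp add: card_image)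
    also have "\<dots> \<le> card {b. poly (fpoly D c a0) b = 0}"
      by (rule card_mono) (use root poly_roots_finite[OF nzf] in auto)
    also have "\<dots> \<le> D" using card_poly_roots_bound[OF nzf[of a0]] by (simp add: degree_fpoly)
    finally show ?thesis .
  qed
  have fibD: "card (fib a) \<le> D" for a using a0[of a] \<open>card (fib a0) \<le> D\<close> by simp
  have inj: "inj_on y (fib a)" if "disc D c a \<noteq> 0" for a
  proof (rule eq_card_imp_inj_on[OF fibfin])
    have "card {b. poly (fpoly D c a) b = 0} = D" by (rule card_roots_fpoly[OF disc_root[OF prime_eqn that]])
    moreover have "y ` fib a = {b. poly (fpoly D c a) b = 0}" using root onto by blast
    ultimately show "card (y ` fib a) = card (fib a)" using fibD[of a] card_image_le[OF fibfin, of y a] by simp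
  qed
  \<comment> \<open>The equation with the twisted coefficients \<open>G j\<close> vanishes on
    \<open>X\<close> as well, since \<open>X\<close> is stable under Frobenius and \<open>x\<close>,
    \<open>y\<close> are rational. By minimality it is the same equation.\<close>
  have tw: "c j (\<lambda>i. a i ^ p) = c j a ^ p" if "j < D" for j a
  proof -
    have "\<forall>j\<in>{..<D}. \<exists>G. pf r (int D - int j) G \<and> (\<forall>z. c j (\<lambda>i. z i ^ p) = G z ^ p)"
      using pf_twist min_eqnD(2)[OF m] by blast
    from bchoice[OF this] obtain G where
      "\<forall>j\<in>{..<D}. pf r (int D - int j) (G j) \<and> (\<forall>z. c j (\<lambda>i. z i ^ p) = G j z ^ p)" ..
    then have G: "\<And>j. j < D \<Longrightarrow> pf r (int D - int j) (G j)" "\<And>j z. j < D \<Longrightarrow> c j (\<lambda>i. z i ^ p) = G j z ^ p" by simp_all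
    have "G j a - c j a = 0"
    proof (rule min_eqnD(4)[where h = "\<lambda>j a. G j a - c j a", OF m])
      fix j assume "j < D"
      then show "PF r (\<lambda>a. G j a - c j a)" by (intro PF_diff PF_I[OF G(1)] PF_I[OF min_eqnD(2)[OF m]])
    next
      fix z assume z: "z \<in> X"
      have "x (\<lambda>i. z i ^ p) j = x z j ^ p" if "j < r" for j using ratform_frob rat that by blast
      then have "c j (x (\<lambda>i. z i ^ p)) = c j (\<lambda>i. x z i ^ p)" if "j < D" for j
        by (intro pf_cong[OF min_eqnD(2)[OF m that]]) auto
      then have "c j (x (\<lambda>i. z i ^ p)) = G j (x z) ^ p" if "j < D" for j using that G(2) by simp
      moreover have "y (\<lambda>i. z i ^ p) = y z ^ p" by (rule ratform_frob[OF yrat])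
      ultimately have "(y z ^ D + (\<Sum>j<D. G j (x z) * y z ^ j)) ^ p = 0"
        using min_eqnD(3)[OF m frob_variety[OF Fp z]]
        by (simp add: frob_add frob_sum power_mult_distrib power_mult[symmetric] mult.commute)
      then have "y z ^ D + (\<Sum>j<D. G j (x z) * y z ^ j) = 0" by simp
      then have "(\<Sum>j<D. G j (x z) * y z ^ j) = (\<Sum>j<D. c j (x z) * y z ^ j)"
        using min_eqnD(3)[OF m z] by (metis add_left_cancel)
      then show "(\<Sum>j<D. (G j (x z) - c j (x z)) * y z ^ j) = 0" by (simp add: left_diff_distrib sum_subtractf)
    qed (rule that)
    then show ?thesis using G(2)[OF that] by simp
  qed
  \<comment> \<open>Since \<open>D \<le> d < p\<close>, the coefficient \<open>D\<close> of
    \<open>y ^ (D - 1)\<close> in the derivative is nonzero.\<close>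
  have "\<exists>a. pderiv (fpoly D c a) \<noteq> 0"
  proof -
    have "\<not> p dvd D" using \<open>0 < D\<close> \<open>D \<le> d\<close> dp(1) by (auto dest: dvd_imp_le)
    then have "(of_nat D :: 'k) \<noteq> 0" by (simp add: of_nat_eq_0_iff_char_dvd char_k)
    moreover have "coeff (pderiv (fpoly D c (\<lambda>_. 0))) (D - 1) = of_nat D"
      using \<open>0 < D\<close> by (simp add: coeff_pderiv coeff_fpoly)
    ultimately show ?thesis by (intro exI[of _ "\<lambda>_. 0"]) auto
  qed
  then have "\<exists>a. disc D c a \<noteq> 0" by (rule disc_nonzero[OF prime_eqn])
  moreover have "card {(a, b). a \<in> Fp_points r \<and> b \<in> Fp \<and> disc D c a \<noteq> 0 \<and> poly (fpoly D c a) b = 0} \<le> card (X \<inter> Fp_points n)"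
  proof -
    let ?N = "{(a, b). a \<in> Fp_points r \<and> b \<in> Fp \<and> disc D c a \<noteq> 0 \<and> poly (fpoly D c a) b = 0}"
    have "\<forall>q\<in>?N. \<exists>P. P \<in> fib (fst q) \<and> y P = snd q" using onto by auto
    from bchoice[OF this] obtain h where h: "\<forall>q\<in>?N. h q \<in> fib (fst q) \<and> y (h q) = snd q" ..
    have "inj_on h ?N"
    proof (rule inj_onI)
      fix q q' assume q: "q \<in> ?N" "q' \<in> ?N" "h q = h q'"
      note hq = h[rule_format, OF q(1)] h[rule_format, OF q(2)]
      have "fst q j = fst q' j" for j
      proof (cases "j < r")
        case True
        have "x (h q) j = fst q j" "x (h q') j = fst q' j" using hq True unfolding fib_def by auto
        then show ?thesis using q(3) by simp
      next
        case False
        then show ?thesis using q unfolding Fp_points_def affine_space_def by auto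
      qed
      then have "fst q = fst q'" by auto
      moreover have "snd q = snd q'" using hq q(3) by simp
      ultimately show "q = q'" by (rule prod_eqI)
    qed
    moreover have "h ` ?N \<subseteq> X \<inter> Fp_points n"
    proof
      fix P assume "P \<in> h ` ?N"
      then obtain q where qN: "q \<in> ?N" and P_def: "P = h q" by blast
      obtain a b where ab: "q = (a, b)" by (rule prod.exhaust)
      have q: "a \<in> Fp_points r" "b \<in> Fp" "disc D c a \<noteq> 0" using qN ab by auto
      have P: "P \<in> fib a" "y P = b" using h[rule_format, OF qN] unfolding P_def ab by simp_all
      \<comment> \<open>The Frobenius image of \<open>P\<close> lies over the same rational point
        \<open>(a, b)\<close>, and only one point of \<open>X\<close> lies there.\<close>
      let ?P = "\<lambda>i. P i ^ p"
      have "P \<in> X" and xP: "\<And>j. j < r \<Longrightarrow> x P j = a j" using P unfolding fib_def by auto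
      have "?P \<in> X" by (rule frob_variety[OF Fp \<open>P \<in> X\<close>])
      moreover have "x ?P j = a j" if "j < r" for j
      proof -
        have "x ?P j = x P j ^ p" using ratform_frob rat that by blast
        then show ?thesis using xP[OF that] q(1) by (simp add: Fp_points_iff mem_Fp)
      qed
      ultimately have "?P \<in> fib a" unfolding fib_def by blast
      moreover have "y ?P = y P" using ratform_frob[OF yrat, of P] P(2) q(2) by (simp add: mem_Fp)
      ultimately have "?P = P" using inj[OF q(3)] P(1) by (meson inj_onD)
      then have "P i \<in> Fp" for i unfolding mem_Fp by (rule fun_cong)
      then show "P \<in> X \<inter> Fp_points n" using \<open>P \<in> X\<close> sub by (auto simp: Fp_points_iff)
    qed
    ultimately show ?thesis using finite_Fp_points by (intro card_inj_on_le[of h]) auto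
  qed
  ultimately show thesis using prime_eqn \<open>D \<le> d\<close> tw by (intro that) auto
qed

end

no_notation vec_index (infixl "$" 100)
unbundle fps_syntax

subsection \<open>Power series: evaluation of polynomials and Hensel's lemma\<close>

text \<open>Multiplying \<open>M v = e u\<close> by the adjugate of \<open>M\<close> turns the left
  side into \<open>det M * v\<close>.\<close>

lemma eigen_dvd:
  fixes M :: "nat \<Rightarrow> nat \<Rightarrow> 'a::idom"
  assumes M: "\<And>k. k < N \<Longrightarrow> (\<Sum>j<N. M k j * v j) = e * u k" and "j < N"
  shows "e dvd det (mat N N (\<lambda>(k,j). M k j)) * v j"
proof -
  let ?M = "mat N N (\<lambda>(k,j). M k j)"
  have car: "?M \<in> carrier_mat N N" by simp
  have Mv: "?M *\<^sub>v vec N v = e \<cdot>\<^sub>v vec N u"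
  proof (rule eq_vecI)
    fix k assume "k < dim_vec (e \<cdot>\<^sub>v vec N u)"
    then have "k < N" by simp
    then show "vec_index (?M *\<^sub>v vec N v) k = vec_index (e \<cdot>\<^sub>v vec N u) k"
      using M[of k] by (simp add: scalar_prod_def atLeast0LessThan)
  qed simp
  have "det ?M \<cdot>\<^sub>v vec N v = adj_mat ?M *\<^sub>v (?M *\<^sub>v vec N v)"
  proof -
    have "adj_mat ?M *\<^sub>v (?M *\<^sub>v vec N v) = (adj_mat ?M * ?M) *\<^sub>v vec N v"
      by (rule assoc_mult_mat_vec[symmetric, OF adj_mat(1)[OF car] car]) simp
    also have "\<dots> = det ?M \<cdot>\<^sub>v vec N v"
      unfolding adj_mat(3)[OF car] by (rule eq_vecI) (auto simp: scalar_prod_def mult_delta_left mult_delta_right)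
    finally show ?thesis by simp
  qed
  also have "\<dots> = e \<cdot>\<^sub>v (adj_mat ?M *\<^sub>v vec N u)"
    unfolding Mv by (rule eq_vecI)
      (use carrier_matD[OF adj_mat(1)[OF car]] in \<open>auto simp: scalar_prod_def sum_distrib_left mult_ac\<close>)
  finally have "vec_index (det ?M \<cdot>\<^sub>v vec N v) j = vec_index (e \<cdot>\<^sub>v (adj_mat ?M *\<^sub>v vec N u)) j" by simp
  then have "det ?M * v j = e * vec_index (adj_mat ?M *\<^sub>v vec N u) j"
    using \<open>j < N\<close> adj_mat(1)[OF car] by simp
  then show ?thesis by simp
qed

lemma red_hom:
  assumes "comm_ring_hom \<phi>"
  shows "\<phi> (red w D n j) = red (\<lambda>j. \<phi> (w j)) D n j"
proof -
  interpret comm_ring_hom \<phi> by fact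
  show ?thesis by (induction n arbitrary: j) (auto simp: hom_distribs)
qed

lemma norm_mat_hom:
  assumes "comm_ring_hom \<phi>"
  shows "\<phi> (norm_mat w D h L k j) = norm_mat (\<lambda>j. \<phi> (w j)) D (\<lambda>i. \<phi> (h i)) L k j"
proof -
  interpret comm_ring_hom \<phi> by fact
  show ?thesis unfolding norm_mat_def by (simp add: hom_distribs red_hom[OF assms])
qed

lemma hom_det_mat:
  assumes "comm_ring_hom \<phi>"
  shows "\<phi> (det (mat N N (\<lambda>(i,j). m i j))) = det (mat N N (\<lambda>(i,j). \<phi> (m i j)))"
proof -
  interpret comm_ring_hom \<phi> by fact
  have "map_mat \<phi> (mat N N (\<lambda>(i,j). m i j)) = mat N N (\<lambda>(i,j). \<phi> (m i j))" by (rule eq_matI) auto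
  then show ?thesis using hom_det[of "mat N N (\<lambda>(i,j). m i j)"] by simp
qed

definition ev1 :: "'a::comm_ring_1 fps \<Rightarrow> 'a poly \<Rightarrow> 'a fps" where
  "ev1 x q = poly (map_poly fps_const q) x"

lemma ev1_hom: "comm_ring_hom (ev1 x)"
proof -
  interpret h: comm_ring_hom "fps_const :: 'a \<Rightarrow> 'a fps" by unfold_locales simp_all
  interpret m: map_poly_comm_ring_hom "fps_const :: 'a \<Rightarrow> 'a fps" ..
  show ?thesis unfolding ev1_def by unfold_locales (simp_all add: m.hom_add m.hom_mult)
qed

lemma ev1_0 [simp]: "ev1 x 0 = 0" and ev1_1 [simp]: "ev1 x 1 = 1" and ev1_add: "ev1 x (q + q') = ev1 x q + ev1 x q'"
  and ev1_mult: "ev1 x (q * q') = ev1 x q * ev1 x q'"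
proof -
  interpret comm_ring_hom "ev1 x" by (rule ev1_hom)
  show "ev1 x 0 = 0" "ev1 x 1 = 1" "ev1 x (q + q') = ev1 x q + ev1 x q'" "ev1 x (q * q') = ev1 x q * ev1 x q'"
    by (simp_all add: hom_distribs)
qed

lemma ev1_sum: "ev1 x (\<Sum>i\<in>A. f i) = (\<Sum>i\<in>A. ev1 x (f i))"
  by (induction A rule: infinite_finite_induct) (simp_all add: ev1_add)

lemma ev1_pCons: "ev1 x (pCons a q) = fps_const a + x * ev1 x q"
proof -
  have "map_poly fps_const (pCons a q) = pCons (fps_const a) (map_poly fps_const q)"
    by (rule poly_eqI) (simp add: coeff_map_poly coeff_pCons split: nat.splits)
  then show ?thesis by (simp add: ev1_def)
qed

lemma ev1_monom: "ev1 x (monom a n) = fps_const a * x ^ n"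
  by (induction n) (simp_all add: monom_0 monom_Suc ev1_pCons mult_ac)

lemma ev1_nth_0: "ev1 x q $ 0 = poly q (x $ 0)"
  by (induction q) (simp_all add: ev1_pCons)

lemma ev1_fps_X: "ev1 fps_X q $ i = coeff q i"
  by (induction q arbitrary: i) (simp_all add: ev1_pCons coeff_pCons split: nat.splits)

lemma fps_X_power_dvd_iff: "fps_X ^ m dvd F \<longleftrightarrow> (\<forall>i<m. F $ i = 0)" for F :: "'a::comm_ring_1 fps"
proof
  assume "fps_X ^ m dvd F"
  then obtain G where "F = fps_X ^ m * G" by (rule dvdE)
  then show "\<forall>i<m. F $ i = 0" by (simp add: fps_X_power_mult_nth)
next
  assume "\<forall>i<m. F $ i = 0"
  then have "F = fps_X ^ m * Abs_fps (\<lambda>i. F $ (i + m))"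
    by (intro fps_ext) (simp add: fps_X_power_mult_nth)
  then show "fps_X ^ m dvd F" by (rule dvdI)
qed

lemma fps_X_power_dvd_ev1:
  fixes Q :: "'a::field poly"
  assumes "Q \<noteq> 0" "fps_X ^ m dvd ev1 (fps_const a + fps_X) Q"
  shows "m \<le> order a Q"
proof (rule ccontr)
  assume "\<not> m \<le> order a Q"
  then have lt: "order a Q < m" by simp
  obtain R where R: "Q = [:-a, 1:] ^ order a Q * R" "\<not> [:-a, 1:] dvd R" using order_decomp[OF assms(1)] by blast
  interpret comm_ring_hom "ev1 (fps_const a + fps_X)" by (rule ev1_hom)
  have "ev1 (fps_const a + fps_X) Q = (ev1 (fps_const a + fps_X) [:-a, 1:]) ^ order a Q * ev1 (fps_const a + fps_X) R"
    by (subst R(1)) (simp add: hom_distribs)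
  also have "ev1 (fps_const a + fps_X) [:-a, 1:] = fps_X" by (simp add: ev1_pCons fps_const_neg[symmetric] del: fps_const_neg)
  finally have "ev1 (fps_const a + fps_X) Q $ order a Q = poly R a" by (simp add: fps_X_power_mult_nth ev1_nth_0)
  moreover have "poly R a \<noteq> 0" using R(2) by (simp add: poly_eq_0_iff_dvd)
  ultimately show False using assms(2) lt unfolding fps_X_power_dvd_iff by simp
qed

lemma poly_taylor:
  fixes P :: "'a::idom poly"
  shows "\<exists>s. poly P (x + h) = poly P x + h * poly (pderiv P) x + h ^ 2 * s"
proof (induction P)
  case 0
  then show ?case by (intro exI[of _ 0]) simp
next
  case (pCons a P)
  then obtain s where "poly P (x + h) = poly P x + h * poly (pderiv P) x + h ^ 2 * s" by blast
  then show ?case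
    by (intro exI[of _ "poly (pderiv P) x + x * s + h * s"]) (simp add: pderiv_pCons algebra_simps power2_eq_square)
qed

lemma fps_poly_cong:
  fixes x y :: "'a::comm_ring_1 fps"
  assumes "\<And>i. i \<le> n \<Longrightarrow> x $ i = y $ i" "i \<le> n"
  shows "poly P x $ i = poly P y $ i"
  using assms(2)
proof (induction P arbitrary: i)
  case (pCons c P)
  have "(x * poly P x) $ i = (y * poly P y) $ i"
    unfolding fps_mult_nth by (rule sum.cong[OF refl]) (use assms(1) pCons in auto)
  then show ?case by simp
qed simp

text \<open>One coefficient is corrected per step, always dividing by the same residue
  \<open>\<delta>\<close> of the derivative. This keeps the coefficients of the root polynomial in
  those of \<open>P\<close>, up to powers of \<open>\<delta>\<close>; \<open>graded_hroot\<close>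
  relies on it.\<close>

primrec hens :: "'a::field fps poly \<Rightarrow> 'a \<Rightarrow> 'a \<Rightarrow> nat \<Rightarrow> 'a fps" where
  "hens P \<delta> b 0 = fps_const b"
| "hens P \<delta> b (Suc n) = hens P \<delta> b n - fps_const (poly P (hens P \<delta> b n) $ Suc n / \<delta>) * fps_X ^ Suc n"

text \<open>Coefficient \<open>i\<close> no longer changes after step \<open>i\<close>, so the limit
  is read off along the diagonal.\<close>

definition hroot :: "'a::field fps poly \<Rightarrow> 'a \<Rightarrow> 'a fps" where
  "hroot P b = Abs_fps (\<lambda>i. hens P (poly (pderiv P) (fps_const b) $ 0) b i $ i)"

theorem hensel:
  fixes P :: "'a::field fps poly"
  assumes "poly P (fps_const b) $ 0 = 0" "poly (pderiv P) (fps_const b) $ 0 \<noteq> 0"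
  shows "poly P (hroot P b) = 0" "hroot P b $ 0 = b"
proof -
  define \<delta> where "\<delta> = poly (pderiv P) (fps_const b) $ 0"
  have nth: "hens P \<delta> b (Suc n) $ i = (if i = Suc n then hens P \<delta> b n $ i - poly P (hens P \<delta> b n) $ Suc n / \<delta> else hens P \<delta> b n $ i)"
    for n i by (simp del: power_Suc)
  have low: "hens P \<delta> b (n + m) $ i = hens P \<delta> b n $ i" if "i \<le> n" for n m i
    by (induction m) (use that nth in auto)
  have h0: "hens P \<delta> b n $ 0 = b" for n using low[of 0 0 n] by simp
  have zero: "i \<le> n \<Longrightarrow> poly P (hens P \<delta> b n) $ i = 0" for n i
  proof (induction n arbitrary: i)
    case 0
    then show ?case using assms(1) by simp
  next
    case (Suc n)
    define x where "x = hens P \<delta> b n"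
    define e where "e = poly P x $ Suc n / \<delta>"
    define h where "h = fps_X ^ Suc n * fps_const (- e)"
    have x': "hens P \<delta> b (Suc n) = x + h" by (simp add: x_def h_def e_def mult.commute fps_const_neg[symmetric] del: fps_const_neg)
    obtain s where s: "poly P (x + h) = poly P x + h * poly (pderiv P) x + h ^ 2 * s" using poly_taylor by blast
    have "h ^ 2 * s = fps_X ^ Suc n * (fps_X ^ Suc n * (fps_const (- e) ^ 2 * s))"
      by (simp only: h_def power_mult_distrib power2_eq_square mult_ac)
    then have h2: "(h ^ 2 * s) $ i = 0"
      using Suc.prems by (simp only: fps_X_power_mult_nth) (auto simp: fps_X_power_mult_nth simp del: power_Suc)
    have h1: "(h * poly (pderiv P) x) $ i = (if i \<le> n then 0 else - e * poly (pderiv P) x $ 0)"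
      using Suc.prems unfolding h_def mult.assoc fps_X_power_mult_nth by (auto simp: le_Suc_eq)
    have "poly (pderiv P) x $ 0 = \<delta>"
      unfolding \<delta>_def by (rule fps_poly_cong[of 0]) (use h0 in \<open>auto simp: x_def\<close>)
    then show ?case
      unfolding x' s using h1 h2 Suc.IH[of i] Suc.prems assms(2)
      by (cases "i \<le> n") (auto simp: x_def[symmetric] le_Suc_eq e_def \<delta>_def[symmetric])
  qed
  have eta: "hroot P b $ i = hens P \<delta> b n $ i" if "i \<le> n" for i n
    using low[of i i "n - i"] that by (simp add: hroot_def \<delta>_def)
  show "poly P (hroot P b) = 0"
  proof (rule fps_ext)
    fix n
    have "poly P (hroot P b) $ n = poly P (hens P \<delta> b n) $ n" by (rule fps_poly_cong[of n]) (use eta in auto)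
    then show "poly P (hroot P b) $ n = 0 $ n" using zero[of n n] by simp
  qed
  show "hroot P b $ 0 = b" using eta[of 0 0] by simp
qed

context Fpbar
begin

lemma fps_frob_add: "(x + y :: 'k fps) ^ p = x ^ p + y ^ p"
  by (rule freshmans_dream) (simp_all add: char_k prime_p)

lemma fps_frob_sum: "(\<Sum>i\<in>A. f i :: 'k fps) ^ p = (\<Sum>i\<in>A. f i ^ p)"
  by (rule freshmans_dream_sum) (simp_all add: char_k prime_p)

lemma fps_frob_diff: "(x - y :: 'k fps) ^ p = x ^ p - y ^ p"
  using fps_frob_add[of "x - y" y] by simp

lemma ev1_frob:
  fixes q :: "'k poly"
  assumes "\<And>i. coeff q i \<in> Fp"
  shows "ev1 x q ^ p = ev1 (x ^ p) q"
  using assms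
proof (induction q)
  case (pCons a q)
  have "a ^ p = a" using pCons.prems[of 0] by (simp add: mem_Fp)
  moreover have "ev1 x q ^ p = ev1 (x ^ p) q" by (rule pCons.IH) (use pCons.prems[of "Suc _"] in simp)
  ultimately show ?case by (simp add: ev1_pCons fps_frob_add power_mult_distrib fps_const_power)
qed (use p_gt_1 in simp)

end

subsection \<open>Stepanov's method: the operators\<close>

definition ev2 :: "'a::comm_ring_1 fps \<Rightarrow> 'a fps \<Rightarrow> 'a poly poly \<Rightarrow> 'a fps" where
  "ev2 x x' q = poly (map_poly (ev1 x) q) x'"

lemma ev2_pCons: "ev2 x x' (pCons a q) = ev1 x a + x' * ev2 x x' q"
proof -
  have "map_poly (ev1 x) (pCons a q) = pCons (ev1 x a) (map_poly (ev1 x) q)"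
    by (rule poly_eqI) (simp add: coeff_map_poly coeff_pCons split: nat.splits)
  then show ?thesis by (simp add: ev2_def)
qed

lemma ev2_hom: "comm_ring_hom (ev2 x x')"
proof -
  interpret h: comm_ring_hom "ev1 x" by (rule ev1_hom)
  interpret m: map_poly_comm_ring_hom "ev1 x" ..
  show ?thesis unfolding ev2_def by unfold_locales (simp_all add: m.hom_add m.hom_mult)
qed

lemma ev2_0 [simp]: "ev2 x x' 0 = 0" and ev2_add: "ev2 x x' (q + q') = ev2 x x' q + ev2 x x' q'"
  and ev2_diff: "ev2 x x' (q - q') = ev2 x x' q - ev2 x x' q'"
  and ev2_mult: "ev2 x x' (q * q') = ev2 x x' q * ev2 x x' q'"
proof -
  interpret comm_ring_hom "ev2 x x'" by (rule ev2_hom)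
  show "ev2 x x' 0 = 0" "ev2 x x' (q + q') = ev2 x x' q + ev2 x x' q'"
    "ev2 x x' (q - q') = ev2 x x' q - ev2 x x' q'" "ev2 x x' (q * q') = ev2 x x' q * ev2 x x' q'"
    by (simp_all add: hom_distribs)
qed

lemma ev2_smult: "ev2 x x' (smult a q) = ev1 x a * ev2 x x' q"
  using ev2_mult[of x x' "[:a:]" q] by (simp add: ev2_pCons)

definition lift :: "'a::comm_ring_1 poly \<Rightarrow> 'a poly poly" where
  "lift q = map_poly (\<lambda>a. [:a:]) q"

lemma coeff_lift: "coeff (lift q) i = [:coeff q i:]"
  by (simp add: lift_def coeff_map_poly)

lemma ev2_lift: "ev2 x x' (lift q) = ev1 x' q"
proof (induction q)
  case (pCons a q)
  have "lift (pCons a q) = pCons [:a:] (lift q)"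
    by (rule poly_eqI) (simp add: coeff_lift coeff_pCons split: nat.splits)
  then show ?case using pCons.IH by (simp add: ev2_pCons ev1_pCons)
qed (simp add: lift_def)

text \<open>Restriction to the diagonal \<open>x' = x\<close>. This is the remainder of division by
  \<open>x' - x\<close>, with \<open>dquot\<close> as quotient.\<close>

definition diag :: "'a::comm_ring_1 poly poly \<Rightarrow> 'a poly" where
  "diag q = poly q [:0, 1:]"

definition dquot :: "'a::comm_ring_1 poly poly \<Rightarrow> 'a poly poly" where
  "dquot q = synthetic_div q [:0, 1:]"

lemma ev2_dquot: "ev2 x x' q = (x' - x) * ev2 x x' (dquot q) + ev1 x (diag q)"
proof (induction q)
  case (pCons a q)
  have "ev1 x (diag (pCons a q)) = ev1 x a + x * ev1 x (diag q)"
    by (simp add: diag_def ev1_add ev1_mult ev1_pCons)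
  moreover have "ev2 x x' (dquot (pCons a q)) = ev1 x (diag q) + x' * ev2 x x' (dquot q)"
    by (simp add: dquot_def diag_def ev2_pCons)
  ultimately show ?case unfolding ev2_pCons pCons.IH by (simp add: algebra_simps)
qed (simp add: diag_def dquot_def)

lemma mult_shift:
  fixes h :: "nat \<Rightarrow> 'a::comm_ring_1"
  assumes "0 < D" "y ^ D + (\<Sum>k<D. c k * y ^ k) = 0"
  shows "y * (\<Sum>k<D. h k * y ^ k) = (\<Sum>k<D. ((if k = 0 then 0 else h (k - 1)) - h (D - 1) * c k) * y ^ k)"
proof -
  obtain e where e: "D = Suc e" using assms(1) by (cases D) auto
  have yD: "y ^ D = - (\<Sum>k<D. c k * y ^ k)" using assms(2) by (simp add: eq_neg_iff_add_eq_0)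
  have "y * (\<Sum>k<D. h k * y ^ k) = (\<Sum>k<e. h k * y ^ Suc k) + h e * y ^ D"
    unfolding e by (simp add: sum_distrib_left algebra_simps)
  also have "(\<Sum>k<e. h k * y ^ Suc k) = (\<Sum>k<D. (if k = 0 then 0 else h (k - 1)) * y ^ k)"
    unfolding e sum.lessThan_Suc_shift by simp
  also have "h e * y ^ D = - (\<Sum>k<D. h (D - 1) * c k * y ^ k)"
    unfolding yD mult_minus_right sum_distrib_left by (simp add: e mult.assoc del: sum.lessThan_Suc)
  finally show ?thesis by (simp add: left_diff_distrib sum_subtractf)
qed

text \<open>If \<open>(x, y)\<close> and \<open>(x', y')\<close> are points of the curve, \<open>mul_diff\<close> is multiplication of
  \<open>\<Sum> h\<^sub>k\<^sub>l(x, x') y\<^sup>k y'\<^sup>l\<close> by \<open>y - y'\<close>. When the new coefficients vanish on the diagonal \<open>x = x'\<close>, they are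
  divisible by \<open>x' - x\<close>; for \<open>x' = x\<^sup>p\<close> this is a gain of one order at a rational \<open>x\<close> with \<open>y \<noteq> y\<^sup>p\<close>.\<close>

definition mul_diff :: "nat \<Rightarrow> (nat \<Rightarrow> 'a::comm_ring_1 poly) \<Rightarrow> (nat \<Rightarrow> nat \<Rightarrow> 'a poly poly) \<Rightarrow> nat \<Rightarrow> nat \<Rightarrow> 'a poly poly" where
  "mul_diff D c h k l = (if k = 0 then 0 else h (k - 1) l) - h (D - 1) l * [:c k:]
    - (if l = 0 then 0 else h k (l - 1)) + h k (D - 1) * lift (c l)"

definition diff_quot :: "nat \<Rightarrow> (nat \<Rightarrow> 'a::comm_ring_1 poly) \<Rightarrow> (nat \<Rightarrow> nat \<Rightarrow> 'a poly poly) \<Rightarrow> nat \<Rightarrow> nat \<Rightarrow> 'a poly poly" where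
  "diff_quot D c h k l = dquot (mul_diff D c h k l)"

definition fam_eval :: "nat \<Rightarrow> 'a::comm_ring_1 fps \<Rightarrow> 'a fps \<Rightarrow> 'a fps \<Rightarrow> 'a fps \<Rightarrow> (nat \<Rightarrow> nat \<Rightarrow> 'a poly poly) \<Rightarrow> 'a fps" where
  "fam_eval D x x' y y' h = (\<Sum>k<D. \<Sum>l<D. ev2 x x' (h k l) * y ^ k * y' ^ l)"

text \<open>The pair \<open>(x, y)\<close> of power series is a formal point of the plane curve
  whose monic equation has the lower coefficients \<open>c j\<close>.\<close>

definition branch :: "nat \<Rightarrow> (nat \<Rightarrow> 'a::comm_ring_1 poly) \<Rightarrow> 'a fps \<Rightarrow> 'a fps \<Rightarrow> bool" where
  "branch D c x y \<longleftrightarrow> y ^ D + (\<Sum>j<D. ev1 x (c j) * y ^ j) = 0"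

lemma fam_eval_mul_diff:
  assumes "0 < D" "branch D c x y" "branch D c x' y'"
  shows "(y - y') * fam_eval D x x' y y' h = fam_eval D x x' y y' (mul_diff D c h)"
proof -
  define e where "e k l = ev2 x x' (h k l)" for k l
  have "y * fam_eval D x x' y y' h = (\<Sum>l<D. (y * (\<Sum>k<D. e k l * y ^ k)) * y' ^ l)"
    unfolding fam_eval_def e_def[symmetric] by (subst sum.swap) (simp add: sum_distrib_left sum_distrib_right mult_ac)
  also have "\<dots> = (\<Sum>l<D. \<Sum>k<D. ((if k = 0 then 0 else e (k - 1) l) - e (D - 1) l * ev1 x (c k)) * y ^ k * y' ^ l)"
    using mult_shift[OF assms(1) assms(2)[unfolded branch_def]] by (simp add: sum_distrib_right)
  also have "\<dots> = (\<Sum>k<D. \<Sum>l<D. ((if k = 0 then 0 else e (k - 1) l) - e (D - 1) l * ev1 x (c k)) * y ^ k * y' ^ l)"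
    by (rule sum.swap)
  finally have 1: "y * fam_eval D x x' y y' h = \<dots>" .
  have "y' * fam_eval D x x' y y' h = (\<Sum>k<D. (y' * (\<Sum>l<D. e k l * y' ^ l)) * y ^ k)"
    unfolding fam_eval_def e_def[symmetric] by (simp add: sum_distrib_left sum_distrib_right mult_ac)
  also have "\<dots> = (\<Sum>k<D. \<Sum>l<D. ((if l = 0 then 0 else e k (l - 1)) - e k (D - 1) * ev1 x' (c l)) * y ^ k * y' ^ l)"
    using mult_shift[OF assms(1) assms(3)[unfolded branch_def]] by (simp add: sum_distrib_right mult.assoc mult.commute[of "y ^ _"])
  finally have 2: "y' * fam_eval D x x' y y' h = \<dots>" .
  have 3: "ev2 x x' (mul_diff D c h k l) = ((if k = 0 then 0 else e (k - 1) l) - e (D - 1) l * ev1 x (c k))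
     - ((if l = 0 then 0 else e k (l - 1)) - e k (D - 1) * ev1 x' (c l))" for k l
    by (simp add: mul_diff_def e_def ev2_add ev2_diff ev2_mult ev2_lift ev2_smult mult.commute)
  show ?thesis
    unfolding left_diff_distrib 1 2 unfolding fam_eval_def 3 by (simp only: left_diff_distrib sum_subtractf)
qed

lemma fam_eval_diff_quot:
  assumes "0 < D" "branch D c x y" "branch D c x' y'" "\<And>k l. k < D \<Longrightarrow> l < D \<Longrightarrow> diag (mul_diff D c h k l) = 0"
  shows "(y - y') * fam_eval D x x' y y' h = (x' - x) * fam_eval D x x' y y' (diff_quot D c h)"
proof -
  have "(y - y') * fam_eval D x x' y y' h = fam_eval D x x' y y' (mul_diff D c h)" by (rule fam_eval_mul_diff[OF assms(1-3)])
  also have "\<dots> = (x' - x) * fam_eval D x x' y y' (diff_quot D c h)"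
    unfolding fam_eval_def diff_quot_def sum_distrib_left
  proof (intro sum.cong refl)
    fix k l assume "k \<in> {..<D}" "l \<in> {..<D}"
    then show "ev2 x x' (mul_diff D c h k l) * y ^ k * y' ^ l = (x' - x) * (ev2 x x' (dquot (mul_diff D c h k l)) * y ^ k * y' ^ l)"
      using ev2_dquot[of x x' "mul_diff D c h k l"] assms(4)[of k l] by (simp add: mult.assoc)
  qed
  finally show ?thesis .
qed

lemma fam_eval_funpow:
  assumes "0 < D" "branch D c x y" "branch D c x' y'"
    "\<And>i k l. i < M \<Longrightarrow> k < D \<Longrightarrow> l < D \<Longrightarrow> diag (mul_diff D c ((diff_quot D c ^^ i) h) k l) = 0"
  shows "(y - y') ^ M * fam_eval D x x' y y' h = (x' - x) ^ M * fam_eval D x x' y y' ((diff_quot D c ^^ M) h)"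
  using assms(4)
proof (induction M)
  case (Suc M)
  have "(y - y') ^ Suc M * fam_eval D x x' y y' h = (y - y') * ((y - y') ^ M * fam_eval D x x' y y' h)" by simp
  also have "\<dots> = (x' - x) ^ M * ((y - y') * fam_eval D x x' y y' ((diff_quot D c ^^ M) h))"
    using Suc.IH Suc.prems by (simp add: mult_ac)
  also have "(y - y') * fam_eval D x x' y y' ((diff_quot D c ^^ M) h) = (x' - x) * fam_eval D x x' y y' (diff_quot D c ((diff_quot D c ^^ M) h))"
    by (rule fam_eval_diff_quot[OF assms(1-3)]) (use Suc.prems[of M] in auto)
  finally show ?case by (simp add: mult_ac)
qed simp

lemma wt_add: "wt \<mu> A \<Longrightarrow> wt \<mu> B \<Longrightarrow> wt \<mu> (A + B)"
  and wt_diff: "wt \<mu> A \<Longrightarrow> wt \<mu> B \<Longrightarrow> wt \<mu> (A - B)"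
  and wt_0 [simp]: "wt \<mu> 0"
  unfolding wt_def by (auto intro: dle_add dle_diff)

lemma wt_mult:
  assumes "wt \<mu> A" "wt \<nu> B" shows "wt (\<mu> + \<nu>) (A * B)"
  unfolding wt_def coeff_mult
proof (intro allI dle_sum)
  fix n i :: nat assume "i \<in> {..n}"
  then have "\<mu> - int i + (\<nu> - int (n - i)) = \<mu> + \<nu> - int n" by (simp add: of_nat_diff)
  moreover have "dle (\<mu> - int i) (coeff A i)" "dle (\<nu> - int (n - i)) (coeff B (n - i))"
    using assms unfolding wt_def by blast+
  ultimately show "dle (\<mu> + \<nu> - int n) (coeff A i * coeff B (n - i))" using dle_mult by metis
qed

lemma wt_pCons: "wt \<mu> (pCons a q) \<longleftrightarrow> dle \<mu> a \<and> wt (\<mu> - 1) q"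
proof
  assume *: "wt \<mu> (pCons a q)"
  have "dle (\<mu> - int 0) a" using * unfolding wt_def by (metis coeff_pCons_0)
  moreover have "dle (\<mu> - 1 - int i) (coeff q i)" for i
    using *[unfolded wt_def, rule_format, of "Suc i"] by (simp add: algebra_simps)
  ultimately show "dle \<mu> a \<and> wt (\<mu> - 1) q" by (simp add: wt_def)
next
  assume *: "dle \<mu> a \<and> wt (\<mu> - 1) q"
  have "dle (\<mu> - int i) (coeff (pCons a q) i)" for i
  proof (cases i)
    case (Suc i')
    then show ?thesis using *[THEN conjunct2, unfolded wt_def, rule_format, of i'] by (simp add: algebra_simps)
  qed (use * in simp)
  then show "wt \<mu> (pCons a q)" by (simp add: wt_def)
qed

lemma wt_lift: "dle \<mu> q \<Longrightarrow> wt \<mu> (lift q)"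
  unfolding wt_def coeff_lift dle_def by (auto simp: coeff_pCons split: nat.splits)

lemma dle_diag: "wt \<mu> q \<Longrightarrow> dle \<mu> (diag q)"
proof (induction q arbitrary: \<mu>)
  case (pCons a q)
  then have *: "dle \<mu> a" "dle (\<mu> - 1) (diag q)" by (auto simp: wt_pCons)
  have "dle 1 [:0, 1 :: 'a:]" by (rule dle_linear) simp
  from dle_mult[OF this *(2)] have "dle \<mu> ([:0, 1:] * diag q)" by simp
  then show ?case using dle_add[OF *(1)] by (simp add: diag_def)
qed (simp add: diag_def)

lemma wt_dquot: "wt \<mu> q \<Longrightarrow> wt (\<mu> - 1) (dquot q)"
proof (induction q arbitrary: \<mu>)
  case (pCons a q)
  have "wt (\<mu> - 1 - 1) (dquot q)" by (rule pCons.IH) (use pCons.prems in \<open>simp add: wt_pCons\<close>)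
  moreover have "dle (\<mu> - 1) (diag q)" by (rule dle_diag) (use pCons.prems in \<open>simp add: wt_pCons\<close>)
  ultimately show ?case by (simp add: dquot_def diag_def wt_pCons)
qed (simp add: dquot_def)

text \<open>Total degree at most \<open>e\<close> in \<open>x\<close>, \<open>x'\<close>,
  \<open>y\<close> and \<open>y'\<close> together.\<close>

definition wt_family :: "nat \<Rightarrow> int \<Rightarrow> (nat \<Rightarrow> nat \<Rightarrow> 'a::comm_ring_1 poly poly) \<Rightarrow> bool" where
  "wt_family D e h \<longleftrightarrow> (\<forall>k<D. \<forall>l<D. wt (e - int k - int l) (h k l))"

lemma wt_mul_diff:
  assumes h: "wt_family D e h" and c: "\<And>j. j < D \<Longrightarrow> dle (int D - int j) (c j)" and "k < D" "l < D"
  shows "wt (e + 1 - int k - int l) (mul_diff D c h k l)"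
proof -
  have hw: "wt (e - int k - int l) (h k l)" if "k < D" "l < D" for k l using h that unfolding wt_family_def by simp
  have 1: "wt (e + 1 - int k - int l) (if k = 0 then 0 else h (k - 1) l)"
    using hw[of "k - 1" l] assms by (auto simp: of_nat_diff algebra_simps)
  have 2: "wt (e + 1 - int k - int l) (if l = 0 then 0 else h k (l - 1))"
    using hw[of k "l - 1"] assms by (auto simp: of_nat_diff algebra_simps)
  have "wt (int D - int k) [:c k:]" using c[OF \<open>k < D\<close>] by (simp add: wt_pCons)
  from wt_mult[OF hw[of "D - 1" l] this] have 3: "wt (e + 1 - int k - int l) (h (D - 1) l * [:c k:])"
    using assms by (simp add: of_nat_diff algebra_simps)
  from wt_mult[OF hw[of k "D - 1"] wt_lift[OF c[OF \<open>l < D\<close>]]]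
  have 4: "wt (e + 1 - int k - int l) (h k (D - 1) * lift (c l))"
    using assms by (simp add: of_nat_diff algebra_simps)
  show ?thesis unfolding mul_diff_def by (intro wt_add wt_diff 1 2 3 4)
qed

text \<open>Multiplication by \<open>y - y'\<close> raises the weight by one and division by
  \<open>x' - x\<close> lowers it again. So the number of conditions is the same for each of the
  \<open>M\<close> steps.\<close>

lemma wt_family_diff_quot:
  assumes "wt_family D e h" "\<And>j. j < D \<Longrightarrow> dle (int D - int j) (c j)"
  shows "wt_family D e (diff_quot D c h)"
  unfolding wt_family_def diff_quot_def
proof (intro allI impI)
  fix k l assume "k < D" "l < D"
  from wt_dquot[OF wt_mul_diff[OF assms this]] show "wt (e - int k - int l) (dquot (mul_diff D c h k l))"
    by (simp add: algebra_simps)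
qed

lemma wt_family_funpow:
  assumes "wt_family D e h" "\<And>j. j < D \<Longrightarrow> dle (int D - int j) (c j)"
  shows "wt_family D e ((diff_quot D c ^^ i) h)"
proof (induction i)
  case (Suc i)
  show ?case using wt_family_diff_quot[OF Suc.IH assms(2)] by simp
qed (simp add: assms(1))

section \<open>Linear algebra for the auxiliary function\<close>

lemma underdetermined:
  fixes a :: "'e \<Rightarrow> 'i \<Rightarrow> 'k::field"
  assumes "finite I" "finite E" "card E < card I"
  shows "\<exists>z. (\<exists>i\<in>I. z i \<noteq> 0) \<and> (\<forall>e\<in>E. (\<Sum>i\<in>I. z i * a e i) = 0)"
proof -
  define N where "N = card I"
  obtain f where f: "bij_betw f {..<N} I" using assms(1) unfolding N_def by (metis ex_bij_betw_nat_finite atLeast0LessThan)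
  obtain g where g: "bij_betw g {..<card E} E" using assms(2) by (metis ex_bij_betw_nat_finite atLeast0LessThan)
  \<comment> \<open>Zero rows fill up the system to a square one, whose determinant then
    vanishes.\<close>
  define m where "m r j = (if r < card E then a (g r) (f j) else 0)" for r j
  have N: "0 < N" "card E \<le> N - 1" using assms(3) unfolding N_def by auto
  have "det (mat N N (\<lambda>(i,j). m j i)) = 0"
  proof (rule det_kernel_zero[of "N - 1" N "\<lambda>j. if j = N - 1 then 1 else 0"])
    fix i assume "i < N"
    have "(\<Sum>j<N. m j i * (if j = N - 1 then 1 else 0)) = (\<Sum>j<N. if j = N - 1 then m j i else 0)"
      by (rule sum.cong) auto
    also have "\<dots> = 0" using N by (simp add: m_def)
    finally show "(\<Sum>j<N. m j i * (if j = N - 1 then 1 else 0)) = 0" .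
  qed (use N in auto)
  moreover have "transpose_mat (mat N N (\<lambda>(i,j). m i j)) = mat N N (\<lambda>(i,j). m j i)" by (rule eq_matI) auto
  ultimately have "det (mat N N (\<lambda>(i,j). m i j)) = 0"
    using det_transpose[of "mat N N (\<lambda>(i,j). m i j)" N] by simp
  then obtain v where v: "\<exists>j<N. v j \<noteq> 0" "\<And>i. i < N \<Longrightarrow> (\<Sum>j<N. m i j * v j) = 0"
    by (rule det_zero_kernel) (rule that)
  define z where "z i = v (the_inv_into {..<N} f i)" for i
  have zf: "z (f j) = v j" if "j < N" for j
    using that f by (simp add: z_def the_inv_into_f_f bij_betw_def)
  show ?thesis
  proof (intro exI conjI ballI)
    from v(1) obtain j where "j < N" "v j \<noteq> 0" by blast
    then have "f j \<in> I" "z (f j) \<noteq> 0" using zf f by (auto simp: bij_betw_def)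
    then show "\<exists>i\<in>I. z i \<noteq> 0" by blast
  next
    fix e assume "e \<in> E"
    then obtain r where r: "r < card E" "e = g r" using g by (auto simp: bij_betw_def)
    have "(\<Sum>i\<in>I. z i * a e i) = (\<Sum>j<N. z (f j) * a e (f j))"
      by (rule sum.reindex_bij_betw[OF f, symmetric])
    also have "\<dots> = (\<Sum>j<N. m r j * v j)" by (rule sum.cong) (use zf r in \<open>auto simp: m_def\<close>)
    also have "\<dots> = 0" by (rule v(2)) (use r N in simp)
    finally show "(\<Sum>i\<in>I. z i * a e i) = 0" .
  qed
qed

lemma synthetic_div_add: "synthetic_div (q + q') x = synthetic_div q x + synthetic_div q' x"
  for q q' :: "'a::comm_ring_1 poly"
  by (induction q q' rule: poly_induct2) (simp_all add: poly_add)

lemma synthetic_div_smult: "synthetic_div (smult a q) x = smult a (synthetic_div q x)"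
  for q :: "'a::comm_ring_1 poly"
  by (induction q) simp_all

text \<open>Combinations with constant coefficients. The operators \<open>mul_diff\<close> and
  \<open>diff_quot\<close> commute with them, so the vanishing conditions are linear equations in
  \<open>z\<close>.\<close>

definition lcomb :: "'i set \<Rightarrow> ('i \<Rightarrow> 'a::comm_ring_1) \<Rightarrow> ('i \<Rightarrow> 'a poly poly) \<Rightarrow> 'a poly poly" where
  "lcomb I z q = (\<Sum>i\<in>I. smult [:z i:] (q i))"

lemma lcomb_mul_diff: "mul_diff D c (\<lambda>k l. lcomb I z (\<lambda>i. b i k l)) k l = lcomb I z (\<lambda>i. mul_diff D c (b i) k l)"
proof -
  have a: "lcomb I z q * r = lcomb I z (\<lambda>i. q i * r)" for q r
    by (simp add: lcomb_def sum_distrib_right)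
  have d: "lcomb I z q - lcomb I z r = lcomb I z (\<lambda>i. q i - r i)" and s: "lcomb I z q + lcomb I z r = lcomb I z (\<lambda>i. q i + r i)" for q r
    by (simp_all add: lcomb_def sum_subtractf sum.distrib smult_diff_right smult_add_right)
  have o: "(if P then 0 else lcomb I z q) = lcomb I z (\<lambda>i. if P then 0 else q i)" for P q
    by (simp add: lcomb_def)
  show ?thesis unfolding mul_diff_def a d s o ..
qed

lemma lcomb_dquot: "dquot (lcomb I z q) = lcomb I z (\<lambda>i. dquot (q i))"
  unfolding lcomb_def dquot_def
  by (induction I rule: infinite_finite_induct) (simp_all add: synthetic_div_add synthetic_div_smult)

lemma lcomb_diff_quot: "diff_quot D c (\<lambda>k l. lcomb I z (\<lambda>i. b i k l)) = (\<lambda>k l. lcomb I z (\<lambda>i. diff_quot D c (b i) k l))"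
  by (intro ext) (simp add: diff_quot_def lcomb_mul_diff lcomb_dquot)

lemma lcomb_funpow: "(diff_quot D c ^^ n) (\<lambda>k l. lcomb I z (\<lambda>i. b i k l)) = (\<lambda>k l. lcomb I z (\<lambda>i. (diff_quot D c ^^ n) (b i) k l))"
  by (induction n) (simp_all add: lcomb_diff_quot)

lemma coeff_diag_lcomb: "coeff (diag (lcomb I z q)) m = (\<Sum>i\<in>I. z i * coeff (diag (q i)) m)"
  by (simp add: lcomb_def diag_def poly_sum coeff_sum)

text \<open>The conditions on the diagonal are linear in the coefficients \<open>z\<close> of
  \<open>h\<close>, and the weight bound leaves the exponents
  \<open>m \<le> A + B + 1 - k - l\<close>. Only the indices \<open>l \<ge> 1\<close> are imposed:
  on an irreducible curve the index 0 will follow, and this saving is what allows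
  \<open>B < M\<close>, without which the final count would be void.\<close>

lemma stepanov_family:
  fixes c :: "nat \<Rightarrow> 'k::field poly"
  assumes c: "\<And>j. j < D \<Longrightarrow> dle (int D - int j) (c j)"
    and card: "card {(i, k, l, m). i < M \<and> k < D \<and> 1 \<le> l \<and> l < D \<and> m + k + l \<le> A + B + 1}
      < card {(k, l, \<alpha>, \<beta>). k < D \<and> l < D \<and> \<alpha> + k \<le> A \<and> \<beta> + l \<le> B}" (is "card ?E < card ?I")
  obtains z h where "\<exists>i\<in>{(k, l, \<alpha>, \<beta>). k < D \<and> l < D \<and> \<alpha> + k \<le> A \<and> \<beta> + l \<le> B}. z i \<noteq> (0::'k)"
    "\<And>k l \<alpha> \<beta>. coeff (coeff (h k l) \<beta>) \<alpha> = (if k < D \<and> l < D \<and> \<alpha> + k \<le> A \<and> \<beta> + l \<le> B then z (k, l, \<alpha>, \<beta>) else 0)"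
    "\<And>i k l. i < M \<Longrightarrow> k < D \<Longrightarrow> 1 \<le> l \<Longrightarrow> l < D \<Longrightarrow> diag (mul_diff D c ((diff_quot D c ^^ i) h) k l) = 0"
proof -
  \<comment> \<open>The family with the single term
    \<open>x ^ \<alpha> * x' ^ \<beta> * y ^ k0 * y' ^ l0\<close>.\<close>
  define b :: "nat \<times> nat \<times> nat \<times> nat \<Rightarrow> nat \<Rightarrow> nat \<Rightarrow> 'k poly poly" where "b = (\<lambda>(k0, l0, \<alpha>, \<beta>) k l. if k = k0 \<and> l = l0 then monom (monom (1::'k) \<alpha>) \<beta> else 0)"
  have I: "finite ?I" by (rule finite_subset[of _ "{..<D} \<times> {..<D} \<times> {..A} \<times> {..B}"]) auto
  have E: "finite ?E" by (rule finite_subset[of _ "{..<M} \<times> {..<D} \<times> {..<D} \<times> {..A + B + 1}"]) auto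
  define a where "a = (\<lambda>(i, k, l, m) j. coeff (diag (mul_diff D c ((diff_quot D c ^^ i) (b j)) k l)) m)"
  obtain z where z: "\<exists>i\<in>?I. z i \<noteq> 0" "\<forall>e\<in>?E. (\<Sum>i\<in>?I. z i * a e i) = 0"
    using underdetermined[OF I E card, of a] by blast
  define h where "h k l = lcomb ?I z (\<lambda>i. b i k l)" for k l
  have ch: "coeff (coeff (h k l) \<beta>) \<alpha> = (if k < D \<and> l < D \<and> \<alpha> + k \<le> A \<and> \<beta> + l \<le> B then z (k, l, \<alpha>, \<beta>) else 0)" for k l \<alpha> \<beta>
  proof -
    have "coeff (coeff (h k l) \<beta>) \<alpha> = (\<Sum>i\<in>?I. if i = (k, l, \<alpha>, \<beta>) then z i else 0)"
      unfolding h_def lcomb_def coeff_sum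
      by (rule sum.cong[OF refl]) (auto simp: b_def split: if_splits)
    also have "\<dots> = (if (k, l, \<alpha>, \<beta>) \<in> ?I then z (k, l, \<alpha>, \<beta>) else 0)" using I by simp
    finally show ?thesis by simp
  qed
  have wt: "wt_family D (int (A + B)) h"
    unfolding wt_family_def wt_def dle_def
  proof (intro allI impI)
    fix k l i j assume "int (A + B) - int k - int l - int i < int j"
    then show "coeff (coeff (h k l) i) j = 0" unfolding ch by auto
  qed
  show thesis
  proof (rule that[OF z(1) ch])
    fix i k l assume ikl: "i < M" "k < D" "1 \<le> l" "l < D"
    have "dle (int (A + B) + 1 - int k - int l) (diag (mul_diff D c ((diff_quot D c ^^ i) h) k l))"
      by (rule dle_diag[OF wt_mul_diff[OF wt_family_funpow[OF wt c] c]]) (use ikl in auto)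
    then have hi: "coeff (diag (mul_diff D c ((diff_quot D c ^^ i) h) k l)) m = 0" if "\<not> m + k + l \<le> A + B + 1" for m
      using that unfolding dle_def by auto
    have lo: "coeff (diag (mul_diff D c ((diff_quot D c ^^ i) h) k l)) m = 0" if "m + k + l \<le> A + B + 1" for m
    proof -
      have "(diff_quot D c ^^ i) h = (\<lambda>k l. lcomb ?I z (\<lambda>j. (diff_quot D c ^^ i) (b j) k l))"
        unfolding h_def[abs_def] by (rule lcomb_funpow)
      then have "coeff (diag (mul_diff D c ((diff_quot D c ^^ i) h) k l)) m = (\<Sum>j\<in>?I. z j * a (i, k, l, m) j)"
        by (simp only: lcomb_mul_diff coeff_diag_lcomb a_def prod.case)
      also have "\<dots> = 0" using z(2) ikl that by (elim ballE[of _ _ "(i, k, l, m)"]) auto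
      finally show ?thesis .
    qed
    show "diag (mul_diff D c ((diff_quot D c ^^ i) h) k l) = 0"
      by (rule poly_eqI) (metis hi lo coeff_0)
  qed
qed

subsection \<open>Stepanov's method: counting points on a curve\<close>

lemma ev1_altdef:
  assumes "\<And>i. n < i \<Longrightarrow> coeff q i = 0"
  shows "ev1 x q = (\<Sum>i\<le>n. fps_const (coeff q i) * x ^ i)"
proof -
  have "q = (\<Sum>i\<le>n. monom (coeff q i) i)"
    by (rule poly_eqI) (use assms in \<open>auto simp: coeff_sum if_distrib not_le cong: if_cong\<close>)
  then have "ev1 x q = ev1 x (\<Sum>i\<le>n. monom (coeff q i) i)" by simp
  then show ?thesis by (simp add: ev1_sum ev1_monom)
qed

lemma poly_poly_altdef:
  fixes q :: "'a::comm_ring_1 poly poly"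
  assumes "\<And>i. n < i \<Longrightarrow> coeff q i = 0"
  shows "poly q m = (\<Sum>i\<le>n. coeff q i * m ^ i)"
proof -
  have "q = (\<Sum>i\<le>n. monom (coeff q i) i)"
    by (rule poly_eqI) (use assms in \<open>auto simp: coeff_sum if_distrib not_le cong: if_cong\<close>)
  then have "poly q m = poly (\<Sum>i\<le>n. monom (coeff q i) i) m" by simp
  then show ?thesis by (simp add: poly_sum poly_monom)
qed

lemma ev1_poly_monom: "ev1 x (poly q (monom 1 n)) = ev2 x (x ^ n) q"
  by (induction q) (simp_all add: ev1_add ev1_mult ev1_monom ev2_pCons)

lemma dle_monom: "int n \<le> \<mu> \<Longrightarrow> dle \<mu> (monom a n)"
  by (auto simp: dle_def)

lemma poly_at_hom: "comm_ring_hom (\<lambda>q :: 'a::comm_ring_1 poly. poly q t)"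
  by unfold_locales simp_all

context Fpbar
begin

lemma dle_iff_pf: "dle \<mu> q \<longleftrightarrow> pf 1 \<mu> (\<lambda>z. poly q (z 0 :: 'k))"
proof
  assume q: "dle \<mu> q"
  show "pf 1 \<mu> (\<lambda>z. poly q (z 0))"
  proof (cases "\<mu> < 0")
    case True
    then show ?thesis using dle_neg[OF q] by (simp add: pf_zero)
  next
    case False
    then obtain n where n: "\<mu> = int n" by (metis nonneg_int_cases not_less)
    have "pf 1 \<mu> (\<lambda>z. \<Sum>j\<le>n. coeff q j * z 0 ^ j)"
    proof (intro pf_sum pf_cmult)
      fix j assume "j \<in> {..n}"
      have "pf 1 (int j * 1) (\<lambda>z. z 0 ^ j)" by (rule pf_power[OF pf_var]) simp_all
      then show "pf 1 \<mu> (\<lambda>z. z 0 ^ j)" by (rule pf_mono) (use \<open>j \<in> {..n}\<close> n in auto)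
    qed
    then show ?thesis using poly_sum_atMost[of n q] q n by simp
  qed
next
  assume "pf 1 \<mu> (\<lambda>z. poly q (z 0))"
  then obtain q' where q': "dle \<mu> q'" "\<And>t. poly q' t = poly q (0 + t * 1)"
    by (rule pf_line[of 1 \<mu> _ "\<lambda>_. 0" "\<lambda>_. 1"]) (rule that)
  have "q' = q" by (rule poly_ext) (simp add: q')
  then show "dle \<mu> q" using q' by simp
qed

end

section \<open>Norms along a plane curve and its formal branches\<close>

locale curve = Fpbar p T for p and T :: "'k::field itself" +
  fixes D :: nat and c :: "nat \<Rightarrow> 'k poly"
  assumes D0: "0 < D" and cdle: "\<And>j. j < D \<Longrightarrow> dle (int D - int j) (c j)"
begin

definition cw :: "nat \<Rightarrow> 'k poly" where "cw j = (if j < D then c j else 1)"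

definition norm_poly :: "nat \<Rightarrow> (nat \<Rightarrow> 'k poly) \<Rightarrow> 'k poly" where
  "norm_poly L h = det (mat D D (\<lambda>(k,j). norm_mat cw D h L k j))"

definition spec :: "'k \<Rightarrow> 'k poly" where
  "spec a = (\<Sum>j\<le>D. monom (poly (cw j) a) j)"

lemma branch_cw: "branch D c x y \<Longrightarrow> (\<Sum>j\<le>D. ev1 x (cw j) * y ^ j) = 0"
  by (simp add: branch_def cw_def sum_atMost_split add.commute)

lemma norm_mat_ev1:
  assumes "branch D c x y"
  shows "(\<Sum>j<D. ev1 x (norm_mat cw D h L k j) * y ^ j) = (\<Sum>i<L. ev1 x (h i) * y ^ i) * y ^ k"
  unfolding norm_mat_hom[OF ev1_hom] by (rule norm_mat_eval[OF D0 _ branch_cw[OF assms]]) (simp add: cw_def)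

text \<open>On a branch the value of \<open>h\<close> is an eigenvalue of the multiplication matrix,
  with the powers of \<open>y\<close> as eigenvector; its entry \<open>y ^ 0 = 1\<close> turns
  \<open>eigen_dvd\<close> into divisibility of the determinant.\<close>

lemma norm_poly_dvd:
  assumes "branch D c x y"
  shows "(\<Sum>i<L. ev1 x (h i) * y ^ i) dvd ev1 x (norm_poly L h)"
proof -
  have "(\<Sum>i<L. ev1 x (h i) * y ^ i) dvd det (mat D D (\<lambda>(k,j). ev1 x (norm_mat cw D h L k j))) * y ^ 0"
    by (rule eigen_dvd[where v = "\<lambda>j. y ^ j" and u = "\<lambda>k. y ^ k", OF norm_mat_ev1[OF assms] D0])
  then show ?thesis unfolding norm_poly_def hom_det_mat[OF ev1_hom] by simp
qed

lemma norm_poly_dle: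
  assumes "\<And>i. i < L \<Longrightarrow> dle (e - int i) (h i)"
  shows "dle (int D * e) (norm_poly L h)"
proof -
  have 1: "pf 1 (int D - int j) (\<lambda>z. poly (c j) (z 0))" if "j < D" for j using cdle[OF that] by (simp add: dle_iff_pf)
  have 2: "pf 1 (e - int i) (\<lambda>z. poly (h i) (z 0))" if "i < L" for i using assms[OF that] by (simp add: dle_iff_pf)
  have mcoeff: "mcoeff D (\<lambda>j z. poly (c j) (z 0)) z j = poly (cw j) (z 0)" for j and z :: "nat \<Rightarrow> 'k"
    by (simp add: mcoeff_def cw_def)
  have "poly (norm_poly L h) (z 0) = det (mat D D (\<lambda>(k,j). norm_mat (mcoeff D (\<lambda>j z. poly (c j) (z 0)) z) D (\<lambda>i. poly (h i) (z 0)) L k j))"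
    for z :: "nat \<Rightarrow> 'k"
    unfolding norm_poly_def hom_det_mat[OF poly_at_hom] norm_mat_hom[OF poly_at_hom] mcoeff ..
  then show ?thesis
    unfolding dle_iff_pf using norm_pf[where c = "\<lambda>j z. poly (c j) (z 0)" and h = "\<lambda>i z. poly (h i) (z 0)", OF D0 1 2] by simp
qed

lemma degree_spec: "degree (spec a) = D" and spec_nz: "spec a \<noteq> 0"
proof -
  have c: "coeff (spec a) j = (if j \<le> D then poly (cw j) a else 0)" for j
    by (simp add: spec_def coeff_sum if_distrib cong: if_cong)
  have "coeff (spec a) D = 1" by (simp add: c cw_def)
  then show "spec a \<noteq> 0" by auto
  show "degree (spec a) = D" by (rule antisym[OF degree_le le_degree]) (auto simp: c cw_def)
qed

definition eqn :: "'k \<Rightarrow> 'k fps poly" where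
  "eqn a = (\<Sum>j\<le>D. monom (ev1 (fps_const a + fps_X) (cw j)) j)"

lemma eqn_0: "poly (eqn a) (fps_const b) $ 0 = poly (spec a) b"
  and eqn_deriv: "poly (pderiv (eqn a)) (fps_const b) $ 0 = poly (pderiv (spec a)) b"
proof -
  have at0: "poly Q (fps_const b) $ 0 = poly (map_poly (\<lambda>x. x $ 0) Q) b" for Q :: "'k fps poly"
  proof (induction Q)
    case (pCons q Q)
    have "map_poly (\<lambda>x. x $ 0) (pCons q Q) = pCons (q $ 0) (map_poly (\<lambda>x. x $ 0) Q)"
      by (rule poly_eqI) (simp add: coeff_map_poly coeff_pCons split: nat.splits)
    then show ?case using pCons.IH by simp
  qed simp
  have m: "map_poly (\<lambda>x. x $ 0) (eqn a) = spec a"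
    by (rule poly_eqI) (simp add: coeff_map_poly eqn_def spec_def coeff_sum ev1_nth_0 if_distrib cong: if_cong)
  have "map_poly (\<lambda>x. x $ 0) (pderiv (eqn a)) = pderiv (map_poly (\<lambda>x. x $ 0) (eqn a))"
    by (rule poly_eqI) (simp add: coeff_map_poly coeff_pderiv fps_of_nat[symmetric] del: fps_of_nat)
  then show "poly (eqn a) (fps_const b) $ 0 = poly (spec a) b" "poly (pderiv (eqn a)) (fps_const b) $ 0 = poly (pderiv (spec a)) b"
    unfolding at0 m by simp_all
qed

lemma hensel_spec:
  assumes "poly (spec a) b = 0" "poly (pderiv (spec a)) b \<noteq> 0"
  shows "branch D c (fps_const a + fps_X) (hroot (eqn a) b)" "hroot (eqn a) b $ 0 = b"
proof -
  have "poly (eqn a) (fps_const b) $ 0 = 0" "poly (pderiv (eqn a)) (fps_const b) $ 0 \<noteq> 0"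
    using assms unfolding eqn_0 eqn_deriv by simp_all
  note * = hensel[OF this]
  show "hroot (eqn a) b $ 0 = b" by (rule *)
  have "poly (eqn a) y = y ^ D + (\<Sum>j<D. ev1 (fps_const a + fps_X) (c j) * y ^ j)" for y
    by (simp add: eqn_def poly_sum poly_monom sum_atMost_split cw_def add.commute)
  then show "branch D c (fps_const a + fps_X) (hroot (eqn a) b)" using *(1) unfolding branch_def by simp
qed

text \<open>Over the completed local ring at \<open>a\<close> the curve splits into \<open>D\<close> branches, and the norm is the product
  of the values on the branches.\<close>

lemma norm_poly_prod:
  assumes y: "\<And>i. i < D \<Longrightarrow> branch D c x (y i)" and inj: "\<And>i j. i < D \<Longrightarrow> j < D \<Longrightarrow> y i $ 0 = y j $ 0 \<Longrightarrow> i = j"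
  shows "ev1 x (norm_poly L h) = (\<Prod>i<D. \<Sum>j<L. ev1 x (h j) * y i ^ j)"
proof -
  define e where "e i = (\<Sum>j<L. ev1 x (h j) * y i ^ j)" for i
  define M where "M = mat D D (\<lambda>(k,j). ev1 x (norm_mat cw D h L k j))"
  define W where "W = mat D D (\<lambda>(j,i). y i ^ j)"
  define E where "E = mat D D (\<lambda>(i,i'). if i = i' then e i else 0)"
  have car: "M \<in> carrier_mat D D" "W \<in> carrier_mat D D" "E \<in> carrier_mat D D" by (simp_all add: M_def W_def E_def)
  have "M * W = W * E"
  proof (rule eq_matI)
    fix k i assume "k < dim_row (W * E)" "i < dim_col (W * E)"
    then have ki: "k < D" "i < D" using car by auto
    have "(M * W) $$ (k, i) = (\<Sum>j<D. ev1 x (norm_mat cw D h L k j) * y i ^ j)"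
      using ki by (simp add: M_def W_def scalar_prod_def atLeast0LessThan)
    also have "\<dots> = e i * y i ^ k" unfolding e_def by (rule norm_mat_ev1[OF y[OF ki(2)]])
    also have "\<dots> = (W * E) $$ (k, i)"
      using ki by (simp add: E_def W_def scalar_prod_def atLeast0LessThan mult_delta_right mult.commute)
    finally show "(M * W) $$ (k, i) = (W * E) $$ (k, i)" .
  qed (use car in auto)
  then have "det M * det W = det (W * E)" using det_mult[OF car(1,2)] by metis
  also have "\<dots> = det W * det E" by (rule det_mult[OF car(2,3)])
  finally have "det M * det W = det W * det E" .
  \<comment> \<open>\<open>W\<close> is a Vandermonde matrix; a kernel vector of its transpose would
    be a polynomial of degree below \<open>D\<close> with the \<open>D\<close> distinct roots
    \<open>y i\<close>.\<close>
  moreover have "det W \<noteq> 0"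
  proof
    assume "det W = 0"
    moreover have "transpose_mat W = mat D D (\<lambda>(i,j). y i ^ j)" unfolding W_def by (rule eq_matI) auto
    ultimately have "det (mat D D (\<lambda>(i,j). y i ^ j)) = 0" using det_transpose[OF car(2)] by simp
    then obtain v where v: "\<exists>j<D. v j \<noteq> 0" "\<And>i. i < D \<Longrightarrow> (\<Sum>j<D. y i ^ j * v j) = 0" by (rule det_zero_kernel) (rule that)
    define R where "R = (\<Sum>j<D. monom (v j) j)"
    have cR: "coeff R j = (if j < D then v j else 0)" for j by (simp add: R_def coeff_sum if_distrib cong: if_cong)
    have "R \<noteq> 0" using v(1) cR by (metis coeff_0)
    have "degree R \<le> D - 1" by (rule degree_le) (use cR in auto)
    then have "degree R < D" using D0 by simp
    have "inj_on y {..<D}" using inj by (auto simp: inj_on_def)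
    then have "D = card (y ` {..<D})" by (simp add: card_image)
    also have "\<dots> \<le> card {x. poly R x = 0}"
    proof (rule card_mono)
      show "finite {x. poly R x = 0}" by (rule poly_roots_finite[OF \<open>R \<noteq> 0\<close>])
      show "y ` {..<D} \<subseteq> {x. poly R x = 0}" using v(2) by (auto simp: R_def poly_sum poly_monom mult.commute)
    qed
    also have "\<dots> \<le> degree R" by (rule card_poly_roots_bound[OF \<open>R \<noteq> 0\<close>])
    finally show False using \<open>degree R < D\<close> by simp
  qed
  ultimately have "det M = det E" by simp
  also have "\<dots> = (\<Prod>i<D. e i)"
  proof -
    have "upper_triangular E" unfolding E_def by (auto simp: upper_triangular_def)
    then have "det E = prod_list (diag_mat E)" by (rule det_upper_triangular[OF _ car(3)])
    also have "\<dots> = (\<Prod>i\<in>{0..<D}. E $$ (i, i))" using prod_list_diag_prod[of E] car(3) by simp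
    finally show ?thesis by (simp add: E_def atLeast0LessThan)
  qed
  finally show ?thesis unfolding e_def norm_poly_def hom_det_mat[OF ev1_hom] M_def .
qed

lemma unit_dvd_cancel:
  fixes u F :: "'k fps"
  assumes "u $ 0 \<noteq> 0" "fps_X ^ m dvd u * F" shows "fps_X ^ m dvd F"
proof -
  have "fps_X ^ m dvd inverse u * (u * F)" by (rule dvd_mult[OF assms(2)])
  moreover have "inverse u * (u * F) = F" using inverse_mult_eq_1[OF assms(1)] by (simp add: mult.assoc[symmetric])
  ultimately show ?thesis by simp
qed

end

text \<open>One formal branch \<open>\<eta>\<close> at 0 carries the irreducibility: the last
  assumption says that \<open>1, ..., \<eta> ^ (D - 1)\<close> are linearly independent over the
  polynomials in \<open>x\<close>.\<close>

locale slice = curve p T D c for p and T :: "'k::field itself" and D c +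
  fixes \<eta> :: "'k fps"
  assumes cFp: "\<And>j i. j < D \<Longrightarrow> coeff (c j) i \<in> prime_subfield"
    and root: "branch D c fps_X \<eta>"
    and minimal: "\<And>w k. (\<Sum>k<D. ev1 fps_X (w k) * \<eta> ^ k) = 0 \<Longrightarrow> k < D \<Longrightarrow> w k = 0"
begin

text \<open>A vanishing norm yields a nonzero polynomial combination \<open>s\<close> of the rows
  that vanishes, and then the values of \<open>h\<close> and \<open>s\<close> at
  \<open>\<eta>\<close> have product 0.\<close>

lemma norm_poly_nonzero:
  assumes "(\<Sum>i<L. ev1 fps_X (h i) * \<eta> ^ i) \<noteq> 0"
  shows "norm_poly L h \<noteq> 0"
proof
  assume "norm_poly L h = 0"
  moreover have "transpose_mat (mat D D (\<lambda>(k,j). norm_mat cw D h L k j)) = mat D D (\<lambda>(j,k). norm_mat cw D h L k j)" by (rule eq_matI) auto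
  ultimately have "det (mat D D (\<lambda>(j,k). norm_mat cw D h L k j)) = 0"
    using det_transpose[of "mat D D (\<lambda>(k,j). norm_mat cw D h L k j)" D] unfolding norm_poly_def by simp
  then obtain s where s: "\<exists>k<D. s k \<noteq> 0" "\<And>j. j < D \<Longrightarrow> (\<Sum>k<D. norm_mat cw D h L k j * s k) = 0"
    by (rule det_zero_kernel) (rule that)
  have "(\<Sum>i<L. ev1 fps_X (h i) * \<eta> ^ i) * (\<Sum>k<D. ev1 fps_X (s k) * \<eta> ^ k)
      = (\<Sum>k<D. ev1 fps_X (s k) * (\<Sum>j<D. ev1 fps_X (norm_mat cw D h L k j) * \<eta> ^ j))"
    unfolding norm_mat_ev1[OF root] sum_distrib_left by (simp add: mult_ac)
  also have "\<dots> = (\<Sum>j<D. \<Sum>k<D. ev1 fps_X (norm_mat cw D h L k j * s k) * \<eta> ^ j)"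
    unfolding sum_distrib_left by (subst sum.swap) (simp add: ev1_mult mult_ac)
  also have "\<dots> = (\<Sum>j<D. ev1 fps_X (\<Sum>k<D. norm_mat cw D h L k j * s k) * \<eta> ^ j)"
    by (simp add: ev1_sum sum_distrib_right)
  also have "\<dots> = 0" using s(2) by simp
  finally have "(\<Sum>k<D. ev1 fps_X (s k) * \<eta> ^ k) = 0" using assms by simp
  then show False using minimal[where w = s] s(1) by blast
qed

text \<open>The value is a combination of the \<open>X\<^sup>\<alpha> \<eta>\<^sup>k\<close> with \<open>p\<close>-th powers of power series as coefficients. After
  division of these by a common power of \<open>X\<close>, reduction modulo \<open>X\<^sup>p\<close> leaves a nonzero combination with constant
  coefficients, whose order is at most \<open>D A < p\<close> by a norm argument.\<close>

lemma fam_eval_nonzero: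
  assumes DA: "D * A < p"
    and z: "\<exists>i\<in>{(k, l, \<alpha>, \<beta>). k < D \<and> l < D \<and> \<alpha> + k \<le> A \<and> \<beta> + l \<le> B}. z i \<noteq> 0"
    and h: "\<And>k l \<alpha> \<beta>. coeff (coeff (h k l) \<beta>) \<alpha> = (if k < D \<and> l < D \<and> \<alpha> + k \<le> A \<and> \<beta> + l \<le> B then z (k, l, \<alpha>, \<beta>) else 0)"
  shows "fam_eval D fps_X (fps_X ^ p) \<eta> (\<eta> ^ p) h \<noteq> 0"
proof
  assume EV0: "fam_eval D fps_X (fps_X ^ p) \<eta> (\<eta> ^ p) h = 0"
  have "\<forall>x. \<exists>y. y ^ p = (x :: 'k)" using frob_surj by blast
  from choice[OF this] obtain R where R: "\<forall>x. R x ^ p = (x :: 'k)" ..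
  have R0: "R x = 0 \<longleftrightarrow> x = 0" for x using R[rule_format, of x] p_gt_1 by (auto simp: zero_power)
  define Z where "Z k l \<alpha> \<beta> = coeff (coeff (h k l) \<beta>) \<alpha>" for k l \<alpha> \<beta>
  \<comment> \<open>\<open>Q k \<alpha> ^ p\<close> is the coefficient of
    \<open>X ^ \<alpha> * \<eta> ^ k\<close>: the powers of \<open>x' = X ^ p\<close> and
    \<open>y' = \<eta> ^ p\<close> are \<open>p\<close>-th powers, and \<open>R\<close> takes
    \<open>p\<close>-th roots of the constants.\<close>
  define Q where "Q k \<alpha> = (\<Sum>l<D. ev1 fps_X (\<Sum>\<beta>\<le>B. monom (R (Z k l \<alpha> \<beta>)) \<beta>) * \<eta> ^ l)" for k \<alpha>
  have Qp: "Q k \<alpha> ^ p = (\<Sum>l<D. \<Sum>\<beta>\<le>B. fps_const (Z k l \<alpha> \<beta>) * (fps_X ^ p) ^ \<beta> * (\<eta> ^ p) ^ l)" for k \<alpha>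
    unfolding Q_def ev1_sum fps_frob_sum power_mult_distrib sum_distrib_right ev1_monom
    by (simp add: R fps_const_power power_mult[symmetric] mult.commute[of p])
  have "fam_eval D fps_X (fps_X ^ p) \<eta> (\<eta> ^ p) h = (\<Sum>k<D. \<Sum>\<alpha>\<le>A. fps_X ^ \<alpha> * \<eta> ^ k * Q k \<alpha> ^ p)"
  proof -
    have e2: "ev2 fps_X (fps_X ^ p) (h k l) = (\<Sum>\<beta>\<le>B. \<Sum>\<alpha>\<le>A. fps_const (Z k l \<alpha> \<beta>) * fps_X ^ \<alpha> * (fps_X ^ p) ^ \<beta>)" for k l
    proof -
      have "ev2 fps_X (fps_X ^ p) (h k l) = ev1 fps_X (poly (h k l) (monom 1 p))"
        by (rule ev1_poly_monom[symmetric])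
      also have "poly (h k l) (monom 1 p) = (\<Sum>\<beta>\<le>B. coeff (h k l) \<beta> * monom 1 p ^ \<beta>)"
        by (rule poly_poly_altdef) (auto intro!: poly_eqI simp: h)
      also have "ev1 fps_X \<dots> = (\<Sum>\<beta>\<le>B. ev1 fps_X (coeff (h k l) \<beta>) * (fps_X ^ p) ^ \<beta>)"
      proof -
        interpret comm_ring_hom "ev1 (fps_X :: 'k fps)" by (rule ev1_hom)
        show ?thesis by (simp add: hom_distribs ev1_monom)
      qed
      also have "\<dots> = (\<Sum>\<beta>\<le>B. (\<Sum>\<alpha>\<le>A. fps_const (Z k l \<alpha> \<beta>) * fps_X ^ \<alpha>) * (fps_X ^ p) ^ \<beta>)"
      proof -
        have "ev1 fps_X (coeff (h k l) \<beta>) = (\<Sum>\<alpha>\<le>A. fps_const (Z k l \<alpha> \<beta>) * fps_X ^ \<alpha>)" for \<beta>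
          unfolding Z_def by (rule ev1_altdef) (simp add: h)
        then show ?thesis by simp
      qed
      finally show ?thesis by (simp add: sum_distrib_right)
    qed
    have "fam_eval D fps_X (fps_X ^ p) \<eta> (\<eta> ^ p) h
        = (\<Sum>k<D. \<Sum>l<D. \<Sum>\<beta>\<le>B. \<Sum>\<alpha>\<le>A. fps_X ^ \<alpha> * \<eta> ^ k * (fps_const (Z k l \<alpha> \<beta>) * (fps_X ^ p) ^ \<beta> * (\<eta> ^ p) ^ l))"
      unfolding fam_eval_def e2 sum_distrib_right by (simp only: mult_ac)
    also have "\<dots> = (\<Sum>k<D. \<Sum>\<alpha>\<le>A. \<Sum>l<D. \<Sum>\<beta>\<le>B. fps_X ^ \<alpha> * \<eta> ^ k * (fps_const (Z k l \<alpha> \<beta>) * (fps_X ^ p) ^ \<beta> * (\<eta> ^ p) ^ l))"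
    proof (rule sum.cong[OF refl])
      fix k
      let ?f = "\<lambda>l \<beta> \<alpha>. fps_X ^ \<alpha> * \<eta> ^ k * (fps_const (Z k l \<alpha> \<beta>) * (fps_X ^ p) ^ \<beta> * (\<eta> ^ p) ^ l)"
      have "(\<Sum>l<D. \<Sum>\<beta>\<le>B. \<Sum>\<alpha>\<le>A. ?f l \<beta> \<alpha>) = (\<Sum>l<D. \<Sum>\<alpha>\<le>A. \<Sum>\<beta>\<le>B. ?f l \<beta> \<alpha>)"
        by (rule sum.cong[OF refl]) (rule sum.swap)
      also have "\<dots> = (\<Sum>\<alpha>\<le>A. \<Sum>l<D. \<Sum>\<beta>\<le>B. ?f l \<beta> \<alpha>)" by (rule sum.swap)
      finally show "(\<Sum>l<D. \<Sum>\<beta>\<le>B. \<Sum>\<alpha>\<le>A. ?f l \<beta> \<alpha>) = (\<Sum>\<alpha>\<le>A. \<Sum>l<D. \<Sum>\<beta>\<le>B. ?f l \<beta> \<alpha>)" .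
    qed
    finally show ?thesis unfolding Qp sum_distrib_left .
  qed
  then have sum0: "(\<Sum>k<D. \<Sum>\<alpha>\<le>A. fps_X ^ \<alpha> * \<eta> ^ k * Q k \<alpha> ^ p) = 0" using EV0 by simp
  have "\<exists>m k \<alpha>. k < D \<and> \<alpha> \<le> A \<and> Q k \<alpha> $ m \<noteq> 0"
  proof -
    obtain k l \<alpha> \<beta> where i: "k < D" "l < D" "\<alpha> + k \<le> A" "\<beta> + l \<le> B" "z (k, l, \<alpha>, \<beta>) \<noteq> 0" using z by auto
    have "Q k \<alpha> \<noteq> 0"
    proof
      assume "Q k \<alpha> = 0"
      then have "(\<Sum>\<beta>\<le>B. monom (R (Z k l \<alpha> \<beta>)) \<beta>) = 0"
        unfolding Q_def by (rule minimal[where w = "\<lambda>l. \<Sum>\<beta>\<le>B. monom (R (Z k l \<alpha> \<beta>)) \<beta>", OF _ i(2)])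
      then have "coeff (\<Sum>\<beta>\<le>B. monom (R (Z k l \<alpha> \<beta>)) \<beta>) \<beta> = 0" by simp
      then have "R (Z k l \<alpha> \<beta>) = 0" using i(4) by (simp add: coeff_sum if_distrib cong: if_cong)
      then show False using i by (simp add: R0 Z_def h)
    qed
    then obtain m where "Q k \<alpha> $ m \<noteq> 0" by (auto simp: fps_eq_iff)
    then show ?thesis using i by (intro exI[of _ m] exI[of _ k] exI[of _ \<alpha>]) auto
  qed
  \<comment> \<open>The least order among all \<open>Q k \<alpha>\<close>, that is, their common
    power of \<open>X\<close>.\<close>
  then obtain m where m: "\<exists>k \<alpha>. k < D \<and> \<alpha> \<le> A \<and> Q k \<alpha> $ m \<noteq> 0"
    and least: "\<And>m'. m' < m \<Longrightarrow> \<not> (\<exists>k \<alpha>. k < D \<and> \<alpha> \<le> A \<and> Q k \<alpha> $ m' \<noteq> 0)"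
    using exists_least_iff[of "\<lambda>m. \<exists>k \<alpha>. k < D \<and> \<alpha> \<le> A \<and> Q k \<alpha> $ m \<noteq> 0"] by blast
  define Q' where "Q' k \<alpha> = fps_shift m (Q k \<alpha>)" for k \<alpha>
  have Q': "Q k \<alpha> = fps_X ^ m * Q' k \<alpha>" if "k < D" "\<alpha> \<le> A" for k \<alpha>
  proof (rule fps_ext)
    fix i
    have "Q k \<alpha> $ i = 0" if "i < m" using least[OF that] \<open>k < D\<close> \<open>\<alpha> \<le> A\<close> by blast
    then show "Q k \<alpha> $ i = (fps_X ^ m * Q' k \<alpha>) $ i" by (simp add: fps_X_power_mult_nth Q'_def)
  qed
  define \<theta> where "\<theta> k \<alpha> = (Q k \<alpha> $ m) ^ p" for k \<alpha>
  define w where "w k = (\<Sum>\<alpha>\<le>A. monom (\<theta> k \<alpha>) \<alpha>)" for k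
  define W where "W = (\<Sum>k<D. ev1 fps_X (w k) * \<eta> ^ k)"
  have "fps_X ^ p dvd W"
  proof -
    have "fps_X ^ (m * p) * (\<Sum>k<D. \<Sum>\<alpha>\<le>A. fps_X ^ \<alpha> * \<eta> ^ k * Q' k \<alpha> ^ p) = (\<Sum>k<D. \<Sum>\<alpha>\<le>A. fps_X ^ \<alpha> * \<eta> ^ k * Q k \<alpha> ^ p)"
      unfolding sum_distrib_left by (intro sum.cong refl) (simp add: Q' power_mult_distrib power_mult mult_ac)
    then have z: "(\<Sum>k<D. \<Sum>\<alpha>\<le>A. fps_X ^ \<alpha> * \<eta> ^ k * Q' k \<alpha> ^ p) = 0" unfolding sum0 by simp
    have "fps_X ^ p dvd Q' k \<alpha> ^ p - fps_const (\<theta> k \<alpha>)" for k \<alpha>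
    proof -
      have "fps_X ^ 1 dvd Q' k \<alpha> - fps_const (Q k \<alpha> $ m)" unfolding fps_X_power_dvd_iff by (simp add: Q'_def)
      then have "fps_X ^ p dvd (Q' k \<alpha> - fps_const (Q k \<alpha> $ m)) ^ p" using dvd_power_same by fastforce
      then show ?thesis by (simp add: fps_frob_diff \<theta>_def fps_const_power)
    qed
    then have "fps_X ^ p dvd (\<Sum>k<D. \<Sum>\<alpha>\<le>A. fps_X ^ \<alpha> * \<eta> ^ k * (Q' k \<alpha> ^ p - fps_const (\<theta> k \<alpha>)))"
      by (intro dvd_sum dvd_mult)
    also have "\<dots> = - W"
      unfolding right_diff_distrib sum_subtractf z W_def w_def ev1_sum ev1_monom sum_distrib_right
      by (simp add: mult_ac)
    finally show ?thesis by simp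
  qed
  have \<theta>0: "\<theta> k \<alpha> = 0" if "\<not> \<alpha> + k \<le> A" for k \<alpha>
  proof -
    have "Z k l \<alpha> \<beta> = 0" for l \<beta> using that by (simp add: Z_def h)
    moreover have "R 0 = 0" by (simp add: R0)
    ultimately show ?thesis using p_gt_1 by (simp add: \<theta>_def Q_def zero_power)
  qed
  have wdle: "dle (int A - int k) (w k)" for k
    unfolding w_def
  proof (rule dle_sum)
    fix \<alpha> assume "\<alpha> \<in> {..A}"
    show "dle (int A - int k) (monom (\<theta> k \<alpha>) \<alpha>)"
      by (cases "\<alpha> + k \<le> A") (auto simp: \<theta>0 intro!: dle_monom)
  qed
  have "W \<noteq> 0"
  proof
    assume "W = 0"
    obtain k \<alpha> where k: "k < D" "\<alpha> \<le> A" "Q k \<alpha> $ m \<noteq> 0" using m by blast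
    have "w k = 0" using minimal[where w = w, OF _ k(1)] \<open>W = 0\<close> unfolding W_def by blast
    moreover have "coeff (w k) \<alpha> = \<theta> k \<alpha>" using k(2) by (simp add: w_def coeff_sum if_distrib cong: if_cong)
    ultimately show False using k(3) by (simp add: \<theta>_def)
  qed
  \<comment> \<open>\<open>X ^ p\<close> divides \<open>W\<close>, and \<open>W\<close> divides the
    norm of \<open>w\<close>, a nonzero polynomial of degree at most
    \<open>D * A < p\<close>.\<close>
  then have N: "norm_poly D w \<noteq> 0" unfolding W_def by (rule norm_poly_nonzero)
  have "W dvd ev1 fps_X (norm_poly D w)" unfolding W_def by (rule norm_poly_dvd[OF root])
  then have "fps_X ^ p dvd ev1 (fps_const 0 + fps_X) (norm_poly D w)" using \<open>fps_X ^ p dvd W\<close> dvd_trans by simp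
  then have "p \<le> order 0 (norm_poly D w)" by (rule fps_X_power_dvd_ev1[OF N])
  also have "\<dots> \<le> degree (norm_poly D w)" by (rule order_degree[OF N])
  also have "\<dots> \<le> D * A" unfolding dle_degree[symmetric] of_nat_mult by (rule norm_poly_dle[OF wdle])
  finally show False using DA by simp
qed

lemma branch_frob:
  assumes "branch D c x y" shows "branch D c (x ^ p) (y ^ p)"
proof -
  have "(y ^ D + (\<Sum>j<D. ev1 x (c j) * y ^ j)) ^ p = 0" using assms p_gt_1 unfolding branch_def by (simp add: zero_power)
  then have "(y ^ D) ^ p + (\<Sum>j<D. ev1 x (c j) ^ p * (y ^ j) ^ p) = 0"
    by (simp add: fps_frob_add fps_frob_sum power_mult_distrib)
  moreover have "ev1 x (c j) ^ p = ev1 (x ^ p) (c j)" if "j < D" for j by (rule ev1_frob[OF cFp[OF that]])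
  ultimately show ?thesis unfolding branch_def by (simp add: power_mult[symmetric] mult.commute)
qed

text \<open>The roots counted are those outside the prime field. On each of their branches the
  auxiliary function vanishes to order \<open>M\<close>; the norm, being the product over the
  branches, collects these orders, while its degree is at most \<open>D * (A + p * B)\<close>. Few
  irrational roots mean many rational points.\<close>

theorem stepanov_count:
  assumes card: "card {(i, k, l, m). i < M \<and> k < D \<and> 1 \<le> l \<and> l < D \<and> m + k + l \<le> A + B + 1}
      < card {(k, l, \<alpha>, \<beta>). k < D \<and> l < D \<and> \<alpha> + k \<le> A \<and> \<beta> + l \<le> B}"
    and DA: "D * A < p" and Dp: "D \<le> p" and S: "S \<subseteq> Fp"
    and simple: "\<And>a b. a \<in> S \<Longrightarrow> poly (spec a) b = 0 \<Longrightarrow> poly (pderiv (spec a)) b \<noteq> 0"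
  shows "M * (\<Sum>a\<in>S. D - card {b \<in> Fp. poly (spec a) b = 0}) \<le> D * (A + p * B)"
proof -
  obtain z h where z: "\<exists>i\<in>{(k, l, \<alpha>, \<beta>). k < D \<and> l < D \<and> \<alpha> + k \<le> A \<and> \<beta> + l \<le> B}. z i \<noteq> (0::'k)"
    and h: "\<And>k l \<alpha> \<beta>. coeff (coeff (h k l) \<beta>) \<alpha> = (if k < D \<and> l < D \<and> \<alpha> + k \<le> A \<and> \<beta> + l \<le> B then z (k, l, \<alpha>, \<beta>) else 0)"
    and K: "\<And>i k l. i < M \<Longrightarrow> k < D \<Longrightarrow> 1 \<le> l \<Longrightarrow> l < D \<Longrightarrow> diag (mul_diff D c ((diff_quot D c ^^ i) h) k l) = 0"
    by (rule stepanov_family[where M = M and A = A and B = B, OF cdle card]) (assumption, rule that)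
  have K0: "diag (mul_diff D c ((diff_quot D c ^^ i) h) k l) = 0" if "i < M" "k < D" "l < D" for i k l
  proof (cases "l = 0") \<comment> \<open>the value at \<open>(x, y) = (x', y')\<close> is 0 because of the factor \<open>y - y'\<close>\<close>
    case True
    let ?q = "mul_diff D c ((diff_quot D c ^^ i) h)"
    have ed: "ev2 fps_X fps_X q = ev1 fps_X (diag q)" for q :: "'k poly poly" using ev2_dquot[of fps_X fps_X q] by simp
    have "0 = fam_eval D fps_X fps_X \<eta> \<eta> ?q" using fam_eval_mul_diff[OF D0 root root, of "(diff_quot D c ^^ i) h"] by simp
    also have "\<dots> = (\<Sum>k<D. \<Sum>l<D. if l = 0 then ev1 fps_X (diag (?q k 0)) * \<eta> ^ k else 0)"
      unfolding fam_eval_def ed by (intro sum.cong refl) (use K[OF that(1)] in auto)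
    also have "\<dots> = (\<Sum>k<D. ev1 fps_X (diag (?q k 0)) * \<eta> ^ k)" using D0 by simp
    finally have "(\<Sum>k<D. ev1 fps_X (diag (?q k 0)) * \<eta> ^ k) = 0" by simp
    from minimal[where w = "\<lambda>k. diag (?q k 0)", OF this that(2)] show ?thesis using True by simp
  next
    case False
    then show ?thesis using K[OF that(1,2) _ that(3)] by simp
  qed
  \<comment> \<open>As \<open>y' = y ^ p\<close>, the family is a polynomial in \<open>y\<close>
    alone. The index \<open>i = k + p * l\<close> codes the pair \<open>(k, l)\<close>,
    unambiguously because \<open>D \<le> p\<close>.\<close>
  define G where "G i = (if i mod p < D then poly (h (i mod p) (i div p)) (monom 1 p) else 0)" for i
  have GE: "(\<Sum>i<D * p. ev1 x (G i) * y ^ i) = fam_eval D x (x ^ p) y (y ^ p) h" for x y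
  proof -
    let ?f = "\<lambda>l k. if k < D then ev2 x (x ^ p) (h k l) * y ^ k * (y ^ p) ^ l else 0"
    have p0: "p > 0" using p_gt_1 by simp
    have "(\<Sum>i<D * p. ev1 x (G i) * y ^ i) = (\<Sum>i<D * p. ?f (i div p) (i mod p))"
    proof (rule sum.cong[OF refl])
      fix i
      have "y ^ i = y ^ (i mod p) * (y ^ p) ^ (i div p)" by (simp add: power_mult[symmetric] power_add[symmetric])
      then show "ev1 x (G i) * y ^ i = ?f (i div p) (i mod p)" by (simp add: G_def ev1_poly_monom mult.assoc)
    qed
    also have "\<dots> = (\<Sum>l<D. \<Sum>k<p. ?f l k)" by (rule sum_div_mod[OF p0])
    also have "\<dots> = (\<Sum>l<D. \<Sum>k<D. ?f l k)" by (intro sum.cong refl sum.mono_neutral_right) (use Dp in auto)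
    also have "\<dots> = (\<Sum>k<D. \<Sum>l<D. ?f l k)" by (rule sum.swap)
    finally show ?thesis unfolding fam_eval_def by simp
  qed
  have Gdle: "dle (int (A + p * B) - int i) (G i)" if "i < D * p" for i
  proof (cases "i mod p < D")
    case True
    define k l where "k = i mod p" and "l = i div p"
    have i: "i = k + p * l" by (simp add: k_def l_def)
    have "poly (h k l) (monom 1 p) = (\<Sum>\<beta>\<le>B. coeff (h k l) \<beta> * monom 1 p ^ \<beta>)"
      by (rule poly_poly_altdef) (auto intro!: poly_eqI simp: h)
    moreover have "dle (int (A + p * B) - int i) (coeff (h k l) \<beta> * monom 1 p ^ \<beta>)" for \<beta>
    proof (cases "\<beta> + l \<le> B")
      case True
      have "dle (int A - int k) (coeff (h k l) \<beta>)" by (auto simp: dle_def h)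
      moreover have "dle (int (p * \<beta>)) (monom 1 p ^ \<beta> :: 'k poly)"
        by (simp add: monom_power dle_monom mult.commute)
      ultimately have "dle (int A - int k + int (p * \<beta>)) (coeff (h k l) \<beta> * monom 1 p ^ \<beta>)" by (rule dle_mult)
      moreover have "p * (\<beta> + l) \<le> p * B" using True by (rule mult_le_mono2)
      then have "int A - int k + int (p * \<beta>) \<le> int (A + p * B) - int i" by (simp add: i algebra_simps flip: of_nat_mult of_nat_add)
      ultimately show ?thesis by (rule dle_mono)
    next
      case False
      then have "coeff (h k l) \<beta> = 0" by (intro poly_eqI) (simp add: h)
      then show ?thesis by simp
    qed
    ultimately have "dle (int (A + p * B) - int i) (poly (h k l) (monom 1 p))" by (simp add: dle_sum)
    then show ?thesis using True by (simp add: G_def k_def l_def)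
  qed (simp add: G_def)
  let ?N = "norm_poly (D * p) G"
  have N0: "?N \<noteq> 0"
    by (rule norm_poly_nonzero) (unfold GE, rule fam_eval_nonzero[OF DA z h])
  have ord: "M * (D - card {b \<in> Fp. poly (spec a) b = 0}) \<le> order a ?N" if aS: "a \<in> S" for a
  proof -
    have "card {b. poly (spec a) b = 0} = D"
      using simple_roots_card[OF spec_nz simple[OF aS]] degree_spec by simp
    then obtain \<beta> where \<beta>: "bij_betw \<beta> {..<D} {b. poly (spec a) b = 0}"
      using poly_roots_finite[OF spec_nz[of a]] by (metis ex_bij_betw_nat_finite atLeast0LessThan)
    let ?x = "fps_const a + fps_X"
    have "\<forall>i\<in>{..<D}. \<exists>y. branch D c ?x y \<and> y $ 0 = \<beta> i"
    proof
      fix i assume "i \<in> {..<D}"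
      then have "poly (spec a) (\<beta> i) = 0" using \<beta> by (auto simp: bij_betw_def)
      then have "branch D c ?x (hroot (eqn a) (\<beta> i))" "hroot (eqn a) (\<beta> i) $ 0 = \<beta> i"
        using hensel_spec[OF _ simple[OF aS], of "\<beta> i"] by simp_all
      then show "\<exists>y. branch D c ?x y \<and> y $ 0 = \<beta> i" by blast
    qed
    from bchoice[OF this] obtain y where y: "\<forall>i\<in>{..<D}. branch D c ?x (y i) \<and> y i $ 0 = \<beta> i" ..
    have a: "a ^ p = a" using aS S by (auto simp: mem_Fp)
    \<comment> \<open>Since \<open>a ^ p = a\<close>, the difference \<open>x ^ p - x\<close> at
      \<open>x = a + X\<close> has order 1.\<close>
    have xp: "?x ^ p - ?x = fps_X * (fps_X ^ (p - 1) - 1)"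
    proof -
      have "fps_X ^ p = fps_X * (fps_X :: 'k fps) ^ (p - 1)"
        using p_gt_1 by (subst power_Suc[symmetric]) simp
      then show ?thesis by (simp add: fps_frob_add fps_const_power a algebra_simps)
    qed
    \<comment> \<open>At a root outside the prime field \<open>y - y ^ p\<close> is a unit, so the
      \<open>M\<close> steps turn into divisibility by \<open>X ^ M\<close>.\<close>
    have dvd: "fps_X ^ M dvd fam_eval D ?x (?x ^ p) (y i) (y i ^ p) h" if "i < D" "\<beta> i \<notin> Fp" for i
    proof (rule unit_dvd_cancel)
      have yi: "branch D c ?x (y i)" "y i $ 0 = \<beta> i" using y that by auto
      have "\<beta> i ^ p \<noteq> \<beta> i" using that(2) by (simp add: mem_Fp)
      then have "(y i - y i ^ p) $ 0 \<noteq> 0" using yi(2) by (simp add: fps_power_zeroth)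
      then show "((y i - y i ^ p) ^ M) $ 0 \<noteq> 0" by (simp add: fps_power_zeroth)
      have "(y i - y i ^ p) ^ M * fam_eval D ?x (?x ^ p) (y i) (y i ^ p) h
          = (?x ^ p - ?x) ^ M * fam_eval D ?x (?x ^ p) (y i) (y i ^ p) ((diff_quot D c ^^ M) h)"
        by (rule fam_eval_funpow[OF D0 yi(1) branch_frob[OF yi(1)] K0])
      then show "fps_X ^ M dvd (y i - y i ^ p) ^ M * fam_eval D ?x (?x ^ p) (y i) (y i ^ p) h"
        unfolding xp power_mult_distrib by simp
    qed
    define I where "I = {i \<in> {..<D}. \<beta> i \<notin> Fp}"
    have cI: "card I = D - card {b \<in> Fp. poly (spec a) b = 0}"
    proof -
      have "\<beta> ` ({..<D} - I) = {b \<in> Fp. poly (spec a) b = 0}" using \<beta> unfolding I_def bij_betw_def by auto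
      moreover have "inj_on \<beta> ({..<D} - I)" using \<beta> unfolding bij_betw_def by (auto intro: inj_on_subset)
      ultimately have "card ({..<D} - I) = card {b \<in> Fp. poly (spec a) b = 0}" by (metis card_image)
      moreover have "card ({..<D} - I) = D - card I" unfolding I_def by (subst card_Diff_subset) auto
      moreover have "card I \<le> D" unfolding I_def using card_mono[of "{..<D}" "{i \<in> {..<D}. \<beta> i \<notin> Fp}"] by auto
      ultimately show ?thesis by simp
    qed
    have "fps_X ^ (M * card I) = (\<Prod>i<D. if \<beta> i \<notin> Fp then fps_X ^ M else (1 :: 'k fps))"
    proof -
      have "(\<Prod>i\<in>I. fps_X ^ M) = (\<Prod>i<D. if \<beta> i \<notin> Fp then fps_X ^ M else (1 :: 'k fps))"
        unfolding I_def by (rule prod.inter_filter) simp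
      then show ?thesis by (simp only: prod_constant power_mult)
    qed
    also have "\<dots> dvd (\<Prod>i<D. fam_eval D ?x (?x ^ p) (y i) (y i ^ p) h)"
      by (rule prod_dvd_prod) (use dvd in auto)
    also have "\<dots> = ev1 ?x ?N"
      unfolding GE[symmetric]
    proof (rule norm_poly_prod[symmetric])
      fix i j assume "i < D" "j < D" "y i $ 0 = y j $ 0"
      then have "\<beta> i = \<beta> j" using y by simp
      then show "i = j" using \<beta> \<open>i < D\<close> \<open>j < D\<close> unfolding bij_betw_def inj_on_def by blast
    qed (use y in auto)
    finally show ?thesis unfolding cI by (rule fps_X_power_dvd_ev1[OF N0])
  qed
  have Sfin: "finite S" using S card_Fp_roots(1) by (rule finite_subset)
  have "M * (\<Sum>a\<in>S. D - card {b \<in> Fp. poly (spec a) b = 0}) \<le> (\<Sum>a\<in>S. order a ?N)"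
    unfolding sum_distrib_left by (rule sum_mono) (rule ord)
  also have "\<dots> = (\<Sum>a\<in>{a \<in> S. poly ?N a = 0}. order a ?N)"
    by (rule sum.mono_neutral_right[OF Sfin]) (auto simp: order_0I)
  also have "\<dots> \<le> (\<Sum>a\<in>{a. poly ?N a = 0}. order a ?N)"
    by (rule sum_mono2) (use poly_roots_finite[OF N0] in auto)
  also have "\<dots> \<le> degree ?N" by (rule sum_order_le_degree[OF N0])
  also have "\<dots> \<le> D * (A + p * B)"
    unfolding dle_degree[symmetric] using norm_poly_dle[of "D * p" "int (A + p * B)" G] Gdle by simp
  finally show ?thesis .
qed

end

subsection \<open>Irreducibility of most lines through a point\<close>

text \<open>The pattern that arises when the direction \<open>v\<close> occurs only in products with
  the parameter of the line.\<close>

definition graded :: "nat \<Rightarrow> ((nat \<Rightarrow> 'k::field) \<Rightarrow> 'k fps) \<Rightarrow> bool" where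
  "graded r S \<longleftrightarrow> (\<forall>i. pf r (int i) (\<lambda>v. S v $ i))"

lemma graded_const: "graded r (\<lambda>_. fps_const b)"
  unfolding graded_def by (auto intro: pf_const pf_zero)

lemma graded_diff: "graded r S \<Longrightarrow> graded r S' \<Longrightarrow> graded r (\<lambda>v. S v - S' v)"
  unfolding graded_def by (auto intro: pf_diff)

lemma graded_mult:
  assumes "graded r S" "graded r S'" shows "graded r (\<lambda>v. S v * S' v)"
  unfolding graded_def fps_mult_nth
proof (intro allI pf_sum)
  fix n i :: nat assume "i \<in> {0..n}"
  then have "int i + int (n - i) = int n" by simp
  moreover have "pf r (int i) (\<lambda>v. S v $ i)" "pf r (int (n - i)) (\<lambda>v. S' v $ (n - i))"
    using assms unfolding graded_def by blast+
  ultimately show "pf r (int n) (\<lambda>v. S v $ i * S' v $ (n - i))" using pf_mult by metis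
qed

lemma graded_power: "graded r S \<Longrightarrow> graded r (\<lambda>v. S v ^ n)"
  by (induction n) (simp_all add: graded_mult graded_const[of r 1, simplified])

lemma graded_sum: "(\<And>i. i \<in> A \<Longrightarrow> graded r (S i)) \<Longrightarrow> graded r (\<lambda>v. \<Sum>i\<in>A. S i v)"
  unfolding graded_def fps_sum_nth by (intro allI pf_sum) auto

lemma graded_monomial:
  assumes "pf r (int n) f" shows "graded r (\<lambda>v. fps_const (f v) * fps_X ^ n)"
  unfolding graded_def
proof
  fix i
  have "(\<lambda>v. (fps_const (f v) * fps_X ^ n) $ i) = (if i = n then f else (\<lambda>_. 0))" by auto
  then show "pf r (int i) (\<lambda>v. (fps_const (f v) * fps_X ^ n) $ i)" using assms by (auto intro: pf_zero)
qed

text \<open>The residue \<open>\<delta>\<close> of the derivative does not depend on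
  \<open>v\<close>, so the recursion \<open>hens\<close> divides only by a constant.\<close>

lemma graded_hroot:
  fixes C :: "nat \<Rightarrow> (nat \<Rightarrow> 'k::field) \<Rightarrow> 'k fps"
  assumes C: "\<And>j. j \<le> D \<Longrightarrow> graded r (C j)"
    and \<delta>: "\<And>v. poly (pderiv (\<Sum>j\<le>D. monom (C j v) j)) (fps_const b) $ 0 = \<delta>"
  shows "graded r (\<lambda>v. hroot (\<Sum>j\<le>D. monom (C j v) j) b)"
proof -
  define P where "P v = (\<Sum>j\<le>D. monom (C j v) j)" for v
  have "graded r (\<lambda>v. hens (P v) \<delta> b n)" for n
  proof (induction n)
    case (Suc n)
    have "graded r (\<lambda>v. \<Sum>j\<le>D. C j v * hens (P v) \<delta> b n ^ j)"
      by (intro graded_sum graded_mult graded_power C Suc.IH) simp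
    then have "pf r (int (Suc n)) (\<lambda>v. poly (P v) (hens (P v) \<delta> b n) $ Suc n)"
      unfolding graded_def P_def poly_sum poly_monom by blast
    then have "pf r (int (Suc n)) (\<lambda>v. (1 / \<delta>) * poly (P v) (hens (P v) \<delta> b n) $ Suc n)" by (rule pf_cmult)
    from graded_diff[OF Suc.IH graded_monomial[OF this]] show ?case by simp
  qed (simp add: graded_const)
  then show ?thesis unfolding graded_def hroot_def P_def[symmetric] using \<delta> by (simp add: P_def)
qed

context curve
begin

text \<open>A relation of least degree \<open>e\<close> for the branch divides the equation of the
  curve up to a factor from the base, by pseudo-division and minimality. Gauss' lemma then makes it
  monic with weighted coefficients, so its total degree is at most \<open>e < D\<close>.\<close>

lemma nonminimal_branch_factor:
  assumes root: "branch D c fps_X \<eta>" and w: "(\<Sum>k<D. ev1 fps_X (w k) * \<eta> ^ k) = 0" "k < D" "w k \<noteq> 0"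
  obtains e w' where "e < D" "w' e = 1" "\<And>j. j \<le> e \<Longrightarrow> dle (int e - int j) (w' j)" "(\<Sum>j\<le>e. ev1 fps_X (w' j) * \<eta> ^ j) = 0"
proof -
  define P where "P e \<longleftrightarrow> (\<exists>w. (\<exists>j\<le>e. w j \<noteq> 0) \<and> (\<Sum>k\<le>e. ev1 fps_X (w k) * \<eta> ^ k) = 0)" for e
  have D: "{..<D} = {..D - 1}" using D0 by auto
  have "P (D - 1)" unfolding P_def using w D by (intro exI[of _ w]) auto
  define e where "e = (LEAST e. P e)"
  have "P e" unfolding e_def using \<open>P (D - 1)\<close> by (rule LeastI)
  have "e \<le> D - 1" unfolding e_def using \<open>P (D - 1)\<close> by (rule Least_le)
  then have "e < D" using D0 by simp
  have least: "h j = 0" if "(\<Sum>k<e. ev1 fps_X (h k) * \<eta> ^ k) = 0" "j < e" for h j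
  proof (rule ccontr)
    assume "h j \<noteq> 0"
    moreover have "{..<e} = {..e - 1}" using that(2) by auto
    ultimately have "P (e - 1)" unfolding P_def using that by (intro exI[of _ h]) auto
    then have "e \<le> e - 1" unfolding e_def by (rule Least_le)
    then show False using that(2) by simp
  qed
  from \<open>P e\<close> obtain u where u: "\<exists>j\<le>e. u j \<noteq> 0" "(\<Sum>k\<le>e. ev1 fps_X (u k) * \<eta> ^ k) = 0" unfolding P_def by blast
  have "u e \<noteq> 0"
  proof
    assume "u e = 0"
    then have "(\<Sum>k<e. ev1 fps_X (u k) * \<eta> ^ k) = 0" using u(2) by (simp add: sum_atMost_split)
    then have "u j = 0" if "j < e" for j using least that by blast
    then show False using u(1) \<open>u e = 0\<close> by (metis le_neq_implies_less)
  qed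
  have inj: "ev1 fps_X q = 0 \<longleftrightarrow> q = 0" for q :: "'k poly"
    by (auto simp: fps_eq_iff ev1_fps_X poly_eq_iff)
  have "0 < e"
  proof (rule ccontr)
    assume "\<not> 0 < e"
    then show False using u(2) \<open>u e \<noteq> 0\<close> by (simp add: inj)
  qed
  have S0: "(\<Sum>i\<le>D. cw i * u e ^ (D - i) * red u e i j) = 0" if "j < e" for j
  proof (rule least[where h = "\<lambda>j. \<Sum>i\<le>D. cw i * u e ^ (D - i) * red u e i j", OF _ that])
    let ?U = "\<lambda>j. ev1 fps_X (u j)"
    interpret h: comm_ring_hom "ev1 (fps_X :: 'k fps)" by (rule ev1_hom)
    have "(\<Sum>j<e. ev1 fps_X (\<Sum>i\<le>D. cw i * u e ^ (D - i) * red u e i j) * \<eta> ^ j)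
        = (\<Sum>i\<le>D. ev1 fps_X (cw i) * ?U e ^ (D - i) * (\<Sum>j<e. red ?U e i j * \<eta> ^ j))"
      unfolding sum_distrib_left
      by (subst sum.swap) (simp add: ev1_sum hom_distribs red_hom[OF ev1_hom] sum_distrib_right mult.assoc)
    also have "\<dots> = (\<Sum>i\<le>D. ?U e ^ D * (ev1 fps_X (cw i) * \<eta> ^ i))"
    proof (rule sum.cong[OF refl])
      fix i assume "i \<in> {..D}"
      then have "?U e ^ D = ?U e ^ (D - i) * ?U e ^ i" by (simp add: power_add[symmetric])
      then show "ev1 fps_X (cw i) * ?U e ^ (D - i) * (\<Sum>j<e. red ?U e i j * \<eta> ^ j) = ?U e ^ D * (ev1 fps_X (cw i) * \<eta> ^ i)"
        using red_eval[OF \<open>0 < e\<close> u(2), of i, symmetric] by (simp add: mult_ac)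
    qed
    also have "\<dots> = ?U e ^ D * (\<Sum>i\<le>D. ev1 fps_X (cw i) * \<eta> ^ i)" by (rule sum_distrib_left[symmetric])
    also have "(\<Sum>i\<le>D. ev1 fps_X (cw i) * \<eta> ^ i) = 0" by (rule branch_cw[OF root])
    finally show "(\<Sum>j<e. ev1 fps_X (\<Sum>i\<le>D. cw i * u e ^ (D - i) * red u e i j) * \<eta> ^ j) = 0" by simp
  qed
  let ?g = "\<Sum>i\<le>D. monom (cw i) i" and ?W = "\<Sum>j\<le>e. monom (u j) j"
  obtain Q where Q: "smult (u e ^ D) ?g = ?W * Q" using pseudo_division[OF \<open>0 < e\<close> S0] by blast
  have cg: "coeff ?g i = (if i \<le> D then cw i else 0)" for i by (simp add: coeff_sum if_distrib cong: if_cong)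
  have cW: "coeff ?W i = (if i \<le> e then u i else 0)" for i by (simp add: coeff_sum if_distrib cong: if_cong)
  have cwD: "cw D = 1" by (simp add: cw_def)
  have dg: "degree ?g = D" by (rule antisym[OF degree_le le_degree]) (simp_all add: cg cwD)
  have dW: "degree ?W = e" by (rule antisym[OF degree_le le_degree]) (use \<open>u e \<noteq> 0\<close> in \<open>simp_all add: cW\<close>)
  have wtg: "wt (int (degree ?g)) ?g" unfolding wt_def dg cg using cdle by (auto simp: cw_def dle_1)
  have lcg: "lead_coeff ?g = 1" unfolding dg cg by (simp add: cw_def)
  have "u e ^ D \<noteq> 0" using \<open>u e \<noteq> 0\<close> by simp
  from gauss_weight[OF this Q lcg wtg] obtain W' where W': "?W = smult (lead_coeff ?W) W'" "lead_coeff W' = 1" "wt (int (degree ?W)) W'" "degree W' = degree ?W"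
    by (elim exE conjE)
  have uW: "u j = u e * coeff W' j" if "j \<le> e" for j
    using arg_cong[OF W'(1), of "\<lambda>q. coeff q j"] that by (simp add: dW cW)
  show thesis
  proof (rule that[of e "coeff W'"])
    show "coeff W' e = 1" using W'(2,4) dW by simp
    show "dle (int e - int j) (coeff W' j)" for j using W'(3) unfolding wt_def dW by blast
    have "ev1 fps_X (u e) * (\<Sum>j\<le>e. ev1 fps_X (coeff W' j) * \<eta> ^ j) = (\<Sum>k\<le>e. ev1 fps_X (u k) * \<eta> ^ k)"
      unfolding sum_distrib_left
    proof (rule sum.cong[OF refl])
      fix j assume "j \<in> {..e}"
      then show "ev1 fps_X (u e) * (ev1 fps_X (coeff W' j) * \<eta> ^ j) = ev1 fps_X (u j) * \<eta> ^ j"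
        using uW[of j] by (simp add: ev1_mult mult.assoc)
    qed
    then show "(\<Sum>j\<le>e. ev1 fps_X (coeff W' j) * \<eta> ^ j) = 0" using u(2) \<open>u e \<noteq> 0\<close> inj by simp
  qed (rule \<open>e < D\<close>)
qed

end

text \<open>Kaltofen's effective form of Bertini's theorem. A proper factor of the restriction to the line \<open>u + t v\<close> is
  a solution of a linear system in the coefficients of the branch \<open>\<eta>\<close>; either a maximal minor of this system
  is a nonzero polynomial in \<open>v\<close>, or there is a solution over the polynomials in \<open>v\<close>, whose norm vanishes.\<close>

theorem (in Fpbar) kaltofen:
  fixes c :: "nat \<Rightarrow> (nat \<Rightarrow> 'k) \<Rightarrow> 'k" and q :: "nat \<Rightarrow> (nat \<Rightarrow> 'k) \<Rightarrow> 'k poly"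
  assumes irr: "prime_eqn r D c"
    and q: "\<And>j v t. j < D \<Longrightarrow> poly (q j v) t = c j (\<lambda>i. u i + t * v i)"
    and qpf: "\<And>j i. j < D \<Longrightarrow> pf r (int i) (\<lambda>v. coeff (q j v) i)"
    and qdle: "\<And>j v. j < D \<Longrightarrow> dle (int D - int j) (q j v)"
    and \<eta>: "graded r \<eta>" and root: "\<And>v. branch D (\<lambda>j. q j v) fps_X (\<eta> v)"
  obtains \<Psi> where "pf r (int (card {(i, k). i + k < D} * (D * (D - 1)))) \<Psi>" "\<exists>v. \<Psi> v \<noteq> 0"
    "\<And>v w k. \<Psi> v \<noteq> 0 \<Longrightarrow> (\<Sum>k<D. ev1 fps_X (w k) * \<eta> v ^ k) = 0 \<Longrightarrow> k < D \<Longrightarrow> w k = 0"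
proof -
  have D0: "0 < D" using irr unfolding prime_eqn_def by simp
  have curve: "curve p T D (\<lambda>j. q j v)" for v
    unfolding curve_def curve_axioms_def using Fpbar_axioms D0 qdle unfolding Fpbar_def by auto
  \<comment> \<open>Exponents of the monomials \<open>x ^ i * y ^ k\<close> of total degree below
    \<open>D\<close>, where a proper monic factor has its support.\<close>
  let ?I = "{(i, k). i + k < D}"
  define N where "N = card ?I"
  \<comment> \<open>Bound for the degree of the norm of a polynomial of total degree at most
    \<open>D - 1\<close>; a value of higher order on the branch forces this norm to be zero.\<close>
  define m where "m = D * (D - 1)"
  have finI: "finite ?I" by (rule finite_subset[of _ "{..<D} \<times> {..<D}"]) auto
  then obtain e where e: "bij_betw e {..<N} ?I" unfolding N_def by (metis ex_bij_betw_nat_finite atLeast0LessThan)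
  have e': "fst (e j) + snd (e j) < D" if "j < N" for j using e that unfolding bij_betw_def by auto
  define C where "C n j v = (fps_X ^ fst (e j) * \<eta> v ^ snd (e j)) $ n" for n j v
  have Cpf: "pf r (int n + - int (fst (e j))) (C n j)" for n j
  proof (cases "n < fst (e j)")
    case True
    then have "C n j = (\<lambda>_. 0)" by (auto simp: C_def fps_X_power_mult_nth)
    then show ?thesis by (simp add: pf_zero)
  next
    case False
    then have "C n j = (\<lambda>v. (\<eta> v ^ snd (e j)) $ (n - fst (e j)))" by (intro ext) (simp add: C_def fps_X_power_mult_nth)
    moreover have "pf r (int (n - fst (e j))) (\<lambda>v. (\<eta> v ^ snd (e j)) $ (n - fst (e j)))"
      using graded_power[OF \<eta>, of "snd (e j)"] unfolding graded_def by blast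
    moreover have "int (n - fst (e j)) = int n + - int (fst (e j))" using False by simp
    ultimately show ?thesis by (simp only:)
  qed
  have sumC: "(\<Sum>k<D. ev1 fps_X (w k) * \<eta> v ^ k) $ n = (\<Sum>j<N. C n j v * coeff (w (snd (e j))) (fst (e j)))"
    if w: "\<And>k i. k < D \<Longrightarrow> D \<le> i + k \<Longrightarrow> coeff (w k) i = 0" for w v n
  proof -
    let ?f = "\<lambda>i k. fps_const (coeff (w k) i) * (fps_X ^ i * \<eta> v ^ k)"
    have "(\<Sum>k<D. ev1 fps_X (w k) * \<eta> v ^ k) = (\<Sum>k<D. \<Sum>i\<le>D. ?f i k)"
    proof (rule sum.cong[OF refl])
      fix k assume "k \<in> {..<D}"
      then have "ev1 fps_X (w k) = (\<Sum>i\<le>D. fps_const (coeff (w k) i) * fps_X ^ i)" by (intro ev1_altdef w) auto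
      then show "ev1 fps_X (w k) * \<eta> v ^ k = (\<Sum>i\<le>D. ?f i k)" by (simp add: sum_distrib_right mult.assoc)
    qed
    also have "\<dots> = (\<Sum>(k, i)\<in>{..<D} \<times> {..D}. ?f i k)" by (simp add: sum.cartesian_product)
    also have "\<dots> = (\<Sum>(k, i)\<in>{(k, i). i + k < D}. ?f i k)"
    proof (rule sum.mono_neutral_right)
      show "\<forall>x\<in>{..<D} \<times> {..D} - {(k, i). i + k < D}. (case x of (k, i) \<Rightarrow> ?f i k) = 0"
      proof
        fix x assume "x \<in> {..<D} \<times> {..D} - {(k, i). i + k < D}"
        then obtain k i where "x = (k, i)" "k < D" "D \<le> i + k" by (cases x) auto
        then show "(case x of (k, i) \<Rightarrow> ?f i k) = 0" using w[of k i] by simp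
      qed
    qed auto
    also have "\<dots> = (\<Sum>(i, k)\<in>?I. ?f i k)"
      by (rule sum.reindex_bij_witness[of _ prod.swap prod.swap]) auto
    also have "\<dots> = (\<Sum>j<N. case e j of (i, k) \<Rightarrow> ?f i k)" by (rule sum.reindex_bij_betw[OF e, symmetric])
    finally show ?thesis by (simp add: fps_sum_nth C_def case_prod_beta mult.commute)
  qed
  have "(\<exists>g. (\<forall>a<N. g a \<in> {..m}) \<and> (\<exists>z. det (mat N N (\<lambda>(a,j). C (g a) j z)) \<noteq> 0)) \<or>
    (\<exists>s. (\<forall>j<N. PF r (s j)) \<and> (\<exists>j<N. \<exists>z. s j z \<noteq> 0) \<and> (\<forall>i\<in>{..m}. \<forall>z. (\<Sum>j<N. C i j z * s j z) = 0))"
    by (rule generic_kernel) (rule PF_I[OF Cpf])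
  then show thesis
  proof (elim disjE exE conjE)
    fix g z assume g: "\<forall>a<N. g a \<in> {..m}" and z: "det (mat N N (\<lambda>(a,j). C (g a) j z)) \<noteq> 0"
    let ?\<Psi> = "\<lambda>v. det (mat N N (\<lambda>(a,j). C (g a) j v))"
    show thesis
    proof (rule that[of ?\<Psi>])
      have "pf r ((\<Sum>a<N. int (g a)) + (\<Sum>j<N. - int (fst (e j)))) ?\<Psi>" by (rule pf_det) (rule Cpf)
      moreover have "(\<Sum>a<N. int (g a)) + (\<Sum>j<N. - int (fst (e j))) \<le> int (N * m)"
      proof -
        have "(\<Sum>a<N. int (g a)) \<le> (\<Sum>a<N. int m)" by (rule sum_mono) (use g in auto)
        moreover have "(\<Sum>j<N. - int (fst (e j))) \<le> 0" by (rule sum_nonpos) simp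
        ultimately show ?thesis by simp
      qed
      ultimately show "pf r (int (card ?I * (D * (D - 1)))) ?\<Psi>" unfolding N_def[symmetric] m_def[symmetric] by (rule pf_mono)
      show "\<exists>v. ?\<Psi> v \<noteq> 0" using z by blast
      fix v w k assume \<Psi>: "?\<Psi> v \<noteq> 0" and w: "(\<Sum>k<D. ev1 fps_X (w k) * \<eta> v ^ k) = 0" "k < D"
      show "w k = 0"
      proof (rule ccontr)
        assume "w k \<noteq> 0"
        obtain f w' where f: "f < D" "w' f = 1" "\<And>j. j \<le> f \<Longrightarrow> dle (int f - int j) (w' j)"
          "(\<Sum>j\<le>f. ev1 fps_X (w' j) * \<eta> v ^ j) = 0"
          by (rule curve.nonminimal_branch_factor[OF curve root w \<open>w k \<noteq> 0\<close>]) (rule that)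
        define y where "y j = (if j \<le> f then w' j else 0)" for j
        have yz: "coeff (y k) i = 0" if "k < D" "D \<le> i + k" for k i
          using f(1) f(3)[of k] that unfolding y_def dle_def by auto
        have "(\<Sum>k<D. ev1 fps_X (y k) * \<eta> v ^ k) = (\<Sum>j\<le>f. ev1 fps_X (w' j) * \<eta> v ^ j)"
          by (rule sum.mono_neutral_cong_right) (use f(1) in \<open>auto simp: y_def\<close>)
        then have 0: "(\<Sum>j<N. C n j v * coeff (y (snd (e j))) (fst (e j))) = 0" for n using sumC[where w = y and v = v and n = n, OF yz] f(4) by simp
        \<comment> \<open>The factor is monic, so its coefficient at \<open>y ^ f\<close> is 1 and
          the kernel vector is nonzero.\<close>
        have "(0, f) \<in> e ` {..<N}" using e f(1) unfolding bij_betw_def by auto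
        then obtain j0 where j0: "j0 < N" "e j0 = (0, f)" by auto
        have "?\<Psi> v = 0"
          by (rule det_kernel_zero[of j0 N "\<lambda>j. coeff (y (snd (e j))) (fst (e j))"]) (use j0 f(2) 0 in \<open>auto simp: y_def\<close>)
        then show False using \<Psi> by simp
      qed
    qed
  next
    fix s j0 z0 assume s: "\<forall>j<N. PF r (s j)" "\<forall>i\<in>{..m}. \<forall>z. (\<Sum>j<N. C i j z * s j z) = 0" and j0: "j0 < N" "s j0 z0 \<noteq> 0"
    define s' where "s' i k = (if i + k < D then s (the_inv_into {..<N} e (i, k)) else (\<lambda>_. 0))" for i k
    have inv: "the_inv_into {..<N} e (e j) = j" if "j < N" for j
      using e that by (intro the_inv_into_f_f) (auto simp: bij_betw_def)
    have s's: "s' (fst (e j)) (snd (e j)) = s j" if "j < N" for j using e'[OF that] inv[OF that] by (simp add: s'_def)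
    have s'PF: "PF r (s' i k)" for i k
    proof (cases "i + k < D")
      case True
      then have "the_inv_into {..<N} e (i, k) < N"
        using the_inv_into_into[of e "{..<N}" "(i, k)" "{..<N}"] e by (auto simp: bij_betw_def)
      then show ?thesis using s(1) True by (simp add: s'_def)
    qed (simp add: s'_def)
    define w where "w v k = (\<Sum>i<D. monom (s' i k v) i)" for v k
    have cw: "coeff (w v k) i = s' i k v" for v k i by (simp add: w_def coeff_sum s'_def if_distrib cong: if_cong)
    have wdle: "dle (int (D - 1) - int k) (w v k)" for v k unfolding dle_def cw by (auto simp: s'_def)
    \<comment> \<open>The value on the branch is divisible by \<open>X ^ (m + 1)\<close> and divides
      the norm, whose degree is at most \<open>m\<close>.\<close>
    have N0: "curve.norm_poly D (\<lambda>j. q j v) D (w v) = 0" for v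
    proof (rule ccontr)
      let ?N = "curve.norm_poly D (\<lambda>j. q j v) D (w v)"
      assume nz: "?N \<noteq> 0"
      let ?H = "\<Sum>k<D. ev1 fps_X (w v k) * \<eta> v ^ k"
      have "?H $ n = 0" if "n \<le> m" for n
      proof -
        have "?H $ n = (\<Sum>j<N. C n j v * coeff (w v (snd (e j))) (fst (e j)))" by (rule sumC) (simp add: cw s'_def)
        also have "\<dots> = (\<Sum>j<N. C n j v * s j v)" by (rule sum.cong) (auto simp: cw s's)
        finally show ?thesis using s(2) that by simp
      qed
      then have "fps_X ^ Suc m dvd ?H" unfolding fps_X_power_dvd_iff by auto
      also have "?H dvd ev1 fps_X ?N" by (rule curve.norm_poly_dvd[OF curve root])
      finally have "fps_X ^ Suc m dvd ev1 (fps_const 0 + fps_X) ?N" by simp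
      then have "Suc m \<le> order 0 ?N" by (rule fps_X_power_dvd_ev1[OF nz])
      also have "\<dots> \<le> degree ?N" by (rule order_degree[OF nz])
      also have "\<dots> \<le> m" unfolding dle_degree[symmetric] m_def of_nat_mult by (rule curve.norm_poly_dle[OF curve wdle])
      finally show False by simp
    qed
    \<comment> \<open>For fixed \<open>\<tau> \<noteq> 0\<close> every point \<open>a\<close> is the
      point \<open>t = \<tau>\<close> of the line with direction \<open>dir a\<close>. The norms on
      these lines are thus the values of the norm of one family \<open>h\<close> over the whole
      base, which \<open>norm_nonzero\<close> forbids to vanish identically.\<close>
    have wz: "poly (w v k) \<tau> = 0" if "\<tau> \<noteq> 0" "k < D" for v k \<tau>
    proof (rule ccontr)
      assume nz: "poly (w v k) \<tau> \<noteq> 0"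
      define dir where "dir a = (\<lambda>i. (1 / \<tau>) * (a i - u i))" for a :: "nat \<Rightarrow> 'k"
      define h where "h k a = poly (w (dir a) k) \<tau>" for k a
      have "PF r (h k)" for k
      proof -
        have dpf: "pf r 1 (\<lambda>a. dir a j)" if "j < r" for j
          unfolding dir_def by (intro pf_cmult pf_diff pf_var pf_const) (use that in simp_all)
        have "PF r (\<lambda>a. s' i k (dir a))" for i
          by (rule PF_comp[where F = "s' i k" and \<phi> = dir, OF s'PF dpf])
        then have "PF r (\<lambda>a. \<Sum>i<D. \<tau> ^ i * s' i k (dir a))" by (intro PF_sum PF_cmult)
        then show ?thesis unfolding h_def w_def poly_sum poly_monom by (simp add: mult.commute)
      qed
      moreover have "\<exists>j<D. \<exists>a. h j a \<noteq> 0"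
      proof (intro exI conjI)
        have "dir (\<lambda>i. u i + \<tau> * v i) = v" using that by (auto simp: dir_def)
        then show "h k (\<lambda>i. u i + \<tau> * v i) \<noteq> 0" using nz by (simp add: h_def)
      qed fact
      ultimately obtain a where a: "det (mat D D (\<lambda>(k,j). norm_mat (mcoeff D c a) D (\<lambda>i. h i a) D k j)) \<noteq> 0"
        using norm_nonzero[OF irr, of h] by blast
      have da: "(\<lambda>i. u i + \<tau> * dir a i) = a" using that by (auto simp: dir_def)
      have "poly (curve.norm_poly D (\<lambda>j. q j (dir a)) D (w (dir a))) \<tau>
          = det (mat D D (\<lambda>(k,j). norm_mat (mcoeff D c a) D (\<lambda>i. h i a) D k j))"
      proof -
        have "poly (curve.cw D (\<lambda>j. q j (dir a)) j) \<tau> = mcoeff D c a j" for j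
          unfolding curve.cw_def[OF curve] mcoeff_def using q[of j "dir a" \<tau>] da by auto
        then show ?thesis
          unfolding curve.norm_poly_def[OF curve] hom_det_mat[OF poly_at_hom] norm_mat_hom[OF poly_at_hom] h_def by simp
      qed
      then show False using a N0[of "dir a"] by simp
    qed
    have "w z0 (snd (e j0)) = 0"
    proof (rule ccontr)
      assume nz: "w z0 (snd (e j0)) \<noteq> 0"
      have "snd (e j0) < D" using e'[OF j0(1)] by simp
      then have "UNIV \<subseteq> insert 0 {t. poly (w z0 (snd (e j0))) t = 0}" using wz by auto
      then show False using infinite_k poly_roots_finite[OF nz] finite_subset by blast
    qed
    then have "s j0 z0 = 0" using cw[of z0 "snd (e j0)" "fst (e j0)"] s's[OF j0(1)] by simp
    then show thesis using j0(2) by simp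
  qed
qed

subsection \<open>Counting points on the hypersurface\<close>

lemma sum_affine: "2 * (\<Sum>k<n. C - int k) = int n * (2 * C - int n + 1)"
  by (induction n) (simp_all add: algebra_simps)

lemma card_pairs:
  assumes "D \<le> A + 1"
  shows "2 * int (card {(k, \<alpha>). k < D \<and> \<alpha> + k \<le> A}) = int D * (2 * int A + 3 - int D)"
proof -
  have "{(k, \<alpha>). k < D \<and> \<alpha> + k \<le> A} = (SIGMA k:{..<D}. {..<A + 1 - k})" by auto
  then have "int (card {(k, \<alpha>). k < D \<and> \<alpha> + k \<le> A}) = (\<Sum>k<D. int (A + 1 - k))" by simp
  also have "\<dots> = (\<Sum>k<D. (int A + 1) - int k)" by (rule sum.cong) (use assms in auto)
  finally show ?thesis using sum_affine[of "int A + 1" D] by (simp add: algebra_simps)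
qed

lemma card_unknowns:
  "card {(k, l, \<alpha>, \<beta>). k < D \<and> l < D \<and> \<alpha> + k \<le> A \<and> \<beta> + l \<le> B}
    = card {(k, \<alpha>). k < D \<and> \<alpha> + k \<le> A} * card {(k, \<alpha>). k < D \<and> \<alpha> + k \<le> (B::nat)}"
proof -
  have "bij_betw (\<lambda>(k, l, \<alpha>, \<beta>). ((k, \<alpha>), (l, \<beta>))) {(k, l, \<alpha>, \<beta>). k < D \<and> l < D \<and> \<alpha> + k \<le> A \<and> \<beta> + l \<le> B}
     ({(k, \<alpha>). k < D \<and> \<alpha> + k \<le> A} \<times> {(k, \<alpha>). k < D \<and> \<alpha> + k \<le> B})"
    by (rule bij_betw_byWitness[where f' = "\<lambda>((k, \<alpha>), (l, \<beta>)). (k, l, \<alpha>, \<beta>)"]) auto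
  then show ?thesis by (simp only: bij_betw_same_card card_cartesian_product)
qed

lemma card_conditions:
  assumes "1 \<le> D" "2 * D \<le> A + B + 2"
  shows "2 * int (card {(i, k, l, m). i < M \<and> k < D \<and> 1 \<le> l \<and> l < D \<and> m + k + l \<le> A + B + 1})
    = int M * (int D * (int D - 1) * (2 * int A + 2 * int B + 5 - 2 * int D))"
proof -
  define C where "C = int A + int B + 2"
  have "{(i, k, l, m). i < M \<and> k < D \<and> 1 \<le> l \<and> l < D \<and> m + k + l \<le> A + B + 1}
      = {..<M} \<times> (SIGMA k:{..<D}. SIGMA l:{1..<D}. {..<A + B + 2 - k - l})" by auto
  then have "int (card {(i, k, l, m). i < M \<and> k < D \<and> 1 \<le> l \<and> l < D \<and> m + k + l \<le> A + B + 1})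
      = int M * (\<Sum>k<D. \<Sum>l\<in>{1..<D}. int (A + B + 2 - k - l))" by simp
  also have "(\<Sum>k<D. \<Sum>l\<in>{1..<D}. int (A + B + 2 - k - l)) = (\<Sum>k<D. \<Sum>l\<in>{1..<D}. (C - int k) - int l)"
    by (intro sum.cong refl) (use assms in \<open>auto simp: C_def\<close>)
  also have "2 * (int M * \<dots>) = int M * (\<Sum>k<D. 2 * (\<Sum>l\<in>{1..<D}. (C - int k) - int l))"
    by (simp add: sum_distrib_left mult_ac)
  also have "(\<Sum>k<D. 2 * (\<Sum>l\<in>{1..<D}. (C - int k) - int l)) = (\<Sum>k<D. (int D - 1) * (2 * (C - int k) - int D))"
  proof (rule sum.cong[OF refl])
    fix k
    have "{..<D} = insert 0 {1..<D}" using assms(1) by auto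
    then have "(\<Sum>l<D. (C - int k) - int l) = (C - int k) + (\<Sum>l\<in>{1..<D}. (C - int k) - int l)" by simp
    then show "2 * (\<Sum>l\<in>{1..<D}. (C - int k) - int l) = (int D - 1) * (2 * (C - int k) - int D)"
      using sum_affine[of "C - int k" D] by (simp add: algebra_simps)
  qed
  also have "\<dots> = (int D - 1) * (2 * (\<Sum>k<D. C - int k) - int D * int D)"
    by (simp add: sum_distrib_left[symmetric] sum_subtractf)
  also have "\<dots> = int D * (int D - 1) * (2 * int A + 2 * int B + 5 - 2 * int D)"
    unfolding sum_affine by (simp add: C_def algebra_simps)
  finally show ?thesis .
qed

text \<open>More unknowns than conditions. To leading order this says
  \<open>D\<^sup>2 A B > M D (D - 1) A\<close>, hence the choice \<open>B / M = 1 - 3 / (5 D)\<close>.\<close>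

lemma stepanov_params:
  fixes D p :: nat
  assumes D: "2 \<le> D" and p: "21 * D ^ 4 \<le> p"
  defines "A \<equiv> (p - 1) div D" and "B \<equiv> 5 * D ^ 2 - 3 * D" and "M \<equiv> 5 * D ^ 2"
  shows "card {(i, k, l, m). i < M \<and> k < D \<and> 1 \<le> l \<and> l < D \<and> m + k + l \<le> A + B + 1}
      < card {(k, l, \<alpha>, \<beta>). k < D \<and> l < D \<and> \<alpha> + k \<le> A \<and> \<beta> + l \<le> B}"
proof -
  define x where "x = int D"
  have x: "2 \<le> x" using D by (simp add: x_def)
  have DD: "2 * D \<le> D ^ 2" using D by (simp add: power2_eq_square)
  have B: "int B = 5 * x ^ 2 - 3 * x" unfolding B_def x_def using DD by (simp add: of_nat_diff)
  have "21 * D ^ 3 \<le> A + 1"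
  proof -
    have "D * (21 * D ^ 3) \<le> p" using p by (simp add: power3_eq_cube power4_eq_xxxx mult_ac)
    then have "D * (21 * D ^ 3 - 1) \<le> p - 1" using D by (simp add: diff_mult_distrib2)
    then have "21 * D ^ 3 - 1 \<le> A" unfolding A_def using D by (simp add: less_eq_div_iff_mult_less_eq mult.commute)
    then show ?thesis by simp
  qed
  then have A: "21 * x ^ 3 \<le> int A + 1" unfolding x_def using of_nat_mono[where 'a = int] by fastforce
  have x2: "2 * x \<le> x ^ 2" and x3: "2 * x ^ 2 \<le> x ^ 3"
    using x mult_right_mono[OF x, of x] mult_right_mono[OF x, of "x ^ 2"] by (simp_all add: power2_eq_square power3_eq_cube)
  have DA: "D \<le> A + 1" using A x2 x3 x unfolding x_def by linarith
  have DB: "D \<le> B + 1" using B x2 x unfolding x_def by linarith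
  \<comment> \<open>\<open>D * a\<close> and \<open>D * b\<close> are twice the two factors in the
    number of unknowns, so both counts are compared after multiplication by 4.\<close>
  define a where "a = 2 * int A + 3 - x"
  have a: "41 * x ^ 3 \<le> a" using A x2 x3 x unfolding a_def by linarith
  define b where "b = 2 * int B + 3 - x"
  have b: "b = 10 * x ^ 2 - 7 * x + 3" unfolding b_def B by simp
  \<comment> \<open>The surplus of \<open>b\<close> over \<open>10 * x * (x - 1)\<close> is
    \<open>3 * x + 3\<close>; multiplied by \<open>a\<close>, which has order \<open>x ^ 3\<close>,
    it absorbs the terms that come from \<open>b - 1\<close>.\<close>
  have "x * (x - 1) * (b - 1) \<le> x * x * (10 * x ^ 2)"
    by (intro mult_mono) (use x x2 b in auto)
  moreover have "x * x * (10 * x ^ 2) = 10 * x ^ 4" by (simp add: power2_eq_square power4_eq_xxxx)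
  ultimately have "10 * (x * (x - 1) * (b - 1)) \<le> 100 * x ^ 4" by linarith
  also have "\<dots> < 3 * x * (41 * x ^ 3)" using x by (simp add: power3_eq_cube power4_eq_xxxx)
  also have "\<dots> \<le> (3 * x + 3) * a" by (intro mult_mono) (use x a in auto)
  also have "\<dots> = a * b - 10 * (x * (x - 1)) * a" unfolding b by (simp add: power2_eq_square algebra_simps)
  finally have "10 * (x * (x - 1)) * (a + b - 1) < a * b" by (simp add: algebra_simps)
  then have "x * x * (10 * (x * (x - 1)) * (a + b - 1)) < x * x * (a * b)" using x by (intro mult_strict_left_mono) auto
  moreover have "4 * int (card {(i, k, l, m). i < M \<and> k < D \<and> 1 \<le> l \<and> l < D \<and> m + k + l \<le> A + B + 1})
      = x * x * (10 * (x * (x - 1)) * (a + b - 1))"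
  proof -
    have "2 * D \<le> A + B + 2" using DA DB by simp
    from card_conditions[OF _ this, of M] D
    have "2 * int (card {(i, k, l, m). i < M \<and> k < D \<and> 1 \<le> l \<and> l < D \<and> m + k + l \<le> A + B + 1})
      = int M * (x * (x - 1) * (2 * int A + 2 * int B + 5 - 2 * x))" by (simp add: x_def)
    moreover have "int M = 5 * x * x" by (simp add: M_def x_def power2_eq_square)
    ultimately show ?thesis unfolding a_def b_def by (simp add: algebra_simps)
  qed
  moreover have "4 * int (card {(k, l, \<alpha>, \<beta>). k < D \<and> l < D \<and> \<alpha> + k \<le> A \<and> \<beta> + l \<le> B}) = x * x * (a * b)"
  proof -
    have "4 * int (card {(k, l, \<alpha>, \<beta>). k < D \<and> l < D \<and> \<alpha> + k \<le> A \<and> \<beta> + l \<le> B})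
      = (2 * int (card {(k, \<alpha>). k < D \<and> \<alpha> + k \<le> A})) * (2 * int (card {(k, \<alpha>). k < D \<and> \<alpha> + k \<le> B}))"
      unfolding card_unknowns by simp
    then show ?thesis unfolding card_pairs[OF DA] card_pairs[OF DB] a_def b_def x_def by (simp add: mult_ac)
  qed
  ultimately show ?thesis by linarith
qed

context slice
begin

text \<open>Division of the estimate \<open>stepanov_count\<close> by \<open>M = 5 * D ^ 2\<close>
  leaves \<open>3 / 5 * p\<close> points as the main term. The term
  \<open>p / (5 * D ^ 2) \<le> p / 20\<close> and the parameters outside \<open>S\<close>, which
  cost at most \<open>p / 42\<close>, are subtracted; \<open>3 / 5 - 1 / 20 - 1 / 42\<close> is just
  above \<open>526 / 1000\<close>.\<close>

lemma curve_count:
  assumes D: "2 \<le> D" and p: "21 * D ^ 4 \<le> p" and S: "S \<subseteq> Fp" "p \<le> card S + 1 + D * (D - 1)"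
    and simple: "\<And>a b. a \<in> S \<Longrightarrow> poly (spec a) b = 0 \<Longrightarrow> poly (pderiv (spec a)) b \<noteq> 0"
  shows "real (\<Sum>a\<in>S. card {b \<in> Fp. poly (spec a) b = 0}) \<ge> 526 / 1000 * real p"
proof -
  define n where "n a = card {b \<in> Fp. poly (spec a) b = 0}" for a
  define A where "A = (p - 1) div D"
  have DA: "D * A < p"
    using p_gt_1 div_times_less_eq_dividend[of "p - 1" D] unfolding A_def mult.commute[of D] by linarith
  have D1: "D * 1 \<le> D ^ 4" using D power_increasing[of 1 4 D] by simp
  then have Dp: "D \<le> p" using p by simp
  have "5 * D ^ 2 * (\<Sum>a\<in>S. D - n a) \<le> D * (A + p * (5 * D ^ 2 - 3 * D))"
    unfolding n_def by (rule stepanov_count[OF stepanov_params[OF D p, folded A_def] DA Dp S(1) simple])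
  then have "real (5 * D ^ 2 * (\<Sum>a\<in>S. D - n a)) \<le> real (D * (A + p * (5 * D ^ 2 - 3 * D)))" by (simp only: of_nat_le_iff)
  also have "\<dots> \<le> real p + real D * real p * (5 * real D ^ 2 - 3 * real D)"
  proof -
    have "3 * D \<le> 5 * D ^ 2" using D by (simp add: power2_eq_square)
    then have K: "real (5 * D ^ 2 - 3 * D) = 5 * real D ^ 2 - 3 * real D" by (simp add: of_nat_diff)
    have "real (D * A) \<le> real p" using DA by (simp only: of_nat_le_iff)
    then show ?thesis unfolding of_nat_mult[of D] of_nat_add of_nat_mult[of p] K by (simp add: distrib_left mult.assoc)
  qed
  finally have st: "5 * real D ^ 2 * real (\<Sum>a\<in>S. D - n a) \<le> real p + real D * real p * (5 * real D ^ 2 - 3 * real D)" by simp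
  have nD: "n a \<le> D" for a
  proof -
    have "n a \<le> card {b. poly (spec a) b = 0}" unfolding n_def by (rule card_mono) (use poly_roots_finite[OF spec_nz] in auto)
    also have "\<dots> \<le> D" using card_poly_roots_bound[OF spec_nz[of a]] by (simp add: degree_spec)
    finally show ?thesis .
  qed
  have "(\<Sum>a\<in>S. D - n a) + (\<Sum>a\<in>S. n a) = D * card S"
    unfolding sum.distrib[symmetric] using nD by (simp add: mult.commute)
  then have sum: "real (\<Sum>a\<in>S. n a) = real D * real (card S) - real (\<Sum>a\<in>S. D - n a)"
    by (metis add_diff_cancel_left' of_nat_add of_nat_mult)
  have cS: "real (card S) \<ge> real p - 1 - real D * (real D - 1)"
  proof -
    have "real p \<le> real (card S + 1 + D * (D - 1))" using S(2) by (simp only: of_nat_le_iff)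
    moreover have "real (D - 1) = real D - 1" using D by (simp add: of_nat_diff)
    ultimately show ?thesis unfolding of_nat_add of_nat_mult by simp
  qed
  let ?x = "real D"
  have x: "?x \<ge> 2" using D by simp
  have px: "real p \<ge> 21 * ?x ^ 4" using p by (metis of_nat_le_iff of_nat_mult of_nat_numeral of_nat_power)
  have "real (\<Sum>a\<in>S. D - n a) \<le> real p / (5 * ?x ^ 2) + real p * (?x - 3 / 5)"
  proof -
    have "real (\<Sum>a\<in>S. D - n a) \<le> (real p + ?x * real p * (5 * ?x ^ 2 - 3 * ?x)) / (5 * ?x ^ 2)"
      using st x by (simp add: pos_le_divide_eq mult.commute)
    also have "\<dots> = real p / (5 * ?x ^ 2) + real p * (?x - 3 / 5)"
      using x by (simp add: field_simps power2_eq_square)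
    finally show ?thesis .
  qed
  moreover have "real p / (5 * ?x ^ 2) \<le> real p / 20"
  proof (rule divide_left_mono)
    have "2 ^ 2 \<le> ?x ^ 2" by (rule power_mono) (use x in auto)
    then show "20 \<le> 5 * ?x ^ 2" by simp
  qed (use x in auto)
  moreover have "?x * (1 + ?x * (?x - 1)) \<le> real p / 42"
  proof -
    have "?x * (1 + ?x * (?x - 1)) \<le> ?x ^ 3"
      using x mult_right_mono[of 1 ?x ?x] by (simp add: power3_eq_cube algebra_simps)
    moreover have "2 * ?x ^ 3 \<le> ?x ^ 4" using x mult_right_mono[of 2 ?x "?x ^ 3"] by (simp add: power3_eq_cube power4_eq_xxxx mult_ac)
    ultimately show ?thesis using px by linarith
  qed
  moreover have "?x * real (card S) \<ge> ?x * (real p - 1 - ?x * (?x - 1))" by (rule mult_left_mono[OF cS]) simp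
  moreover have "?x * (real p - 1 - ?x * (?x - 1)) = ?x * real p - ?x * (1 + ?x * (?x - 1))" by (simp add: algebra_simps)
  moreover have "real p * (?x - 3 / 5) = ?x * real p - 3 / 5 * real p" by (simp add: algebra_simps)
  ultimately have "real (\<Sum>a\<in>S. n a) \<ge> 3 / 5 * real p - real p / 20 - real p / 42" unfolding sum by linarith
  then show ?thesis unfolding n_def by simp
qed

end

context Fpbar
begin

text \<open>Induction through the leading coefficient with respect to the last variable: over its
  zeros all \<open>p\<close> values are allowed, elsewhere at most \<open>i\<close> of them. The
  factor \<open>p\<close> on the left avoids the exponent \<open>r - 1\<close>.\<close>

lemma schwartz_zippel:
  fixes F :: "(nat \<Rightarrow> 'k) \<Rightarrow> 'k"
  assumes "pf r (int d) F" "F z \<noteq> 0"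
  shows "card {a \<in> Fp_points r. F a = 0} * p \<le> d * p ^ r"
  using assms
proof (induction r arbitrary: F d z)
  case 0
  have "F a \<noteq> 0" for a using pf_restrict_const[OF 0(1), of a z] 0(2) by simp
  then show ?case by simp
next
  case (Suc r)
  obtain Q where Q: "\<And>z. F z = poly (Q z) (z r)" "\<And>i. pf r (int d - int i) (\<lambda>z. coeff (Q z) i)"
    "\<And>z. dle (int d) (Q z)" by (rule pf_last[OF Suc.prems(1)]) (rule that)
  have Qc: "Q z = Q z'" if "\<And>i. i < r \<Longrightarrow> z i = z' i" for z z'
    by (rule poly_eqI) (rule pf_cong[OF Q(2)], rule that)
  let ?J = "{i. i \<le> d \<and> (\<exists>z. coeff (Q z) i \<noteq> 0)}"
  have "Q z \<noteq> 0" using Suc.prems(2) Q(1)[of z] by auto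
  then have "lead_coeff (Q z) \<noteq> 0" by simp
  moreover have "degree (Q z) \<le> d" using Q(3)[of z] by (simp add: dle_degree)
  ultimately have "degree (Q z) \<in> ?J" by blast
  then have J: "?J \<noteq> {}" "finite ?J" by auto
  define i where "i = Max ?J"
  have "i \<in> ?J" unfolding i_def by (rule Max_in[OF J(2,1)])
  then obtain z0 where i: "i \<le> d" "coeff (Q z0) i \<noteq> 0" by blast
  have high: "coeff (Q z) j = 0" if "i < j" for z j
  proof (rule ccontr)
    assume nz: "coeff (Q z) j \<noteq> 0"
    then have "j \<le> d" using Q(3)[of z] unfolding dle_def by (metis not_less of_nat_less_iff)
    then have "j \<le> i" unfolding i_def using nz by (intro Max_ge[OF J(2)]) auto
    then show False using that by simp
  qed
  define Z where "Z = {a \<in> Fp_points r. coeff (Q a) i = 0}"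
  have "pf r (int (d - i)) (\<lambda>z. coeff (Q z) i)" using Q(2)[of i] i(1) by (simp add: of_nat_diff)
  from Suc.IH[where F = "\<lambda>z. coeff (Q z) i", OF this i(2)] have IH: "card Z * p \<le> (d - i) * p ^ r" unfolding Z_def .
  define R where "R a = (if a \<in> Z then Fp else {b. poly (Q a) b = 0})" for a
  have finFp: "finite (Fp_points r :: (nat \<Rightarrow> 'k) set)" by (rule finite_Fp_points)
  have R: "finite (R a)" "card (R a) \<le> (if a \<in> Z then p else i)" if "a \<in> Fp_points r" for a
  proof -
    have "Q a \<noteq> 0" if "a \<notin> Z" using \<open>a \<in> Fp_points r\<close> that unfolding Z_def by auto
    moreover have "degree (Q a) \<le> i" by (rule degree_le) (use high in auto)
    ultimately show "finite (R a)" "card (R a) \<le> (if a \<in> Z then p else i)"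
      unfolding R_def using card_Fp_roots(1,2) poly_roots_finite[of "Q a"] card_poly_roots_bound[of "Q a"] by auto
  qed
  have "card {a \<in> Fp_points (Suc r). F a = 0} \<le> card (SIGMA a:Fp_points r. R a)"
  proof (rule card_inj_on_le)
    let ?f = "\<lambda>a :: nat \<Rightarrow> 'k. (a(r := 0), a r)"
    show "inj_on ?f {a \<in> Fp_points (Suc r). F a = 0}"
    proof (rule inj_onI)
      fix a a' :: "nat \<Rightarrow> 'k" assume "?f a = ?f a'"
      then have "a(r := 0) = a'(r := 0)" "a r = a' r" by auto
      then show "a = a'" by (metis fun_upd_triv fun_upd_upd)
    qed
    show "?f ` {a \<in> Fp_points (Suc r). F a = 0} \<subseteq> (SIGMA a:Fp_points r. R a)"
    proof
      fix y assume "y \<in> ?f ` {a \<in> Fp_points (Suc r). F a = 0}"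
      then obtain a where a: "a \<in> Fp_points (Suc r)" "F a = 0" and y: "y = (a(r := 0), a r)" by blast
      have "a(r := 0) \<in> Fp_points r" using a(1) Fp_closed(1) unfolding Fp_points_iff affine_space_def by (auto simp: le_Suc_eq)
      moreover have "a r \<in> R (a(r := 0))"
      proof -
        have "poly (Q (a(r := 0))) (a r) = 0" using a(2) Q(1)[of a] Qc[of "a(r := 0)" a] by simp
        then show ?thesis using a(1) unfolding R_def Fp_points_iff by auto
      qed
      ultimately show "y \<in> (SIGMA a:Fp_points r. R a)" unfolding y by blast
    qed
    show "finite (SIGMA a:Fp_points r. R a)" by (rule finite_SigmaI) (use finFp R in auto)
  qed
  also have "\<dots> = (\<Sum>a\<in>Fp_points r. card (R a))" by (rule card_SigmaI) (use finFp R in auto)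
  also have "\<dots> \<le> (\<Sum>a\<in>Fp_points r. (if a \<in> Z then p else 0) + i)" by (rule sum_mono) (use R in fastforce)
  also have "\<dots> = card Z * p + p ^ r * i"
  proof -
    have "Fp_points r \<inter> Z = Z" unfolding Z_def by auto
    then show ?thesis using finFp by (simp add: sum.distrib sum.If_cases card_Fp_points Int_def[symmetric])
  qed
  also have "\<dots> \<le> (d - i) * p ^ r + p ^ r * i" using IH by simp
  also have "\<dots> = d * p ^ r" using i(1) by (simp add: algebra_simps flip: add_mult_distrib2)
  finally show ?case by (simp add: mult_ac)
qed

text \<open>Both sides are polynomials in \<open>t ^ p\<close>, which runs through the whole field;
  comparing coefficients gives \<open>coeff q i = coeff q i ^ p\<close>.\<close>

lemma coeff_in_Fp:
  assumes "\<And>t. poly q (t ^ p) = poly q t ^ p"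
  shows "coeff q i \<in> (Fp :: 'k set)"
proof -
  let ?r = "\<Sum>i\<le>degree q. monom (coeff q i - coeff q i ^ p) i"
  have "?r = 0"
  proof (rule poly_ext)
    fix s :: 'k
    obtain t where t: "s = t ^ p" using frob_surj[of s] by auto
    have "poly ?r s = poly q (t ^ p) - poly q t ^ p"
      unfolding t poly_altdef[of q] frob_sum
      by (simp add: poly_sum poly_monom algebra_simps sum_subtractf power_mult_distrib power_mult[symmetric])
    then show "poly ?r s = poly 0 s" using assms by simp
  qed
  then have "coeff ?r i = 0" by simp
  then have "coeff q i ^ p = coeff q i"
    by (cases "i \<le> degree q") (use p_gt_1 in \<open>auto simp: coeff_sum if_distrib coeff_eq_0 zero_power cong: if_cong\<close>)
  then show ?thesis by (simp add: mem_Fp)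
qed

end

context Fpbar
begin

text \<open>A point \<open>(a, b)\<close> is met on \<open>p - 1\<close> of the parametrised lines
  through \<open>u\<close>, once for each \<open>t \<noteq> 0\<close>, with
  \<open>v = (a - u) / t\<close>. Summing the points on the good lines therefore overcounts at most
  by the factor \<open>p - 1\<close>.\<close>

lemma hypersurface_count:
  fixes c :: "nat \<Rightarrow> (nat \<Rightarrow> 'k) \<Rightarrow> 'k"
  assumes irr: "prime_eqn r D c" and tw: "\<And>j a. j < D \<Longrightarrow> c j (\<lambda>i. a i ^ p) = c j a ^ p"
    and disc: "\<exists>a. disc D c a \<noteq> 0" and D: "2 \<le> D" and p: "21 * D ^ 4 \<le> p"
  shows "real p ^ r / 2 \<le> real (card {(a, b). a \<in> Fp_points r \<and> b \<in> Fp \<and> disc D c a \<noteq> 0 \<and> poly (fpoly D c a) b = 0})"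
proof -
  let ?T = "{(a, b). a \<in> Fp_points r \<and> b \<in> Fp \<and> disc D c a \<noteq> 0 \<and> poly (fpoly D c a) b = 0}"
  have D0: "0 < D" and c: "\<And>j. j < D \<Longrightarrow> pf r (int D - int j) (c j)" using irr unfolding prime_eqn_def by simp_all
  define m where "m = D * (D - 1)"
  have mD: "m + D = D ^ 2" using D unfolding m_def by (cases D) (simp_all add: power2_eq_square)
  have D24: "D ^ 2 \<le> D ^ 4" using D by (intro power_increasing) auto
  have mp: "m < p" using mD D24 p D by linarith
  have dpf: "pf r (int m) (disc D c)" using disc_pf[OF irr] D0 by (simp add: m_def of_nat_diff)
  have "int m < int (card Fp)" using mp card_Fp_roots(2) by simp
  moreover obtain a0 where "disc D c a0 \<noteq> 0" using disc by blast
  ultimately obtain u where "\<forall>i<r. u i \<in> Fp" "\<forall>i\<ge>r. u i = 0" and du: "disc D c u \<noteq> 0"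
    using pf_nonzero_grid[OF dpf, of a0 Fp] card_Fp_roots(1) by blast
  then have u: "u \<in> Fp_points r" unfolding Fp_points_def affine_space_def by simp
  \<comment> \<open>Any root over \<open>u\<close> may serve as origin of the branch, whether it
    lies in the prime field or not.\<close>
  obtain b0 where b0: "poly (fpoly D c u) b0 = 0" using alg_root[of "fpoly D c u"] D0 by (auto simp: degree_fpoly)
  have "\<forall>j\<in>{..<D}. \<exists>Q. (\<forall>v t. poly (Q v) t = c j (\<lambda>i. u i + t * v i)) \<and> (\<forall>i. pf r (int i) (\<lambda>v. coeff (Q v) i)) \<and>
     (\<forall>v. dle (int D - int j) (Q v))"
  proof
    fix j assume "j \<in> {..<D}"
    then have "pf r (int D - int j) (c j)" using c by simp
    then obtain Q where "\<And>v t. poly (Q v) t = c j (\<lambda>i. u i + t * v i)" "\<And>i. pf r (int i) (\<lambda>v. coeff (Q v) i)"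
      "\<And>v. dle (int D - int j) (Q v)" by (rule pf_line_dir[where u = u]) (rule that)
    then show "\<exists>Q. (\<forall>v t. poly (Q v) t = c j (\<lambda>i. u i + t * v i)) \<and> (\<forall>i. pf r (int i) (\<lambda>v. coeff (Q v) i)) \<and>
       (\<forall>v. dle (int D - int j) (Q v))" by blast
  qed
  from bchoice[OF this] obtain q where
    "\<forall>j\<in>{..<D}. (\<forall>v t. poly (q j v) t = c j (\<lambda>i. u i + t * v i)) \<and> (\<forall>i. pf r (int i) (\<lambda>v. coeff (q j v) i)) \<and>
       (\<forall>v. dle (int D - int j) (q j v))" ..
  then have q: "\<And>j v t. j < D \<Longrightarrow> poly (q j v) t = c j (\<lambda>i. u i + t * v i)"
    and qpf: "\<And>j i. j < D \<Longrightarrow> pf r (int i) (\<lambda>v. coeff (q j v) i)"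
    and qdle: "\<And>j v. j < D \<Longrightarrow> dle (int D - int j) (q j v)" by simp_all
  have curve: "curve p T D (\<lambda>j. q j v)" for v
    unfolding curve_def curve_axioms_def using Fpbar_axioms D0 qdle unfolding Fpbar_def by auto
  have cw: "poly (curve.cw D (\<lambda>j. q j v) j) t = mcoeff D c (\<lambda>i. u i + t * v i) j" for v j t
    unfolding curve.cw_def[OF curve] mcoeff_def using q by auto
  have spec: "curve.spec D (\<lambda>j. q j v) t = fpoly D c (\<lambda>i. u i + t * v i)" for v t
    unfolding curve.spec_def[OF curve] fpoly_def cw ..
  have spec0: "curve.spec D (\<lambda>j. q j v) 0 = fpoly D c u" for v unfolding spec by simp
  have d0: "poly (pderiv (fpoly D c u)) b0 \<noteq> 0" by (rule disc_root[OF irr du b0])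
  define \<eta> where "\<eta> v = hroot (curve.eqn D (\<lambda>j. q j v) 0) b0" for v
  have root: "branch D (\<lambda>j. q j v) fps_X (\<eta> v)" for v
    using curve.hensel_spec(1)[OF curve, where a = 0 and b = b0] b0 d0 unfolding \<eta>_def spec0 by simp
  have graded: "graded r \<eta>"
  proof -
    have eq: "curve.eqn D (\<lambda>j. q j v) 0 = (\<Sum>j\<le>D. monom (ev1 fps_X (curve.cw D (\<lambda>j. q j v) j)) j)" for v
      unfolding curve.eqn_def[OF curve] by simp
    have "graded r (\<lambda>v. ev1 fps_X (curve.cw D (\<lambda>j. q j v) j))" if "j \<le> D" for j
    proof (cases "j < D")
      case True
      then show ?thesis unfolding graded_def ev1_fps_X curve.cw_def[OF curve] using qpf by simp
    next
      case False
      then show ?thesis unfolding curve.cw_def[OF curve] using graded_const[of r 1] by simp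
    qed
    then show ?thesis unfolding \<eta>_def[abs_def] eq
    proof (rule graded_hroot)
      fix v
      show "poly (pderiv (\<Sum>j\<le>D. monom (ev1 fps_X (curve.cw D (\<lambda>j. q j v) j)) j)) (fps_const b0) $ 0
        = poly (pderiv (fpoly D c u)) b0"
        using curve.eqn_deriv[OF curve, of v 0 b0] unfolding eq spec0 .
    qed
  qed
  define \<Delta> where "\<Delta> = card {(i, k). i + k < D} * (D * (D - 1))"
  obtain \<Psi> where \<Psi>: "pf r (int \<Delta>) \<Psi>" "\<exists>v. \<Psi> v \<noteq> 0"
    "\<And>v w k. \<Psi> v \<noteq> 0 \<Longrightarrow> (\<Sum>k<D. ev1 fps_X (w k) * \<eta> v ^ k) = 0 \<Longrightarrow> k < D \<Longrightarrow> w k = 0"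
    by (rule kaltofen[OF irr q qpf qdle graded root]) (assumption+, rule that[unfolded \<Delta>_def])
  \<comment> \<open>The minor has one row for each of the \<open>D * (D + 1) / 2\<close> monomials,
    and a row has degree at most \<open>D * (D - 1)\<close>.\<close>
  have \<Delta>: "2 * \<Delta> \<le> D ^ 4"
  proof -
    have "{(i, k). i + k < D} = {(k, \<alpha>). k < D \<and> \<alpha> + k \<le> D - 1}" using D0 by auto
    then have "2 * int (card {(i, k). i + k < D}) = int D * (int D + 1)"
      using card_pairs[of D "D - 1"] D0 by (simp add: of_nat_diff)
    then have "int (2 * card {(i, k). i + k < D}) = int (D * (D + 1))" by (simp add: distrib_left)
    then have "2 * card {(i, k). i + k < D} = D * (D + 1)" by (simp only: of_nat_eq_iff)
    then have "2 * \<Delta> = D * (D + 1) * (D * (D - 1))" unfolding \<Delta>_def by simp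
    also have "\<dots> = D ^ 2 * ((D + 1) * (D - 1))" by (simp only: power2_eq_square mult_ac)
    also have "\<dots> \<le> D ^ 2 * D ^ 2" by (intro mult_le_mono2) (cases D, simp_all add: power2_eq_square)
    finally show ?thesis by (simp flip: power_add)
  qed
  define V where "V = {v \<in> Fp_points r. \<Psi> v \<noteq> 0}"
  \<comment> \<open>The parameter \<open>t = 0\<close> is left out because there all directions
    share the point \<open>u\<close>.\<close>
  define S where "S v = {t \<in> Fp. t \<noteq> 0 \<and> disc D c (\<lambda>i. u i + t * v i) \<noteq> 0}" for v
  define R where "R v t = {b \<in> Fp. poly (fpoly D c (\<lambda>i. u i + t * v i)) b = 0}" for v t
  have N: "526 / 1000 * real p \<le> real (\<Sum>t\<in>S v. card (R v t))" if "v \<in> V" for v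
  proof -
    have v: "\<And>i. v i \<in> Fp" "\<Psi> v \<noteq> 0" using that unfolding V_def Fp_points_iff by auto
    have ui: "\<And>i. u i \<in> Fp" using u unfolding Fp_points_iff by simp
    have Fpc: "coeff (q j v) i \<in> Fp" if "j < D" for j i
    proof (rule coeff_in_Fp)
      fix t
      have "(\<lambda>i. u i + t ^ p * v i) = (\<lambda>i. (u i + t * v i) ^ p)"
        using v(1) ui by (simp add: frob_add power_mult_distrib mem_Fp)
      then show "poly (q j v) (t ^ p) = poly (q j v) t ^ p" using q[OF that] tw[OF that, of "\<lambda>i. u i + t * v i"] by simp
    qed
    interpret slice p T D "\<lambda>j. q j v" "\<eta> v"
      by (intro slice.intro curve slice_axioms.intro Fpc root \<Psi>(3)[OF v(2)])
    obtain E where E: "dle (int m) E" "\<And>t. poly E t = disc D c (\<lambda>i. u i + t * v i)"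
      by (rule pf_line[OF dpf, of u v]) (rule that)
    have "E \<noteq> 0" using E(2)[of 0] du by auto
    have "card {t. poly E t = 0} \<le> m"
      using card_poly_roots_bound[OF \<open>E \<noteq> 0\<close>] E(1) by (simp add: dle_degree)
    moreover have "Fp \<subseteq> S v \<union> ({0} \<union> {t. poly E t = 0})" unfolding S_def E(2) by auto
    then have "card Fp \<le> card (S v \<union> ({0} \<union> {t. poly E t = 0}))"
      by (rule card_mono[rotated]) (use poly_roots_finite[OF \<open>E \<noteq> 0\<close>] card_Fp_roots(1) in \<open>auto simp: S_def\<close>)
    moreover have "\<dots> \<le> card (S v) + card ({0} \<union> {t. poly E t = 0})" by (rule card_Un_le)
    moreover have "card ({0} \<union> {t. poly E t = 0}) \<le> card {0 :: 'k} + card {t. poly E t = 0}" by (rule card_Un_le)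
    ultimately have "p \<le> card (S v) + 1 + D * (D - 1)" unfolding m_def[symmetric] card_Fp_roots(2) by simp
    then have "526 / 1000 * real p \<le> real (\<Sum>a\<in>S v. card {b \<in> Fp. poly (curve.spec D (\<lambda>j. q j v) a) b = 0})"
    proof (rule curve_count[OF D p, rotated])
      fix a b assume "a \<in> S v" "poly (curve.spec D (\<lambda>j. q j v) a) b = 0"
      then show "poly (pderiv (curve.spec D (\<lambda>j. q j v) a)) b \<noteq> 0"
        unfolding spec using disc_root[OF irr] by (simp add: S_def)
    qed (auto simp: S_def)
    then show ?thesis unfolding spec R_def .
  qed
  let ?\<Omega> = "SIGMA v:V. SIGMA t:S v. R v t"
  have fin: "finite V" "finite (S v)" "finite (R v t)" for v t
    using finite_Fp_points[of r] card_Fp_roots(1) unfolding V_def S_def R_def by auto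
  have Tfin: "finite ?T"
    by (rule finite_subset[of _ "Fp_points r \<times> Fp"]) (use finite_Fp_points card_Fp_roots(1) in auto)
  have "card ?\<Omega> \<le> card (?T \<times> (Fp - {0}))"
  proof (rule card_inj_on_le)
    let ?f = "\<lambda>(v, t, b). (((\<lambda>i. u i + t * v i), b), t)"
    show "inj_on ?f ?\<Omega>"
    proof (rule inj_onI)
      fix x x' assume x: "x \<in> ?\<Omega>" "x' \<in> ?\<Omega>" "?f x = ?f x'"
      obtain v t b v' t' b' where xx: "x = (v, t, b)" "x' = (v', t', b')" by (metis prod_cases3)
      have e: "(\<lambda>i. u i + t * v i) = (\<lambda>i. u i + t' * v' i)" "b = b'" "t = t'"
        using x(3) unfolding xx prod.case prod.inject by blast+
      have "t \<noteq> 0" using x(1) unfolding xx S_def by auto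
      then have "v i = v' i" for i using fun_cong[OF e(1), of i] e(3) by simp
      then show "x = x'" unfolding xx using e(2,3) by auto
    qed
    show "?f ` ?\<Omega> \<subseteq> ?T \<times> (Fp - {0})"
    proof
      fix y assume "y \<in> ?f ` ?\<Omega>"
      then obtain v t b where y: "y = (((\<lambda>i. u i + t * v i), b), t)" and *: "v \<in> V" "t \<in> S v" "b \<in> R v t" by auto
      have "(\<lambda>i. u i + t * v i) \<in> Fp_points r"
        using u * unfolding V_def S_def Fp_points_iff affine_space_def by (simp add: Fp_closed)
      then show "y \<in> ?T \<times> (Fp - {0})" using * unfolding y S_def R_def by auto
    qed
    show "finite (?T \<times> (Fp - {0 :: 'k}))" using Tfin card_Fp_roots(1) by simp
  qed
  also have "card (?T \<times> (Fp - {0})) = card ?T * (p - 1)"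
    using Fp_closed(1) card_Fp_roots(1,2) by (simp add: card_cartesian_product card_Diff_singleton)
  finally have up: "real (card ?\<Omega>) \<le> real (card ?T) * real (p - 1)" unfolding of_nat_mult[symmetric] by (simp only: of_nat_le_iff)
  have "card ?\<Omega> = (\<Sum>v\<in>V. card (SIGMA t:S v. R v t))" by (rule card_SigmaI) (use fin in auto)
  also have "\<dots> = (\<Sum>v\<in>V. \<Sum>t\<in>S v. card (R v t))" by (intro sum.cong refl card_SigmaI) (use fin in auto)
  finally have "real (card ?\<Omega>) = (\<Sum>v\<in>V. real (\<Sum>t\<in>S v. card (R v t)))" by simp
  also have "\<dots> \<ge> (\<Sum>v\<in>V. 526 / 1000 * real p)" by (rule sum_mono) (rule N)
  finally have low: "real (card V) * (526 / 1000 * real p) \<le> real (card ?\<Omega>)" by simp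
  \<comment> \<open>The proportion of bad directions is at most
    \<open>\<Delta> / p \<le> 1 / 42\<close>, by \<open>2 * \<Delta> \<le> D ^ 4\<close> and
    \<open>21 * D ^ 4 \<le> p\<close>.\<close>
  have cV: "real (card V) \<ge> 41 / 42 * real p ^ r"
  proof -
    obtain z where z: "\<Psi> z \<noteq> 0" using \<Psi>(2) by blast
    let ?B = "{v \<in> Fp_points r. \<Psi> v = 0}"
    have "42 * (card ?B * p) \<le> 21 * (2 * \<Delta>) * p ^ r" using schwartz_zippel[OF \<Psi>(1) z] by simp
    also have "\<dots> \<le> p * p ^ r" using \<Delta> p by (intro mult_le_mono1) simp
    finally have "42 * card ?B * p \<le> p ^ r * p" by (simp add: mult_ac)
    then have "42 * card ?B \<le> p ^ r" using p_gt_1 by simp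
    then have "real (42 * card ?B) \<le> real (p ^ r)" by (simp only: of_nat_le_iff)
    then have "42 * real (card ?B) \<le> real p ^ r" by simp
    moreover have "card V + card ?B = p ^ r"
    proof -
      have "V \<union> ?B = Fp_points r" "V \<inter> ?B = {}" unfolding V_def by auto
      then show ?thesis using card_Un_disjoint[of V ?B] fin(1) finite_Fp_points[of r] by (simp add: card_Fp_points)
    qed
    then have "real (card V + card ?B) = real (p ^ r)" by (simp only:)
    then have "real (card V) + real (card ?B) = real p ^ r" by simp
    ultimately show ?thesis by simp
  qed
  have p1: "real (p - 1) \<le> real p" "0 < real p" using p_gt_1 by simp_all
  have "real p ^ r / 2 * real p \<le> 41 / 42 * real p ^ r * (526 / 1000 * real p)" using p1 by simp
  also have "\<dots> \<le> real (card V) * (526 / 1000 * real p)" by (rule mult_right_mono[OF cV]) simp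
  also have "\<dots> \<le> real (card ?T) * real (p - 1)" using low up by simp
  also have "\<dots> \<le> real (card ?T) * real p" by (rule mult_left_mono[OF p1(1)]) simp
  finally show ?thesis using p1(2) by simp
qed

text \<open>For \<open>D = 1\<close> the hypersurface is the graph of a function that takes values
  in the prime field at rational points, and the discriminant is 1.\<close>

lemma hypersurface_count_linear:
  fixes c :: "nat \<Rightarrow> (nat \<Rightarrow> 'k) \<Rightarrow> 'k"
  assumes tw: "\<And>j a. j < 1 \<Longrightarrow> c j (\<lambda>i. a i ^ p) = c j a ^ p"
  shows "p ^ r \<le> card {(a, b). a \<in> Fp_points r \<and> b \<in> Fp \<and> disc 1 c a \<noteq> 0 \<and> poly (fpoly 1 c a) b = 0}" (is "_ \<le> card ?T")
proof -
  have disc: "disc 1 c a \<noteq> 0" for a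
  proof -
    have "norm_mat (mcoeff 1 c a) 1 (\<lambda>i. of_nat (Suc i) * mcoeff 1 c a (Suc i)) 1 0 0 = 1" by (simp add: norm_mat_def mcoeff_def)
    then show ?thesis unfolding disc_def by (subst det_single) simp_all
  qed
  have "card (Fp_points r :: (nat \<Rightarrow> 'k) set) \<le> card ?T"
  proof (rule card_inj_on_le[of "\<lambda>a. (a, - c 0 a)"])
    show "inj_on (\<lambda>a. (a, - c 0 a)) (Fp_points r)" by (rule inj_onI) simp
    show "(\<lambda>a. (a, - c 0 a)) ` Fp_points r \<subseteq> ?T"
    proof
      fix y assume "y \<in> (\<lambda>a. (a, - c 0 a)) ` Fp_points r"
      then obtain a where a: "a \<in> Fp_points r" "y = (a, - c 0 a)" by blast
      have "(\<lambda>i. a i ^ p) = a" using a(1) unfolding Fp_points_iff mem_Fp by auto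
      then have "c 0 a \<in> Fp" using tw[of 0 a] by (simp add: mem_Fp)
      then show "y \<in> ?T" using a disc Fp_closed(6) by (simp add: poly_fpoly)
    qed
    show "finite ?T" by (rule finite_subset[of _ "Fp_points r \<times> Fp"]) (use finite_Fp_points card_Fp_roots(1) in auto)
  qed
  then show ?thesis by (simp add: card_Fp_points)
qed

theorem card_points_ge:
  fixes X :: "(nat \<Rightarrow> 'k) set"
  assumes "irreducible_closed n X" "Fp_variety n X" "has_dim n X r" "has_degree n X r d"
    and d: "d + 1 < p" "d * d < p" "2 \<le> d \<longrightarrow> 21 * d ^ 4 \<le> p"
  shows "real p ^ r / 2 \<le> real (card (X \<inter> Fp_points n))"
proof -
  obtain D c where irr: "prime_eqn r D c" and "D \<le> d" and tw: "\<And>j a. j < D \<Longrightarrow> c j (\<lambda>i. a i ^ p) = c j a ^ p"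
    and disc: "\<exists>a. disc D c a \<noteq> 0"
    and le: "card {(a, b). a \<in> Fp_points r \<and> b \<in> Fp \<and> disc D c a \<noteq> 0 \<and> poly (fpoly D c a) b = 0} \<le> card (X \<inter> Fp_points n)"
    by (rule rational_model[OF assms(1-4) d(1,2)]) (rule that)
  have "0 < D" using irr unfolding prime_eqn_def by simp
  have "real p ^ r / 2 \<le> real (card {(a, b). a \<in> Fp_points r \<and> b \<in> Fp \<and> disc D c a \<noteq> 0 \<and> poly (fpoly D c a) b = 0})"
  proof (cases "D = 1")
    case True
    have "p ^ r \<le> card {(a, b). a \<in> Fp_points r \<and> b \<in> Fp \<and> disc D c a \<noteq> 0 \<and> poly (fpoly D c a) b = 0}"
      unfolding True by (rule hypersurface_count_linear, rule tw) (simp add: True)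
    then have "real p ^ r \<le> real (card {(a, b). a \<in> Fp_points r \<and> b \<in> Fp \<and> disc D c a \<noteq> 0 \<and> poly (fpoly D c a) b = 0})"
      unfolding of_nat_power[symmetric] by (simp only: of_nat_le_iff)
    moreover have "0 \<le> real p ^ r" by simp
    ultimately show ?thesis by linarith
  next
    case False
    then have "2 \<le> D" using \<open>0 < D\<close> by simp
    moreover have "21 * D ^ 4 \<le> 21 * d ^ 4" using \<open>D \<le> d\<close> by (simp add: power_mono)
    then have "21 * D ^ 4 \<le> p" using d(3) \<open>2 \<le> D\<close> \<open>D \<le> d\<close> by linarith
    ultimately show ?thesis by (intro hypersurface_count[OF irr tw disc])
  qed
  also have "\<dots> \<le> real (card (X \<inter> Fp_points n))" using le by simp
  finally show ?thesis .
qed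

end

section \<open>Sumsets and the numerical hypothesis\<close>

lemma card_setsum_le:
  fixes Y U :: "(nat \<Rightarrow> 'k::field) set"
  assumes "finite Y" "finite U" "v \<in> U" "w \<in> U" "v \<noteq> w" and shift: "\<And>a. a \<in> Y \<Longrightarrow> (\<lambda>i. a i + (v i - w i)) \<in> Y"
  shows "card (setsum_vec Y U) + card Y \<le> card Y * card U"
proof -
  have "setsum_vec Y U \<subseteq> (\<lambda>(a, u). vadd a u) ` (Y \<times> (U - {v}))"
  proof
    fix y assume "y \<in> setsum_vec Y U"
    then obtain a u where y: "y = vadd a u" "a \<in> Y" "u \<in> U" unfolding setsum_vec_def by blast
    show "y \<in> (\<lambda>(a, u). vadd a u) ` (Y \<times> (U - {v}))"
    proof (cases "u = v")
      case True
      have "y = vadd (\<lambda>i. a i + (v i - w i)) w" unfolding y True vadd_def by auto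
      then show ?thesis using shift[OF y(2)] assms(4,5) by (intro image_eqI[of _ _ "(\<lambda>i. a i + (v i - w i), w)"]) auto
    next
      case False
      then show ?thesis using y by (intro image_eqI[of _ _ "(a, u)"]) auto
    qed
  qed
  then have "card (setsum_vec Y U) \<le> card (Y \<times> (U - {v}))"
    using assms(1,2) by (meson card_image_le card_mono finite_Diff finite_SigmaI finite_imageI le_trans)
  also have "\<dots> = card Y * (card U - 1)" using assms(2,3) by (simp add: card_cartesian_product)
  moreover have "card U \<noteq> 0" using assms(2,3) by auto
  then have "card Y * (card U - 1) + card Y = card Y * card U" by (cases "card U") auto
  ultimately show ?thesis by simp
qed

text \<open>With \<open>s = sqrt p\<close> and \<open>x = d\<close> the hypothesis implies
  \<open>s ^ 2 \<ge> 2 * x ^ 2 * s + 25 / 2 * x ^ 4\<close>. So \<open>s \<ge> k * x ^ 2\<close>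
  gives \<open>s ^ 2 \<ge> (2 * k + 25 / 2) * x ^ 4\<close>. Starting at \<open>k = 0\<close>, this
  improves to \<open>k = 7 / 2\<close>, then to \<open>k = 22 / 5\<close>, and the third round
  yields the factor \<open>21.3\<close>.\<close>

lemma bound_params:
  fixes p d N :: nat
  assumes d: "2 \<le> d" and p: "0 < p"
    and H: "real p \<ge> 4 * (real d ^ 2 + (5 * real d powr (13/3) + real d ^ 2 * real N) * real p powr (-1/2)) ^ 2"
  shows "21 * d ^ 4 \<le> p"
proof -
  define s where "s = sqrt (real p)"
  have s: "s > 0" "s * s = real p" using p by (simp_all add: s_def)
  have ps: "real p powr (-1/2) = 1 / s" using p unfolding s_def by (simp add: powr_minus_divide powr_half_sqrt)
  define x where "x = real d"
  have x: "x \<ge> 2" using d by (simp add: x_def)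
  have x43: "x powr (13/3) \<ge> 5 / 4 * x ^ 4"
  proof -
    have "x powr (13/3) = x ^ 4 * x powr (1/3)" using x powr_add[of x 4 "1/3"] by simp
    \<comment> \<open>\<open>(5 / 4) ^ 3 = 125 / 64 < 2 \<le> x\<close>; the constant turns
      \<open>5 * x powr (13 / 3)\<close> into at least \<open>25 / 4 * x ^ 4\<close>.\<close>
    moreover have "x powr (1/3) \<ge> 5 / 4"
    proof (rule ccontr)
      assume "\<not> ?thesis"
      then have "(x powr (1/3)) ^ 3 < (5/4) ^ 3" by (intro power_strict_mono) auto
      moreover have "(x powr (1/3)) ^ 3 = x" using x by (simp add: powr_power)
      ultimately show False using x by (simp add: power3_eq_cube)
    qed
    ultimately show ?thesis using x by simp
  qed
  define y where "y = x ^ 2 + (5 * x powr (13/3) + x ^ 2 * real N) * (1 / s)"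
  have "y \<ge> 0" unfolding y_def using s x by simp
  have "4 * y ^ 2 \<le> real p" using H unfolding ps y_def x_def .
  then have "(2 * y) ^ 2 \<le> s ^ 2" unfolding power2_eq_square[of s] s(2) by (simp add: power_mult_distrib)
  then have ys: "2 * y \<le> s" using power2_le_imp_le s(1) by (metis less_imp_le)
  have "x ^ 2 + 25 / 4 * x ^ 4 * (1 / s) \<le> y"
  proof -
    have "25 / 4 * x ^ 4 \<le> 5 * x powr (13/3) + x ^ 2 * real N" using x43 x by (simp add: add_increasing2)
    then show ?thesis unfolding y_def using s(1) by (intro add_left_mono mult_right_mono) auto
  qed
  then have "2 * (x ^ 2 + 25 / 4 * x ^ 4 * (1 / s)) * s \<le> s * s" using ys s(1) by (intro mult_right_mono) auto
  moreover have "2 * (x ^ 2 + 25 / 4 * x ^ 4 * (1 / s)) * s = 2 * x ^ 2 * s + 25 / 2 * x ^ 4" using s(1) by (simp add: field_simps)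
  ultimately have main: "2 * x ^ 2 * s + 25 / 2 * x ^ 4 \<le> s * s" by simp
  have x4: "x ^ 4 = x ^ 2 * x ^ 2" by (simp add: power4_eq_xxxx power2_eq_square)
  have x2: "x ^ 2 > 0" using x by simp
  have step: "l * x ^ 4 \<le> s * s" if "k * x ^ 2 \<le> s" "l = 2 * k + 25 / 2" for k l
    using main mult_left_mono[OF that(1), of "2 * x ^ 2"] x2 unfolding x4 that(2) by (simp add: algebra_simps)
  have root: "k * x ^ 2 \<le> s" if "k * k * x ^ 4 \<le> s * s" "0 \<le> k" for k
    using that s(1) power2_le_imp_le[of "k * x ^ 2" s] unfolding x4 power2_eq_square[of s] power2_eq_square[of "k * _"] by (simp add: mult_ac)
  have x40: "0 \<le> x ^ 4" using x by simp
  have "25 / 2 * x ^ 4 \<le> s * s" by (rule step[of 0]) (use s(1) in simp_all)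
  then have "7 / 2 * (7 / 2) * x ^ 4 \<le> s * s" using x40 by linarith
  then have "7 / 2 * x ^ 2 \<le> s" by (rule root) simp
  then have "39 / 2 * x ^ 4 \<le> s * s" by (rule step) simp
  then have "22 / 5 * (22 / 5) * x ^ 4 \<le> s * s" using x40 by linarith
  then have "22 / 5 * x ^ 2 \<le> s" by (rule root) simp
  then have "213 / 10 * x ^ 4 \<le> s * s" by (rule step) simp
  then have "21 * x ^ 4 \<le> real p" unfolding s(2) using x40 by linarith
  then have "real (21 * d ^ 4) \<le> real p" by (simp add: x_def)
  then show ?thesis by (simp only: of_nat_le_iff)
qed

theorem theorem4p3:
  fixes p n r d :: nat
    and U X :: "(nat \<Rightarrow> 'k::field) set"
  assumes "is_alg_closure_Fp p TYPE('k)"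
    and "p > d" and "d \<ge> 1"
    and "U \<subseteq> Fp_points n" and "U \<noteq> {}"
    and "closed_under_shifts_to_zero n U"
    and "Fp_variety n X" and "irreducible_closed n X"
    and "has_dim n X r" and "has_degree n X r d"
    and "\<not> shift_free X (setdiff_vec U U)"
    and "real p \<ge> 4 * (real d ^ 2 + (5 * real d powr (13/3)
            + real d ^ 2 * real (card (setdiff_vec U U))) * real p powr (-1/2)) ^ 2"
  shows "real (card (X \<inter> Fp_points n)) * real (card U)
           - real (card (setsum_vec (X \<inter> Fp_points n) U)) \<ge> real p ^ r / 2"
proof -
  interpret Fpbar p "TYPE('k)" by (rule Fpbar.intro) (rule assms(1))
  let ?Y = "X \<inter> Fp_points n"
  have d: "d + 1 < p \<and> d * d < p \<and> (2 \<le> d \<longrightarrow> 21 * d ^ 4 \<le> p)"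
  proof (cases "d = 1")
    case True
    \<comment> \<open>For \<open>d = 1\<close> the squared expression is at least 1, so
      \<open>p \<ge> 4\<close>, which gives \<open>d + 1 < p\<close>.\<close>
    have "real p \<ge> 4 * 1 ^ 2"
    proof (rule order_trans[OF _ assms(12)], intro mult_left_mono power_mono)
      show "1 \<le> real d ^ 2 + (5 * real d powr (13/3) + real d ^ 2 * real (card (setdiff_vec U U))) * real p powr (-1/2)"
        using True by simp
    qed auto
    then show ?thesis using True by simp
  next
    case False
    then have "2 \<le> d" using assms(3) by simp
    then have "21 * d ^ 4 \<le> p" by (rule bound_params[OF _ _ assms(12)]) (use p_gt_1 in simp)
    moreover have "d ^ 2 \<le> d ^ 4" using \<open>2 \<le> d\<close> by (intro power_increasing) auto
    moreover have "2 * d \<le> d ^ 2" using \<open>2 \<le> d\<close> by (simp add: power2_eq_square)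
    ultimately show ?thesis using \<open>2 \<le> d\<close> unfolding power2_eq_square[symmetric] by (intro conjI impI) linarith+
  qed
  have "real p ^ r / 2 \<le> real (card ?Y)"
    using card_points_ge[OF assms(8,7,9,10)] d by blast
  moreover have "card (setsum_vec ?Y U) + card ?Y \<le> card ?Y * card U"
  proof -
    obtain u where u: "u \<in> setdiff_vec U U" "u \<noteq> (\<lambda>_. 0)" "X = vshift X u"
      using assms(11) unfolding shift_free_def by blast
    then obtain v w where vw: "v \<in> U" "w \<in> U" "u = (\<lambda>i. v i - w i)" unfolding setdiff_vec_def by blast
    have "finite ?Y" "finite U" using finite_Fp_points assms(4) by (auto intro: finite_subset)
    then show ?thesis
    proof (rule card_setsum_le[OF _ _ vw(1,2)])
      show "v \<noteq> w" using u(2) vw(3) by auto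
      fix a assume a: "a \<in> ?Y"
      have "(\<lambda>i. a i + (v i - w i)) = vadd a u" unfolding vadd_def vw(3) by simp
      then have "(\<lambda>i. a i + (v i - w i)) \<in> X" using a u(3) unfolding vshift_def by blast
      moreover have "(\<lambda>i. a i + (v i - w i)) \<in> Fp_points n"
      proof -
        have "v \<in> Fp_points n" "w \<in> Fp_points n" "a \<in> Fp_points n" using vw assms(4) a by auto
        then show ?thesis unfolding Fp_points_iff affine_space_def by (simp add: Fp_closed)
      qed
      ultimately show "(\<lambda>i. a i + (v i - w i)) \<in> ?Y" by simp
    qed
  qed
  then have "real (card (setsum_vec ?Y U)) + real (card ?Y) \<le> real (card ?Y) * real (card U)"
    unfolding of_nat_add[symmetric] of_nat_mult[symmetric] by (simp only: of_nat_le_iff)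
  ultimately show ?thesis by linarith
qed

end
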